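(* Let $\alpha\in(0,\frac\pi6]$, let $m\ge10^3$ be an integer, and let $(\boldsymbol{v},P)$ be the strong solution on $D_m\times[0,T]$ described in the context. Then (at almost every time $t$) the pressure $P$ satisfies $$\begin{aligned}\|\nabla P\|_{L^2}\le{}&(1+\cot\alpha)\Big\|\frac1\rho(v_\phi^2+v_\theta^2)\Big\|_{L^2}+6\|\partial_\rho v_\phi\|_{L^2}+6\Big\|\frac{\partial_\phi v_\phi}{\rho}\Big\|_{L^2}+18(2+\cot\alpha)\|v_\phi\|_{L^2}\\&+\Big\|\Big(v_\rho\partial_\rho+\frac1\rho v_\phi\partial_\phi\Big)v_\rho\Big\|_{L^2}+\Big\|\Big[v_\rho\Big(\partial_\rho+\frac1\rho\Big)+\frac1\rho v_\phi\partial_\phi\Big]v_\phi\Big\|_{L^2},\end{aligned}$$ where $L^2$ means $L^2(D_m)$.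
   Context: Spherical coordinates $(\rho,\phi,\theta)$ on $\mathbb{R}^3$: $\rho=|x|$, $\phi$ the angle from the positive $x_3$-axis, $\theta$ the azimuthal angle, with the usual orthonormal frame $\boldsymbol{e_\rho},\boldsymbol{e_\phi},\boldsymbol{e_\theta}$. All functions and vector fields are axially symmetric (components $v_\rho,v_\phi,v_\theta$ and $P$ independent of $\theta$). $D_m=\{\frac1m<\rho<1,\ \frac\pi2-\alpha<\phi<\frac\pi2+\alpha,\ \theta\in[0,2\pi)\}$, with boundary pieces $R_{1,m},R_{2,m}$ ($\phi=\frac\pi2\mp\alpha$), $A_{1,m}$ ($\rho=\frac1m$), $A_{2,m}$ ($\rho=1$). Let $\omega_\theta=\frac1\rho\partial_\rho(\rho v_\phi)-\frac1\rho\partial_\phi v_\rho$. Boundary condition (BC): $\boldsymbol{v}\cdot\boldsymbol{n}=0$ on $\partial D_m$; on $R_{1,m}\cup R_{2,m}$: $v_\phi=\partial_\rho v_\phi=\partial_\phi v_\rho=0$, $\partial_\phi v_\theta=\cot\phi\,v_\theta$, $\omega_\theta=0$; on $A_{2,m}$: $v_\rho=\partial_\phi v_\rho=0$, $\partial_\rho v_\theta=\frac1\rho v_\theta$, $\partial_\rho v_\phi=\frac1\rho v_\phi$, $\omega_\theta=\frac2\rho v_\phi$; on $A_{1,m}$: $v_\rho=\partial_\phi v_\rho=0$, $\partial_\rho v_\theta=\frac1\rho v_\theta$, $\partial_\rho v_\phi=-\frac1\rho v_\phi$, $\omega_\theta=0$. Standing solution: $(\boldsymbol{v},P)$ is the strong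 solution on $D_m\times[0,T]$ of $\Delta\boldsymbol{v}-(\boldsymbol{v}\cdot\nabla)\boldsymbol{v}-\nabla P-\partial_t\boldsymbol{v}=0$, $\nabla\cdot\boldsymbol{v}=0$, with (BC) and initial data $\boldsymbol{v}_0\in H^2(D_m)$ which is divergence free, satisfies (BC), and has zero azimuthal angular momentum $\int_{D_m}\rho\sin\phi\,v_{\theta,0}\,dx=0$; it satisfies $\boldsymbol{v}\in H^1_tL^2_x\cap L^2_tH^2_x\cap L^\infty_{tx}(D_m\times[0,T])$, $P\in L^2_tH^1_x(D_m\times[0,T])$, and the equations hold in the $L^2_{tx}$ sense. *)

theory Defs
  imports "HOL-Analysis.Analysis"
begin

section \<open>Weak derivatives, Sobolev spaces and traces\<close>

abbreviation lborel_on :: "'a::euclidean_space set \<Rightarrow> 'a measure" where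
  "lborel_on \<Omega> \<equiv> restrict_space lborel \<Omega>"

definition L2 :: "'a measure \<Rightarrow> ('a \<Rightarrow> 'b::euclidean_space) \<Rightarrow> bool" where
  "L2 M f \<longleftrightarrow> f \<in> borel_measurable M \<and> integrable M (\<lambda>x. (norm (f x))\<^sup>2)"

text \<open>Meaningful only for functions with \<^term>\<open>L2 M f\<close>: the Bochner integral of a
  non-integrable function is 0.\<close>

definition L2_norm :: "'a measure \<Rightarrow> ('a \<Rightarrow> 'b::euclidean_space) \<Rightarrow> real" where
  "L2_norm M f = sqrt (\<integral>x. (norm (f x))\<^sup>2 \<partial>M)"

primrec C_k :: "nat \<Rightarrow> ('a::euclidean_space \<Rightarrow> real) \<Rightarrow> bool" where
  "C_k 0 f \<longleftrightarrow> continuous_on UNIV f"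
| "C_k (Suc k) f \<longleftrightarrow> (\<forall>x. f differentiable (at x)) \<and>
     (\<forall>b\<in>Basis. C_k k (\<lambda>x. frechet_derivative f (at x) b))"

definition smooth :: "('a::euclidean_space \<Rightarrow> real) \<Rightarrow> bool" where
  "smooth f \<longleftrightarrow> (\<forall>k. C_k k f)"

definition test_function :: "'a::euclidean_space set \<Rightarrow> ('a \<Rightarrow> real) \<Rightarrow> bool" where
  "test_function \<Omega> \<psi> \<longleftrightarrow> smooth \<psi> \<and> (\<exists>K. compact K \<and> K \<subseteq> \<Omega> \<and> (\<forall>x. x \<notin> K \<longrightarrow> \<psi> x = 0))"

definition locally_integrable ::
    "'a::euclidean_space set \<Rightarrow> ('a \<Rightarrow> 'b::euclidean_space) \<Rightarrow> bool" where
  "locally_integrable \<Omega> f \<longleftrightarrow> (\<forall>K. compact K \<longrightarrow> K \<subseteq> \<Omega> \<longrightarrow> set_integrable lborel K f)"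

definition has_weak_deriv ::
    "'a::euclidean_space set \<Rightarrow> 'a \<Rightarrow> ('a \<Rightarrow> 'b::euclidean_space) \<Rightarrow> ('a \<Rightarrow> 'b) \<Rightarrow> bool" where
  "has_weak_deriv \<Omega> b f g \<longleftrightarrow> locally_integrable \<Omega> f \<and> locally_integrable \<Omega> g \<and>
     (\<forall>\<psi>. test_function \<Omega> \<psi> \<longrightarrow>
        (\<integral>x. frechet_derivative \<psi> (at x) b *\<^sub>R f x \<partial>lborel_on \<Omega>)
          = - (\<integral>x. \<psi> x *\<^sub>R g x \<partial>lborel_on \<Omega>))"

text \<open>A weak derivative is unique only up to null sets; the following picks one representative.\<close>

definition weak_deriv ::
    "'a::euclidean_space set \<Rightarrow> 'a \<Rightarrow> ('a \<Rightarrow> 'b::euclidean_space) \<Rightarrow> 'a \<Rightarrow> 'b" where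
  "weak_deriv \<Omega> b f = (SOME g. has_weak_deriv \<Omega> b f g)"

primrec sobolev_H ::
    "nat \<Rightarrow> 'a::euclidean_space set \<Rightarrow> ('a \<Rightarrow> 'b::euclidean_space) \<Rightarrow> bool" where
  "sobolev_H 0 \<Omega> f \<longleftrightarrow> L2 (lborel_on \<Omega>) f"
| "sobolev_H (Suc k) \<Omega> f \<longleftrightarrow> L2 (lborel_on \<Omega>) f \<and>
     (\<forall>b\<in>Basis. \<exists>g. has_weak_deriv \<Omega> b f g \<and> sobolev_H k \<Omega> g)"

text \<open>Square of the norm of the Sobolev space above.\<close>

primrec sobolev_sqnorm ::
    "nat \<Rightarrow> 'a::euclidean_space set \<Rightarrow> ('a \<Rightarrow> 'b::euclidean_space) \<Rightarrow> real" where
  "sobolev_sqnorm 0 \<Omega> f = (L2_norm (lborel_on \<Omega>) f)\<^sup>2"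
| "sobolev_sqnorm (Suc k) \<Omega> f = (L2_norm (lborel_on \<Omega>) f)\<^sup>2
     + (\<Sum>b\<in>Basis. sobolev_sqnorm k \<Omega> (weak_deriv \<Omega> b f))"

text \<open>The trace of an \<open>H\<^sup>1\<close> function on a piece of the boundary with surface measure \<open>\<sigma>\<close>: the
  \<open>L\<^sup>2(\<sigma>)\<close> limit of the restrictions of smooth functions approximating it in \<open>H\<^sup>1\<close>.\<close>

definition has_trace ::
    "'a::euclidean_space set \<Rightarrow> 'a measure \<Rightarrow> ('a \<Rightarrow> real) \<Rightarrow> ('a \<Rightarrow> real) \<Rightarrow> bool" where
  "has_trace \<Omega> \<sigma> f g \<longleftrightarrow> sobolev_H 1 \<Omega> f \<and> L2 \<sigma> g \<and>
     (\<exists>u::nat \<Rightarrow> 'a \<Rightarrow> real. (\<forall>k. smooth (u k)) \<and>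
        (\<lambda>k. sobolev_sqnorm 1 \<Omega> (\<lambda>x. u k x - f x)) \<longlonglongrightarrow> 0 \<and>
        (\<lambda>k. L2_norm \<sigma> (\<lambda>x. u k x - g x)) \<longlonglongrightarrow> 0)"

definition trace_eq ::
    "'a::euclidean_space set \<Rightarrow> 'a measure \<Rightarrow> ('a \<Rightarrow> real) \<Rightarrow> ('a \<Rightarrow> real) \<Rightarrow> bool" where
  "trace_eq \<Omega> \<sigma> f g \<longleftrightarrow> (\<exists>h. has_trace \<Omega> \<sigma> f h \<and> has_trace \<Omega> \<sigma> g h)"

definition weak_grad ::
    "'a::euclidean_space set \<Rightarrow> ('a \<Rightarrow> real) \<Rightarrow> 'a \<Rightarrow> 'a" where
  "weak_grad \<Omega> f x = (\<Sum>b\<in>Basis. weak_deriv \<Omega> b f x *\<^sub>R b)"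

definition weak_div ::
    "'a::euclidean_space set \<Rightarrow> ('a \<Rightarrow> 'a) \<Rightarrow> 'a \<Rightarrow> real" where
  "weak_div \<Omega> w x = (\<Sum>b\<in>Basis. weak_deriv \<Omega> b w x \<bullet> b)"

definition weak_laplacian ::
    "'a::euclidean_space set \<Rightarrow> ('a \<Rightarrow> 'b::euclidean_space) \<Rightarrow> 'a \<Rightarrow> 'b" where
  "weak_laplacian \<Omega> w x = (\<Sum>b\<in>Basis. weak_deriv \<Omega> b (weak_deriv \<Omega> b w) x)"

text \<open>The field \<open>(v \<cdot> \<nabla>)w\<close>.\<close>

definition convection ::
    "'a::euclidean_space set \<Rightarrow> ('a \<Rightarrow> 'a) \<Rightarrow> ('a \<Rightarrow> 'b::euclidean_space) \<Rightarrow> 'a \<Rightarrow> 'b" where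
  "convection \<Omega> v w x = (\<Sum>b\<in>Basis. (v x \<bullet> b) *\<^sub>R weak_deriv \<Omega> b w x)"


section \<open>Spaces on the space-time cylinder\<close>

definition cylinder :: "real \<Rightarrow> 'a set \<Rightarrow> (real \<times> 'a) set" where
  "cylinder T \<Omega> = {0<..<T} \<times> \<Omega>"

definition time_deriv ::
    "real \<Rightarrow> 'a::euclidean_space set \<Rightarrow> (real \<Rightarrow> 'a \<Rightarrow> 'b::euclidean_space) \<Rightarrow> real \<Rightarrow> 'a \<Rightarrow> 'b" where
  "time_deriv T \<Omega> f t x = weak_deriv (cylinder T \<Omega>) (1, 0) (\<lambda>(s, y). f s y) (t, x)"

text \<open>\<open>H\<^sup>1\<close> in time with values in \<open>L\<^sup>2\<close>.\<close>

definition H1t_L2x ::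
    "real \<Rightarrow> 'a::euclidean_space set \<Rightarrow> (real \<Rightarrow> 'a \<Rightarrow> 'b::euclidean_space) \<Rightarrow> bool" where
  "H1t_L2x T \<Omega> f \<longleftrightarrow> L2 (lborel_on (cylinder T \<Omega>)) (\<lambda>(t, x). f t x) \<and>
     (\<exists>g. has_weak_deriv (cylinder T \<Omega>) (1, 0) (\<lambda>(t, x). f t x) g \<and>
          L2 (lborel_on (cylinder T \<Omega>)) g)"

text \<open>Lebesgue rather than Borel integrability in \<open>t\<close>: the Sobolev norm is junk on the null set of
  times at which \<^term>\<open>f t\<close> is not in the Sobolev space.\<close>

definition L2t_Hx ::
    "nat \<Rightarrow> real \<Rightarrow> 'a::euclidean_space set \<Rightarrow> (real \<Rightarrow> 'a \<Rightarrow> 'b::euclidean_space) \<Rightarrow> bool" where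
  "L2t_Hx k T \<Omega> f \<longleftrightarrow> (\<lambda>(t, x). f t x) \<in> borel_measurable (lborel_on (cylinder T \<Omega>)) \<and>
     (AE t in lborel_on {0<..<T}. sobolev_H k \<Omega> (f t)) \<and>
     integrable (lebesgue_on {0<..<T}) (\<lambda>t. sobolev_sqnorm k \<Omega> (f t))"

definition Linf_tx ::
    "real \<Rightarrow> 'a::euclidean_space set \<Rightarrow> (real \<Rightarrow> 'a \<Rightarrow> 'b::euclidean_space) \<Rightarrow> bool" where
  "Linf_tx T \<Omega> f \<longleftrightarrow> (\<lambda>(t, x). f t x) \<in> borel_measurable (lborel_on (cylinder T \<Omega>)) \<and>
     (\<exists>C. AE (t, x) in lborel_on (cylinder T \<Omega>). norm (f t x) \<le> C)"

text \<open>A member of \<open>H\<^sup>1\<close> in time with values in \<open>L\<^sup>2\<close> is continuous from \<open>[0,T]\<close> to \<open>L\<^sup>2\<close> after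
  modification on a null set of times; its initial value is that of the continuous representative.\<close>

definition has_initial_value ::
    "real \<Rightarrow> 'a::euclidean_space set \<Rightarrow> (real \<Rightarrow> 'a \<Rightarrow> 'b::euclidean_space) \<Rightarrow> ('a \<Rightarrow> 'b) \<Rightarrow> bool" where
  "has_initial_value T \<Omega> f f0 \<longleftrightarrow>
     (\<exists>w. (AE t in lborel_on {0<..<T}. AE x in lborel_on \<Omega>. w t x = f t x) \<and>
          (\<forall>t\<in>{0..T}. L2 (lborel_on \<Omega>) (w t)) \<and>
          (\<forall>s\<in>{0..T}. ((\<lambda>t. L2_norm (lborel_on \<Omega>) (\<lambda>x. w t x - w s x)) \<longlongrightarrow> 0)
                         (at s within {0..T})) \<and>
          (AE x in lborel_on \<Omega>. w 0 x = f0 x))"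


section \<open>Spherical coordinates\<close>

definition sph :: "real \<Rightarrow> real \<Rightarrow> real \<Rightarrow> real^3" where
  "sph r p q = vector [r * sin p * cos q, r * sin p * sin q, r * cos p]"

definition rho :: "real^3 \<Rightarrow> real" where "rho x = norm x"

definition phi :: "real^3 \<Rightarrow> real" where "phi x = arccos (x $ 3 / norm x)"

definition theta :: "real^3 \<Rightarrow> real" where "theta x = Arg2pi (Complex (x $ 1) (x $ 2))"

definition e_rho :: "real^3 \<Rightarrow> real^3" where
  "e_rho x = vector [sin (phi x) * cos (theta x), sin (phi x) * sin (theta x), cos (phi x)]"

definition e_phi :: "real^3 \<Rightarrow> real^3" where
  "e_phi x = vector [cos (phi x) * cos (theta x), cos (phi x) * sin (theta x), - sin (phi x)]"

definition e_theta :: "real^3 \<Rightarrow> real^3" where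
  "e_theta x = vector [- sin (theta x), cos (theta x), 0]"

definition c_rho :: "(real^3 \<Rightarrow> real^3) \<Rightarrow> real^3 \<Rightarrow> real" where "c_rho w x = w x \<bullet> e_rho x"
definition c_phi :: "(real^3 \<Rightarrow> real^3) \<Rightarrow> real^3 \<Rightarrow> real" where "c_phi w x = w x \<bullet> e_phi x"
definition c_theta :: "(real^3 \<Rightarrow> real^3) \<Rightarrow> real^3 \<Rightarrow> real" where "c_theta w x = w x \<bullet> e_theta x"

text \<open>The coordinate derivatives, by the chain rule: the coordinate tangent vectors of \<^term>\<open>sph\<close>
  with respect to \<open>\<rho>\<close> and \<open>\<phi>\<close> are \<open>e_rho\<close> and \<open>\<rho> e_phi\<close>.\<close>

definition d_rho :: "(real^3) set \<Rightarrow> (real^3 \<Rightarrow> real) \<Rightarrow> real^3 \<Rightarrow> real" where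
  "d_rho \<Omega> f x = weak_grad \<Omega> f x \<bullet> e_rho x"

definition d_phi :: "(real^3) set \<Rightarrow> (real^3 \<Rightarrow> real) \<Rightarrow> real^3 \<Rightarrow> real" where
  "d_phi \<Omega> f x = weak_grad \<Omega> f x \<bullet> (rho x *\<^sub>R e_phi x)"

definition omega_theta :: "(real^3) set \<Rightarrow> (real^3 \<Rightarrow> real^3) \<Rightarrow> real^3 \<Rightarrow> real" where
  "omega_theta \<Omega> w x = 1 / rho x * d_rho \<Omega> (\<lambda>y. rho y * c_phi w y) x
                        - 1 / rho x * d_phi \<Omega> (c_rho w) x"

text \<open>Almost everywhere equal to a function that does not depend on \<open>\<theta>\<close>.\<close>

definition theta_indep :: "(real^3) set \<Rightarrow> (real^3 \<Rightarrow> real) \<Rightarrow> bool" where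
  "theta_indep \<Omega> f \<longleftrightarrow> (\<exists>G::real \<Rightarrow> real \<Rightarrow> real. AE x in lborel_on \<Omega>. f x = G (rho x) (phi x))"

definition axisymmetric :: "(real^3) set \<Rightarrow> (real^3 \<Rightarrow> real^3) \<Rightarrow> bool" where
  "axisymmetric \<Omega> w \<longleftrightarrow>
     theta_indep \<Omega> (c_rho w) \<and> theta_indep \<Omega> (c_phi w) \<and> theta_indep \<Omega> (c_theta w)"


section \<open>The domain and the boundary condition\<close>

definition Dm :: "real \<Rightarrow> nat \<Rightarrow> (real^3) set" where
  "Dm \<alpha> m = {x. 1 / real m < rho x \<and> rho x < 1 \<and> pi/2 - \<alpha> < phi x \<and> phi x < pi/2 + \<alpha>}"

text \<open>Surface measure on the spherical boundary piece of radius \<open>r\<close> (area element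
  \<open>r\<^sup>2 sin \<phi> d\<phi> d\<theta>\<close>), and on the conical boundary piece at polar angle \<open>p\<close> (area element
  \<open>\<rho> sin p d\<rho> d\<theta>\<close>).\<close>

definition sphere_piece :: "real \<Rightarrow> real \<Rightarrow> (real^3) measure" where
  "sphere_piece \<alpha> r =
     distr (density (lborel_on ({pi/2 - \<alpha><..<pi/2 + \<alpha>} \<times> {0..<2*pi}))
              (\<lambda>(p, q). ennreal (r\<^sup>2 * sin p)))
       borel (\<lambda>(p, q). sph r p q)"

definition cone_piece :: "nat \<Rightarrow> real \<Rightarrow> (real^3) measure" where
  "cone_piece m p =
     distr (density (lborel_on ({1 / real m<..<1} \<times> {0..<2*pi}))
              (\<lambda>(r, q). ennreal (r * sin p)))
       borel (\<lambda>(r, q). sph r p q)"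

definition R1 :: "real \<Rightarrow> nat \<Rightarrow> (real^3) measure" where "R1 \<alpha> m = cone_piece m (pi/2 - \<alpha>)"
definition R2 :: "real \<Rightarrow> nat \<Rightarrow> (real^3) measure" where "R2 \<alpha> m = cone_piece m (pi/2 + \<alpha>)"
definition A1 :: "real \<Rightarrow> nat \<Rightarrow> (real^3) measure" where "A1 \<alpha> m = sphere_piece \<alpha> (1 / real m)"
definition A2 :: "real \<Rightarrow> nat \<Rightarrow> (real^3) measure" where "A2 \<alpha> m = sphere_piece \<alpha> 1"

text \<open>The first conjunct is \<open>w \<cdot> n = 0\<close>, the outward normal \<open>n\<close> being \<open>- e_phi\<close>, \<open>e_phi\<close>,
  \<open>- e_rho\<close>, \<open>e_rho\<close> on the four pieces.\<close>

definition boundary_condition :: "real \<Rightarrow> nat \<Rightarrow> (real^3 \<Rightarrow> real^3) \<Rightarrow> bool" where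
  "boundary_condition \<alpha> m w \<longleftrightarrow>
    (let D = Dm \<alpha> m; wr = c_rho w; wp = c_phi w; wt = c_theta w in
      (trace_eq D (R1 \<alpha> m) (\<lambda>x. w x \<bullet> (- e_phi x)) (\<lambda>_. 0) \<and>
       trace_eq D (R2 \<alpha> m) (\<lambda>x. w x \<bullet> e_phi x) (\<lambda>_. 0) \<and>
       trace_eq D (A1 \<alpha> m) (\<lambda>x. w x \<bullet> (- e_rho x)) (\<lambda>_. 0) \<and>
       trace_eq D (A2 \<alpha> m) (\<lambda>x. w x \<bullet> e_rho x) (\<lambda>_. 0)) \<and>
      (\<forall>\<sigma>\<in>{R1 \<alpha> m, R2 \<alpha> m}.
         trace_eq D \<sigma> wp (\<lambda>_. 0) \<and>
         trace_eq D \<sigma> (d_rho D wp) (\<lambda>_. 0) \<and>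
         trace_eq D \<sigma> (d_phi D wr) (\<lambda>_. 0) \<and>
         trace_eq D \<sigma> (d_phi D wt) (\<lambda>x. cot (phi x) * wt x) \<and>
         trace_eq D \<sigma> (omega_theta D w) (\<lambda>_. 0)) \<and>
      (trace_eq D (A2 \<alpha> m) wr (\<lambda>_. 0) \<and>
       trace_eq D (A2 \<alpha> m) (d_phi D wr) (\<lambda>_. 0) \<and>
       trace_eq D (A2 \<alpha> m) (d_rho D wt) (\<lambda>x. 1 / rho x * wt x) \<and>
       trace_eq D (A2 \<alpha> m) (d_rho D wp) (\<lambda>x. 1 / rho x * wp x) \<and>
       trace_eq D (A2 \<alpha> m) (omega_theta D w) (\<lambda>x. 2 / rho x * wp x)) \<and>
      (trace_eq D (A1 \<alpha> m) wr (\<lambda>_. 0) \<and>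
       trace_eq D (A1 \<alpha> m) (d_phi D wr) (\<lambda>_. 0) \<and>
       trace_eq D (A1 \<alpha> m) (d_rho D wt) (\<lambda>x. 1 / rho x * wt x) \<and>
       trace_eq D (A1 \<alpha> m) (d_rho D wp) (\<lambda>x. - (1 / rho x) * wp x) \<and>
       trace_eq D (A1 \<alpha> m) (omega_theta D w) (\<lambda>_. 0)))"


section \<open>Strong solutions\<close>

definition admissible_initial_data :: "real \<Rightarrow> nat \<Rightarrow> (real^3 \<Rightarrow> real^3) \<Rightarrow> bool" where
  "admissible_initial_data \<alpha> m v0 \<longleftrightarrow>
     axisymmetric (Dm \<alpha> m) v0 \<and>
     sobolev_H 2 (Dm \<alpha> m) v0 \<and>
     (AE x in lborel_on (Dm \<alpha> m). weak_div (Dm \<alpha> m) v0 x = 0) \<and>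
     boundary_condition \<alpha> m v0 \<and>
     (\<integral>x. rho x * sin (phi x) * c_theta v0 x \<partial>lborel_on (Dm \<alpha> m)) = 0"

text \<open>The almost-everywhere quantifiers over \<open>t\<close> and \<open>x\<close> in the equations are iterated because the
  representatives chosen by \<^term>\<open>weak_deriv\<close> at different times need not be jointly measurable.\<close>

definition strong_solution ::
    "real \<Rightarrow> nat \<Rightarrow> real \<Rightarrow> (real^3 \<Rightarrow> real^3) \<Rightarrow> (real \<Rightarrow> real^3 \<Rightarrow> real^3) \<Rightarrow>
     (real \<Rightarrow> real^3 \<Rightarrow> real) \<Rightarrow> bool" where
  "strong_solution \<alpha> m T v0 v P \<longleftrightarrow>
    (let D = Dm \<alpha> m in
      admissible_initial_data \<alpha> m v0 \<and>
      (AE t in lborel_on {0<..<T}. axisymmetric D (v t) \<and> theta_indep D (P t)) \<and>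
      H1t_L2x T D v \<and> L2t_Hx 2 T D v \<and> Linf_tx T D v \<and>
      L2t_Hx 1 T D P \<and>
      (AE t in lborel_on {0<..<T}. AE x in lborel_on D.
         weak_laplacian D (v t) x - convection D (v t) (v t) x
           - weak_grad D (P t) x - time_deriv T D v t x = 0) \<and>
      (AE t in lborel_on {0<..<T}. AE x in lborel_on D. weak_div D (v t) x = 0) \<and>
      (AE t in lborel_on {0<..<T}. boundary_condition \<alpha> m (v t)) \<and>
      has_initial_value T D v v0)"

end

theory Submission imports Defs
begin

text \<open>Test the momentum equation at a fixed time with \<open>\<nabla>P\<close>. The time derivative is a limit of divergence
  free tangential fields, so it is orthogonal to gradients. By axial symmetry \<open>\<Delta>v \<cdot> \<nabla>P\<close> is minus the curl
  of \<open>\<omega>\<^sub>\<theta> e\<^sub>\<theta>\<close> paired with \<open>\<nabla>P\<close>, and a curl of \<open>f e\<^sub>\<theta>\<close> is orthogonal to gradients as soon as \<open>f\<close>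
  vanishes on the boundary. By the boundary condition \<open>f = \<omega>\<^sub>\<theta> - \<kappa> (\<rho> - 1/m) v\<^sub>\<phi>\<close> with
  \<open>\<kappa> = 2 / (1 - 1/m)\<close> does vanish there, so \<open>\<omega>\<^sub>\<theta>\<close> may be replaced by \<open>\<kappa> (\<rho> - 1/m) v\<^sub>\<phi>\<close>, which costs only
  first derivatives of \<open>v\<^sub>\<phi>\<close>. Boundary terms are removed with cutoff functions: a zero trace makes the
  mass in a boundary strip of width \<open>\<epsilon>\<close> small compared with \<open>\<epsilon>\<close>.\<close>


section \<open>Smooth functions on open sets\<close>

text \<open>The boundary condition is known only as equality of traces, a trace is known only
  through smooth functions converging in \<open>H1\<close>, and the pressure has a single weak
  derivative. Hence no surface integral and no second derivative of the pressure is ever formed.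
  Integrations by parts use cutoffs supported inside \<open>D\<close>, and any further derivative is
  placed on the product of a test function with a smooth approximant. Traces enter in two ways: they
  supply these approximants, and a one-dimensional estimate along coordinate lines turns a zero
  trace into smallness in thin strips. The correction of the vorticity depends on the radius alone
  and vanishes on the inner sphere. Its quotient by the radius is then bounded by \<kappa>, and m at
  least 1000 gives \<kappa> at most 3, so no power of m appears. The proof yields the factor 2 for
  the first derivatives of \<open>v_phi\<close> and \<open>6 + 3 * cot \<alpha>\<close> for
  \<open>v_phi\<close> itself; the stated constants leave room. The factor
  \<open>1 + cot \<alpha>\<close> comes from the centrifugal terms of the convection: one copy in
  the radial component, and one multiplied by cot \<phi> in the polar component, where |cot \<phi>|
  is at most tan \<alpha>, hence at most cot \<alpha>.\<close>

abbreviation (input) FD :: "('a::real_normed_vector => 'b::real_normed_vector) => 'a => 'a => 'b" where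
 "FD f x == frechet_derivative f (at x)"

text \<open>The statement's \<open>C_k\<close> speaks of functions on the whole space, whereas
  \<open>norm\<close>, \<open>s\<close> and the frame coefficients are smooth only away from the
  origin or the axis. The derivatives are full derivatives at points of \<open>S\<close>, so the
  notion is meant for open \<open>S\<close>.\<close>

primrec Ck_on :: "nat => 'a::euclidean_space set => ('a => real) => bool" where
 "Ck_on 0 S f \<longleftrightarrow> continuous_on S f"
| "Ck_on (Suc k) S f \<longleftrightarrow> (\<forall>x\<in>S. f differentiable (at x)) \<and>
  (\<forall>b\<in>Basis. Ck_on k S (%x. FD f x b))"

definition smooth_on :: "'a::euclidean_space set => ('a => real) => bool" where
 "smooth_on S f \<longleftrightarrow> (\<forall>k. Ck_on k S f)"

lemma C_k_iff_Ck_on: "C_k k f \<longleftrightarrow> Ck_on k UNIV f"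
 by (induction k arbitrary: f) auto

lemma smooth_iff_smooth_on: "smooth f \<longleftrightarrow> smooth_on UNIV f"
 by (simp add: smooth_def smooth_on_def C_k_iff_Ck_on)

lemma frechet_derivative_cong_open:
 assumes "open S" "x \<in> S" "\<And>y. y \<in> S ==> f y = g y"
 shows "FD f x = FD g x"
proof -
 have "(f has_derivative D) (at x) \<longleftrightarrow> (g has_derivative D) (at x)" for D
  using has_derivative_transform_within_open[OF _ assms(1,2)] assms(3) by metis
 then show ?thesis by (simp add: frechet_derivative_def)
qed

lemma Ck_on_cong:
 assumes "open S" "\<And>y. y \<in> S ==> f y = g y" "Ck_on k S f"
 shows "Ck_on k S g"
 using assms(2,3)
proof (induction k arbitrary: f g)
 case 0
 then show ?case using continuous_on_cong[of S S f g] by simp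
next
 case (Suc k)
 have d: "g differentiable (at x)" if "x \<in> S" for x
 proof -
  have "f differentiable (at x)" using Suc.prems(2) that by simp
  then obtain D where D: "(f has_derivative D) (at x)" unfolding differentiable_def by blast
  have "(g has_derivative D) (at x)"
   by (rule has_derivative_transform_within_open[OF D assms(1) that]) (rule Suc.prems(1))
  then show ?thesis unfolding differentiable_def by blast
 qed
 moreover have "Ck_on k S (%x. FD g x b)" if "b \<in> Basis" for b
  by (rule Suc.IH[of "%x. FD f x b" "%x. FD g x b"])
   (use Suc.prems(2) that in \<open>simp_all add: frechet_derivative_cong_open[OF assms(1) _ Suc.prems(1)]\<close>)
 ultimately show ?case by simp
qed

text \<open>Lets an explicit formula replace the derivative selected by
  \<open>frechet_derivative\<close>; the closure properties below are proved through it.\<close>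

lemma Ck_on_SucI:
 assumes "open S" "\<And>x. x \<in> S ==> (f has_derivative f' x) (at x)"
  "\<And>b. b \<in> Basis ==> Ck_on k S (%x. f' x b)"
 shows "Ck_on (Suc k) S f"
proof -
 have e: "FD f x = f' x" if "x \<in> S" for x
  using frechet_derivative_at[OF assms(2)[OF that]] by simp
 have "Ck_on k S (%x. FD f x b)" if "b \<in> Basis" for b
  by (rule Ck_on_cong[OF assms(1) _ assms(3)[OF that]]) (simp add: e)
 then show ?thesis using assms(2) by (auto simp: differentiable_def)
qed

lemma Ck_on_SucD:
 assumes "Ck_on (Suc k) S f"
 shows "Ck_on k S f"
 using assms
proof (induction k arbitrary: f)
 case 0
 then show ?case
  by (auto intro!: continuous_at_imp_continuous_on differentiable_imp_continuous_within)
next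
 case (Suc k)
 have "Ck_on k S (%x. FD f x b)" if "b \<in> Basis" for b
  using Suc.prems Suc.IH that by fastforce
 moreover have "\<forall>x\<in>S. f differentiable (at x)" using Suc.prems by simp
 ultimately show ?case by simp
qed

lemma Ck_on_subset: "Ck_on k S f ==> T \<subseteq> S ==> Ck_on k T f"
 by (induction k arbitrary: f) (auto intro: continuous_on_subset)

lemma Ck_on_Un:
 assumes "open S" "open T" "Ck_on k S f" "Ck_on k T f"
 shows "Ck_on k (S \<union> T) f"
 using assms(3,4)
 by (induction k arbitrary: f) (auto intro: continuous_on_open_Un assms(1,2))

lemma Ck_on_const: "open S ==> Ck_on k S (%x. c)"
proof (induction k arbitrary: c)
 case (Suc k)
 then show ?case by (intro Ck_on_SucI[where f'="%x h. 0"]) auto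
qed simp

lemma Ck_on_bounded_linear:
 assumes "open S" "bounded_linear f"
 shows "Ck_on k S f"
proof (cases k)
 case 0
 then show ?thesis using assms linear_continuous_on by auto
next
 case (Suc j)
 show ?thesis unfolding Suc
  by (rule Ck_on_SucI[where f'="%x. f"])
   (auto intro: assms Ck_on_const bounded_linear_imp_has_derivative)
qed

lemma Ck_on_add:
 assumes "open S" "Ck_on k S f" "Ck_on k S g"
 shows "Ck_on k S (%x. f x + g x)"
 using assms(2,3)
proof (induction k arbitrary: f g)
 case 0
 then show ?case by (auto intro: continuous_intros)
next
 case (Suc k)
 show ?case
  by (rule Ck_on_SucI[OF assms(1), where f'="%x h. FD f x h + FD g x h"])
   (use Suc in \<open>auto intro!: has_derivative_add simp: frechet_derivative_works[symmetric]\<close>)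
qed

lemma Ck_on_mult:
 assumes "open S" "Ck_on k S f" "Ck_on k S g"
 shows "Ck_on k S (%x. f x * g x)"
 using assms(2,3)
proof (induction k arbitrary: f g)
 case 0
 then show ?case by (auto intro: continuous_intros)
next
 case (Suc k)
 show ?case
 proof (rule Ck_on_SucI[OF assms(1), where f'="%x h. f x * FD g x h + FD f x h * g x"])
  show "Ck_on k S (%x. f x * FD g x b + FD f x b * g x)"
   if "b \<in> Basis" for b
   by (intro Ck_on_add[OF assms(1)] Suc.IH) (use Suc.prems Ck_on_SucD that in auto)
 qed (use Suc in \<open>auto intro!: has_derivative_mult simp: frechet_derivative_works[symmetric]\<close>)
qed

lemma linear_real_eq:
 fixes D :: "real => real"
 assumes "linear D"
 shows "D = (%h. D 1 * h)"
proof
 fix h show "D h = D 1 * h" using linear_cmul[OF assms, of h 1] by simp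
qed

text \<open>The induction generalises over the outer function because the chain rule replaces \<phi>
  by its derivative. An outer function of one real variable is enough: powers, the step function and
  the time factor of a product test function.\<close>

lemma Ck_on_compose:
 fixes \<phi> :: "real => real"
 assumes "open S" "Ck_on k I \<phi>" "Ck_on k S f" "f ` S \<subseteq> I"
 shows "Ck_on k S (%x. \<phi> (f x))"
 using assms(2,3)
proof (induction k arbitrary: \<phi>)
 case 0
 then show ?case using assms(4) continuous_on_compose2[of I \<phi> S f] by simp
next
 case (Suc k)
 let ?d = "%y. FD \<phi> y 1"
 show ?case
 proof (rule Ck_on_SucI[OF assms(1), where f'="%x h. ?d (f x) * FD f x h"])
  fix x assume x: "x \<in> S"
  then have "\<phi> differentiable at (f x)" "f differentiable at x" using Suc.prems assms(4) by auto
  then have "(\<phi> has_derivative FD \<phi> (f x)) (at (f x))"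
   and fd: "(f has_derivative FD f x) (at x)"
   by (simp_all add: frechet_derivative_works[symmetric])
  moreover have "FD \<phi> (f x) = (%h. ?d (f x) * h)"
   by (rule linear_real_eq[OF linear_frechet_derivative[OF \<open>\<phi> differentiable at (f x)\<close>]])
  ultimately have "(\<phi> has_derivative (%h. ?d (f x) * h)) (at (f x))" by metis
  from has_derivative_compose[OF fd this]
  show "((%x. \<phi> (f x)) has_derivative (%h. ?d (f x) * FD f x h)) (at x)" .
 next
  fix b :: 'a assume "b \<in> Basis"
  then have fb: "Ck_on k S (%x. FD f x b)" using Suc.prems(2) unfolding Ck_on.simps by blast
  have "Ck_on k I ?d" using Suc.prems(1) unfolding Ck_on.simps by (metis Basis_real_def singletonI)
  then have "Ck_on k S (%x. ?d (f x))" by (rule Suc.IH) (rule Ck_on_SucD[OF Suc.prems(2)])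
  from Ck_on_mult[OF assms(1) this fb]
  show "Ck_on k S (%x. ?d (f x) * FD f x b)" .
 qed
qed

text \<open>Real exponents form a family closed under differentiation, which covers square roots and
  reciprocals by one induction.\<close>

lemma Ck_on_powr: "Ck_on k {0<..} (%x::real. x powr a)"
proof (induction k arbitrary: a)
 case 0
 show ?case by (auto intro!: continuous_intros)
next
 case (Suc k)
 show ?case
 proof (rule Ck_on_SucI[where f'="%x h. h * (a * x powr (a - 1))"])
  fix x :: real assume "x \<in> {0<..}"
  then show "((%x. x powr a) has_derivative (%h. h * (a * x powr (a - 1)))) (at x)"
   using has_real_derivative_powr[of x a] by (simp add: has_field_derivative_def mult_commute_abs mult.commute)
 qed (use Suc in \<open>auto intro!: Ck_on_mult Ck_on_const\<close>)
qed

lemma smooth_onD: "smooth_on S f ==> Ck_on k S f"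
 by (simp add: smooth_on_def)

lemma smooth_on_cong: "open S ==> (\<And>y. y \<in> S ==> f y = g y) ==> smooth_on S f ==> smooth_on S g"
 unfolding smooth_on_def using Ck_on_cong by blast

lemma smooth_on_subset: "smooth_on S f ==> T \<subseteq> S ==> smooth_on T f"
 unfolding smooth_on_def using Ck_on_subset by blast

lemma smooth_on_Un: "open S ==> open T ==> smooth_on S f ==> smooth_on T f ==> smooth_on (S \<union> T) f"
 unfolding smooth_on_def using Ck_on_Un by blast

lemma smooth_on_const: "open S ==> smooth_on S (%x. c)"
 unfolding smooth_on_def using Ck_on_const by blast

lemma smooth_on_bounded_linear: "open S ==> bounded_linear f ==> smooth_on S f"
 unfolding smooth_on_def using Ck_on_bounded_linear by blast

lemma smooth_on_id: "open S ==> smooth_on S (%x. x)"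
 by (simp add: smooth_on_bounded_linear bounded_linear_ident)

lemma smooth_on_inner: "open S ==> smooth_on S (%x. x \<bullet> c)"
 by (simp add: smooth_on_bounded_linear bounded_linear_inner_left)

lemma smooth_on_vec_nth: "open S ==> smooth_on S (%x::real^'n. x $ i)"
 by (simp add: smooth_on_bounded_linear bounded_linear_vec_nth)

lemma smooth_on_add: "open S ==> smooth_on S f ==> smooth_on S g ==> smooth_on S (%x. f x + g x)"
 unfolding smooth_on_def using Ck_on_add by blast

lemma smooth_on_mult: "open S ==> smooth_on S f ==> smooth_on S g ==> smooth_on S (%x. f x * g x)"
 unfolding smooth_on_def using Ck_on_mult by blast

lemma smooth_on_uminus: "open S ==> smooth_on S f ==> smooth_on S (%x. - f x)"
 using smooth_on_mult[of S "%x. -1" f] smooth_on_const[of S "-1"] by simp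

lemma smooth_on_diff: "open S ==> smooth_on S f ==> smooth_on S g ==> smooth_on S (%x. f x - g x)"
 using smooth_on_add[of S f "%x. - g x"] smooth_on_uminus[of S g] by simp

lemma smooth_on_power: "open S ==> smooth_on S f ==> smooth_on S (%x. f x ^ n)"
 by (induction n) (auto intro: smooth_on_const smooth_on_mult)

lemma smooth_on_sum:
 "open S ==> (\<And>i. i \<in> I ==> smooth_on S (f i)) ==> smooth_on S (%x. \<Sum>i\<in>I. f i x)"
 by (induction I rule: infinite_finite_induct) (auto intro!: smooth_on_const smooth_on_add)

lemma smooth_on_prod:
 "open S ==> (\<And>i. i \<in> I ==> smooth_on S (f i)) ==> smooth_on S (%x. \<Prod>i\<in>I. f i x)"
 by (induction I rule: infinite_finite_induct) (auto intro!: smooth_on_const smooth_on_mult)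

lemma smooth_on_compose:
 fixes \<phi> :: "real => real"
 shows "open S ==> smooth_on I \<phi> ==> smooth_on S f ==> f ` S \<subseteq> I ==> smooth_on S (%x. \<phi> (f x))"
 unfolding smooth_on_def using Ck_on_compose by blast

lemma smooth_on_powr:
 "open S ==> smooth_on S f ==> (\<And>x. x \<in> S ==> 0 < f x) ==> smooth_on S (%x. f x powr a)"
 by (rule smooth_on_compose[where I="{0<..}"]) (auto simp: smooth_on_def Ck_on_powr)

lemma smooth_on_sqrt:
 assumes "open S" "smooth_on S f" "\<And>x. x \<in> S ==> 0 < f x"
 shows "smooth_on S (%x. sqrt (f x))"
 by (rule smooth_on_cong[OF assms(1) _ smooth_on_powr[OF assms, where a="1/2"]])
  (use assms(3) in \<open>auto simp: powr_half_sqrt less_imp_le\<close>)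

lemma smooth_on_divide:
 assumes "open S" "smooth_on S g" "smooth_on S f" "\<And>x. x \<in> S ==> 0 < f x"
 shows "smooth_on S (%x. g x / f x)"
proof (rule smooth_on_cong[OF assms(1) _ smooth_on_mult[OF assms(1,2) smooth_on_powr[OF assms(1,3,4), where a="-1"]]])
 fix y assume "y \<in> S"
 with assms(4)[OF this] show "g y * f y powr -1 = g y / f y"
  by (simp add: powr_minus_divide)
qed

lemma smooth_on_deriv: "smooth_on S f ==> b \<in> Basis ==> smooth_on S (%x. FD f x b)"
 unfolding smooth_on_def by (metis Ck_on.simps(2))

lemma smooth_on_imp_continuous: "smooth_on S f ==> continuous_on S f"
 using smooth_onD[of S f 0] by simp

lemma smooth_on_differentiable: "smooth_on S f ==> x \<in> S ==> f differentiable (at x)"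
 using smooth_onD[of S f "Suc 0"] by simp

lemma smooth_on_has_derivative:
 "smooth_on S f ==> x \<in> S ==> (f has_derivative FD f x) (at x)"
 using smooth_on_differentiable frechet_derivative_works by blast

lemma frechet_derivative_mult:
 fixes f g :: "'a::real_normed_vector => real"
 assumes "f differentiable (at x)" "g differentiable (at x)"
 shows "FD (%x. f x * g x) x h
  = f x * FD g x h + FD f x h * g x"
 using has_derivative_mult[OF assms[unfolded frechet_derivative_works]]
 by (simp add: frechet_derivative_at[symmetric])

lemma frechet_derivative_inner_gradient:
 fixes f :: "'a::euclidean_space => real"
 assumes "f differentiable (at x)"
 shows "FD f x h = (\<Sum>b\<in>Basis. (h \<bullet> b) * FD f x b)"
proof -
 interpret linear "FD f x" using linear_frechet_derivative[OF assms] .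
 show ?thesis by (subst euclidean_representation[of h, symmetric]) (simp add: sum scaleR)
qed

subsection \<open>A smooth step function\<close>

text \<open>The division by \<open>x ^ n\<close> makes the family closed under differentiation, so
  smoothness at 0 becomes an induction over the order with \<open>n\<close> arbitrary.\<close>

definition flat_exp :: "nat => real => real" where
 "flat_exp n x = (if x > 0 then exp (- (1 / x)) / x ^ n else 0)"

lemma flat_exp_right: "((%x. exp (- (1 / x)) / x ^ n) \<longlongrightarrow> 0) (at_right (0::real))"
proof -
 have "((%y::real. y ^ n / exp y) \<longlongrightarrow> 0) at_top" by (rule tendsto_power_div_exp_0)
 from filterlim_compose[OF this filterlim_inverse_at_top_right]
 show ?thesis by (simp add: exp_minus field_simps)
qed

lemma flat_exp_tendsto_0: "(flat_exp n \<longlongrightarrow> 0) (at 0)"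
proof (rule filterlim_split_at_real)
 show "(flat_exp n \<longlongrightarrow> 0) (at_left 0)"
  by (rule Lim_transform_eventually[where f="%x. 0"])
   (auto simp: flat_exp_def eventually_at_filter intro!: always_eventually)
 show "(flat_exp n \<longlongrightarrow> 0) (at_right 0)"
  by (rule Lim_transform_eventually[OF flat_exp_right[of n]])
   (auto simp: flat_exp_def eventually_at_filter intro!: always_eventually)
qed

lemma flat_exp_has_derivative:
 "(flat_exp n has_real_derivative (flat_exp (n + 2) x - n * flat_exp (n + 1) x)) (at x)"
proof -
 consider "x > 0" | "x < 0" | "x = 0" by linarith
 then show ?thesis
 proof cases
  case 1
  have "((%x. exp (- (1 / x)) / x ^ n) has_real_derivative
   (exp (- (1 / x)) * (1 / x\<^sup>2) * x ^ n - exp (- (1 / x)) * (n * x ^ (n - 1))) / (x ^ n * x ^ n)) (at x)"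
   using 1 by (auto intro!: derivative_eq_intros simp: power2_eq_square)
  also have "(exp (- (1 / x)) * (1 / x\<^sup>2) * x ^ n - exp (- (1 / x)) * (n * x ^ (n - 1))) / (x ^ n * x ^ n)
   = flat_exp (n + 2) x - n * flat_exp (n + 1) x"
   using 1 by (cases n) (auto simp: flat_exp_def divide_simps power2_eq_square algebra_simps)
  finally show ?thesis
   by (rule has_field_derivative_transform_within_open[of _ _ _ "{0<..}"]) (use 1 in \<open>auto simp: flat_exp_def\<close>)
 next
  case 2
  have "((%x. 0) has_real_derivative 0) (at x)" by simp
  then have "(flat_exp n has_real_derivative 0) (at x)"
   by (rule has_field_derivative_transform_within_open[of _ _ _ "{..<0}"]) (use 2 in \<open>auto simp: flat_exp_def\<close>)
  then show ?thesis using 2 by (simp add: flat_exp_def)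
 next
  case 3
  \<comment> \<open>The difference quotient of \<open>flat_exp n\<close> at 0 is
    \<open>flat_exp (n + 1)\<close>, which tends to 0.\<close>
  have "(flat_exp n has_real_derivative 0) (at 0)"
   unfolding has_field_derivative_iff
   by (rule Lim_transform_eventually[OF flat_exp_tendsto_0[of "n + 1"]])
    (auto simp: flat_exp_def eventually_at_filter intro!: always_eventually)
  then show ?thesis using 3 by (simp add: flat_exp_def)
 qed
qed

lemma smooth_on_flat_exp: "smooth_on UNIV (flat_exp n)"
proof -
 have "Ck_on k UNIV (flat_exp n)" for k
 proof (induction k arbitrary: n)
  case 0
  show ?case
   by (auto intro!: continuous_at_imp_continuous_on DERIV_isCont[OF flat_exp_has_derivative])
 next
  case (Suc k)
  show ?case
  proof (rule Ck_on_SucI[where f'="%x h. h * (flat_exp (n + 2) x + (- real n) * flat_exp (n + 1) x)"])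
   fix x :: real
   show "(flat_exp n has_derivative (%h. h * (flat_exp (n + 2) x + (- real n) * flat_exp (n + 1) x))) (at x)"
    using flat_exp_has_derivative[of n x] by (simp add: has_field_derivative_def mult_commute_abs)
   fix b :: real
   show "Ck_on k UNIV (%x. b * (flat_exp (n + 2) x + (- real n) * flat_exp (n + 1) x))"
    by (intro Ck_on_mult Ck_on_add Ck_on_const Suc.IH open_UNIV)
  qed simp
 qed
 then show ?thesis by (simp add: smooth_on_def)
qed

text \<open>The transition from 0 to 1 takes place on [1,2] and not on [0,1]: a cutoff
  \<open>smooth_step (d / eps)\<close> then vanishes already for \<open>d <= eps\<close>, which
  gives it compact support inside an open set.\<close>

definition smooth_step :: "real => real" where
 "smooth_step t = flat_exp 0 (t - 1) / (flat_exp 0 (t - 1) + flat_exp 0 (2 - t))"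

lemma smooth_step_denominator: "flat_exp 0 (t - 1) + flat_exp 0 (2 - t) > 0"
 by (cases "t > 1") (auto simp: flat_exp_def add_pos_nonneg)

lemma smooth_on_smooth_step: "smooth_on UNIV smooth_step"
 unfolding smooth_step_def[abs_def]
proof (rule smooth_on_divide)
 have a: "smooth_on UNIV (%t::real. t - 1)" "smooth_on UNIV (%t::real. 2 - t)"
  by (auto intro!: smooth_on_diff smooth_on_const smooth_on_id)
 show b: "smooth_on UNIV (%t. flat_exp 0 (t - 1))"
  by (rule smooth_on_compose[OF _ smooth_on_flat_exp a(1)]) auto
 have "smooth_on UNIV (%t. flat_exp 0 (2 - t))"
  by (rule smooth_on_compose[OF _ smooth_on_flat_exp a(2)]) auto
 then show "smooth_on UNIV (%t. flat_exp 0 (t - 1) + flat_exp 0 (2 - t))"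
  by (intro smooth_on_add b) auto
qed (auto simp: smooth_step_denominator)

lemma smooth_step_eq_0: "t <= 1 ==> smooth_step t = 0"
 by (simp add: smooth_step_def flat_exp_def)

lemma smooth_step_eq_1: "t \<ge> 2 ==> smooth_step t = 1"
 by (simp add: smooth_step_def flat_exp_def)

lemma smooth_step_nonneg: "0 <= smooth_step t"
 by (simp add: smooth_step_def flat_exp_def)

lemma smooth_step_le_1: "smooth_step t <= 1"
proof -
 have "0 <= flat_exp 0 (2 - t)" by (simp add: flat_exp_def)
 then show ?thesis using smooth_step_denominator[of t] by (simp add: smooth_step_def divide_le_eq_1)
qed

definition smooth_step' :: "real => real" where
 "smooth_step' t = FD smooth_step t 1"

lemma smooth_step_has_derivative: "(smooth_step has_real_derivative smooth_step' t) (at t)"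
proof -
 have d: "smooth_step differentiable (at t)"
  using smooth_on_differentiable[OF smooth_on_smooth_step] by simp
 then have "(smooth_step has_derivative FD smooth_step t) (at t)"
  by (simp add: frechet_derivative_works[symmetric])
 moreover have "FD smooth_step t = (%h. smooth_step' t * h)"
  unfolding smooth_step'_def by (rule linear_real_eq[OF linear_frechet_derivative[OF d]])
 ultimately show ?thesis by (simp add: has_field_derivative_def)
qed

lemma smooth_step'_eq_0:
 assumes "t < 1 \<or> t > 2"
 shows "smooth_step' t = 0"
proof -
 have "(smooth_step has_real_derivative 0) (at t)"
 proof (cases "t < 1")
  case True
  have "((%x. 0) has_real_derivative 0) (at t)" by simp
  then show ?thesis
   by (rule has_field_derivative_transform_within_open[of _ _ _ "{..<1}"]) (use True in \<open>auto simp: smooth_step_eq_0\<close>)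
 next
  case False
  have "((%x. 1) has_real_derivative 0) (at t)" by simp
  then show ?thesis
   by (rule has_field_derivative_transform_within_open[of _ _ _ "{2<..}"]) (use False assms in \<open>auto simp: smooth_step_eq_1\<close>)
 qed
 then show ?thesis using DERIV_unique smooth_step_has_derivative by blast
qed

lemma smooth_step'_bounded: obtains C where "C > 0" "\<And>t. \<bar>smooth_step' t\<bar> <= C"
proof -
 have "smooth_on UNIV smooth_step'"
  using smooth_on_deriv[OF smooth_on_smooth_step, of 1] by (simp add: smooth_step'_def[abs_def])
 then have "continuous_on {1..2} smooth_step'"
  using smooth_on_imp_continuous continuous_on_subset by blast
 then have "bounded (smooth_step' ` {1..2})"
  using compact_continuous_image compact_imp_bounded compact_Icc by blast
 then obtain C where C: "C > 0" "\<And>t. t \<in> {1..2} ==> \<bar>smooth_step' t\<bar> <= C"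
  by (auto simp: bounded_pos)
 show thesis
 proof (rule that[OF C(1)])
  fix t show "\<bar>smooth_step' t\<bar> <= C"
   using C smooth_step'_eq_0[of t] by (cases "t \<in> {1..2}") auto
 qed
qed

subsection \<open>Test functions\<close>

text \<open>The open sets \<Omega> and \<open>- K\<close> cover the space; the function is smooth on
  the first and identically 0 on the second. Functions smooth only on \<Omega> can therefore be
  factors of test functions.\<close>

lemma test_functionI:
 assumes "open \<Omega>" "smooth_on \<Omega> \<psi>" "compact K" "K \<subseteq> \<Omega>" "\<And>x. x \<notin> K ==> \<psi> x = 0"
 shows "test_function \<Omega> \<psi>"
proof -
 have o: "open (- K)" using assms(3) compact_imp_closed by blast
 have "smooth_on (- K) \<psi>"
  by (rule smooth_on_cong[OF o _ smooth_on_const[OF o, of 0]]) (use assms(5) in auto)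
 then have "smooth_on (\<Omega> \<union> - K) \<psi>" using smooth_on_Un[OF assms(1) o assms(2)] by blast
 moreover have "\<Omega> \<union> - K = UNIV" using assms(4) by blast
 ultimately show ?thesis
  unfolding test_function_def smooth_iff_smooth_on using assms(3-5) by metis
qed

lemma test_functionD:
 assumes "test_function \<Omega> \<psi>"
 shows "smooth_on S \<psi>" "continuous_on S \<psi>" "\<psi> differentiable (at x)"
proof -
 have *: "smooth_on UNIV \<psi>" using assms by (simp add: test_function_def smooth_iff_smooth_on)
 show a: "smooth_on S \<psi>" using * smooth_on_subset by blast
 show "continuous_on S \<psi>" using a smooth_on_imp_continuous by blast
 show "\<psi> differentiable (at x)" using * smooth_on_differentiable by blast
qed

lemma test_function_support:
 assumes "test_function \<Omega> \<psi>"
 obtains K where "compact K" "K \<subseteq> \<Omega>" "\<And>x. x \<notin> K ==> \<psi> x = 0"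
  "\<And>x h. x \<notin> K ==> FD \<psi> x h = 0"
proof -
 obtain K where K: "compact K" "K \<subseteq> \<Omega>" "\<And>x. x \<notin> K ==> \<psi> x = 0"
  using assms by (auto simp: test_function_def)
 have "FD \<psi> x h = 0" if "x \<notin> K" for x h
 proof -
  have "FD \<psi> x = FD (%x. 0) x"
   by (rule frechet_derivative_cong_open[of "- K"]) (use K that compact_imp_closed in auto)
  then show ?thesis by simp
 qed
 with K show thesis using that by blast
qed

lemma test_function_deriv:
 assumes "test_function \<Omega> \<psi>" "b \<in> Basis"
 shows "test_function \<Omega> (%x. FD \<psi> x b)"
proof -
 obtain K where K: "compact K" "K \<subseteq> \<Omega>" "\<And>x h. x \<notin> K ==> FD \<psi> x h = 0"
  using test_function_support[OF assms(1)] by metis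
 show ?thesis unfolding test_function_def smooth_iff_smooth_on
  using K smooth_on_deriv[OF test_functionD(1)[OF assms(1)] assms(2)] by blast
qed

lemma test_function_mult:
 assumes "open \<Omega>" "test_function \<Omega> \<psi>" "smooth_on \<Omega> a"
 shows "test_function \<Omega> (%x. a x * \<psi> x)"
proof -
 obtain K where K: "compact K" "K \<subseteq> \<Omega>" "\<And>x. x \<notin> K ==> \<psi> x = 0"
  using test_function_support[OF assms(2)] by metis
 show ?thesis
  by (rule test_functionI[OF assms(1) smooth_on_mult[OF assms(1,3) test_functionD(1)[OF assms(2)]] K(1,2)])
   (use K in auto)
qed

lemma test_function_bounded:
 assumes "test_function \<Omega> \<psi>"
 obtains C where "C > 0" "\<And>x. \<bar>\<psi> x\<bar> <= C"
proof -
 obtain K where K: "compact K" "K \<subseteq> \<Omega>" "\<And>x. x \<notin> K ==> \<psi> x = 0"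
  using test_function_support[OF assms(1)] by metis
 have "bounded (\<psi> ` K)"
  using K(1) test_functionD(2)[OF assms] compact_continuous_image compact_imp_bounded by blast
 then obtain C where C: "C > 0" "\<And>t. t \<in> K ==> \<bar>\<psi> t\<bar> <= C"
  by (auto simp: bounded_pos)
 show thesis
 proof (rule that[OF C(1)])
  fix t show "\<bar>\<psi> t\<bar> <= C" using C K(3)[of t] by (cases "t \<in> K") auto
 qed
qed

lemma test_function_deriv_bounded:
 assumes "test_function \<Omega> \<psi>" "b \<in> Basis"
 obtains C where "C > 0" "\<And>x. \<bar>FD \<psi> x b\<bar> <= C"
 using test_function_bounded[OF test_function_deriv[OF assms]] by metis

text \<open>Bounded partial derivatives bound the operator norm of the derivative. The global
  Lipschitz constant later dominates difference quotients along translations and rotations.\<close>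

lemma test_function_lipschitz:
 assumes "test_function \<Omega> \<psi>"
 obtains C where "C > 0" "\<And>x y. \<bar>\<psi> x - \<psi> y\<bar> <= C * norm (x - y)"
proof -
 have "\<exists>C>0. \<forall>x. \<bar>FD \<psi> x b\<bar> <= C" if "b \<in> Basis" for b
  using test_function_deriv_bounded[OF assms that] by metis
 then obtain C where C: "\<And>b. b \<in> Basis ==> C b > 0"
   "\<And>b x. b \<in> Basis ==> \<bar>FD \<psi> x b\<bar> <= C b"
  by metis
 let ?C = "\<Sum>b\<in>Basis. C b"
 have on: "onorm (FD \<psi> x) <= ?C" for x
 proof (rule onorm_bound)
  show "0 <= ?C" using C(1) by (intro sum_nonneg) (simp add: less_imp_le)
  fix h
  have "\<bar>FD \<psi> x h\<bar> <= (\<Sum>b\<in>Basis. \<bar>(h \<bullet> b) * FD \<psi> x b\<bar>)"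
   by (subst frechet_derivative_inner_gradient[OF test_functionD(3)[OF assms]]) (rule sum_abs)
  also have "\<dots> <= (\<Sum>b\<in>Basis. norm h * C b)"
   by (intro sum_mono) (auto simp: abs_mult Basis_le_norm intro!: mult_mono C)
  finally show "norm (FD \<psi> x h) <= ?C * norm h"
   by (simp add: sum_distrib_left mult.commute)
 qed
 show thesis
 proof (rule that)
  show "?C > 0" using sum_pos[OF finite_Basis nonempty_Basis, of C] C(1) by blast
  fix x y
  show "\<bar>\<psi> x - \<psi> y\<bar> <= ?C * norm (x - y)"
   using differentiable_bound[of UNIV \<psi> "%x. FD \<psi> x" ?C x y] on
    test_functionD(3)[OF assms] by (auto simp: frechet_derivative_works[symmetric])
 qed
qed

text \<open>Since \<open>U\<close> is a countable union of balls, \<open>\<psi> n\<close> can be one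
  minus the product of \<open>1 - b i n\<close> over the first \<open>n\<close> balls, where
  \<open>b i n\<close> is a bump in ball \<open>i\<close>. One factor equal to 0 already makes
  \<open>\<psi> n x = 1\<close>, and each point of \<open>U\<close> is eventually in this
  situation.\<close>

lemma exists_test_functions_indicator:
 fixes U :: "'a::euclidean_space set"
 assumes "open U"
 obtains \<psi> :: "nat => 'a => real" where "\<And>n. test_function U (\<psi> n)"
  "\<And>n x. 0 <= \<psi> n x" "\<And>n x. \<psi> n x <= 1" "\<And>x. (%n. \<psi> n x) \<longlonglongrightarrow> indicator U x"
proof -
 obtain \<D> :: "'a set set" where D: "countable \<D>" "\<And>X. X \<in> \<D> ==> \<exists>c r. X = ball c r" "\<Union>\<D> = U"
 proof -
  define F where "F = {B. B \<subseteq> U \<and> (\<exists>c r. B = ball c r)}"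
  have op: "open S" if "S \<in> F" for S using that by (auto simp: F_def)
  obtain F' where F': "F' \<subseteq> F" "countable F'" "\<Union>F' = \<Union>F"
   using Lindelof[of F] op by metis
  have "x \<in> \<Union>F" if x: "x \<in> U" for x
  proof -
   obtain e where "e > 0" "ball x e \<subseteq> U" using assms x open_contains_ball by blast
   then have "ball x e \<in> F" "x \<in> ball x e" by (auto simp: F_def)
   then show ?thesis by blast
  qed
  then have "\<Union>F = U" by (auto simp: F_def)
  moreover have "\<exists>c r. X = ball c r" if "X \<in> F'" for X
   using that F'(1) unfolding F_def by blast
  ultimately show thesis using F' that[of F'] by auto
 qed
 \<comment> \<open>The empty ball is added so that an enumeration by all natural numbers exists even
   if the family of balls is empty.\<close>
 define \<E> where "\<E> = insert {} \<D>"
 have "countable \<E>" "\<E> ~= {}" using D by (auto simp: \<E>_def)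
 then obtain B where B: "range (B :: nat => 'a set) = \<E>" using uncountable_def by blast
 have "\<exists>c r. B i = ball c r" for i
 proof -
  have "B i \<in> \<E>" using B by blast
  then show ?thesis using D(2) unfolding \<E>_def by (metis ball_empty insertE order_refl)
 qed
 then obtain c r where cr: "\<And>i. B i = ball (c i) (r i)" by metis
 have BU: "(\<Union>i. B i) = U" using B D(3) by (auto simp: \<E>_def)
 \<comment> \<open>A negative radius also describes the empty ball; truncating it at 0 keeps the
   comparison of squared distances correct.\<close>
 define r' where "r' i = max 0 (r i)" for i
 have cr': "B i = ball (c i) (r' i)" for i by (auto simp: cr r'_def ball_empty max_def)
 \<comment> \<open>The squared distance is smooth at the centre too. The bump is nonzero only where
   the squared distance is below \<open>(r' i)\<^sup>2 - 1 / n\<close>, which is inside a compact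
   part of the open ball.\<close>
 define b where "b i n x = smooth_step (real n * ((r' i)\<^sup>2 - (x - c i) \<bullet> (x - c i)))" for i n x
 define \<psi> where "\<psi> n x = 1 - (\<Prod>i<n. 1 - b i n x)" for n x
 have sm: "smooth_on UNIV (b i n)" for i n
 proof -
  have "smooth_on UNIV (%x. (x - c i) \<bullet> (x - c i))"
   by (subst euclidean_inner)
    (auto intro!: smooth_on_sum smooth_on_mult smooth_on_diff smooth_on_inner smooth_on_const simp: inner_diff_left)
  then show ?thesis unfolding b_def
   by (intro smooth_on_compose[OF _ smooth_on_smooth_step] smooth_on_mult smooth_on_diff smooth_on_const) auto
 qed
 have b01: "0 <= b i n x" "b i n x <= 1" for i n x
  by (auto simp: b_def smooth_step_nonneg smooth_step_le_1)
 have p01: "0 <= (\<Prod>i<n. 1 - b i n x)" "(\<Prod>i<n. 1 - b i n x) <= 1" for n x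
  using b01 by (auto intro!: prod_nonneg prod_le_1)
 define K where "K i n = {x. (norm (x - c i))\<^sup>2 <= (r' i)\<^sup>2 - 1 / real n} \<inter> cball (c i) (r' i)" for i n
 have Kc: "compact (K i n)" for i n
  unfolding K_def by (intro closed_Int_compact closed_Collect_le continuous_intros) auto
 have KB: "K i n \<subseteq> B i" if "n > 0" for i n
 proof
  fix x assume "x \<in> K i n"
  then have "(norm (x - c i))\<^sup>2 <= (r' i)\<^sup>2 - 1 / real n" by (simp add: K_def)
  also have "\<dots> < (r' i)\<^sup>2" using that by simp
  finally have "norm (x - c i) < r' i" by (rule power2_less_imp_less) (simp add: r'_def)
  then show "x \<in> B i" by (simp add: cr' dist_norm norm_minus_commute)
 qed
 have b0: "b i n x = 0" if "x \<notin> K i n" "n > 0" for i n x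
 proof -
  have "real n * ((r' i)\<^sup>2 - (norm (x - c i))\<^sup>2) <= 1"
  proof (rule ccontr)
   assume "\<not> ?thesis"
   then have *: "(norm (x - c i))\<^sup>2 < (r' i)\<^sup>2 - 1 / real n" using that by (simp add: field_simps)
   also have "\<dots> <= (r' i)\<^sup>2" by simp
   finally have "norm (x - c i) < r' i" by (rule power2_less_imp_less) (simp add: r'_def)
   with * that show False by (auto simp: K_def dist_norm norm_minus_commute)
  qed
  then show ?thesis by (simp add: b_def smooth_step_eq_0 dot_square_norm)
 qed
 show thesis
 proof (rule that[of \<psi>])
  fix n
  show "test_function U (\<psi> n)"
   unfolding test_function_def smooth_iff_smooth_on
  proof (intro conjI exI[of _ "\<Union>i<n. K i n"])
   show "smooth_on UNIV (\<psi> n)"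
    unfolding \<psi>_def by (intro smooth_on_diff smooth_on_prod smooth_on_const sm) auto
   show "compact (\<Union>i<n. K i n)" using Kc by (intro compact_UN) auto
   show "(\<Union>i<n. K i n) \<subseteq> U" using KB BU by (cases "n > 0") auto
   show "\<forall>x. x \<notin> (\<Union>i<n. K i n) --> \<psi> n x = 0"
    using b0 by (cases "n > 0") (auto simp: \<psi>_def)
  qed
  fix x
  show "0 <= \<psi> n x" "\<psi> n x <= 1" using p01[of n x] by (auto simp: \<psi>_def)
 next
  fix x
  show "(%n. \<psi> n x) \<longlonglongrightarrow> indicator U x"
  proof (cases "x \<in> U")
   case False
   have "\<psi> n x = 0" for n
   proof (cases "n > 0")
    case True
    then have "x \<notin> K i n" for i using KB[OF True] BU False by blast
    then show ?thesis using b0[OF _ True] by (simp add: \<psi>_def)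
   qed (simp add: \<psi>_def)
   then show ?thesis using False by simp
  next
   case True
   then obtain i where "x \<in> B i" using BU by blast
   then have "norm (x - c i) < r' i" by (simp add: cr' dist_norm norm_minus_commute)
   then have pos: "(r' i)\<^sup>2 - (norm (x - c i))\<^sup>2 > 0"
    by (simp add: power_strict_mono)
   obtain N where N: "real N * ((r' i)\<^sup>2 - (norm (x - c i))\<^sup>2) > 2"
    using reals_Archimedean3[OF pos] by blast
   have "\<psi> n x = 1" if "n \<ge> max N (Suc i)" for n
   proof -
    have "real N * ((r' i)\<^sup>2 - (norm (x - c i))\<^sup>2) <= real n * ((r' i)\<^sup>2 - (norm (x - c i))\<^sup>2)"
     using that pos by (intro mult_right_mono) auto
    then have "b i n x = 1" using N by (simp add: b_def smooth_step_eq_1 dot_square_norm)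
    then have "(\<Prod>i<n. 1 - b i n x) = 0" using that by (intro prod_zero) auto
    then show ?thesis by (simp add: \<psi>_def)
   qed
   then have "eventually (%n. \<psi> n x = 1) sequentially"
    using eventually_sequentially by blast
   then show ?thesis using True tendsto_eventually by simp
  qed
 qed
qed


section \<open>Weak derivatives\<close>

text \<open>The closed balls have to lie in \<Omega> because local integrability speaks about
  compact subsets.\<close>

lemma open_countable_cballs:
 fixes \<Omega> :: "'a::euclidean_space set"
 assumes "open \<Omega>"
 obtains c :: "nat => 'a" and r where "\<Omega> = (\<Union>i. ball (c i) (r i))" "\<And>i. cball (c i) (r i) \<subseteq> \<Omega>"
proof -
 define F where "F = {B. \<exists>c r. B = ball c r \<and> cball c r \<subseteq> \<Omega>}"
 have op: "open S" if "S \<in> F" for S using that by (auto simp: F_def)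
 obtain F' where F': "F' \<subseteq> F" "countable F'" "\<Union>F' = \<Union>F"
  using Lindelof[of F] op by metis
 have "x \<in> \<Union>F" if x: "x \<in> \<Omega>" for x
 proof -
  obtain e where e: "e > 0" "cball x e \<subseteq> \<Omega>" using assms x open_contains_cball by blast
  then have "ball x e \<in> F" "x \<in> ball x e" by (auto simp: F_def)
  then show ?thesis by blast
 qed
 moreover have "X \<subseteq> \<Omega>" if "X \<in> F" for X
  using that ball_subset_cball unfolding F_def by blast
 ultimately have U: "\<Union>F' = \<Omega>" using F'(3) by blast
 \<comment> \<open>A ball of negative radius puts the empty set into the family, so indexing by
   natural numbers works for empty \<Omega> as well.\<close>
 have "ball (0::'a) (-1) \<in> F" unfolding F_def by (auto intro!: exI[of _ 0] exI[of _ "-1"])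
 moreover have "ball (0::'a) (-1) = {}" by simp
 ultimately have "{} \<in> F" by metis
 define B where "B = from_nat_into (insert {} F')"
 have B: "range B = insert {} F'" unfolding B_def
  by (rule range_from_nat_into) (use F'(2) in auto)
 have "B i \<in> F" for i
 proof -
  have "B i \<in> insert {} F'" unfolding B[symmetric] by simp
  then show ?thesis using F'(1) \<open>{} \<in> F\<close> by auto
 qed
 then have "\<exists>c r. B i = ball c r \<and> cball c r \<subseteq> \<Omega>" for i
  unfolding F_def by simp
 then obtain c r where cr: "\<And>i. B i = ball (c i) (r i) \<and> cball (c i) (r i) \<subseteq> \<Omega>" by metis
 have "\<Omega> = \<Union>(insert {} F')" using U by simp
 also have "\<dots> = (\<Union>i. ball (c i) (r i))" unfolding B[symmetric] using cr by simp
 finally show thesis using that cr by blast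
qed

lemma test_function_mono: "test_function U \<psi> ==> U \<subseteq> \<Omega> ==> test_function \<Omega> \<psi>"
 unfolding test_function_def by blast

lemma test_function_eq_0: "test_function \<Omega> \<psi> ==> x \<notin> \<Omega> ==> \<psi> x = 0"
 unfolding test_function_def by blast

lemma open_Int_space_lborel [simp]: "open \<Omega> ==> \<Omega> \<inter> space lborel \<in> sets lborel"
 by simp

lemma AE_lborel_on:
 "open \<Omega> ==> (AE x in lborel_on \<Omega>. P x) \<longleftrightarrow> (AE x in lborel. x \<in> \<Omega> --> P x)"
 by (rule AE_restrict_space_iff) simp

lemma integrable_lborel_on:
 fixes f :: "'a::euclidean_space => 'b::euclidean_space"
 shows "open \<Omega> ==> integrable (lborel_on \<Omega>) f \<longleftrightarrow> integrable lborel (%x. indicator \<Omega> x *\<^sub>R f x)"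
 by (rule integrable_restrict_space) simp

lemma integral_lborel_on:
 fixes f :: "'a::euclidean_space => 'b::euclidean_space"
 shows "open \<Omega> ==> (\<integral>x. f x \<partial>lborel_on \<Omega>) = (\<integral>x. indicator \<Omega> x *\<^sub>R f x \<partial>lborel)"
 by (rule integral_restrict_space) simp

lemma integral_test_scaleR_lborel_on:
 fixes f :: "'a::euclidean_space => 'b::euclidean_space"
 assumes "open \<Omega>" "\<And>x. x \<notin> \<Omega> ==> \<psi> x = 0"
 shows "(\<integral>x. \<psi> x *\<^sub>R f x \<partial>lborel_on \<Omega>) = (\<integral>x. \<psi> x *\<^sub>R f x \<partial>lborel)"
 unfolding integral_lborel_on[OF assms(1)]
 by (rule Bochner_Integration.integral_cong) (use assms(2) in \<open>auto simp: indicator_def\<close>)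

text \<open>The function is the pointwise limit of its restrictions to finite unions of closed
  balls, each of which is integrable and so measurable.\<close>

lemma locally_integrable_borel:
 fixes f :: "'a::euclidean_space => 'b::euclidean_space"
 assumes "open \<Omega>" "locally_integrable \<Omega> f"
 shows "f \<in> borel_measurable (lborel_on \<Omega>)"
proof -
 obtain c :: "nat => 'a" and r where cr: "\<Omega> = (\<Union>i. ball (c i) (r i))" "\<And>i. cball (c i) (r i) \<subseteq> \<Omega>"
  using open_countable_cballs[OF assms(1)] by metis
 let ?K = "%n. \<Union>i<n. cball (c i) (r i)"
 have m: "(%x. indicator (?K n) x *\<^sub>R f x) \<in> borel_measurable lborel" for n
 proof -
  have "compact (?K n)" "?K n \<subseteq> \<Omega>" using cr(2) by auto
  then have "integrable lborel (%x. indicator (?K n) x *\<^sub>R f x)"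
   using assms(2) unfolding locally_integrable_def set_integrable_def by metis
  then show ?thesis by (rule borel_measurable_integrable)
 qed
 have "(%x. indicator \<Omega> x *\<^sub>R f x) \<in> borel_measurable lborel"
 proof (rule borel_measurable_LIMSEQ_metric[OF m])
  fix x
  show "(%n. indicator (?K n) x *\<^sub>R f x) \<longlonglongrightarrow> indicator \<Omega> x *\<^sub>R f x"
  proof (cases "x \<in> \<Omega>")
   case True
   then obtain i where "x \<in> ball (c i) (r i)" using cr(1) by blast
   then have i: "x \<in> cball (c i) (r i)" using ball_subset_cball by blast
   have "eventually (%n. indicator (?K n) x *\<^sub>R f x = indicator \<Omega> x *\<^sub>R f x) sequentially"
    unfolding eventually_sequentially
    by (rule exI[of _ "Suc i"]) (use i True in \<open>auto simp: indicator_def Suc_le_eq\<close>)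
   then show ?thesis by (rule tendsto_eventually)
  next
   case False
   then have "x \<notin> ?K n" for n using cr(2) by blast
   then show ?thesis using False by simp
  qed
 qed
 then show ?thesis using borel_measurable_restrict_space_iff[of \<Omega> lborel f] assms(1) by simp
qed

lemma integrable_mult_compact_support:
 fixes f :: "'a::euclidean_space => 'b::euclidean_space"
 assumes "open \<Omega>" "locally_integrable \<Omega> f" "continuous_on UNIV \<psi>" "compact K" "K \<subseteq> \<Omega>"
  "\<And>x. x \<notin> K ==> \<psi> x = 0"
 shows "integrable lborel (%x. \<psi> x *\<^sub>R f x)"
proof -
 have "bounded (\<psi> ` K)"
  by (intro compact_imp_bounded compact_continuous_image assms(4) continuous_on_subset[OF assms(3)]) auto
 then obtain C where C: "C > 0" "\<And>t. t \<in> K ==> \<bar>\<psi> t\<bar> <= C"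
  by (auto simp: bounded_pos)
 have iK: "integrable lborel (%x. indicator K x *\<^sub>R f x)"
  using assms(2,4,5) unfolding locally_integrable_def set_integrable_def by metis
 have e: "\<psi> x *\<^sub>R f x = \<psi> x *\<^sub>R (indicator K x *\<^sub>R f x)" for x
  using assms(6)[of x] by (auto simp: indicator_def)
 have m: "\<psi> \<in> borel_measurable borel" using assms(3) by (rule borel_measurable_continuous_onI)
 show ?thesis
 proof (rule Bochner_Integration.integrable_bound)
  show "integrable lborel (%x. C *\<^sub>R (indicator K x *\<^sub>R f x))" using iK by (rule integrable_scaleR_right)
  show "(%x. \<psi> x *\<^sub>R f x) \<in> borel_measurable lborel"
   unfolding e using m borel_measurable_integrable[OF iK] by measurable
  show "AE x in lborel. norm (\<psi> x *\<^sub>R f x) <= norm (C *\<^sub>R (indicator K x *\<^sub>R f x))"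
   using C assms(6) by (intro AE_I2) (auto simp: indicator_def intro!: mult_right_mono)
 qed
qed

lemma integrable_test_scaleR:
 fixes f :: "'a::euclidean_space => 'b::euclidean_space"
 assumes "open \<Omega>" "locally_integrable \<Omega> f" "test_function \<Omega> \<psi>"
 shows "integrable lborel (%x. \<psi> x *\<^sub>R f x)" "integrable (lborel_on \<Omega>) (%x. \<psi> x *\<^sub>R f x)"
proof -
 obtain K where K: "compact K" "K \<subseteq> \<Omega>" "\<And>x. x \<notin> K ==> \<psi> x = 0"
  using test_function_support[OF assms(3)] by metis
 show *: "integrable lborel (%x. \<psi> x *\<^sub>R f x)"
  by (rule integrable_mult_compact_support[OF assms(1,2) test_functionD(2)[OF assms(3)] K(1,2)]) (use K in auto)
 have "(%x. indicator \<Omega> x *\<^sub>R \<psi> x *\<^sub>R f x) = (%x. \<psi> x *\<^sub>R f x)"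
  using test_function_eq_0[OF assms(3)] by (auto simp: indicator_def fun_eq_iff)
 then show "integrable (lborel_on \<Omega>) (%x. \<psi> x *\<^sub>R f x)"
  unfolding integrable_lborel_on[OF assms(1)] using * by simp
qed

lemma locally_integrable_mult_continuous:
 fixes f :: "'a::euclidean_space => 'b::euclidean_space"
 assumes "locally_integrable \<Omega> f" "continuous_on \<Omega> a"
 shows "locally_integrable \<Omega> (%x. a x *\<^sub>R f x)"
 unfolding locally_integrable_def set_integrable_def
proof (intro allI impI)
 fix K assume K: "compact K" "K \<subseteq> \<Omega>"
 have c: "continuous_on K a" using assms(2) K(2) continuous_on_subset by blast
 then have "bounded (a ` K)" by (intro compact_imp_bounded compact_continuous_image c K(1))
 then obtain C where C: "C > 0" "\<And>t. t \<in> K ==> \<bar>a t\<bar> <= C"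
  by (auto simp: bounded_pos)
 have iK: "integrable lborel (%x. indicator K x *\<^sub>R f x)"
  using assms(1) K unfolding locally_integrable_def set_integrable_def by metis
 have "K \<in> sets borel" using K(1) by (rule borel_compact)
 then have m: "(%x. indicator K x *\<^sub>R a x) \<in> borel_measurable lborel"
  using borel_measurable_continuous_on_indicator[OF _ c] by simp
 have e: "indicator K x *\<^sub>R a x *\<^sub>R f x = (indicator K x *\<^sub>R a x) *\<^sub>R (indicator K x *\<^sub>R f x)" for x
  by (auto simp: indicator_def)
 show "integrable lborel (%x. indicator K x *\<^sub>R a x *\<^sub>R f x)"
 proof (rule Bochner_Integration.integrable_bound)
  show "integrable lborel (%x. C *\<^sub>R (indicator K x *\<^sub>R f x))" using iK by (rule integrable_scaleR_right)
  show "(%x. indicator K x *\<^sub>R a x *\<^sub>R f x) \<in> borel_measurable lborel"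
   unfolding e using m borel_measurable_integrable[OF iK] by measurable
  show "AE x in lborel. norm (indicator K x *\<^sub>R a x *\<^sub>R f x) <= norm (C *\<^sub>R (indicator K x *\<^sub>R f x))"
   using C by (intro AE_I2) (auto simp: indicator_def intro!: mult_right_mono)
 qed
qed

lemma locally_integrable_add:
 fixes f :: "'a::euclidean_space => 'b::euclidean_space"
 shows "locally_integrable \<Omega> f ==> locally_integrable \<Omega> g ==> locally_integrable \<Omega> (%x. f x + g x)"
 unfolding locally_integrable_def by (auto intro: set_integral_add)

lemma locally_integrable_diff:
 fixes f :: "'a::euclidean_space => 'b::euclidean_space"
 shows "locally_integrable \<Omega> f ==> locally_integrable \<Omega> g ==> locally_integrable \<Omega> (%x. f x - g x)"
 unfolding locally_integrable_def by (auto intro: set_integral_diff)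

lemma locally_integrable_inner:
 fixes f :: "'a::euclidean_space => 'b::euclidean_space"
 shows "locally_integrable \<Omega> f ==> locally_integrable \<Omega> (%x. f x \<bullet> c)"
 unfolding locally_integrable_def set_integrable_def
 using integrable_inner_left[of c lborel] by (fastforce simp: inner_scaleR_left)

lemma locally_integrable_smooth:
 assumes "open \<Omega>" "continuous_on \<Omega> f"
 shows "locally_integrable \<Omega> f"
 unfolding locally_integrable_def
 using assms(2) borel_integrable_compact continuous_on_subset
 by (metis set_integrable_def)

lemma locally_integrable_integrable:
 fixes f :: "'a::euclidean_space => 'b::euclidean_space"
 assumes "open \<Omega>" "integrable (lborel_on \<Omega>) f"
 shows "locally_integrable \<Omega> f"
 unfolding locally_integrable_def set_integrable_def
proof (intro allI impI)
 fix K assume K: "compact K" "K \<subseteq> \<Omega>"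
 have "integrable lborel (%x. indicator \<Omega> x *\<^sub>R f x)" using assms by (simp add: integrable_lborel_on)
 then have "integrable lborel (%x. indicator K x *\<^sub>R (indicator \<Omega> x *\<^sub>R f x))"
  by (rule integrable_mult_indicator[rotated]) (use borel_compact[OF K(1)] in auto)
 moreover have e: "indicator K x *\<^sub>R (indicator \<Omega> x *\<^sub>R f x) = indicator K x *\<^sub>R f x" for x
  using K(2) by (auto simp: indicator_def)
 ultimately show "integrable lborel (%x. indicator K x *\<^sub>R f x)" by (simp only:)
qed

text \<open>Inside a ball the function is integrable. Test functions increasing up to indicators,
  dominated by the function itself, show that its integral over each open subset is 0; open sets are
  closed under intersection and generate the Borel sets, so all its set integrals vanish. Countably
  many balls then exhaust \<Omega>.\<close>

theorem fundamental_lemma: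
 fixes h :: "'a::euclidean_space => 'b::euclidean_space"
 assumes \<Omega>: "open \<Omega>" and li: "locally_integrable \<Omega> h"
  and z: "\<And>\<psi>. test_function \<Omega> \<psi> ==> (\<integral>x. \<psi> x *\<^sub>R h x \<partial>lborel_on \<Omega>) = 0"
 shows "AE x in lborel_on \<Omega>. h x = 0"
proof -
 have ball: "AE x in lborel. x \<in> ball c r --> h x = 0" if cr: "cball c r \<subseteq> \<Omega>" for c r
 proof -
  define f where "f x = indicator (cball c r) x *\<^sub>R h x" for x
  have fi: "integrable lborel f"
   using li cr unfolding f_def locally_integrable_def set_integrable_def by auto
  define g where "g x = indicator (ball c r) x *\<^sub>R f x" for x
  have gi: "integrable lborel g" unfolding g_def using fi by (intro integrable_mult_indicator) auto
  have gm[measurable]: "g \<in> borel_measurable borel" using gi by auto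
  have basic: "set_lebesgue_integral lborel U g = 0" if U: "open U" for U
  proof -
   \<comment> \<open>Intersecting with the ball makes the approximating functions test functions for
     \<Omega>, although \<open>U\<close> is an arbitrary open set.\<close>
   have op: "open (U \<inter> ball c r)" using U by auto
   obtain \<psi> :: "nat => 'a => real" where \<psi>: "\<And>n. test_function (U \<inter> ball c r) (\<psi> n)"
    "\<And>n x. 0 <= \<psi> n x" "\<And>n x. \<psi> n x <= 1" "\<And>x. (%n. \<psi> n x) \<longlonglongrightarrow> indicator (U \<inter> ball c r) x"
    using exists_test_functions_indicator[OF op] by metis
   have sub: "U \<inter> ball c r \<subseteq> \<Omega>" using cr ball_subset_cball by blast
   have m[measurable]: "\<psi> n \<in> borel_measurable borel" for n
    using test_functionD(2)[OF \<psi>(1)] by (rule borel_measurable_continuous_onI)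
   have e: "\<psi> n x *\<^sub>R h x = \<psi> n x *\<^sub>R g x" for n x
    using test_function_eq_0[OF \<psi>(1)[of n], of x] ball_subset_cball[of c r]
    by (auto simp: g_def f_def indicator_def)
   have "(%n. \<integral>x. \<psi> n x *\<^sub>R g x \<partial>lborel) \<longlonglongrightarrow> (\<integral>x. indicator (U \<inter> ball c r) x *\<^sub>R g x \<partial>lborel)"
   proof (rule integral_dominated_convergence[where w="%x. norm (g x)"])
    show "AE x in lborel. (%n. \<psi> n x *\<^sub>R g x) \<longlonglongrightarrow> indicator (U \<inter> ball c r) x *\<^sub>R g x"
     by (intro AE_I2 tendsto_intros \<psi>(4))
    show "AE x in lborel. norm (\<psi> n x *\<^sub>R g x) <= norm (g x)" for n
     using \<psi>(2,3) by (auto intro!: mult_left_le_one_le)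
    show "(%x. indicator (U \<inter> ball c r) x *\<^sub>R g x) \<in> borel_measurable lborel"
     using op by (intro borel_measurable_scaleR borel_measurable_indicator) auto
    show "(%x. \<psi> n x *\<^sub>R g x) \<in> borel_measurable lborel" for n by measurable
    show "integrable lborel (%x. norm (g x))" using gi by (rule integrable_norm)
   qed
   moreover have "(\<integral>x. \<psi> n x *\<^sub>R g x \<partial>lborel) = 0" for n
   proof -
    have t: "test_function \<Omega> (\<psi> n)" using test_function_mono[OF \<psi>(1) sub] .
    have "(\<integral>x. \<psi> n x *\<^sub>R g x \<partial>lborel) = (\<integral>x. \<psi> n x *\<^sub>R h x \<partial>lborel_on \<Omega>)"
     unfolding e[symmetric]
     by (rule integral_test_scaleR_lborel_on[OF \<Omega>, symmetric]) (rule test_function_eq_0[OF t])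
    then show ?thesis using z[OF t] by simp
   qed
   ultimately have "(%n. 0) \<longlonglongrightarrow> (\<integral>x. indicator (U \<inter> ball c r) x *\<^sub>R g x \<partial>lborel)"
    by (simp only:)
   then have "(\<integral>x. indicator (U \<inter> ball c r) x *\<^sub>R g x \<partial>lborel) = 0"
    by (metis LIMSEQ_const_iff)
   moreover have "indicator (U \<inter> ball c r) x *\<^sub>R g x = indicator U x *\<^sub>R g x" for x
    by (auto simp: g_def indicator_def)
   ultimately show ?thesis unfolding set_lebesgue_integral_def by simp
  qed
  have "set_lebesgue_integral lborel A g = 0" if A: "A \<in> sets lborel" for A
  proof -
   have As: "A \<in> sigma_sets UNIV {S. open S}" using A by (simp add: borel_def)
   have sg: "sigma_sets UNIV {S::'a set. open S} = sets lborel" by (simp add: borel_def)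
   have si: "set_integrable lborel B g" if "B \<in> sets lborel" for B
    unfolding set_integrable_def using gi that by (intro integrable_mult_indicator)
   have "Int_stable {S::'a set. open S}" by (auto simp: Int_stable_def)
   then show ?thesis using _ As
   proof (rule sigma_sets_induct_disjoint)
    fix B assume B: "B \<in> sigma_sets UNIV {S::'a set. open S}" "set_lebesgue_integral lborel B g = 0"
    have Bm: "B \<in> sets lborel" using B(1) sg by simp
    have "set_lebesgue_integral lborel ((UNIV - B) \<union> B) g
     = set_lebesgue_integral lborel (UNIV - B) g + set_lebesgue_integral lborel B g"
     by (rule set_integral_Un) (use Bm si in auto)
    moreover have "(UNIV - B) \<union> B = UNIV" by auto
    ultimately show "set_lebesgue_integral lborel (UNIV - B) g = 0"
     using basic[of UNIV] B(2) by simp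
   next
    fix B :: "nat => 'a set" assume B: "disjoint_family B" "range B \<subseteq> sigma_sets UNIV {S. open S}"
     "\<And>i. set_lebesgue_integral lborel (B i) g = 0"
    have Bm: "B i \<in> sets lborel" for i using B(2) sg by blast
    have "set_lebesgue_integral lborel (\<Union>i. B i) g = (\<Sum>i. set_lebesgue_integral lborel (B i) g)"
     by (rule lebesgue_integral_countable_add) (use Bm B(1) si in \<open>auto simp: disjoint_family_on_def\<close>)
    then show "set_lebesgue_integral lborel (\<Union>i. B i) g = 0" using B(3) by simp
   qed (use basic in \<open>auto simp: set_lebesgue_integral_def\<close>)
  qed
  from sigma_finite_measure.density_zero[OF sigma_finite_lborel gi this] show ?thesis
   by (rule AE_mp) (use ball_subset_cball[of c r] in \<open>auto simp: g_def f_def indicator_def\<close>)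
 qed
 obtain c :: "nat => 'a" and r where cr: "\<Omega> = (\<Union>i. ball (c i) (r i))" "\<And>i. cball (c i) (r i) \<subseteq> \<Omega>"
  using open_countable_cballs[OF \<Omega>] by metis
 have "AE x in lborel. \<forall>i. x \<in> ball (c i) (r i) --> h x = 0"
  unfolding AE_all_countable using ball[OF cr(2)] by blast
 then have "AE x in lborel. x \<in> \<Omega> --> h x = 0"
  by (rule AE_mp) (use cr(1) in auto)
 then show ?thesis by (simp add: AE_lborel_on[OF \<Omega>])
qed

section \<open>Calculus of weak derivatives\<close>

lemma has_weak_deriv_unique:
 fixes f :: "'a::euclidean_space => 'b::euclidean_space"
 assumes "open \<Omega>" "has_weak_deriv \<Omega> b f g" "has_weak_deriv \<Omega> b f h"
 shows "AE x in lborel_on \<Omega>. g x = h x"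
proof -
 have l: "locally_integrable \<Omega> g" "locally_integrable \<Omega> h"
  using assms unfolding has_weak_deriv_def by auto
 have "AE x in lborel_on \<Omega>. g x - h x = 0"
 proof (rule fundamental_lemma[OF assms(1) locally_integrable_diff[OF l]])
  fix \<psi> :: "'a => real" assume t: "test_function \<Omega> \<psi>"
  have "(\<integral>x. \<psi> x *\<^sub>R g x \<partial>lborel_on \<Omega>) = (\<integral>x. \<psi> x *\<^sub>R h x \<partial>lborel_on \<Omega>)"
   using assms(2,3) t unfolding has_weak_deriv_def by (metis neg_equal_iff_equal)
  then show "(\<integral>x. \<psi> x *\<^sub>R (g x - h x) \<partial>lborel_on \<Omega>) = 0"
   using integrable_test_scaleR(2)[OF assms(1) l(1) t] integrable_test_scaleR(2)[OF assms(1) l(2) t]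
   by (simp add: scaleR_diff_right)
 qed
 then show ?thesis by simp
qed

lemma locally_integrable_cong_AE:
 fixes f f' :: "'a::euclidean_space => 'b::euclidean_space"
 assumes "open \<Omega>" "AE x in lborel_on \<Omega>. f x = f' x" "f' \<in> borel_measurable (lborel_on \<Omega>)"
  "locally_integrable \<Omega> f"
 shows "locally_integrable \<Omega> f'"
 unfolding locally_integrable_def set_integrable_def
proof (intro allI impI)
 fix K assume K: "compact K" "K \<subseteq> \<Omega>"
 have ae: "AE x in lborel. x \<in> \<Omega> --> f x = f' x" using assms(2) by (simp add: AE_lborel_on[OF assms(1)])
 have iK: "integrable lborel (%x. indicator K x *\<^sub>R f x)"
  using assms(4) K unfolding locally_integrable_def set_integrable_def by metis
 have [measurable]: "K \<in> sets borel" using K(1) by (rule borel_compact)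
 have m: "(%x. indicator \<Omega> x *\<^sub>R f' x) \<in> borel_measurable borel"
  using assms(1,3) borel_measurable_restrict_space_iff[of \<Omega> lborel f'] by simp
 have e: "indicator K x *\<^sub>R f' x = indicator K x *\<^sub>R (indicator \<Omega> x *\<^sub>R f' x)" for x
  using K(2) by (auto simp: indicator_def)
 show "integrable lborel (%x. indicator K x *\<^sub>R f' x)"
 proof (rule integrable_cong_AE_imp[OF iK])
  show "(%x. indicator K x *\<^sub>R f' x) \<in> borel_measurable lborel" unfolding e using m by measurable
  show "AE x in lborel. indicator K x *\<^sub>R f x = indicator K x *\<^sub>R f' x"
   using ae by (rule AE_mp) (use K(2) in \<open>auto simp: indicator_def\<close>)
 qed
qed

lemma integral_test_cong_AE:
 fixes f f' :: "'a::euclidean_space => 'b::euclidean_space"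
 assumes "open \<Omega>" "AE x in lborel_on \<Omega>. f x = f' x"
  "locally_integrable \<Omega> f" "locally_integrable \<Omega> f'" "test_function \<Omega> \<psi>"
 shows "(\<integral>x. \<psi> x *\<^sub>R f x \<partial>lborel_on \<Omega>) = (\<integral>x. \<psi> x *\<^sub>R f' x \<partial>lborel_on \<Omega>)"
 by (rule integral_cong_AE)
  (use assms(2) in \<open>auto intro: borel_measurable_integrable[OF integrable_test_scaleR(2)[OF assms(1,3,5)]]
    borel_measurable_integrable[OF integrable_test_scaleR(2)[OF assms(1,4,5)]]\<close>)

text \<open>Measurability of the new functions is assumed because equality almost everywhere does
  not carry Borel measurability over.\<close>

lemma has_weak_deriv_cong_AE:
 fixes f f' :: "'a::euclidean_space => 'b::euclidean_space"
 assumes "open \<Omega>" "b \<in> Basis" "has_weak_deriv \<Omega> b f g"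
  "AE x in lborel_on \<Omega>. f x = f' x" "f' \<in> borel_measurable (lborel_on \<Omega>)"
  "AE x in lborel_on \<Omega>. g x = g' x" "g' \<in> borel_measurable (lborel_on \<Omega>)"
 shows "has_weak_deriv \<Omega> b f' g'"
proof -
 have l: "locally_integrable \<Omega> f" "locally_integrable \<Omega> g" using assms(3) unfolding has_weak_deriv_def by auto
 have l': "locally_integrable \<Omega> f'" "locally_integrable \<Omega> g'"
  using locally_integrable_cong_AE[OF assms(1)] l assms by blast+
 show ?thesis unfolding has_weak_deriv_def
 proof (intro conjI allI impI l')
  fix \<psi> :: "'a => real" assume t: "test_function \<Omega> \<psi>"
  show "(\<integral>x. FD \<psi> x b *\<^sub>R f' x \<partial>lborel_on \<Omega>) = - (\<integral>x. \<psi> x *\<^sub>R g' x \<partial>lborel_on \<Omega>)"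
   using integral_test_cong_AE[OF assms(1,4) l(1) l'(1) test_function_deriv[OF t assms(2)]]
    integral_test_cong_AE[OF assms(1,6) l(2) l'(2) t] assms(3) t
   unfolding has_weak_deriv_def by metis
 qed
qed

lemma has_weak_deriv_cong:
 fixes f f' :: "'a::euclidean_space => 'b::euclidean_space"
 assumes "open \<Omega>" "b \<in> Basis" "has_weak_deriv \<Omega> b f g"
  "\<And>x. x \<in> \<Omega> ==> f x = f' x" "\<And>x. x \<in> \<Omega> ==> g x = g' x"
 shows "has_weak_deriv \<Omega> b f' g'"
proof -
 have l: "locally_integrable \<Omega> f" "locally_integrable \<Omega> g" using assms(3) unfolding has_weak_deriv_def by auto
 have sp: "space (lborel_on \<Omega>) = \<Omega>" by (simp add: space_restrict_space)
 have "f \<in> borel_measurable (lborel_on \<Omega>) \<longleftrightarrow> f' \<in> borel_measurable (lborel_on \<Omega>)"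
  by (rule measurable_cong) (use assms(4) sp in auto)
 moreover have "g \<in> borel_measurable (lborel_on \<Omega>) \<longleftrightarrow> g' \<in> borel_measurable (lborel_on \<Omega>)"
  by (rule measurable_cong) (use assms(5) sp in auto)
 ultimately show ?thesis
  by (intro has_weak_deriv_cong_AE[OF assms(1-3)])
   (use locally_integrable_borel[OF assms(1)] l assms(4,5) sp in auto)
qed

lemma has_weak_deriv_add:
 fixes f :: "'a::euclidean_space => 'b::euclidean_space"
 assumes "open \<Omega>" "b \<in> Basis" "has_weak_deriv \<Omega> b f g" "has_weak_deriv \<Omega> b f' g'"
 shows "has_weak_deriv \<Omega> b (%x. f x + f' x) (%x. g x + g' x)"
proof -
 have l: "locally_integrable \<Omega> f" "locally_integrable \<Omega> g" "locally_integrable \<Omega> f'" "locally_integrable \<Omega> g'"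
  using assms(3,4) unfolding has_weak_deriv_def by auto
 show ?thesis unfolding has_weak_deriv_def
 proof (intro conjI allI impI locally_integrable_add l)
  fix \<psi> :: "'a => real" assume t: "test_function \<Omega> \<psi>"
  note i = integrable_test_scaleR(2)[OF assms(1)]
  show "(\<integral>x. FD \<psi> x b *\<^sub>R (f x + f' x) \<partial>lborel_on \<Omega>) = - (\<integral>x. \<psi> x *\<^sub>R (g x + g' x) \<partial>lborel_on \<Omega>)"
   using assms(3,4) t i[OF l(1) test_function_deriv[OF t assms(2)]] i[OF l(3) test_function_deriv[OF t assms(2)]]
    i[OF l(2) t] i[OF l(4) t]
   unfolding has_weak_deriv_def by (simp add: scaleR_add_right)
 qed
qed

lemma has_weak_deriv_inner:
 fixes f :: "'a::euclidean_space => 'b::euclidean_space"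
 assumes "open \<Omega>" "b \<in> Basis" "has_weak_deriv \<Omega> b f g"
 shows "has_weak_deriv \<Omega> b (%x. f x \<bullet> c) (%x. g x \<bullet> c)"
proof -
 have l: "locally_integrable \<Omega> f" "locally_integrable \<Omega> g"
  using assms(3) unfolding has_weak_deriv_def by auto
 show ?thesis unfolding has_weak_deriv_def
 proof (intro conjI allI impI locally_integrable_inner l)
  fix \<psi> :: "'a => real" assume t: "test_function \<Omega> \<psi>"
  note i = integrable_test_scaleR(2)[OF assms(1)]
  have "(\<integral>x. FD \<psi> x b *\<^sub>R f x \<partial>lborel_on \<Omega>) \<bullet> c = (- (\<integral>x. \<psi> x *\<^sub>R g x \<partial>lborel_on \<Omega>)) \<bullet> c"
   using assms(3) t unfolding has_weak_deriv_def by metis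
  then show "(\<integral>x. FD \<psi> x b *\<^sub>R (f x \<bullet> c) \<partial>lborel_on \<Omega>) = - (\<integral>x. \<psi> x *\<^sub>R (g x \<bullet> c) \<partial>lborel_on \<Omega>)"
   using integral_inner_left[OF i[OF l(1) test_function_deriv[OF t assms(2)]], of c]
    integral_inner_left[OF i[OF l(2) t], of c] by simp
 qed
qed

text \<open>The weak derivative of \<open>f\<close> is tested with \<open>a * \<psi>\<close>, which
  is a test function although \<open>a\<close> is smooth on \<Omega> only.\<close>

lemma has_weak_deriv_mult_smooth:
 fixes f :: "'a::euclidean_space => real"
 assumes "open \<Omega>" "b \<in> Basis" "has_weak_deriv \<Omega> b f g" "smooth_on \<Omega> a"
 shows "has_weak_deriv \<Omega> b (%x. a x * f x) (%x. FD a x b * f x + a x * g x)"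
proof -
 have l: "locally_integrable \<Omega> f" "locally_integrable \<Omega> g"
  using assms(3) unfolding has_weak_deriv_def by auto
 have sd: "smooth_on \<Omega> (%x. FD a x b)" using smooth_on_deriv assms by blast
 have l': "locally_integrable \<Omega> (%x. a x * f x)" "locally_integrable \<Omega> (%x. FD a x b * f x)"
  "locally_integrable \<Omega> (%x. a x * g x)"
  using locally_integrable_mult_continuous[OF l(1) smooth_on_imp_continuous[OF assms(4)]]
   locally_integrable_mult_continuous[OF l(1) smooth_on_imp_continuous[OF sd]]
   locally_integrable_mult_continuous[OF l(2) smooth_on_imp_continuous[OF assms(4)]] by auto
 show ?thesis unfolding has_weak_deriv_def
 proof (intro conjI allI impI locally_integrable_add l')
  fix \<psi> :: "'a => real" assume t: "test_function \<Omega> \<psi>"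
  note i = integrable_test_scaleR(2)[OF assms(1)]
  have t1: "test_function \<Omega> (%x. a x * \<psi> x)" using test_function_mult[OF assms(1) t assms(4)] .
  have sp: "space (lborel_on \<Omega>) = \<Omega>" by (simp add: space_restrict_space)
  have ti: "integrable (lborel_on \<Omega>) (%x. FD \<psi> x b *\<^sub>R (a x * f x))"
   "integrable (lborel_on \<Omega>) (%x. \<psi> x *\<^sub>R (FD a x b * f x))"
   "integrable (lborel_on \<Omega>) (%x. \<psi> x *\<^sub>R (a x * g x))"
   by (intro i l' t test_function_deriv[OF t assms(2)])+
  have "(\<integral>x. FD (%x. a x * \<psi> x) x b *\<^sub>R f x \<partial>lborel_on \<Omega>)
   = (\<integral>x. FD \<psi> x b *\<^sub>R (a x * f x) + \<psi> x *\<^sub>R (FD a x b * f x) \<partial>lborel_on \<Omega>)"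
  proof (rule Bochner_Integration.integral_cong)
   fix x assume "x \<in> space (lborel_on \<Omega>)"
   then have "a differentiable at x" using sp smooth_on_differentiable[OF assms(4)] by simp
   from frechet_derivative_mult[OF this test_functionD(3)[OF t]]
   show "FD (%x. a x * \<psi> x) x b *\<^sub>R f x
    = FD \<psi> x b *\<^sub>R (a x * f x) + \<psi> x *\<^sub>R (FD a x b * f x)"
    by (simp add: algebra_simps)
  qed simp
  then have "(\<integral>x. FD \<psi> x b *\<^sub>R (a x * f x) \<partial>lborel_on \<Omega>)
    + (\<integral>x. \<psi> x *\<^sub>R (FD a x b * f x) \<partial>lborel_on \<Omega>)
   = - (\<integral>x. (a x * \<psi> x) *\<^sub>R g x \<partial>lborel_on \<Omega>)"
   using assms(3) t1 ti(1,2) unfolding has_weak_deriv_def by simp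
  then show "(\<integral>x. FD \<psi> x b *\<^sub>R (a x * f x) \<partial>lborel_on \<Omega>) =
   - (\<integral>x. \<psi> x *\<^sub>R (FD a x b * f x + a x * g x) \<partial>lborel_on \<Omega>)"
   using ti(2,3) by (simp add: distrib_left mult_ac)
 qed
qed

lemma has_weak_deriv_const_mult:
 fixes f :: "'a::euclidean_space => real"
 assumes "open \<Omega>" "b \<in> Basis" "has_weak_deriv \<Omega> b f g"
 shows "has_weak_deriv \<Omega> b (%x. c * f x) (%x. c * g x)"
 using has_weak_deriv_mult_smooth[OF assms smooth_on_const[OF assms(1), of c]] by simp

lemma has_weak_deriv_diff:
 fixes f :: "'a::euclidean_space => real"
 assumes "open \<Omega>" "b \<in> Basis" "has_weak_deriv \<Omega> b f g" "has_weak_deriv \<Omega> b f' g'"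
 shows "has_weak_deriv \<Omega> b (%x. f x - f' x) (%x. g x - g' x)"
 using has_weak_deriv_add[OF assms(1-3) has_weak_deriv_const_mult[OF assms(1,2,4), of "-1"]] by simp

lemma has_weak_deriv_0:
 assumes "open \<Omega>" "b \<in> Basis"
 shows "has_weak_deriv \<Omega> b (%x. 0::real) (%x. 0)"
 unfolding has_weak_deriv_def locally_integrable_def set_integrable_def by simp

text \<open>The difference quotients of \<open>\<tau> \<mapsto> \<integral> \<psi> (\<Phi> \<tau> x) f x\<close> vanish and converge to the integral in question.\<close>

lemma integral_flow_derivative_eq_0:
 fixes f \<psi> \<psi>' w :: "'a::euclidean_space => real" and \<Phi> :: "real => 'a => 'a"
 assumes inv: "\<And>\<tau>. (\<integral>x. \<psi> (\<Phi> \<tau> x) * f x \<partial>lborel) = (\<integral>x. \<psi> x * f x \<partial>lborel)"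
  and int: "\<And>\<tau>. integrable lborel (%x. \<psi> (\<Phi> \<tau> x) * f x)" "integrable lborel (%x. \<psi> x * f x)"
  and der: "\<And>x. ((%\<tau>. \<psi> (\<Phi> \<tau> x)) has_real_derivative \<psi>' x) (at 0)" and \<Phi>0: "\<And>x. \<Phi> 0 x = x"
  and w: "integrable lborel w" "\<And>\<tau> x. 0 < \<tau> ==> \<tau> <= 1 ==> \<bar>(\<psi> (\<Phi> \<tau> x) - \<psi> x) * f x\<bar> <= \<tau> * w x"
  and m: "(%x. \<psi>' x * f x) \<in> borel_measurable lborel"
 shows "(\<integral>x. \<psi>' x * f x \<partial>lborel) = 0"
proof -
 \<comment> \<open>A sequence in (0,1], since domination is available only for such
   parameters.\<close>
 define t where "t n = 1 / real (Suc n)" for n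
 have t: "0 < t n" "t n <= 1" for n by (auto simp: t_def)
 have t0: "t \<longlonglongrightarrow> 0" unfolding t_def by (rule LIMSEQ_Suc[OF lim_1_over_n])
 have ft: "filterlim t (at 0) sequentially"
  using t0 t(1) by (auto simp: filterlim_at less_imp_neq[THEN not_sym] intro!: always_eventually)
 define q where "q n x = (\<psi> (\<Phi> (t n) x) - \<psi> x) * f x / t n" for n x
 have "(%n. \<integral>x. q n x \<partial>lborel) \<longlonglongrightarrow> (\<integral>x. \<psi>' x * f x \<partial>lborel)"
 proof (rule integral_dominated_convergence[where w=w])
  show "(%x. \<psi>' x * f x) \<in> borel_measurable lborel" by (rule m)
  show "q n \<in> borel_measurable lborel" for n
   unfolding q_def left_diff_distrib
   using borel_measurable_integrable[OF int(1)[of "t n"]] borel_measurable_integrable[OF int(2)] by measurable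
  show "integrable lborel w" by (rule w)
  show "AE x in lborel. (%n. q n x) \<longlonglongrightarrow> \<psi>' x * f x"
  proof (rule AE_I2)
   fix x
   have "((%\<tau>. (\<psi> (\<Phi> \<tau> x) - \<psi> x) / \<tau>) \<longlongrightarrow> \<psi>' x) (at 0)"
    using der[of x] by (simp add: has_field_derivative_iff \<Phi>0)
   from filterlim_compose[OF this ft]
   have "(%n. (\<psi> (\<Phi> (t n) x) - \<psi> x) / t n) \<longlonglongrightarrow> \<psi>' x" .
   from tendsto_mult_right[OF this, of "f x"] show "(%n. q n x) \<longlonglongrightarrow> \<psi>' x * f x"
    by (simp add: q_def)
  qed
  show "AE x in lborel. norm (q n x) <= w x" for n
   using w(2)[OF t[of n]] t(1)[of n] by (auto simp: q_def divide_le_eq mult.commute)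
 qed
 moreover have "(\<integral>x. q n x \<partial>lborel) = 0" for n
  unfolding q_def left_diff_distrib using int inv[of "t n"] by simp
 ultimately have "(%n. 0) \<longlonglongrightarrow> (\<integral>x. \<psi>' x * f x \<partial>lborel)" by (simp only:)
 then show ?thesis by (metis LIMSEQ_const_iff)
qed

text \<open>Lebesgue measure is invariant under translation along \<open>b\<close>; differentiating
  this invariance at the identity gives the claim.\<close>

lemma integral_test_deriv_eq_0:
 fixes \<psi> :: "'a::euclidean_space => real"
 assumes t: "test_function UNIV \<psi>" and b: "b \<in> Basis"
 shows "(\<integral>x. FD \<psi> x b \<partial>lborel) = 0"
proof -
 obtain K where K: "compact K" "\<And>x. x \<notin> K ==> \<psi> x = 0"
  using test_function_support[OF t] by metis
 obtain C where C: "C > 0" "\<And>x y. \<bar>\<psi> x - \<psi> y\<bar> <= C * norm (x - y)"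
  using test_function_lipschitz[OF t] by metis
 obtain B where B: "\<And>x. x \<in> K ==> norm x <= B" using compact_imp_bounded[OF K(1)] bounded_iff by blast
 have l1: "locally_integrable UNIV (%x::'a. 1::real)" by (rule locally_integrable_smooth) auto
 have i: "integrable lborel \<psi>" using integrable_test_scaleR(1)[OF _ l1 t] by simp
 have ib: "integrable lborel (%x. \<psi> (x + \<tau> *\<^sub>R b))" for \<tau>
 proof -
  have "integrable (distr lborel borel ((+) (\<tau> *\<^sub>R b))) \<psi>" unfolding lborel_distr_plus by (rule i)
  then have "integrable lborel (%x. \<psi> (\<tau> *\<^sub>R b + x))" by (subst (asm) integrable_distr_eq) (use i in auto)
  then show ?thesis by (simp add: add.commute)
 qed
 have "(\<integral>x. FD \<psi> x b * 1 \<partial>lborel) = 0"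
 \<comment> \<open>Shifts by at most 1 move the support, of norm at most \<open>B\<close>, within
   the ball of radius \<open>B + 1\<close>; there the difference is bounded by the Lipschitz
   constant times \<tau>.\<close>
 proof (rule integral_flow_derivative_eq_0[where \<psi>=\<psi> and \<Phi>="%\<tau> x. x + \<tau> *\<^sub>R b" and w="%x. C * indicator (cball 0 (B+1)) x"])
  fix \<tau>
  have "(\<integral>x. \<psi> x \<partial>lborel) = (\<integral>x. \<psi> x \<partial>distr lborel borel ((+) (\<tau> *\<^sub>R b)))"
   unfolding lborel_distr_plus ..
  also have "\<dots> = (\<integral>x. \<psi> (\<tau> *\<^sub>R b + x) \<partial>lborel)" by (rule integral_distr) (use i in auto)
  finally show "(\<integral>x. \<psi> (x + \<tau> *\<^sub>R b) * 1 \<partial>lborel) = (\<integral>x. \<psi> x * 1 \<partial>lborel)" by (simp add: add.commute)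
 next
  fix x
  have "(\<psi> has_derivative FD \<psi> x) (at (x + 0 *\<^sub>R b))"
   using test_functionD(3)[OF t, of x] frechet_derivative_works by auto
  moreover have "((%\<tau>. x + \<tau> *\<^sub>R b) has_derivative (%h. h *\<^sub>R b)) (at 0)"
   by (auto intro!: derivative_eq_intros)
  ultimately have "((%\<tau>. \<psi> (x + \<tau> *\<^sub>R b)) has_derivative (%h. FD \<psi> x (h *\<^sub>R b))) (at 0)"
   using has_derivative_compose by blast
  then show "((%\<tau>. \<psi> (x + \<tau> *\<^sub>R b)) has_real_derivative FD \<psi> x b) (at 0)"
   using linear_cmul[OF linear_frechet_derivative[OF test_functionD(3)[OF t, of x]]]
   by (simp add: has_field_derivative_def mult_commute_abs)
 next
  show "integrable lborel (%x::'a. C * indicator (cball 0 (B+1)) x)"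
   by (intro integrable_mult_right integrable_real_indicator)
    (use emeasure_bounded_finite[OF bounded_cball[of "0::'a" "B+1"]] in auto)
 next
  fix \<tau> :: real and x assume \<tau>: "0 < \<tau>" "\<tau> <= 1"
  show "\<bar>(\<psi> (x + \<tau> *\<^sub>R b) - \<psi> x) * 1\<bar> <= \<tau> * (C * indicator (cball 0 (B+1)) x)"
  proof (cases "norm x <= B + 1")
   case True
   have "\<bar>\<psi> (x + \<tau> *\<^sub>R b) - \<psi> x\<bar> <= C * \<tau>" using C(2)[of "x + \<tau> *\<^sub>R b" x] b \<tau> by simp
   then show ?thesis using True by (simp add: mult.commute)
  next
   case False
   have "norm x <= norm (x + \<tau> *\<^sub>R b) + norm (\<tau> *\<^sub>R b)"
    using norm_triangle_ineq4[of "x + \<tau> *\<^sub>R b" "\<tau> *\<^sub>R b"] by simp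
   then have "norm (x + \<tau> *\<^sub>R b) > B" using False b \<tau> by simp
   then have "\<psi> x = 0" "\<psi> (x + \<tau> *\<^sub>R b) = 0" using K(2) B False by fastforce+
   then show ?thesis using C(1) \<tau> by simp
  qed
 next
  have "continuous_on UNIV (%x. FD \<psi> x b)"
   using test_functionD(2)[OF test_function_deriv[OF t b]] .
  then show "(%x. FD \<psi> x b * 1) \<in> borel_measurable lborel"
   using borel_measurable_continuous_onI by auto
 qed (use i ib in auto)
 then show ?thesis by simp
qed

text \<open>The product \<open>u * \<psi>\<close> is a test function on the whole space, so the
  integral of its derivative is 0; the product rule holds at every point since outside \<Omega> all
  three terms vanish.\<close>

lemma has_weak_deriv_smooth:
 assumes "open \<Omega>" "b \<in> Basis" "smooth_on \<Omega> u"
 shows "has_weak_deriv \<Omega> b u (%x. FD u x b)"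
proof -
 have sd: "smooth_on \<Omega> (%x. FD u x b)" using smooth_on_deriv assms by blast
 have l: "locally_integrable \<Omega> u" "locally_integrable \<Omega> (%x. FD u x b)"
  by (intro locally_integrable_smooth assms(1) smooth_on_imp_continuous assms(3) sd)+
 show ?thesis unfolding has_weak_deriv_def
 proof (intro conjI allI impI l)
  fix \<psi> :: "'a => real" assume t: "test_function \<Omega> \<psi>"
  let ?u' = "%x. FD u x b" and ?\<psi>' = "%x. FD \<psi> x b"
  note t' = test_function_deriv[OF t assms(2)]
  have tm: "test_function UNIV (%x. u x * \<psi> x)"
   using test_function_mult[OF assms(1) t assms(3)] test_function_mono by blast
  note i = integrable_test_scaleR(1)[OF assms(1) l(1) t'] integrable_test_scaleR(1)[OF assms(1) l(2) t]
  obtain K where K: "compact K" "K \<subseteq> \<Omega>" "\<And>x. x \<notin> K ==> \<psi> x = 0"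
   using test_function_support[OF t] by metis
  have e: "FD (%x. u x * \<psi> x) x b = ?\<psi>' x *\<^sub>R u x + \<psi> x *\<^sub>R ?u' x" for x
  proof (cases "x \<in> \<Omega>")
   case True
   then show ?thesis
    using frechet_derivative_mult[OF smooth_on_differentiable[OF assms(3) True] test_functionD(3)[OF t], of b]
    by (simp add: mult.commute)
  next
   case False
   then have "x \<in> - K" using K by blast
   then have "FD (%x. u x * \<psi> x) x = FD (%x. 0) x"
    by (rule frechet_derivative_cong_open[rotated]) (use K compact_imp_closed in auto)
   moreover have "?\<psi>' x = 0" "\<psi> x = 0" using test_function_eq_0 t t' False by blast+
   ultimately show ?thesis by simp
  qed
  have "(\<integral>x. ?\<psi>' x *\<^sub>R u x \<partial>lborel) + (\<integral>x. \<psi> x *\<^sub>R ?u' x \<partial>lborel) = 0"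
   using integral_test_deriv_eq_0[OF tm assms(2)] i unfolding e by simp
  then show "(\<integral>x. ?\<psi>' x *\<^sub>R u x \<partial>lborel_on \<Omega>) = - (\<integral>x. \<psi> x *\<^sub>R ?u' x \<partial>lborel_on \<Omega>)"
   using integral_test_scaleR_lborel_on[OF assms(1), of \<psi> ?u'] test_function_eq_0[OF t]
    integral_test_scaleR_lborel_on[OF assms(1), of ?\<psi>' u] test_function_eq_0[OF t'] by simp
 qed
qed


section \<open>Symmetry of second derivatives\<close>

lemma smooth_line_derivative:
 assumes "smooth_on UNIV f"
 shows "((%s. f (y + s *\<^sub>R v)) has_real_derivative FD f (y + s *\<^sub>R v) v) (at s)"
proof -
 have d: "f differentiable at x" for x using smooth_on_differentiable[OF assms] by simp
 then have "(f has_derivative FD f (y + s *\<^sub>R v)) (at (y + s *\<^sub>R v))"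
  using frechet_derivative_works by blast
 moreover have "((%s. y + s *\<^sub>R v) has_derivative (%h. h *\<^sub>R v)) (at s)"
  by (auto intro!: derivative_eq_intros)
 ultimately have "((%s. f (y + s *\<^sub>R v)) has_derivative (%h. FD f (y + s *\<^sub>R v) (h *\<^sub>R v))) (at s)"
  using has_derivative_compose by blast
 then show ?thesis
  using linear_cmul[OF linear_frechet_derivative[OF d]]
  by (simp add: has_field_derivative_def mult_commute_abs)
qed

text \<open>Two applications of the mean value theorem, first in direction \<open>i\<close> to a
  difference in direction \<open>j\<close>, then in direction \<open>j\<close> to the resulting
  derivative.\<close>

lemma second_difference_mvt:
 assumes f: "smooth_on UNIV f" and i: "i \<in> Basis" and j: "j \<in> Basis" and t: "0 < t"
 shows "\<exists>\<xi>. norm (\<xi> - x) <= 2 * t \<and>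
  f (x + t *\<^sub>R i + t *\<^sub>R j) - f (x + t *\<^sub>R i) - f (x + t *\<^sub>R j) + f x
  = t\<^sup>2 * FD (%y. FD f y i) \<xi> j"
proof -
 let ?fi = "%y. FD f y i"
 have fi: "smooth_on UNIV ?fi" using smooth_on_deriv[OF f i] .
 define g where "g s = f ((x + t *\<^sub>R j) + s *\<^sub>R i) - f (x + s *\<^sub>R i)" for s
 have "(g has_real_derivative ?fi ((x + t *\<^sub>R j) + s *\<^sub>R i) - ?fi (x + s *\<^sub>R i)) (at s)" for s
  unfolding g_def by (intro DERIV_diff smooth_line_derivative f)
 then obtain s where s: "0 < s" "s < t"
  "g t - g 0 = (t - 0) * (?fi ((x + t *\<^sub>R j) + s *\<^sub>R i) - ?fi (x + s *\<^sub>R i))"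
  using MVT2[OF t, of g "%s. ?fi ((x + t *\<^sub>R j) + s *\<^sub>R i) - ?fi (x + s *\<^sub>R i)"] by blast
 define h where "h r = ?fi ((x + s *\<^sub>R i) + r *\<^sub>R j)" for r
 have "(h has_real_derivative frechet_derivative ?fi (at ((x + s *\<^sub>R i) + r *\<^sub>R j)) j) (at r)" for r
  unfolding h_def by (intro smooth_line_derivative fi)
 then obtain r where r: "0 < r" "r < t"
  "h t - h 0 = (t - 0) * frechet_derivative ?fi (at ((x + s *\<^sub>R i) + r *\<^sub>R j)) j"
  using MVT2[OF t, of h "%r. frechet_derivative ?fi (at ((x + s *\<^sub>R i) + r *\<^sub>R j)) j"] by blast
 show ?thesis
 proof (intro exI conjI)
  have "norm (x + s *\<^sub>R i + r *\<^sub>R j - x) <= norm (s *\<^sub>R i) + norm (r *\<^sub>R j)"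
   using norm_triangle_ineq[of "s *\<^sub>R i" "r *\<^sub>R j"] by simp
  also have "\<dots> <= 2 * t" using s r i j by simp
  finally show "norm (x + s *\<^sub>R i + r *\<^sub>R j - x) <= 2 * t" .
  have "f (x + t *\<^sub>R i + t *\<^sub>R j) - f (x + t *\<^sub>R i) - f (x + t *\<^sub>R j) + f x = g t - g 0"
   by (simp add: g_def algebra_simps)
  also have "\<dots> = t * (h t - h 0)" unfolding s(3) by (simp add: h_def algebra_simps)
  finally show "f (x + t *\<^sub>R i + t *\<^sub>R j) - f (x + t *\<^sub>R i) - f (x + t *\<^sub>R j) + f x
   = t\<^sup>2 * frechet_derivative ?fi (at (x + s *\<^sub>R i + r *\<^sub>R j)) j"
   unfolding r(3) by (simp add: power2_eq_square)
 qed
qed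

text \<open>The second difference is symmetric in \<open>i\<close> and \<open>j\<close>. Expanding
  it in both orders gives the two mixed derivatives at points tending to \<open>x\<close>, and both
  are continuous.\<close>

lemma frechet_derivative_commute:
 assumes f: "smooth_on UNIV f" and i: "i \<in> Basis" and j: "j \<in> Basis"
 shows "FD (%y. FD f y i) x j
  = FD (%y. FD f y j) x i" (is "?A x = ?B x")
proof -
 have c: "smooth_on UNIV (%x. FD (%y. FD f y a) x b)"
  if "a \<in> Basis" "b \<in> Basis" for a b using that smooth_on_deriv f by blast
 have cA: "isCont ?A x" and cB: "isCont ?B x"
  using smooth_on_imp_continuous[OF c[OF i j]] smooth_on_imp_continuous[OF c[OF j i]]
  by (simp_all add: continuous_on_eq_continuous_at)
 define t where "t n = 1 / real (Suc n)" for n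
 have t: "0 < t n" for n by (auto simp: t_def)
 have t0: "t \<longlonglongrightarrow> 0" unfolding t_def by (rule LIMSEQ_Suc[OF lim_1_over_n])
 then have t0': "(%n. 2 * t n) \<longlonglongrightarrow> 0" using tendsto_mult_right_zero by blast
 define \<Delta> where "\<Delta> n = f (x + t n *\<^sub>R i + t n *\<^sub>R j) - f (x + t n *\<^sub>R i) - f (x + t n *\<^sub>R j) + f x" for n
 have "\<exists>\<xi>. norm (\<xi> - x) <= 2 * t n \<and> \<Delta> n = (t n)\<^sup>2 * ?A \<xi>" for n
  unfolding \<Delta>_def using second_difference_mvt[OF f i j t[of n], where x=x] .
 then obtain \<xi> where \<xi>: "\<And>n. norm (\<xi> n - x) <= 2 * t n" "\<And>n. \<Delta> n = (t n)\<^sup>2 * ?A (\<xi> n)"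
  by metis
 have "\<exists>\<zeta>. norm (\<zeta> - x) <= 2 * t n \<and> \<Delta> n = (t n)\<^sup>2 * ?B \<zeta>" for n
 proof -
  have "f (x + t n *\<^sub>R j + t n *\<^sub>R i) - f (x + t n *\<^sub>R j) - f (x + t n *\<^sub>R i) + f x = \<Delta> n"
   by (simp add: \<Delta>_def algebra_simps)
  then show ?thesis using second_difference_mvt[OF f j i t[of n], where x=x] by (simp only:)
 qed
 then obtain \<zeta> where \<zeta>: "\<And>n. norm (\<zeta> n - x) <= 2 * t n" "\<And>n. \<Delta> n = (t n)\<^sup>2 * ?B (\<zeta> n)"
  by metis
 have e: "?A (\<xi> n) = ?B (\<zeta> n)" for n
  using \<xi>(2)[of n] \<zeta>(2)[of n] t[of n] by simp
 have "\<xi> \<longlonglongrightarrow> x" "\<zeta> \<longlonglongrightarrow> x"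
  by (auto intro!: LIM_zero_cancel[of _ x] Lim_null_comparison[OF _ t0'] always_eventually \<xi>(1) \<zeta>(1))
 then have "(%n. ?A (\<xi> n)) \<longlonglongrightarrow> ?A x" "(%n. ?B (\<zeta> n)) \<longlonglongrightarrow> ?B x"
  using isCont_tendsto_compose[OF cA] isCont_tendsto_compose[OF cB] by blast+
 then show ?thesis unfolding e using LIMSEQ_unique by blast
qed

text \<open>Both derivatives are moved onto the test function, where they commute
  classically.\<close>

lemma has_weak_deriv_mixed:
 fixes f :: "'a::euclidean_space => real"
 assumes "open \<Omega>" "i \<in> Basis" "j \<in> Basis"
  "has_weak_deriv \<Omega> i f fi" "has_weak_deriv \<Omega> j fi fij"
  "has_weak_deriv \<Omega> j f fj" "has_weak_deriv \<Omega> i fj fji"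
 shows "AE x in lborel_on \<Omega>. fij x = fji x"
proof -
 have l: "locally_integrable \<Omega> fij" "locally_integrable \<Omega> fji"
  using assms unfolding has_weak_deriv_def by auto
 have "AE x in lborel_on \<Omega>. fij x - fji x = 0"
 proof (rule fundamental_lemma[OF assms(1) locally_integrable_diff[OF l]])
  fix \<psi> :: "'a => real" assume t: "test_function \<Omega> \<psi>"
  note ti = test_function_deriv[OF t assms(2)] and tj = test_function_deriv[OF t assms(3)]
  have "(\<integral>x. \<psi> x *\<^sub>R fij x \<partial>lborel_on \<Omega>)
   = (\<integral>x. FD (%y. FD \<psi> y j) x i *\<^sub>R f x \<partial>lborel_on \<Omega>)"
   using assms(4)[unfolded has_weak_deriv_def, THEN conjunct2, THEN conjunct2, rule_format, OF tj]
    assms(5)[unfolded has_weak_deriv_def, THEN conjunct2, THEN conjunct2, rule_format, OF t] by simp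
  also have "\<dots> = (\<integral>x. FD (%y. FD \<psi> y i) x j *\<^sub>R f x \<partial>lborel_on \<Omega>)"
   using frechet_derivative_commute[OF test_functionD(1)[OF t] assms(2,3)] by simp
  also have "\<dots> = (\<integral>x. \<psi> x *\<^sub>R fji x \<partial>lborel_on \<Omega>)"
   using assms(6)[unfolded has_weak_deriv_def, THEN conjunct2, THEN conjunct2, rule_format, OF ti]
    assms(7)[unfolded has_weak_deriv_def, THEN conjunct2, THEN conjunct2, rule_format, OF t] by simp
  finally show "(\<integral>x. \<psi> x *\<^sub>R (fij x - fji x) \<partial>lborel_on \<Omega>) = 0"
   using integrable_test_scaleR(2)[OF assms(1) l(1) t] integrable_test_scaleR(2)[OF assms(1) l(2) t]
   by (simp add: right_diff_distrib)
 qed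
 then show ?thesis by simp
qed

subsection \<open>Rotations about the axis\<close>

definition rot :: "real => real^3 => real^3" where
 "rot \<tau> x = vector [cos \<tau> * x $ 1 - sin \<tau> * x $ 2, sin \<tau> * x $ 1 + cos \<tau> * x $ 2, x $ 3]"

lemma inner_real3: "(x::real^3) \<bullet> y = x $ 1 * y $ 1 + x $ 2 * y $ 2 + x $ 3 * y $ 3"
 by (simp add: inner_vec_def sum_3)

lemma power2_norm_real3: "(norm (x::real^3))\<^sup>2 = (x $ 1)\<^sup>2 + (x $ 2)\<^sup>2 + (x $ 3)\<^sup>2"
 unfolding power2_norm_eq_inner inner_real3 by (simp add: power2_eq_square)

lemma vec3_eq_iff: "(x::real^3) = y \<longleftrightarrow> x $ 1 = y $ 1 \<and> x $ 2 = y $ 2 \<and> x $ 3 = y $ 3"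
 by (simp add: vec_eq_iff forall_3)

lemma orthogonal_rot: "orthogonal_transformation (rot \<tau>)"
 unfolding orthogonal_transformation_def
proof (intro conjI allI)
 show "linear (rot \<tau>)" by (rule linearI) (auto simp: rot_def vec3_eq_iff algebra_simps)
 fix v w :: "real^3"
 have "rot \<tau> v \<bullet> rot \<tau> w = ((cos \<tau>)\<^sup>2 + (sin \<tau>)\<^sup>2) * (v $ 1 * w $ 1 + v $ 2 * w $ 2) + v $ 3 * w $ 3"
  unfolding rot_def inner_real3 vector_3 by algebra
 then show "rot \<tau> v \<bullet> rot \<tau> w = v \<bullet> w" by (simp add: inner_real3)
qed

lemma norm_rot: "norm (rot \<tau> x) = norm x"
 using orthogonal_rot orthogonal_transformation_norm by blast

lemma rho_rot: "rho (rot \<tau> x) = rho x" and phi_rot: "phi (rot \<tau> x) = phi x"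
 by (simp_all add: rho_def phi_def norm_rot) (simp add: rot_def)

text \<open>Lebesgue measure is determined by its values on boxes, and the preimage of a box is its
  image under the inverse orthogonal map, which has the same measure.\<close>

lemma distr_lborel_orthogonal:
 fixes f :: "real^'n::{finite,wellorder} => real^'n::_"
 assumes "orthogonal_transformation f"
 shows "distr lborel borel f = lborel"
proof (rule lborel_eqI[symmetric])
 have f: "f \<in> borel_measurable borel"
  using orthogonal_transformation_linear[OF assms] by (simp add: borel_measurable_continuous_onI linear_continuous_on linear_linear)
 have inv: "orthogonal_transformation (inv f)" and bij: "bij f"
  using assms orthogonal_transformation_inv orthogonal_transformation_bij by blast+
 fix l u :: "(real, 'n) vec" assume lu: "\<And>b. b \<in> Basis ==> l \<bullet> b <= u \<bullet> b"
 have v: "f -` box l u = inv f ` box l u" using bij by (simp add: bij_vimage_eq_inv_image)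
 have m: "f -` box l u \<in> sets borel" using measurable_sets[OF f, of "box l u"] by simp
 have lm: "f -` box l u \<in> lmeasurable" unfolding v by (rule measurable_orthogonal_image[OF inv]) simp
 have "emeasure (distr lborel borel f) (box l u) = emeasure lborel (f -` box l u)"
  using f by (subst emeasure_distr) auto
 also have "\<dots> = emeasure lebesgue (f -` box l u)" using m by simp
 also have "\<dots> = ennreal (measure lebesgue (f -` box l u))" by (rule emeasure_eq_measure2[OF lm])
 also have "\<dots> = ennreal (measure lebesgue (box l u))" unfolding v
  by (subst measure_orthogonal_image[OF inv]) simp_all
 also have "\<dots> = (\<Prod>b\<in>Basis. (u - l) \<bullet> b)" using lu by (simp add: measure_completion measure_lborel_box)
 finally show "emeasure (distr lborel borel f) (box l u) = (\<Prod>b\<in>Basis. (u - l) \<bullet> b)" .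
qed simp

abbreviation ax :: "3 => real^3" where "ax i \<equiv> axis i 1"

lemma Basis_real3: "(Basis :: (real^3) set) = {ax 1, ax 2, ax 3}"
 by (auto simp: Basis_vec_def UNIV_3)

lemma sum_Basis_real3:
 fixes g :: "real^3 => 'a::comm_monoid_add"
 shows "(\<Sum>b\<in>Basis. g b) = g (ax 1) + g (ax 2) + g (ax 3)"
proof -
 have "ax 1 ~= ax 2" "ax 1 ~= ax 3" "ax 2 ~= ax 3" by (simp_all add: axis_eq_axis)
 then show ?thesis unfolding Basis_real3 by (simp add: add.assoc)
qed

lemma ax_Basis [simp]: "ax i \<in> Basis" by simp

lemma frechet_derivative_real3:
 fixes f :: "real^3 => real"
 assumes "f differentiable (at x)"
 shows "FD f x h = h $ 1 * FD f x (ax 1)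
  + h $ 2 * FD f x (ax 2) + h $ 3 * FD f x (ax 3)"
 by (subst frechet_derivative_inner_gradient[OF assms]) (simp add: sum_Basis_real3 inner_axis)

lemma frechet_derivative_vec_nth: "FD (%x::real^3. x $ i) x h = h $ i"
proof -
 have "((%x::real^3. x $ i) has_derivative (%h. h $ i)) (at x)"
  by (rule bounded_linear_imp_has_derivative[OF bounded_linear_vec_nth])
 from frechet_derivative_at[OF this] show ?thesis by metis
qed

text \<open>As \<open>f\<close> is invariant under rotations almost everywhere, the integral of
  \<open>\<psi> (rot \<tau> x) * f x\<close> does not depend on \<tau>; its derivative at \<tau> = 0
  is the integral in question.\<close>

lemma theta_indep_integral_eq_0:
 fixes f \<psi> :: "real^3 => real"
 assumes \<Omega>: "open \<Omega>" "bounded \<Omega>" "\<And>\<tau> x. rot \<tau> x \<in> \<Omega> \<longleftrightarrow> x \<in> \<Omega>"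
  and f: "integrable (lborel_on \<Omega>) f" "theta_indep \<Omega> f" and t: "test_function \<Omega> \<psi>"
 shows "(\<integral>x. (x $ 1 * FD \<psi> x (ax 2) - x $ 2 * FD \<psi> x (ax 1)) * f x \<partial>lborel_on \<Omega>) = 0"
proof -
 let ?L = "%x. x $ 1 * FD \<psi> x (ax 2) - x $ 2 * FD \<psi> x (ax 1)"
 define f0 where "f0 x = indicator \<Omega> x * f x" for x
 have f0: "integrable lborel f0" using f(1) by (simp add: integrable_lborel_on[OF \<Omega>(1)] f0_def[abs_def])
 then have f0m[measurable]: "f0 \<in> borel_measurable borel" by simp
 \<comment> \<open>No measurability of \<open>G\<close> is known; it serves only to see that
   \<open>f0\<close> and its rotations agree almost everywhere.\<close>
 obtain G where "AE x in lborel. x \<in> \<Omega> --> f x = G (rho x) (phi x)"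
  using f(2) unfolding theta_indep_def AE_lborel_on[OF \<Omega>(1)] by blast
 then have G: "AE x in lborel. f0 x = indicator \<Omega> x * G (rho x) (phi x)"
  by (rule AE_mp) (auto simp: f0_def indicator_def)
 have rm[measurable]: "rot \<tau> \<in> borel \<rightarrow>\<^sub>M borel" for \<tau>
  using orthogonal_transformation_linear[OF orthogonal_rot]
  by (simp add: borel_measurable_continuous_onI linear_continuous_on linear_linear)
 have d: "distr lborel borel (rot \<tau>) = lborel" for \<tau> by (rule distr_lborel_orthogonal[OF orthogonal_rot])
 have "AE x in lborel. f0 (rot \<tau> x) = indicator \<Omega> (rot \<tau> x) * G (rho (rot \<tau> x)) (phi (rot \<tau> x))" for \<tau>
 proof -
  have "AE x in distr lborel borel (rot \<tau>). f0 x = indicator \<Omega> x * G (rho x) (phi x)"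
   using G by (simp only: d)
  from AE_distrD[OF _ this] show ?thesis by simp
 qed
 then have inv: "AE x in lborel. f0 (rot \<tau> x) = f0 x" for \<tau>
  using G by eventually_elim (simp add: rho_rot phi_rot \<Omega>(3) indicator_def)
 obtain C where C: "C > 0" "\<And>x y. \<bar>\<psi> x - \<psi> y\<bar> <= C * norm (x - y)"
  using test_function_lipschitz[OF t] by metis
 obtain B where B: "\<And>x. x \<in> \<Omega> ==> norm x <= B" "B > 0" using \<Omega>(2) by (auto simp: bounded_pos)
 obtain E where E: "E > 0" "\<And>x. \<bar>\<psi> x\<bar> <= E" using test_function_bounded[OF t] by metis
 have [measurable]: "\<psi> \<in> borel_measurable borel"
  using test_functionD(2)[OF t] by (rule borel_measurable_continuous_onI)
 have dm[measurable]: "(%x. FD \<psi> x (ax i)) \<in> borel_measurable borel" for i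
  using test_functionD(2)[OF test_function_deriv[OF t ax_Basis]] by (rule borel_measurable_continuous_onI)
 have ir: "integrable lborel (%x. \<psi> (rot \<tau> x) * f0 x)" for \<tau>
  by (rule Bochner_Integration.integrable_bound[OF integrable_mult_right[OF f0, of E]])
   (use E in \<open>auto simp: abs_mult intro!: mult_right_mono\<close>)
 have ip: "integrable lborel (%x. \<psi> x * f0 x)"
  by (rule Bochner_Integration.integrable_bound[OF integrable_mult_right[OF f0, of E]])
   (use E in \<open>auto simp: abs_mult intro!: mult_right_mono\<close>)
 have "(\<integral>x. ?L x * f0 x \<partial>lborel) = 0"
 proof (rule integral_flow_derivative_eq_0[where \<psi>=\<psi> and \<Phi>=rot and w="%x. C * (2 * B) * \<bar>f0 x\<bar>"])
  fix \<tau>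
  have "(\<integral>x. \<psi> x * f0 x \<partial>lborel) = (\<integral>x. \<psi> x * f0 x \<partial>distr lborel borel (rot \<tau>))" unfolding d ..
  also have "\<dots> = (\<integral>x. \<psi> (rot \<tau> x) * f0 (rot \<tau> x) \<partial>lborel)" by (rule integral_distr) auto
  also have "\<dots> = (\<integral>x. \<psi> (rot \<tau> x) * f0 x \<partial>lborel)"
   by (rule integral_cong_AE) (use inv[of \<tau>] in auto)
  finally show "(\<integral>x. \<psi> (rot \<tau> x) * f0 x \<partial>lborel) = (\<integral>x. \<psi> x * f0 x \<partial>lborel)" ..
 next
  fix x
  have r0: "rot 0 x = x" by (simp add: rot_def vec3_eq_iff)
  have dr: "((%\<tau>. rot \<tau> x) has_derivative (%h. h *\<^sub>R vector [- (x $ 2), x $ 1, 0])) (at 0)"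
  proof (rule has_derivative_componentwise_within[THEN iffD2])
   show "\<forall>i\<in>Basis. ((%\<tau>. rot \<tau> x \<bullet> i) has_derivative (%h. (h *\<^sub>R vector [- (x $ 2), x $ 1, 0]) \<bullet> i)) (at 0)"
    unfolding Basis_real3 rot_def by (auto simp: inner_axis intro!: derivative_eq_intros)
  qed
  have "(\<psi> has_derivative FD \<psi> x) (at (rot 0 x))"
   using test_functionD(3)[OF t, of x] frechet_derivative_works r0 by auto
  from has_derivative_compose[OF dr this]
  have "((%\<tau>. \<psi> (rot \<tau> x)) has_derivative (%h. FD \<psi> x (h *\<^sub>R vector [- (x $ 2), x $ 1, 0]))) (at 0)" .
  moreover have "(%h. FD \<psi> x (h *\<^sub>R vector [- (x $ 2), x $ 1, 0])) = (%h. ?L x * h)"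
   by (rule ext, subst frechet_derivative_real3[OF test_functionD(3)[OF t]]) (simp add: algebra_simps)
  ultimately show "((%\<tau>. \<psi> (rot \<tau> x)) has_real_derivative ?L x) (at 0)"
   by (simp add: has_field_derivative_def)
 next
  show "rot 0 x = x" for x by (simp add: rot_def vec3_eq_iff)
  show "integrable lborel (%x. C * (2 * B) * \<bar>f0 x\<bar>)" using f0 by (intro integrable_mult_right integrable_abs)
 next
  fix \<tau> :: real and x assume \<tau>: "0 < \<tau>" "\<tau> <= 1"
  show "\<bar>(\<psi> (rot \<tau> x) - \<psi> x) * f0 x\<bar> <= \<tau> * (C * (2 * B) * \<bar>f0 x\<bar>)"
  proof (cases "x \<in> \<Omega>")
   case True
   have "(norm (rot \<tau> x - x))\<^sup>2 = (2 - 2 * cos \<tau>) * ((x $ 1)\<^sup>2 + (x $ 2)\<^sup>2)"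
   proof -
    have "(norm (rot \<tau> x - x))\<^sup>2 = (cos \<tau> * x $ 1 - sin \<tau> * x $ 2 - x $ 1)\<^sup>2 + (sin \<tau> * x $ 1 + cos \<tau> * x $ 2 - x $ 2)\<^sup>2"
     by (simp add: power2_norm_real3 rot_def)
    also have "\<dots> = ((sin \<tau>)\<^sup>2 + (cos \<tau>)\<^sup>2 + 1 - 2 * cos \<tau>) * ((x $ 1)\<^sup>2 + (x $ 2)\<^sup>2)"
     by algebra
    finally show ?thesis by simp
   qed
   \<comment> \<open>The chord length: 2 - 2 cos \<tau> = 4 sin(\<tau>/2)^2 is at most \<tau>^2. A
     rotation by \<tau> thus moves a point of \<Omega> by at most \<open>\<tau> * B\<close>, which
     gives domination linear in \<tau>.\<close>
   also have "\<dots> <= \<tau>\<^sup>2 * B\<^sup>2"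
   proof (rule mult_mono)
    have "1 - cos \<tau> = 2 * (sin (\<tau> / 2))\<^sup>2" using cos_double_sin[of "\<tau>/2"] by simp
    moreover have "(sin (\<tau> / 2))\<^sup>2 <= (\<tau> / 2)\<^sup>2"
     using power_mono[OF abs_sin_x_le_abs_x[of "\<tau> / 2"], of 2] by (simp only: power2_abs abs_ge_zero)
    ultimately show "2 - 2 * cos \<tau> <= \<tau>\<^sup>2" by (simp add: power2_eq_square)
    have "(x $ 1)\<^sup>2 + (x $ 2)\<^sup>2 <= (norm x)\<^sup>2" by (simp add: power2_norm_real3)
    also have "\<dots> <= B\<^sup>2" using B(1)[OF True] by (intro power_mono) auto
    finally show "(x $ 1)\<^sup>2 + (x $ 2)\<^sup>2 <= B\<^sup>2" .
   qed auto
   finally have "(norm (rot \<tau> x - x))\<^sup>2 <= (\<tau> * B)\<^sup>2" by (simp add: power_mult_distrib)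
   then have "norm (rot \<tau> x - x) <= \<tau> * B" using \<tau> B(2) power2_le_imp_le by fastforce
   then have "\<bar>\<psi> (rot \<tau> x) - \<psi> x\<bar> <= C * (\<tau> * B)"
    using C(1) C(2)[of "rot \<tau> x" x] mult_left_mono[of "norm (rot \<tau> x - x)" "\<tau> * B" C] by linarith
   also have "\<dots> <= \<tau> * (C * (2 * B))" using C(1) \<tau> B(2) by (simp add: mult_ac)
   finally show ?thesis by (simp add: abs_mult mult_right_mono mult.assoc[symmetric])
  qed (simp add: f0_def)
 qed (use ir ip in auto)
 then show ?thesis unfolding integral_lborel_on[OF \<Omega>(1)] f0_def by (simp add: mult_ac)
qed

text \<open>The infinitesimal rotation x1 d_2 - x2 d_1 is divergence free, so it moves to the test
  function without a zero order term, and the integral obtained is the one just shown to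
  vanish.\<close>

lemma theta_indep_weak_deriv:
 fixes f :: "real^3 => real"
 assumes \<Omega>: "open \<Omega>" "bounded \<Omega>" "\<And>\<tau> x. rot \<tau> x \<in> \<Omega> \<longleftrightarrow> x \<in> \<Omega>"
  and f: "integrable (lborel_on \<Omega>) f" "theta_indep \<Omega> f"
  and w: "has_weak_deriv \<Omega> (ax 1) f f1" "has_weak_deriv \<Omega> (ax 2) f f2"
 shows "AE x in lborel_on \<Omega>. x $ 1 * f2 x = x $ 2 * f1 x"
proof -
 have s: "smooth_on \<Omega> (%x. x $ i)" for i by (rule smooth_on_vec_nth[OF \<Omega>(1)])
 have w1: "has_weak_deriv \<Omega> (ax 2) (%x. x $ 1 * f x) (%x. x $ 1 * f2 x)"
  using has_weak_deriv_mult_smooth[OF \<Omega>(1) ax_Basis w(2) s[of 1]]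
  by (simp add: frechet_derivative_vec_nth axis_def)
 have w2: "has_weak_deriv \<Omega> (ax 1) (%x. x $ 2 * f x) (%x. x $ 2 * f1 x)"
  using has_weak_deriv_mult_smooth[OF \<Omega>(1) ax_Basis w(1) s[of 2]]
  by (simp add: frechet_derivative_vec_nth axis_def)
 have l: "locally_integrable \<Omega> (%x. x $ 1 * f2 x)" "locally_integrable \<Omega> (%x. x $ 2 * f1 x)"
  "locally_integrable \<Omega> (%x. x $ 1 * f x)" "locally_integrable \<Omega> (%x. x $ 2 * f x)"
  using w1 w2 unfolding has_weak_deriv_def by auto
 have "AE x in lborel_on \<Omega>. x $ 1 * f2 x - x $ 2 * f1 x = 0"
 proof (rule fundamental_lemma[OF \<Omega>(1) locally_integrable_diff[OF l(1,2)]])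
  fix \<psi> :: "real^3 => real" assume t: "test_function \<Omega> \<psi>"
  note i = integrable_test_scaleR(2)[OF \<Omega>(1)]
  note i1 = i[OF l(1) t] and i2 = i[OF l(2) t]
   and i3 = i[OF l(3) test_function_deriv[OF t ax_Basis[of 2]]]
   and i4 = i[OF l(4) test_function_deriv[OF t ax_Basis[of 1]]]
  have "(\<integral>x. \<psi> x *\<^sub>R (x $ 1 * f2 x - x $ 2 * f1 x) \<partial>lborel_on \<Omega>)
   = (\<integral>x. \<psi> x *\<^sub>R (x $ 1 * f2 x) \<partial>lborel_on \<Omega>) - (\<integral>x. \<psi> x *\<^sub>R (x $ 2 * f1 x) \<partial>lborel_on \<Omega>)"
   using i1 i2 by (simp add: right_diff_distrib)
  also have "\<dots> = (\<integral>x. FD \<psi> x (ax 1) *\<^sub>R (x $ 2 * f x) \<partial>lborel_on \<Omega>)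
    - (\<integral>x. FD \<psi> x (ax 2) *\<^sub>R (x $ 1 * f x) \<partial>lborel_on \<Omega>)"
   using w1 w2 t unfolding has_weak_deriv_def by simp
  also have "\<dots> = - (\<integral>x. (x $ 1 * FD \<psi> x (ax 2) - x $ 2 * FD \<psi> x (ax 1)) * f x \<partial>lborel_on \<Omega>)"
  proof -
   have "(x $ 1 * FD \<psi> x (ax 2) - x $ 2 * FD \<psi> x (ax 1)) * f x
    = FD \<psi> x (ax 2) *\<^sub>R (x $ 1 * f x) - FD \<psi> x (ax 1) *\<^sub>R (x $ 2 * f x)" for x
    by (simp add: algebra_simps)
   then show ?thesis using Bochner_Integration.integral_diff[OF i3 i4] by simp
  qed
  also have "\<dots> = 0" using theta_indep_integral_eq_0[OF \<Omega> f t] by simp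
  finally show "(\<integral>x. \<psi> x *\<^sub>R (x $ 1 * f2 x - x $ 2 * f1 x) \<partial>lborel_on \<Omega>) = 0" .
 qed
 then show ?thesis by simp
qed

section \<open>Square integrable functions\<close>

lemma L2D: "L2 M f ==> f \<in> borel_measurable M" "L2 M f ==> integrable M (%x. (norm (f x))\<^sup>2)"
 by (auto simp: L2_def)

lemma L2_real_iff: "L2 M f \<longleftrightarrow> f \<in> borel_measurable M \<and> integrable M (%x. (f x)\<^sup>2)" for f :: "'a => real"
 by (simp add: L2_def)

lemma L2_integrable_mult:
 fixes f g :: "'a => real"
 assumes "L2 M f" "L2 M g"
 shows "integrable M (%x. f x * g x)"
proof (rule Bochner_Integration.integrable_bound)
 show "integrable M (%x. (f x)\<^sup>2 + (g x)\<^sup>2)" using assms by (simp add: L2_real_iff)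
 show "(%x. f x * g x) \<in> borel_measurable M" using assms by (auto simp: L2_real_iff)
 show "AE x in M. norm (f x * g x) <= norm ((f x)\<^sup>2 + (g x)\<^sup>2)"
 proof (rule AE_I2)
  fix x
  have "0 <= (\<bar>f x\<bar> - \<bar>g x\<bar>)\<^sup>2" "0 <= (f x)\<^sup>2" "0 <= (g x)\<^sup>2" by auto
  then have "2 * (\<bar>f x\<bar> * \<bar>g x\<bar>) <= (f x)\<^sup>2 + (g x)\<^sup>2" "0 <= \<bar>f x\<bar> * \<bar>g x\<bar>" by (auto simp: power2_diff)
  then have "\<bar>f x\<bar> * \<bar>g x\<bar> <= (f x)\<^sup>2 + (g x)\<^sup>2" by linarith
  then show "norm (f x * g x) <= norm ((f x)\<^sup>2 + (g x)\<^sup>2)" by (simp add: abs_mult)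
 qed
qed

lemma L2_mult_bounded:
 fixes f a :: "'a => real"
 assumes "L2 M f" "a \<in> borel_measurable M" "AE x in M. \<bar>a x\<bar> <= C"
 shows "L2 M (%x. a x * f x)"
 unfolding L2_real_iff
proof
 show "(%x. a x * f x) \<in> borel_measurable M" using assms by (auto simp: L2_real_iff)
 show "integrable M (%x. (a x * f x)\<^sup>2)"
 proof (rule Bochner_Integration.integrable_bound)
  show "integrable M (%x. C\<^sup>2 * (f x)\<^sup>2)" using assms by (simp add: L2_real_iff)
  show "AE x in M. norm ((a x * f x)\<^sup>2) <= norm (C\<^sup>2 * (f x)\<^sup>2)"
   using assms(3)
  proof (rule AE_mp, intro AE_I2 impI)
   fix x assume "\<bar>a x\<bar> <= C"
   then have "(a x)\<^sup>2 <= C\<^sup>2" by (metis abs_ge_zero power2_abs power_mono)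
   then show "norm ((a x * f x)\<^sup>2) <= norm (C\<^sup>2 * (f x)\<^sup>2)"
    by (simp add: power_mult_distrib mult_right_mono)
  qed
 qed (use assms in \<open>auto simp: L2_real_iff\<close>)
qed

lemma L2_cong_AE:
 fixes f g :: "'a => 'b::euclidean_space"
 assumes "L2 M f" "AE x in M. f x = g x" "g \<in> borel_measurable M"
 shows "L2 M g"
 unfolding L2_def
proof
 have [measurable]: "f \<in> borel_measurable M" "g \<in> borel_measurable M" using assms by (auto simp: L2_def)
 show "integrable M (%x. (norm (g x))\<^sup>2)"
  by (rule integrable_cong_AE_imp[OF L2D(2)[OF assms(1)]]) (use assms(2) in auto)
qed (rule assms)

lemma L2_norm_cong_AE:
 fixes f g :: "'a => 'b::euclidean_space"
 assumes "f \<in> borel_measurable M" "AE x in M. f x = g x" "g \<in> borel_measurable M"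
 shows "L2_norm M f = L2_norm M g"
 unfolding L2_norm_def using assms by (intro arg_cong[where f=sqrt] integral_cong_AE) auto

lemma L2_scale: "L2 M f ==> L2 M (%x. c * f x)" for f :: "'a => real"
 using L2_mult_bounded[of M f "%_. c" "\<bar>c\<bar>"] by simp

lemma L2_add:
 fixes f g :: "'a => real"
 assumes "L2 M f" "L2 M g"
 shows "L2 M (%x. f x + g x)"
proof -
 have "integrable M (%x. (f x)\<^sup>2 + (g x)\<^sup>2 + 2 * (f x * g x))"
  using assms L2_integrable_mult[OF assms] by (intro Bochner_Integration.integrable_add integrable_mult_right) (auto simp: L2_real_iff)
 then show ?thesis using assms by (auto simp: L2_real_iff power2_sum mult.assoc)
qed

lemma L2_diff: "L2 M f ==> L2 M g ==> L2 M (%x. f x - g x)" for f g :: "'a => real"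
 using L2_add[of M f "%x. (-1) * g x"] L2_scale[of M g "-1"] by simp

lemma L2_norm_nonneg [simp]: "0 <= L2_norm M f"
 by (simp add: L2_norm_def)

lemma L2_norm_power2: "(L2_norm M f)\<^sup>2 = (\<integral>x. (norm (f x))\<^sup>2 \<partial>M)"
 by (simp add: L2_norm_def)

lemma L2_norm_scale: "L2_norm M (%x. c * f x) = \<bar>c\<bar> * L2_norm M f" for f :: "'a => real"
 by (simp add: L2_norm_def power_mult_distrib real_sqrt_mult)

text \<open>The functions are not taken modulo null sets, so a vanishing norm is treated first: the
  factor, and with it the product, is then 0 almost everywhere.\<close>

lemma L2_cauchy_schwarz:
 fixes f g :: "'a => real"
 assumes f: "L2 M f" and g: "L2 M g"
 shows "\<bar>\<integral>x. f x * g x \<partial>M\<bar> <= L2_norm M f * L2_norm M g"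
proof -
 have zero: "(\<integral>x. f x * g x \<partial>M) = 0" if "L2 M f" "L2 M g" "L2_norm M f = 0" for f g :: "'a => real"
 proof -
  have "(\<integral>x. (f x)\<^sup>2 \<partial>M) = 0" using that(3) by (simp add: L2_norm_def)
  then have "AE x in M. (f x)\<^sup>2 = 0"
   using that(1) by (subst (asm) integral_nonneg_eq_0_iff_AE) (auto simp: L2_real_iff)
  then have "AE x in M. f x * g x = 0" by (rule AE_mp) auto
  then show ?thesis by (rule integral_eq_zero_AE)
 qed
 show ?thesis
 proof (cases "L2_norm M f = 0 \<or> L2_norm M g = 0")
  case True
  then have "(\<integral>x. f x * g x \<partial>M) = 0" using zero[OF f g] zero[OF g f] by (auto simp: mult.commute)
  then show ?thesis by simp
 next
  case False
  let ?A = "L2_norm M f" and ?B = "L2_norm M g"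
  have pos: "?A > 0" "?B > 0" using False L2_norm_nonneg[of M f] L2_norm_nonneg[of M g] by linarith+
  have "\<bar>\<integral>x. f x * g x \<partial>M\<bar> <= (\<integral>x. \<bar>f x * g x\<bar> \<partial>M)" by (rule integral_abs_bound)
  \<comment> \<open>Young's inequality with the weights for which both terms contribute half of
    \<open>?A * ?B\<close>.\<close>
  also have "\<dots> <= (\<integral>x. ?B / (2 * ?A) * (f x)\<^sup>2 + ?A / (2 * ?B) * (g x)\<^sup>2 \<partial>M)"
  proof (rule integral_mono)
   show "integrable M (%x. \<bar>f x * g x\<bar>)" using L2_integrable_mult[OF f g] by (rule integrable_abs)
   show "integrable M (%x. ?B / (2 * ?A) * (f x)\<^sup>2 + ?A / (2 * ?B) * (g x)\<^sup>2)"
    using f g by (simp add: L2_real_iff)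
   fix x
   have "0 <= (?B * \<bar>f x\<bar> - ?A * \<bar>g x\<bar>)\<^sup>2" by simp
   then have "2 * (?A * ?B * (\<bar>f x\<bar> * \<bar>g x\<bar>)) <= ?B\<^sup>2 * (f x)\<^sup>2 + ?A\<^sup>2 * (g x)\<^sup>2"
    by (simp add: power2_diff power_mult_distrib mult_ac)
   then show "\<bar>f x * g x\<bar> <= ?B / (2 * ?A) * (f x)\<^sup>2 + ?A / (2 * ?B) * (g x)\<^sup>2"
    using pos by (simp add: abs_mult field_simps power2_eq_square)
  qed
  also have "\<dots> = ?B / (2 * ?A) * ?A\<^sup>2 + ?A / (2 * ?B) * ?B\<^sup>2"
   using f g by (simp add: L2_real_iff L2_norm_power2)
  also have "\<dots> = ?A * ?B" using pos by (simp add: field_simps power2_eq_square)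
  finally show ?thesis .
 qed
qed

lemma L2_norm_triangle:
 fixes f g :: "'a => real"
 assumes f: "L2 M f" and g: "L2 M g"
 shows "L2_norm M (%x. f x + g x) <= L2_norm M f + L2_norm M g"
proof (rule power2_le_imp_le)
 have "(L2_norm M (%x. f x + g x))\<^sup>2 = (\<integral>x. (f x)\<^sup>2 + (g x)\<^sup>2 + 2 * (f x * g x) \<partial>M)"
  by (simp add: L2_norm_power2 power2_sum mult.assoc)
 also have "\<dots> = (L2_norm M f)\<^sup>2 + (L2_norm M g)\<^sup>2 + 2 * (\<integral>x. f x * g x \<partial>M)"
  using f g L2_integrable_mult[OF f g] by (simp add: L2_real_iff L2_norm_power2)
 also have "\<dots> <= (L2_norm M f + L2_norm M g)\<^sup>2"
  using L2_cauchy_schwarz[OF f g] by (simp add: power2_sum)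
 finally show "(L2_norm M (%x. f x + g x))\<^sup>2 <= (L2_norm M f + L2_norm M g)\<^sup>2" .
qed simp

lemma L2_norm_mono:
 fixes f g :: "'a => real"
 assumes "L2 M g" "f \<in> borel_measurable M" "AE x in M. \<bar>f x\<bar> <= \<bar>g x\<bar>"
 shows "L2_norm M f <= L2_norm M g"
proof -
 have ae: "AE x in M. (f x)\<^sup>2 <= (g x)\<^sup>2" using assms(3) by (rule AE_mp) (auto simp: abs_le_square_iff)
 have "integrable M (%x. (f x)\<^sup>2)"
  by (rule Bochner_Integration.integrable_bound[of _ "%x. (g x)\<^sup>2"]) (use assms ae in \<open>auto simp: L2_real_iff\<close>)
 then show ?thesis unfolding L2_norm_def
  using assms(1) ae by (auto simp: L2_real_iff intro!: integral_mono_AE)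
qed

lemma L2_integrable:
 fixes f :: "'a => real"
 assumes "finite_measure M" "L2 M f"
 shows "integrable M f"
proof -
 interpret finite_measure M by fact
 have "L2 M (%x. 1::real)" by (simp add: L2_real_iff)
 from L2_integrable_mult[OF assms(2) this] show ?thesis by simp
qed

lemma L2_bounded:
 fixes f :: "'a => real"
 assumes "finite_measure M" "f \<in> borel_measurable M" "AE x in M. \<bar>f x\<bar> <= C"
 shows "L2 M f"
proof -
 interpret finite_measure M by fact
 have "L2 M (%x. 1::real)" by (simp add: L2_real_iff)
 from L2_mult_bounded[OF this assms(2,3)] show ?thesis by simp
qed


section \<open>Geometry of the domain\<close>

locale conical_shell =
 fixes \<alpha> :: real and m :: nat
 assumes \<alpha>_pos: "0 < \<alpha>" and \<alpha>_le: "\<alpha> <= pi / 6" and m_ge: "m \<ge> 10 ^ 3"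
begin

abbreviation D :: "(real^3) set" where "D \<equiv> Dm \<alpha> m"
abbreviation M :: "(real^3) measure" where "M \<equiv> lborel_on D"
definition a :: real where "a = 1 / real m"

lemma a_pos: "0 < a" and a_le: "a <= 1 / 1000"
proof -
 have "real m \<ge> 1000" using m_ge by simp
 then show "0 < a" "a <= 1 / 1000" by (auto simp: a_def field_simps)
qed

lemma sin_\<alpha>: "0 < sin \<alpha>" "sin \<alpha> <= 1/2" and cos_\<alpha>: "1/2 <= cos \<alpha>" "cos \<alpha> < 1"
proof -
 have "\<alpha> < pi" using \<alpha>_pos \<alpha>_le pi_gt_zero by linarith
 then show "0 < sin \<alpha>" using \<alpha>_pos by (rule sin_gt_zero[rotated])
 then have "sin \<alpha> * sin \<alpha> > 0" by simp
 have "sin \<alpha> <= sin (pi / 6)" using \<alpha>_pos \<alpha>_le pi_gt_zero by (intro sin_monotone_2pi_le) auto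
 then show "sin \<alpha> <= 1/2" by (simp add: sin_30)
 have "cos (pi / 3) <= cos \<alpha>" using \<alpha>_pos \<alpha>_le pi_gt_zero by (intro cos_monotone_0_pi_le) auto
 then show "1/2 <= cos \<alpha>" by (simp add: cos_60)
 have "cos \<alpha> < cos 0" using \<alpha>_pos \<open>\<alpha> < pi\<close> by (intro cos_monotone_0_pi) auto
 then show "cos \<alpha> < 1" by simp
qed

lemma pi_bounds: "0 < pi/2 - \<alpha>" "pi/2 + \<alpha> < pi"
 using \<alpha>_le \<alpha>_pos pi_gt_zero by (linarith, linarith)

lemma abs_component_le_norm: "\<bar>x $ 3\<bar> <= norm (x :: real^3)"
 using component_le_norm_cart by blast

lemma cos_phi: "x ~= 0 ==> cos (phi x) = x $ 3 / norm x"
 unfolding phi_def using abs_component_le_norm[of x] by (intro cos_arccos) (auto simp: field_simps)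

lemma phi_bounds: "x ~= 0 ==> 0 <= phi x \<and> phi x <= pi"
 unfolding phi_def using abs_component_le_norm[of x] by (auto intro!: arccos_lbound arccos_ubound simp: field_simps)

lemma phi_Dm_iff:
 assumes "x ~= 0"
 shows "pi/2 - \<alpha> < phi x \<and> phi x < pi/2 + \<alpha> \<longleftrightarrow> (x $ 3)\<^sup>2 < (sin \<alpha>)\<^sup>2 * (norm x)\<^sup>2"
proof -
 have "pi/2 - \<alpha> < phi x \<longleftrightarrow> cos (phi x) < cos (pi/2 - \<alpha>)"
  using phi_bounds[OF assms] pi_bounds \<alpha>_pos by (intro cos_mono_less_eq[symmetric]) auto
 moreover have "phi x < pi/2 + \<alpha> \<longleftrightarrow> cos (pi/2 + \<alpha>) < cos (phi x)"
  using phi_bounds[OF assms] pi_bounds \<alpha>_pos by (intro cos_mono_less_eq[symmetric]) auto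
 moreover have "cos (pi/2 - \<alpha>) = sin \<alpha>" "cos (pi/2 + \<alpha>) = - sin \<alpha>"
  by (simp_all add: cos_diff cos_add)
 ultimately have "pi/2 - \<alpha> < phi x \<and> phi x < pi/2 + \<alpha> \<longleftrightarrow> \<bar>x $ 3 / norm x\<bar> < sin \<alpha>"
  using cos_phi[OF assms] abs_less_iff[of "x $ 3 / norm x" "sin \<alpha>"] by linarith
 also have "\<dots> \<longleftrightarrow> \<bar>x $ 3\<bar> < \<bar>sin \<alpha> * norm x\<bar>"
  using assms sin_\<alpha> by (simp add: field_simps abs_mult)
 also have "\<dots> \<longleftrightarrow> (x $ 3)\<^sup>2 < (sin \<alpha> * norm x)\<^sup>2" by (metis abs_le_square_iff not_le)
 finally show ?thesis by (simp add: power_mult_distrib)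
qed

text \<open>Angle and radius are replaced by polynomial inequalities. They make openness visible,
  and the differences of their sides are the smooth functions \<open>d i\<close> on which the
  cutoffs are built.\<close>

lemma Dm_iff: "x \<in> D \<longleftrightarrow> a\<^sup>2 < (norm x)\<^sup>2 \<and> (norm x)\<^sup>2 < 1 \<and> (x $ 3)\<^sup>2 < (sin \<alpha>)\<^sup>2 * (norm x)\<^sup>2"
proof (cases "x = 0")
 case True
 then show ?thesis using a_pos by (simp add: Dm_def rho_def a_def[symmetric])
next
 case False
 have "a < norm x \<longleftrightarrow> a\<^sup>2 < (norm x)\<^sup>2"
  using a_pos by (metis less_imp_le norm_ge_zero power2_less_imp_less power_strict_mono zero_less_numeral)
 moreover have "norm x < 1 \<longleftrightarrow> (norm x)\<^sup>2 < 1" by (simp add: power_less_one_iff abs_square_less_1)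
 ultimately show ?thesis using phi_Dm_iff[OF False] by (auto simp: Dm_def rho_def a_def[symmetric])
qed

lemma open_Dm [simp, measurable]: "open D"
proof -
 have "D = {x. a\<^sup>2 < (norm x)\<^sup>2} \<inter> {x. (norm x)\<^sup>2 < 1} \<inter> {x. (x $ 3)\<^sup>2 < (sin \<alpha>)\<^sup>2 * (norm x)\<^sup>2}"
  using Dm_iff by auto
 then show ?thesis by (auto intro!: open_Int open_Collect_less continuous_intros)
qed

lemma norm_Dm: "x \<in> D ==> a < norm x" "x \<in> D ==> norm x < 1"
 by (auto simp: Dm_def rho_def a_def)

lemma Dm_nonzero: "x \<in> D ==> x ~= 0"
 using norm_Dm a_pos by fastforce

lemma bounded_Dm: "bounded D"
 unfolding bounded_iff using norm_Dm less_imp_le by blast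

lemma rot_Dm: "rot \<tau> x \<in> D \<longleftrightarrow> x \<in> D"
 by (simp add: Dm_def rho_rot phi_rot)

lemma finite_measure_Dm: "finite_measure M"
proof -
 have "emeasure lborel D < \<infinity>" by (rule emeasure_bounded_finite[OF bounded_Dm])
 moreover have "emeasure M (space M) = emeasure lborel D"
  by (simp add: space_restrict_space emeasure_restrict_space)
 ultimately show ?thesis by (intro finite_measureI) auto
qed

text \<open>The distance to the axis, that is rho sin \<phi>. It is positive on \<open>D\<close>, so
  division by it is smooth there.\<close>

definition s :: "real^3 => real" where "s x = sqrt ((x $ 1)\<^sup>2 + (x $ 2)\<^sup>2)"

lemma s_power2: "(s x)\<^sup>2 = (x $ 1)\<^sup>2 + (x $ 2)\<^sup>2"
 by (simp add: s_def)

lemma norm_s: "(norm x)\<^sup>2 = (s x)\<^sup>2 + (x $ 3)\<^sup>2"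
 by (simp add: s_power2 power2_norm_real3)

text \<open>The bound sin \<alpha> <= 1/2 leaves at most a quarter of the squared norm to the third
  coordinate.\<close>

lemma s_lower: assumes "x \<in> D" shows "norm x / 2 < s x"
proof (rule power2_less_imp_less)
 have "(sin \<alpha>)\<^sup>2 <= (1/2)\<^sup>2" using sin_\<alpha> by (intro power_mono) auto
 then have "(sin \<alpha>)\<^sup>2 * (norm x)\<^sup>2 <= (1/2)\<^sup>2 * (norm x)\<^sup>2" by (rule mult_right_mono) simp
 then have "(sin \<alpha>)\<^sup>2 * (norm x)\<^sup>2 <= (norm x)\<^sup>2 / 4" by (simp add: power_divide)
 moreover have "0 < (norm x)\<^sup>2" using Dm_nonzero[OF assms] by simp
 moreover have "(x $ 3)\<^sup>2 < (sin \<alpha>)\<^sup>2 * (norm x)\<^sup>2" using assms unfolding Dm_iff by blast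
 ultimately have "(norm x)\<^sup>2 / 4 < (s x)\<^sup>2"
  using norm_s[of x] by linarith
 then show "(norm x / 2)\<^sup>2 < (s x)\<^sup>2" by (simp add: power_divide)
 show "0 <= s x" by (simp add: s_def)
qed

lemma s_pos: "x \<in> D ==> 0 < s x"
proof -
 assume "x \<in> D"
 from s_lower[OF this] norm_ge_zero[of x] show "0 < s x" by linarith
qed

lemma s_pos2: "x \<in> D ==> 0 < (x $ 1)\<^sup>2 + (x $ 2)\<^sup>2"
 using s_pos s_power2 by (metis zero_less_power)

lemma sin_phi: assumes "x \<in> D" shows "sin (phi x) = s x / norm x"
proof -
 have n: "norm x > 0" using Dm_nonzero[OF assms] by simp
 have "sin (phi x) = sqrt (1 - (x $ 3 / norm x)\<^sup>2)" unfolding phi_def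
  using abs_component_le_norm[of x] n by (intro sin_arccos) (auto simp: field_simps)
 also have "1 - (x $ 3 / norm x)\<^sup>2 = (s x / norm x)\<^sup>2"
 proof -
  have "(s x)\<^sup>2 = (norm x)\<^sup>2 - (x $ 3)\<^sup>2" using norm_s[of x] by simp
  then show ?thesis using n by (simp add: power_divide diff_divide_distrib)
 qed
 also have "sqrt \<dots> = s x / norm x" using n s_pos[OF assms] by simp
 finally show ?thesis .
qed

lemma cos_theta: "x \<in> D ==> cos (theta x) = x $ 1 / s x"
 and sin_theta: "x \<in> D ==> sin (theta x) = x $ 2 / s x"
proof -
 assume x: "x \<in> D"
 have "cmod (Complex (x $ 1) (x $ 2)) = s x" by (simp add: s_def cmod_def)
 then show "cos (theta x) = x $ 1 / s x" "sin (theta x) = x $ 2 / s x"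
  using cos_Arg2pi[of "Complex (x $ 1) (x $ 2)"] sin_Arg2pi[of "Complex (x $ 1) (x $ 2)"] s_pos[OF x]
  by (simp_all add: theta_def field_simps)
qed

lemma e_rho_Dm: "x \<in> D ==> e_rho x = vector [x $ 1 / norm x, x $ 2 / norm x, x $ 3 / norm x]"
 using s_pos[of x] by (simp add: e_rho_def vec3_eq_iff sin_phi cos_phi[OF Dm_nonzero] cos_theta sin_theta)

lemma e_phi_Dm: "x \<in> D ==> e_phi x = vector [x $ 1 * x $ 3 / (norm x * s x), x $ 2 * x $ 3 / (norm x * s x), - (s x / norm x)]"
 by (simp add: e_phi_def vec3_eq_iff sin_phi cos_phi[OF Dm_nonzero] cos_theta sin_theta)

lemma e_theta_Dm: "x \<in> D ==> e_theta x = vector [- (x $ 2 / s x), x $ 1 / s x, 0]"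
 by (simp add: e_theta_def vec3_eq_iff cos_theta sin_theta)

subsection \<open>Integration in spherical coordinates\<close>

text \<open>The azimuthal interval is half open so that the coordinate map is injective on the box
  and still covers all of \<open>D\<close>.\<close>

definition box3 :: "(real^3) set" where
 "box3 = {y. a < y $ 1 \<and> y $ 1 < 1 \<and> pi/2 - \<alpha> < y $ 2 \<and> y $ 2 < pi/2 + \<alpha> \<and> 0 <= y $ 3 \<and> y $ 3 < 2 * pi}"

definition sph3 :: "real^3 => real^3" where "sph3 y = sph (y $ 1) (y $ 2) (y $ 3)"

lemma norm_sph: assumes "0 <= r" shows "norm (sph r p q) = r"
proof -
 have "(norm (sph r p q))\<^sup>2 = r\<^sup>2 * ((sin p)\<^sup>2 * ((cos q)\<^sup>2 + (sin q)\<^sup>2) + (cos p)\<^sup>2)"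
  unfolding power2_norm_real3 sph_def vector_3 by algebra
 then have "(norm (sph r p q))\<^sup>2 = r\<^sup>2" by simp
 then show ?thesis using assms by (simp add: power2_eq_iff_nonneg)
qed

lemma phi_sph: assumes "0 < r" "0 <= p" "p <= pi" shows "phi (sph r p q) = p"
 using assms norm_sph[of r p q] by (simp add: phi_def) (simp add: sph_def arccos_cos)

lemma theta_sph: assumes "0 < r" "0 < p" "p < pi" "0 <= q" "q < 2 * pi" shows "theta (sph r p q) = q"
 unfolding theta_def
proof (rule Arg2pi_unique)
 show "complex_of_real (r * sin p) * exp (\<i> * complex_of_real q) = Complex (sph r p q $ 1) (sph r p q $ 2)"
  by (simp add: sph_def exp_Euler complex_eq_iff cos_of_real sin_of_real)
qed (use assms sin_gt_zero in auto)

lemma sph_coords: assumes "x \<in> D" shows "sph (rho x) (phi x) (theta x) = x"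
 using s_pos[OF assms] Dm_nonzero[OF assms]
 by (simp add: sph_def vec3_eq_iff sin_phi[OF assms] cos_phi cos_theta[OF assms] sin_theta[OF assms] rho_def)

lemma sph3_inj: "inj_on sph3 box3"
proof (rule inj_on_inverseI[where g="%x. vector [rho x, phi x, theta x]"])
 fix y assume "y \<in> box3"
 then have "0 < y $ 1" "0 < y $ 2" "y $ 2 < pi" "0 <= y $ 3" "y $ 3 < 2 * pi"
  using a_pos pi_bounds by (auto simp: box3_def)
 then show "vector [rho (sph3 y), phi (sph3 y), theta (sph3 y)] = y"
  by (simp add: sph3_def vec3_eq_iff phi_sph theta_sph rho_def norm_sph)
qed

lemma sph3_in_Dm: assumes "y \<in> box3" shows "sph3 y \<in> D" "rho (sph3 y) = y $ 1" "phi (sph3 y) = y $ 2"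
proof -
 have y: "0 < y $ 1" "0 < y $ 2" "y $ 2 < pi" "0 <= y $ 3" "y $ 3 < 2 * pi"
  using a_pos pi_bounds assms by (auto simp: box3_def)
 show r: "rho (sph3 y) = y $ 1" and p: "phi (sph3 y) = y $ 2"
  using y by (simp_all add: sph3_def rho_def norm_sph phi_sph)
 show "sph3 y \<in> D" using assms by (simp add: Dm_def r p box3_def a_def)
qed

lemma sph3_image: "sph3 ` box3 = D"
proof
 show "sph3 ` box3 \<subseteq> D" using sph3_in_Dm by blast
 show "D \<subseteq> sph3 ` box3"
 proof
  fix x assume x: "x \<in> D"
  have "vector [rho x, phi x, theta x] \<in> box3"
   using x Arg2pi[of "Complex (x $ 1) (x $ 2)"] by (auto simp: Dm_def box3_def a_def theta_def)
  moreover have "sph3 (vector [rho x, phi x, theta x]) = x" using sph_coords[OF x] by (simp add: sph3_def)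
  ultimately show "x \<in> sph3 ` box3" by (metis imageI)
 qed
qed

definition sph3' :: "real^3 => real^3 => real^3" where
 "sph3' y h = vector
  [sin (y $ 2) * cos (y $ 3) * h $ 1 + y $ 1 * cos (y $ 2) * cos (y $ 3) * h $ 2 - y $ 1 * sin (y $ 2) * sin (y $ 3) * h $ 3,
  sin (y $ 2) * sin (y $ 3) * h $ 1 + y $ 1 * cos (y $ 2) * sin (y $ 3) * h $ 2 + y $ 1 * sin (y $ 2) * cos (y $ 3) * h $ 3,
  cos (y $ 2) * h $ 1 - y $ 1 * sin (y $ 2) * h $ 2]"

lemma sph3_has_derivative: "(sph3 has_derivative sph3' y) (at y)"
proof (rule has_derivative_componentwise_within[THEN iffD2])
 have nth: "((%x::real^3. x $ i) has_derivative (%h. h $ i)) (at y)" for i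
  by (rule bounded_linear_imp_has_derivative[OF bounded_linear_vec_nth])
 show "\<forall>i\<in>Basis. ((%x. sph3 x \<bullet> i) has_derivative (%x. sph3' y x \<bullet> i)) (at y)"
  unfolding Basis_real3 sph3_def sph3'_def sph_def
  by (auto simp: inner_axis fun_eq_iff algebra_simps intro!: derivative_eq_intros nth)
qed

lemma det_sph3': "det (matrix (sph3' y)) = (y $ 1)\<^sup>2 * sin (y $ 2)"
proof -
 have t: "(sin (y $ 2))\<^sup>2 + (cos (y $ 2))\<^sup>2 = 1" "(sin (y $ 3))\<^sup>2 + (cos (y $ 3))\<^sup>2 = 1" by simp_all
 show ?thesis
  unfolding det_3 matrix_def sph3'_def
  by (simp add: axis_def) (use t in algebra)
qed

lemma sph3_measurable [measurable]: "sph3 \<in> borel \<rightarrow>\<^sub>M borel"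
 by (intro borel_measurable_continuous_onI has_derivative_continuous_on)
  (use sph3_has_derivative in \<open>auto intro: has_derivative_at_withinI\<close>)

lemma vec_nth_measurable [measurable]: "(%y::real^3. y $ i) \<in> borel_measurable borel"
 by (intro borel_measurable_continuous_onI continuous_intros)

lemma box3_borel [measurable]: "box3 \<in> sets borel"
 unfolding box3_def by measurable

lemma jacobian_nonneg: "y \<in> box3 ==> 0 < (y $ 1)\<^sup>2 * sin (y $ 2)"
 using a_pos pi_bounds by (auto simp: box3_def intro!: mult_pos_pos sin_gt_zero)

text \<open>The change of variables theorem enters as a formula for the measure of an image, applied
  to the part of the box that is mapped into \<open>A\<close>; the image has finite measure because
  \<open>D\<close> is bounded.\<close>

lemma emeasure_Dm_sph3:
 assumes A: "A \<in> sets borel"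
 shows "emeasure lborel (A \<inter> D) = (\<integral>\<^sup>+y. indicator (box3 \<inter> sph3 -` A) y * ennreal ((y $ 1)\<^sup>2 * sin (y $ 2)) \<partial>lborel)"
proof -
 define T where "T = box3 \<inter> sph3 -` A"
 have Tm: "T \<in> sets borel" unfolding T_def using A by measurable
 have img: "sph3 ` T = A \<inter> D" unfolding T_def sph3_image[symmetric] by auto
 have AD: "A \<inter> D \<in> sets borel" "bounded (A \<inter> D)" 
  using A borel_open[OF open_Dm] bounded_subset[OF bounded_Dm, of "A \<inter> D"] by auto
 then have fin: "emeasure lborel (A \<inter> D) < \<infinity>" using emeasure_bounded_finite by blast
 then have lm: "A \<inter> D \<in> lmeasurable" using bounded_set_imp_lmeasurable[OF AD(2)] AD(1) by simp
 have "((%y. \<bar>det (matrix (sph3' y))\<bar>) has_integral measure lebesgue (A \<inter> D)) T"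
 proof (rule has_measure_differentiable_image[THEN iffD1, of T sph3])
  show "T \<in> sets lebesgue" using Tm by simp
  show "inj_on sph3 T" using sph3_inj by (rule inj_on_subset) (auto simp: T_def)
  show "sph3 ` T \<in> lmeasurable \<and> measure lebesgue (sph3 ` T) = measure lebesgue (A \<inter> D)"
   unfolding img using lm by simp
  show "(sph3 has_derivative sph3' y) (at y within T)" for y
   using sph3_has_derivative by (rule has_derivative_at_withinI)
 qed
 from nn_integral_has_integral_lebesgue[OF _ this]
 have "(\<integral>\<^sup>+y. ennreal (indicator T y * \<bar>det (matrix (sph3' y))\<bar>) \<partial>lborel) = ennreal (measure lebesgue (A \<inter> D))"
  by simp
 also have "ennreal (measure lebesgue (A \<inter> D)) = emeasure lborel (A \<inter> D)"
  using AD fin by (simp add: emeasure_eq_ennreal_measure)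
 finally have "emeasure lborel (A \<inter> D) = (\<integral>\<^sup>+y. ennreal (indicator T y * \<bar>det (matrix (sph3' y))\<bar>) \<partial>lborel)" ..
 also have "\<dots> = (\<integral>\<^sup>+y. indicator T y * ennreal ((y $ 1)\<^sup>2 * sin (y $ 2)) \<partial>lborel)"
 proof (rule nn_integral_cong)
  fix y
  show "ennreal (indicator T y * \<bar>det (matrix (sph3' y))\<bar>) = indicator T y * ennreal ((y $ 1)\<^sup>2 * sin (y $ 2))"
  proof (cases "y \<in> T")
   case True
   then show ?thesis using jacobian_nonneg[of y] by (simp add: det_sph3' T_def)
  qed simp
 qed
 finally show ?thesis unfolding T_def .
qed

text \<open>The volume of \<open>D\<close> is the image of the weighted volume of the box. The
  formula is kept for nonnegative integrals, where it and the later iterated integrals need no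
  integrability conditions.\<close>

lemma nn_integral_Dm:
 assumes f: "f \<in> borel_measurable borel"
 shows "(\<integral>\<^sup>+x. indicator D x * f x \<partial>lborel)
  = (\<integral>\<^sup>+y. indicator box3 y * (ennreal ((y $ 1)\<^sup>2 * sin (y $ 2)) * f (sph3 y)) \<partial>lborel)"
proof -
 note [measurable] = f
 have Dm: "D \<in> sets borel" by (simp add: borel_open)
 define w where "w y = indicator box3 y * ennreal ((y $ 1)\<^sup>2 * sin (y $ 2))" for y
 have [measurable]: "w \<in> borel_measurable borel" unfolding w_def by measurable
 have eq: "density lborel (indicator D) = distr (density lborel w) borel sph3"
 proof (rule measure_eqI)
  fix A assume "A \<in> sets (density lborel (indicator D :: real^3 => ennreal))"
  then have A[measurable]: "A \<in> sets borel" by simp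
  have "emeasure (density lborel (indicator D)) A = emeasure lborel (A \<inter> D)"
   using Dm by (subst emeasure_density) (auto simp: Int_commute simp flip: indicator_inter_arith)
  moreover have "emeasure (distr (density lborel w) borel sph3) A = emeasure (density lborel w) (sph3 -` A)"
   by (subst emeasure_distr) auto
  moreover have "\<dots> = (\<integral>\<^sup>+y. w y * indicator (sph3 -` A) y \<partial>lborel)"
   by (subst emeasure_density) (auto intro: measurable_sets_borel[OF sph3_measurable])
  ultimately show "emeasure (density lborel (indicator D)) A = emeasure (distr (density lborel w) borel sph3) A"
   unfolding emeasure_Dm_sph3[OF A] by (simp add: w_def indicator_inter_arith mult_ac)
 qed simp
 have "(\<integral>\<^sup>+x. indicator D x * f x \<partial>lborel) = (\<integral>\<^sup>+x. f x \<partial>density lborel (indicator D))"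
  using Dm by (subst nn_integral_density) auto
 also have "\<dots> = (\<integral>\<^sup>+y. f (sph3 y) \<partial>density lborel w)"
  unfolding eq by (subst nn_integral_distr) auto
 also have "\<dots> = (\<integral>\<^sup>+y. w y * f (sph3 y) \<partial>lborel)" by (subst nn_integral_density) auto
 finally show ?thesis by (simp add: w_def mult.assoc)
qed

end

text \<open>A permutation of the coordinates is allowed so that the same argument makes either the
  radius or the polar angle the innermost variable of an iterated integral.\<close>

lemma distr_lborel_real3:
 fixes \<iota> :: "real \<times> real \<times> real => real^3"
 assumes \<iota>: "\<iota> \<in> borel \<rightarrow>\<^sub>M borel"
  and box: "\<And>l u. \<exists>i j k. {i, j, k} = (UNIV :: 3 set) \<and>
   \<iota> -` box l u = {l $ i <..< u $ i} \<times> {l $ j <..< u $ j} \<times> {l $ k <..< u $ k}"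
 shows "distr lborel borel \<iota> = lborel"
proof (rule lborel_eqI[symmetric])
 fix l u :: "real^3" assume lu: "\<And>b. b \<in> Basis ==> l \<bullet> b <= u \<bullet> b"
 have le: "l $ i <= u $ i" for i using lu[of "axis i 1"] by (simp add: inner_axis)
 obtain i j k where ijk: "{i, j, k} = (UNIV :: 3 set)"
  "\<iota> -` box l u = {l $ i <..< u $ i} \<times> {l $ j <..< u $ j} \<times> {l $ k <..< u $ k}" using box by metis
 have "emeasure (distr lborel borel \<iota>) (box l u) = emeasure lborel (\<iota> -` box l u)"
  using \<iota> by (subst emeasure_distr) auto
 also have "\<dots> = emeasure (lborel \<Otimes>\<^sub>M (lborel \<Otimes>\<^sub>M lborel)) ({l $ i <..< u $ i} \<times> {l $ j <..< u $ j} \<times> {l $ k <..< u $ k})"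
  unfolding ijk(2) lborel_prod ..
 also have "\<dots> = emeasure lborel {l $ i <..< u $ i} * emeasure (lborel \<Otimes>\<^sub>M lborel) ({l $ j <..< u $ j} \<times> {l $ k <..< u $ k})"
  by (rule sigma_finite_measure.emeasure_pair_measure_Times) (auto simp: lborel_prod sigma_finite_lborel)
 also have "emeasure (lborel \<Otimes>\<^sub>M lborel) ({l $ j <..< u $ j} \<times> {l $ k <..< u $ k})
  = emeasure lborel {l $ j <..< u $ j} * emeasure lborel {l $ k <..< u $ k}"
  by (rule sigma_finite_measure.emeasure_pair_measure_Times) (auto simp: sigma_finite_lborel)
 also have "emeasure lborel {l $ i <..< u $ i} * (emeasure lborel {l $ j <..< u $ j} * emeasure lborel {l $ k <..< u $ k})
  = ennreal ((u $ i - l $ i) * ((u $ j - l $ j) * (u $ k - l $ k)))"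
  using le by (simp add: ennreal_mult)
 also have "(u $ i - l $ i) * ((u $ j - l $ j) * (u $ k - l $ k)) = (\<Prod>b\<in>Basis. (u - l) \<bullet> b)"
 proof -
  have "card {i, j, k} = 3" unfolding ijk(1) by simp
  then have d: "i ~= j" "i ~= k" "j ~= k" by (auto simp: card_insert_if split: if_splits)
  have "(\<Prod>b\<in>Basis. (u - l) \<bullet> b) = (\<Prod>i\<in>UNIV. (u - l) $ i)"
  proof -
   have "ax 1 ~= ax 2" "ax 1 ~= ax 3" "ax 2 ~= ax 3" by (simp_all add: axis_eq_axis)
   then show ?thesis unfolding Basis_real3 UNIV_3 by (simp add: inner_axis)
  qed
  also have "\<dots> = (\<Prod>i\<in>{i, j, k}. (u - l) $ i)" unfolding ijk(1) ..
  finally show ?thesis using d by simp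
 qed
 finally show "emeasure (distr lborel borel \<iota>) (box l u) = (\<Prod>b\<in>Basis. (u - l) \<bullet> b)" .
qed simp

lemma nn_integral_real3_1:
 fixes f :: "real^3 => ennreal"
 assumes [measurable]: "f \<in> borel_measurable borel"
 shows "(\<integral>\<^sup>+x. f x \<partial>lborel) = (\<integral>\<^sup>+y. \<integral>\<^sup>+c. f (vector [c, fst y, snd y]) \<partial>lborel \<partial>(lborel :: (real \<times> real) measure))"
proof -
 define \<iota> :: "real \<times> real \<times> real => real^3" where "\<iota> z = vector [fst z, fst (snd z), snd (snd z)]" for z
 have m[measurable]: "\<iota> \<in> borel \<rightarrow>\<^sub>M borel"
  unfolding borel_measurable_euclidean_space[of \<iota>] \<iota>_def
  by (auto simp: Basis_real3 inner_axis intro!: borel_measurable_continuous_onI continuous_intros)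
 have d: "distr lborel borel \<iota> = lborel"
 proof (rule distr_lborel_real3[OF m])
  fix l u :: "real^3"
  show "\<exists>i j k. {i, j, k} = (UNIV :: 3 set) \<and> \<iota> -` box l u = {l $ i <..< u $ i} \<times> {l $ j <..< u $ j} \<times> {l $ k <..< u $ k}"
   by (rule exI[of _ 1], rule exI[of _ 2], rule exI[of _ 3])
    (auto simp only: UNIV_3 \<iota>_def mem_box_cart forall_3 vector_3 vimage_eq mem_Times_iff greaterThanLessThan_iff insert_commute fst_conv snd_conv)
 qed
 have [measurable]: "(%z. f (\<iota> z)) \<in> borel_measurable (lborel \<Otimes>\<^sub>M lborel)" unfolding lborel_prod by measurable
 have "(\<integral>\<^sup>+x. f x \<partial>lborel) = (\<integral>\<^sup>+x. f x \<partial>distr lborel borel \<iota>)" unfolding d ..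
 also have "\<dots> = (\<integral>\<^sup>+z. f (\<iota> z) \<partial>(lborel \<Otimes>\<^sub>M lborel))" unfolding lborel_prod by (subst nn_integral_distr) auto
 also have "\<dots> = (\<integral>\<^sup>+y. \<integral>\<^sup>+c. f (\<iota> (c, y)) \<partial>lborel \<partial>lborel)" by (rule lborel_pair.nn_integral_snd[symmetric]) measurable
 finally show ?thesis by (simp add: \<iota>_def)
qed

lemma nn_integral_real3_2:
 fixes f :: "real^3 => ennreal"
 assumes [measurable]: "f \<in> borel_measurable borel"
 shows "(\<integral>\<^sup>+x. f x \<partial>lborel) = (\<integral>\<^sup>+y. \<integral>\<^sup>+c. f (vector [fst y, c, snd y]) \<partial>lborel \<partial>(lborel :: (real \<times> real) measure))"
proof -
 define \<iota> :: "real \<times> real \<times> real => real^3" where "\<iota> z = vector [fst (snd z), fst z, snd (snd z)]" for z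
 have m[measurable]: "\<iota> \<in> borel \<rightarrow>\<^sub>M borel"
  unfolding borel_measurable_euclidean_space[of \<iota>] \<iota>_def
  by (auto simp: Basis_real3 inner_axis intro!: borel_measurable_continuous_onI continuous_intros)
 have d: "distr lborel borel \<iota> = lborel"
 proof (rule distr_lborel_real3[OF m])
  fix l u :: "real^3"
  show "\<exists>i j k. {i, j, k} = (UNIV :: 3 set) \<and> \<iota> -` box l u = {l $ i <..< u $ i} \<times> {l $ j <..< u $ j} \<times> {l $ k <..< u $ k}"
   by (rule exI[of _ 2], rule exI[of _ 1], rule exI[of _ 3])
    (auto simp only: UNIV_3 \<iota>_def mem_box_cart forall_3 vector_3 vimage_eq mem_Times_iff greaterThanLessThan_iff insert_commute fst_conv snd_conv)
 qed
 have [measurable]: "(%z. f (\<iota> z)) \<in> borel_measurable (lborel \<Otimes>\<^sub>M lborel)" unfolding lborel_prod by measurable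
 have "(\<integral>\<^sup>+x. f x \<partial>lborel) = (\<integral>\<^sup>+x. f x \<partial>distr lborel borel \<iota>)" unfolding d ..
 also have "\<dots> = (\<integral>\<^sup>+z. f (\<iota> z) \<partial>(lborel \<Otimes>\<^sub>M lborel))" unfolding lborel_prod by (subst nn_integral_distr) auto
 also have "\<dots> = (\<integral>\<^sup>+y. \<integral>\<^sup>+c. f (\<iota> (c, y)) \<partial>lborel \<partial>lborel)" by (rule lborel_pair.nn_integral_snd[symmetric]) measurable
 finally show ?thesis by (simp add: \<iota>_def)
qed


section \<open>Boundary strips\<close>

text \<open>The increment from \<open>c\<close> to \<open>x\<close> is the integral of the
  derivative, whose square is at most the length of the interval times the integral of the squared
  derivative. In the application \<open>c\<close> is the end of the interval lying on the
  boundary.\<close>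

lemma square_le_boundary_plus_gradient:
 fixes w w' :: "real => real"
 assumes ab: "lo < hi" and c: "lo <= c" "c <= hi" and x: "lo <= x" "x <= hi"
  and der: "\<And>y. (w has_real_derivative w' y) (at y)" and cont: "continuous_on UNIV w'"
 shows "ennreal ((w x)\<^sup>2) <= ennreal (2 * (w c)\<^sup>2)
  + ennreal (2 * (hi - lo)) * (\<integral>\<^sup>+y. indicator {lo<..<hi} y * ennreal ((w' y)\<^sup>2) \<partial>lborel)"
proof -
 define f where "f y = indicator {lo..hi} y * \<bar>w' y\<bar>" for y
 define i where "i y = (indicator {lo..hi} y :: real)" for y
 have ci: "isCont w' y" for y using cont continuous_on_eq_continuous_at by blast
 have int: "integrable lborel (%y. indicator {lo..hi} y *\<^sub>R g y)" if "continuous_on UNIV g" for g :: "real => real"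
  using borel_integrable_compact[of "{lo..hi}" g] continuous_on_subset[OF that] by auto
 have [measurable]: "w' \<in> borel_measurable borel" using cont by (rule borel_measurable_continuous_onI)
 have i2: "L2 lborel i" unfolding L2_real_iff i_def using int[of "%_. 1"]
  by (auto simp: power2_eq_square simp flip: indicator_inter_arith)
 have f2: "L2 lborel f" unfolding L2_real_iff
 proof
  show "f \<in> borel_measurable lborel" unfolding f_def by measurable
  have "(f y)\<^sup>2 = indicator {lo..hi} y *\<^sub>R (w' y)\<^sup>2" for y by (auto simp: f_def indicator_def)
  then show "integrable lborel (%y. (f y)\<^sup>2)" using int[of "%y. (w' y)\<^sup>2"] cont by (simp add: continuous_on_power)
 qed
 have fi: "integrable lborel f" unfolding f_def using int[of "%y. \<bar>w' y\<bar>"] cont by (simp add: continuous_on_rabs)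
 have diff: "\<bar>w q - w p\<bar> <= (\<integral>y. f y \<partial>lborel)" if "lo <= p" "p <= q" "q <= hi" for p q
 proof -
  have "w q - w p = (\<integral>y. w' y * indicator {p..q} y \<partial>lborel)"
   by (rule integral_FTC_Icc_real[symmetric]) (use that der ci in auto)
  also have "\<bar>\<dots>\<bar> <= (\<integral>y. \<bar>w' y * indicator {p..q} y\<bar> \<partial>lborel)" by (rule integral_abs_bound)
  also have "\<dots> <= (\<integral>y. f y \<partial>lborel)"
  proof (rule integral_mono_AE'[OF fi])
   show "AE y in lborel. \<bar>w' y * indicator {p..q} y\<bar> <= f y"
    using that by (auto simp: f_def indicator_def)
  qed (auto simp: f_def)
  finally show ?thesis .
 qed
 have "\<bar>w x - w c\<bar> <= (\<integral>y. f y \<partial>lborel)"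
  using diff[of c x] diff[of x c] c x by (cases "c <= x") (auto simp: abs_minus_commute)
 also have "(\<integral>y. f y \<partial>lborel) = (\<integral>y. i y * f y \<partial>lborel)"
  by (rule arg_cong[where f="%g. integral\<^sup>L lborel g"]) (auto simp: f_def i_def fun_eq_iff indicator_def)
 also have "\<dots> <= L2_norm lborel i * L2_norm lborel f" using L2_cauchy_schwarz[OF i2 f2] by linarith
 finally have "(w x - w c)\<^sup>2 <= (L2_norm lborel i * L2_norm lborel f)\<^sup>2"
  by (metis abs_ge_zero power2_abs power_mono)
 also have "\<dots> = (hi - lo) * (\<integral>y. (f y)\<^sup>2 \<partial>lborel)"
  using ab by (simp add: power_mult_distrib L2_norm_power2) (simp add: i_def power2_eq_square flip: indicator_inter_arith)
 finally have d: "(w x - w c)\<^sup>2 <= (hi - lo) * (\<integral>y. (f y)\<^sup>2 \<partial>lborel)" .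
 have J: "(\<integral>\<^sup>+y. indicator {lo<..<hi} y * ennreal ((w' y)\<^sup>2) \<partial>lborel) = ennreal (\<integral>y. (f y)\<^sup>2 \<partial>lborel)"
 proof -
  have "(\<integral>\<^sup>+y. indicator {lo<..<hi} y * ennreal ((w' y)\<^sup>2) \<partial>lborel) = (\<integral>\<^sup>+y. ennreal ((f y)\<^sup>2) \<partial>lborel)"
  proof (rule nn_integral_cong_AE)
   show "AE y in lborel. indicator {lo<..<hi} y * ennreal ((w' y)\<^sup>2) = ennreal ((f y)\<^sup>2)"
    using AE_lborel_singleton[of lo] AE_lborel_singleton[of hi]
    by eventually_elim (auto simp: f_def indicator_def)
  qed
  also have "\<dots> = ennreal (\<integral>y. (f y)\<^sup>2 \<partial>lborel)"
   by (rule nn_integral_eq_integral) (use f2 in \<open>auto simp: L2_real_iff\<close>)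
  finally show ?thesis .
 qed
 have nn: "0 <= (\<integral>y. (f y)\<^sup>2 \<partial>lborel)" by simp
 \<comment> \<open>The difference of the two sides is the square
   \<open>(w x - 2 * w c)\<^sup>2\<close>.\<close>
 have "(w x)\<^sup>2 <= 2 * (w c)\<^sup>2 + 2 * (w x - w c)\<^sup>2"
 proof -
  have "0 <= (w x - 2 * w c)\<^sup>2" by simp
  then show ?thesis by (simp add: power2_eq_square algebra_simps)
 qed
 also have "\<dots> <= 2 * (w c)\<^sup>2 + 2 * (hi - lo) * (\<integral>y. (f y)\<^sup>2 \<partial>lborel)" using d unfolding mult.assoc by linarith
 finally have "ennreal ((w x)\<^sup>2) <= ennreal (2 * (w c)\<^sup>2 + 2 * (hi - lo) * (\<integral>y. (f y)\<^sup>2 \<partial>lborel))"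
  by (rule ennreal_leI)
 also have "\<dots> = ennreal (2 * (w c)\<^sup>2) + ennreal (2 * (hi - lo)) * ennreal (\<integral>y. (f y)\<^sup>2 \<partial>lborel)"
  using ab nn by (subst ennreal_plus) (auto simp: ennreal_mult)
 finally show ?thesis unfolding J .
qed

text \<open>The weight \<omega> is the volume density along a coordinate line and \<open>B\<close>
  the surface density at its end. Both are comparable with the constant \<open>W\<close> up to the
  factor \<kappa>, which reduces the claim to the unweighted pointwise bound.\<close>

lemma weighted_interval_estimate:
 fixes w w' \<omega> :: "real => real"
 assumes ab: "lo < hi" and c: "lo <= c" "c <= hi"
  and der: "\<And>y. (w has_real_derivative w' y) (at y)" and cont: "continuous_on UNIV w'"
  and \<omega>: "\<And>y. lo < y ==> y < hi ==> 0 <= \<omega> y \<and> \<omega> y <= W \<and> W <= \<kappa> * \<omega> y"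
  and \<omega>m[measurable]: "\<omega> \<in> borel_measurable borel"
  and W: "0 <= W" "0 <= \<kappa>" "0 <= B" "W <= \<kappa> * B"
 shows "(\<integral>\<^sup>+y. indicator {lo<..<hi} y * (ennreal (\<omega> y) * ennreal ((w y)\<^sup>2)) \<partial>lborel)
  <= ennreal (2 * \<kappa> * (hi - lo)) * (ennreal B * ennreal ((w c)\<^sup>2))
   + ennreal (2 * \<kappa> * (hi - lo)\<^sup>2) * (\<integral>\<^sup>+y. indicator {lo<..<hi} y * (ennreal (\<omega> y) * ennreal ((w' y)\<^sup>2)) \<partial>lborel)"
proof -
 define \<delta> where "\<delta> = hi - lo"
 have \<delta>: "0 < \<delta>" using ab by (simp add: \<delta>_def)
 have [measurable]: "w' \<in> borel_measurable borel" using cont by (rule borel_measurable_continuous_onI)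
 define J where "J = (\<integral>\<^sup>+y. indicator {lo<..<hi} y * ennreal ((w' y)\<^sup>2) \<partial>lborel)"
 define K where "K = ennreal (2 * (w c)\<^sup>2) + ennreal (2 * \<delta>) * J"
 have "(\<integral>\<^sup>+y. indicator {lo<..<hi} y * (ennreal (\<omega> y) * ennreal ((w y)\<^sup>2)) \<partial>lborel)
  <= (\<integral>\<^sup>+y. (ennreal W * K) * indicator {lo<..<hi} y \<partial>lborel)"
 proof (rule nn_integral_mono)
  fix y
  show "indicator {lo<..<hi} y * (ennreal (\<omega> y) * ennreal ((w y)\<^sup>2)) <= (ennreal W * K) * indicator {lo<..<hi} y"
  proof (cases "lo < y \<and> y < hi")
   case True
   have "ennreal ((w y)\<^sup>2) <= K" unfolding K_def J_def \<delta>_def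
    by (rule square_le_boundary_plus_gradient[OF ab c _ _ der cont]) (use True in auto)
   moreover have "ennreal (\<omega> y) <= ennreal W" using \<omega>[of y] True by (simp add: ennreal_leI)
   ultimately show ?thesis using True by (auto intro: mult_mono)
  qed auto
 qed
 also have "\<dots> = ennreal W * K * ennreal \<delta>"
  using ab by (subst nn_integral_cmult) (auto simp: \<delta>_def)
 also have "\<dots> = ennreal \<delta> * (ennreal W * ennreal (2 * (w c)\<^sup>2)) + ennreal \<delta> * ennreal (2 * \<delta>) * (ennreal W * J)"
  unfolding K_def by (simp add: algebra_simps)
 also have "\<dots> <= ennreal \<delta> * (ennreal (\<kappa> * B) * ennreal (2 * (w c)\<^sup>2)) + ennreal \<delta> * ennreal (2 * \<delta>) *
   (ennreal \<kappa> * (\<integral>\<^sup>+y. indicator {lo<..<hi} y * (ennreal (\<omega> y) * ennreal ((w' y)\<^sup>2)) \<partial>lborel))"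
 proof (intro add_mono mult_left_mono mult_right_mono)
  show "ennreal W <= ennreal (\<kappa> * B)" using W by (simp add: ennreal_leI)
  have "ennreal W * J = (\<integral>\<^sup>+y. ennreal W * (indicator {lo<..<hi} y * ennreal ((w' y)\<^sup>2)) \<partial>lborel)"
   unfolding J_def by (rule nn_integral_cmult[symmetric]) measurable
  also have "\<dots> <= (\<integral>\<^sup>+y. ennreal \<kappa> * (indicator {lo<..<hi} y * (ennreal (\<omega> y) * ennreal ((w' y)\<^sup>2))) \<partial>lborel)"
  proof (rule nn_integral_mono)
   fix y
   show "ennreal W * (indicator {lo<..<hi} y * ennreal ((w' y)\<^sup>2))
    <= ennreal \<kappa> * (indicator {lo<..<hi} y * (ennreal (\<omega> y) * ennreal ((w' y)\<^sup>2)))"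
   proof (cases "lo < y \<and> y < hi")
    case True
    have "ennreal W <= ennreal (\<kappa> * \<omega> y)" using \<omega>[of y] True by (simp add: ennreal_leI)
    also have "\<dots> = ennreal \<kappa> * ennreal (\<omega> y)" using W \<omega>[of y] True by (simp add: ennreal_mult)
    finally have "ennreal W * ennreal ((w' y)\<^sup>2) <= ennreal \<kappa> * ennreal (\<omega> y) * ennreal ((w' y)\<^sup>2)" by (rule mult_right_mono) simp
    then show ?thesis using True by (simp add: mult.assoc)
   qed auto
  qed
  also have "\<dots> = ennreal \<kappa> * (\<integral>\<^sup>+y. indicator {lo<..<hi} y * (ennreal (\<omega> y) * ennreal ((w' y)\<^sup>2)) \<partial>lborel)"
   by (rule nn_integral_cmult) measurable
  finally show "ennreal W * J <= ennreal \<kappa> * (\<integral>\<^sup>+y. indicator {lo<..<hi} y * (ennreal (\<omega> y) * ennreal ((w' y)\<^sup>2)) \<partial>lborel)" .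
 qed auto
 also have "ennreal \<delta> * (ennreal (\<kappa> * B) * ennreal (2 * (w c)\<^sup>2)) = ennreal (2 * \<kappa> * \<delta>) * (ennreal B * ennreal ((w c)\<^sup>2))"
 proof -
  have "\<delta> * ((\<kappa> * B) * (2 * (w c)\<^sup>2)) = (2 * \<kappa> * \<delta>) * (B * (w c)\<^sup>2)" by simp
  then show ?thesis using \<delta> W by (simp flip: ennreal_mult)
 qed
 also have "ennreal \<delta> * ennreal (2 * \<delta>) * (ennreal \<kappa> * (\<integral>\<^sup>+y. indicator {lo<..<hi} y * (ennreal (\<omega> y) * ennreal ((w' y)\<^sup>2)) \<partial>lborel))
  = ennreal (2 * \<kappa> * \<delta>\<^sup>2) * (\<integral>\<^sup>+y. indicator {lo<..<hi} y * (ennreal (\<omega> y) * ennreal ((w' y)\<^sup>2)) \<partial>lborel)"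
 proof -
  have "\<delta> * (2 * \<delta>) * \<kappa> = 2 * \<kappa> * \<delta>\<^sup>2" by (simp add: power2_eq_square)
  then have "ennreal \<delta> * ennreal (2 * \<delta>) * ennreal \<kappa> = ennreal (2 * \<kappa> * \<delta>\<^sup>2)" using \<delta> W by (simp flip: ennreal_mult)
  moreover have "ennreal \<delta> * ennreal (2 * \<delta>) * (ennreal \<kappa> * X) = ennreal \<delta> * ennreal (2 * \<delta>) * ennreal \<kappa> * X" for X
   by (simp only: mult.assoc)
  ultimately show ?thesis by simp
 qed
 finally show ?thesis unfolding \<delta>_def .
qed

definition grad_sq :: "(real^3 => real) => real^3 => real" where
 "grad_sq u x = (\<Sum>b\<in>Basis. (FD u x b)\<^sup>2)"

lemma directional_le_grad_sq:
 assumes "u differentiable (at x)" "norm h <= 1"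
 shows "(FD u x h)\<^sup>2 <= grad_sq u x"
proof -
 let ?g = "vector [FD u x (ax 1), FD u x (ax 2), FD u x (ax 3)] :: real^3"
 have "FD u x h = h \<bullet> ?g"
  by (subst frechet_derivative_real3[OF assms(1)]) (simp add: inner_real3)
 then have "(FD u x h)\<^sup>2 <= (norm h)\<^sup>2 * (norm ?g)\<^sup>2"
  using Cauchy_Schwarz_ineq[of h ?g] by (simp add: power2_norm_eq_inner)
 also have "\<dots> <= 1 * (norm ?g)\<^sup>2" using assms(2) by (intro mult_right_mono) (auto simp: power_le_one)
 also have "\<dots> = grad_sq u x" by (simp add: power2_norm_real3 grad_sq_def sum_Basis_real3)
 finally show ?thesis .
qed

section \<open>Strip estimates for smooth functions\<close>

context conical_shell
begin

text \<open>One statement for all four boundary pieces. The point \<open>\<iota> c y\<close> of the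
  coordinate box has transverse coordinate \<open>c\<close> and tangential coordinates
  \<open>y\<close>; \<open>c0\<close> is the end of [lo,hi] that lies on the boundary, and
  \<open>\<tau>\<close> is the velocity of the curve in \<open>c\<close>, of length at most 1, so
  only the gradient of \<open>u\<close> matters. The factor 8 is twice the factor 4 by which the
  weights may differ.\<close>

lemma strip_estimate_general:
 fixes \<iota> :: "real => real \<times> real => real^3" and \<tau> :: "real => real \<times> real => real^3"
  and B W :: "real \<times> real => real" and \<sigma> :: "(real^3) measure"
 assumes u: "smooth u"
  and fub: "\<And>f :: real^3 => ennreal. f \<in> borel_measurable borel ==>
   (\<integral>\<^sup>+x. f x \<partial>lborel) = (\<integral>\<^sup>+y. \<integral>\<^sup>+c. f (\<iota> c y) \<partial>lborel \<partial>lborel)"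
  and \<iota>m: "(%z. \<iota> (snd z) (fst z)) \<in> borel \<rightarrow>\<^sub>M borel"
  and E[measurable]: "E \<in> sets borel" and Z[measurable]: "Z \<in> sets borel" and ZD: "Z \<subseteq> D"
  and box: "\<And>c y. \<iota> c y \<in> box3 \<and> sph3 (\<iota> c y) \<in> Z \<longleftrightarrow> y \<in> E \<and> lo < c \<and> c < hi"
  and lohi: "lo < hi" "lo <= c0" "c0 <= hi"
  and der: "\<And>c y. ((%c. sph3 (\<iota> c y)) has_vector_derivative \<tau> c y) (at c)"
  and \<tau>c: "\<And>y. continuous_on UNIV (%c. \<tau> c y)"
  and \<tau>1: "\<And>c y. y \<in> E ==> lo < c ==> c < hi ==> norm (\<tau> c y) <= 1"
  and \<omega>: "\<And>c y. y \<in> E ==> lo < c ==> c < hi ==>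
   (\<iota> c y $ 1)\<^sup>2 * sin (\<iota> c y $ 2) <= W y \<and> W y <= 4 * ((\<iota> c y $ 1)\<^sup>2 * sin (\<iota> c y $ 2))"
  and WB: "\<And>y. y \<in> E ==> 0 <= B y \<and> W y <= 4 * B y" and Bm[measurable]: "B \<in> borel_measurable borel"
  and \<sigma>: "\<And>f. f \<in> borel_measurable borel ==>
   (\<integral>\<^sup>+x. f x \<partial>\<sigma>) = (\<integral>\<^sup>+y. indicator E y * (ennreal (B y) * f (sph3 (\<iota> c0 y))) \<partial>lborel)"
 shows "(\<integral>\<^sup>+x. indicator Z x * ennreal ((u x)\<^sup>2) \<partial>lborel)
  <= ennreal (8 * (hi - lo)) * (\<integral>\<^sup>+x. ennreal ((u x)\<^sup>2) \<partial>\<sigma>)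
   + ennreal (8 * (hi - lo)\<^sup>2) * (\<integral>\<^sup>+x. indicator Z x * ennreal (grad_sq u x) \<partial>lborel)"
proof -
 have su: "smooth_on UNIV u" using u by (simp add: smooth_iff_smooth_on)
 have ud: "u differentiable (at x)" for x using smooth_on_differentiable[OF su] by simp
 have cu': "continuous_on UNIV (%x. FD u x b)" if "b \<in> Basis" for b
  using smooth_on_imp_continuous[OF smooth_on_deriv[OF su that]] .
 have um[measurable]: "u \<in> borel_measurable borel"
  using smooth_on_imp_continuous[OF su] by (rule borel_measurable_continuous_onI)
 have gm[measurable]: "grad_sq u \<in> borel_measurable borel"
  unfolding grad_sq_def[abs_def] by (intro borel_measurable_sum borel_measurable_power borel_measurable_continuous_onI cu')
 have \<iota>m1[measurable]: "(%c. \<iota> c y) \<in> borel \<rightarrow>\<^sub>M borel" for y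
 proof -
  have "(%c::real. (y, c)) \<in> borel \<rightarrow>\<^sub>M borel" by (intro borel_measurable_continuous_onI continuous_intros)
  from measurable_compose[OF this \<iota>m] show ?thesis by simp
 qed
 have \<iota>m2[measurable]: "(%y. \<iota> c y) \<in> borel \<rightarrow>\<^sub>M borel" for c
 proof -
  have "(%y::real \<times> real. (y, c)) \<in> borel \<rightarrow>\<^sub>M borel" by (intro borel_measurable_continuous_onI continuous_intros)
  from measurable_compose[OF this \<iota>m] show ?thesis by simp
 qed
 have \<iota>m3[measurable]: "(%z. \<iota> (snd z) (fst z)) \<in> borel_measurable (borel \<Otimes>\<^sub>M borel)"
  unfolding borel_prod by (rule \<iota>m)
 define \<omega> where "\<omega> c y = (\<iota> c y $ 1)\<^sup>2 * sin (\<iota> c y $ 2)" for c y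
 have conv: "(\<integral>\<^sup>+x. indicator Z x * g x \<partial>lborel)
  = (\<integral>\<^sup>+y. indicator E y * (\<integral>\<^sup>+c. indicator {lo<..<hi} c * (ennreal (\<omega> c y) * g (sph3 (\<iota> c y))) \<partial>lborel) \<partial>lborel)"
  if [measurable]: "g \<in> borel_measurable borel" for g :: "real^3 => ennreal"
 proof -
  have "(\<integral>\<^sup>+x. indicator Z x * g x \<partial>lborel) = (\<integral>\<^sup>+x. indicator D x * (indicator Z x * g x) \<partial>lborel)"
   using ZD by (intro nn_integral_cong) (auto simp: indicator_def)
  also have "\<dots> = (\<integral>\<^sup>+y. indicator box3 y * (ennreal ((y $ 1)\<^sup>2 * sin (y $ 2)) * (indicator Z (sph3 y) * g (sph3 y))) \<partial>lborel)"
   by (rule nn_integral_Dm) measurable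
  also have "\<dots> = (\<integral>\<^sup>+y. \<integral>\<^sup>+c. indicator box3 (\<iota> c y) * (ennreal (\<omega> c y) * (indicator Z (sph3 (\<iota> c y)) * g (sph3 (\<iota> c y)))) \<partial>lborel \<partial>lborel)"
   unfolding \<omega>_def by (rule fub) measurable
  also have "\<dots> = (\<integral>\<^sup>+y. \<integral>\<^sup>+c. indicator E y * (indicator {lo<..<hi} c * (ennreal (\<omega> c y) * g (sph3 (\<iota> c y)))) \<partial>lborel \<partial>lborel)"
  proof (intro nn_integral_cong)
   fix c y
   show "indicator box3 (\<iota> c y) * (ennreal (\<omega> c y) * (indicator Z (sph3 (\<iota> c y)) * g (sph3 (\<iota> c y))))
    = indicator E y * (indicator {lo<..<hi} c * (ennreal (\<omega> c y) * g (sph3 (\<iota> c y))))"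
    using box[of c y] by (auto simp: indicator_def split: if_splits)
  qed
  also have "\<dots> = (\<integral>\<^sup>+y. indicator E y * (\<integral>\<^sup>+c. indicator {lo<..<hi} c * (ennreal (\<omega> c y) * g (sph3 (\<iota> c y))) \<partial>lborel) \<partial>lborel)"
   unfolding \<omega>_def by (intro nn_integral_cong nn_integral_cmult) measurable
  finally show ?thesis .
 qed
 have mm: "(%y. \<integral>\<^sup>+c. indicator {lo<..<hi} c * (ennreal (\<omega> c y) * g (sph3 (\<iota> c y))) \<partial>lborel) \<in> borel_measurable borel"
  if [measurable]: "g \<in> borel_measurable borel" for g :: "real^3 => ennreal"
 proof (rule lborel.borel_measurable_nn_integral)
  show "(%(y, c). indicator {lo<..<hi} c * (ennreal (\<omega> c y) * g (sph3 (\<iota> c y)))) \<in> borel_measurable (borel \<Otimes>\<^sub>M lborel)"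
   unfolding \<omega>_def split_beta' by measurable
 qed
 have inner: "(\<integral>\<^sup>+c. indicator {lo<..<hi} c * (ennreal (\<omega> c y) * ennreal ((u (sph3 (\<iota> c y)))\<^sup>2)) \<partial>lborel)
   <= ennreal (8 * (hi - lo)) * (ennreal (B y) * ennreal ((u (sph3 (\<iota> c0 y)))\<^sup>2))
    + ennreal (8 * (hi - lo)\<^sup>2) * (\<integral>\<^sup>+c. indicator {lo<..<hi} c * (ennreal (\<omega> c y) * ennreal (grad_sq u (sph3 (\<iota> c y)))) \<partial>lborel)"
  if y: "y \<in> E" for y
 proof -
  define w where "w c = u (sph3 (\<iota> c y))" for c
  define w' where "w' c = FD u (sph3 (\<iota> c y)) (\<tau> c y)" for c
  have w: "(w has_real_derivative w' c) (at c)" for c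
  proof -
   have "((%c. sph3 (\<iota> c y)) has_derivative (%h. h *\<^sub>R \<tau> c y)) (at c)"
    using der by (simp add: has_vector_derivative_def)
   moreover have "(u has_derivative FD u (sph3 (\<iota> c y))) (at (sph3 (\<iota> c y)))"
    using ud frechet_derivative_works by blast
   ultimately have "(w has_derivative (%h. FD u (sph3 (\<iota> c y)) (h *\<^sub>R \<tau> c y))) (at c)"
    unfolding w_def by (rule has_derivative_compose)
   then show ?thesis
    using linear_cmul[OF linear_frechet_derivative[OF ud]]
    by (simp add: has_field_derivative_def w'_def mult_commute_abs)
  qed
  have cc: "continuous_on UNIV (%c. sph3 (\<iota> c y))"
   by (intro continuous_at_imp_continuous_on ballI has_vector_derivative_continuous[OF der])
  have w'_eq: "w' = (%c. \<tau> c y $ 1 * FD u (sph3 (\<iota> c y)) (ax 1)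
   + \<tau> c y $ 2 * FD u (sph3 (\<iota> c y)) (ax 2)
   + \<tau> c y $ 3 * FD u (sph3 (\<iota> c y)) (ax 3))"
   unfolding w'_def by (rule ext) (rule frechet_derivative_real3[OF ud])
  have w'c: "continuous_on UNIV w'"
   unfolding w'_eq
   by (intro continuous_intros continuous_on_compose2[OF cu' cc] \<tau>c) auto
  have "(\<integral>\<^sup>+c. indicator {lo<..<hi} c * (ennreal (\<omega> c y) * ennreal ((w c)\<^sup>2)) \<partial>lborel)
   <= ennreal (2 * 4 * (hi - lo)) * (ennreal (B y) * ennreal ((w c0)\<^sup>2))
    + ennreal (2 * 4 * (hi - lo)\<^sup>2) * (\<integral>\<^sup>+c. indicator {lo<..<hi} c * (ennreal (\<omega> c y) * ennreal ((w' c)\<^sup>2)) \<partial>lborel)"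
  proof (rule weighted_interval_estimate[OF lohi w w'c, where W="W y"])
   show "(%c. \<omega> c y) \<in> borel_measurable borel" unfolding \<omega>_def by measurable
   show *: "0 <= \<omega> c y \<and> \<omega> c y <= W y \<and> W y <= 4 * \<omega> c y" if "lo < c" "c < hi" for c
    using \<omega>[OF y that] box[of c y] y that jacobian_nonneg[of "\<iota> c y"] by (auto simp: \<omega>_def)
   show "0 <= W y" using *[of "(lo+hi)/2"] lohi by auto
  qed (use WB[OF y] in auto)
  also have "\<dots> <= ennreal (2 * 4 * (hi - lo)) * (ennreal (B y) * ennreal ((w c0)\<^sup>2))
    + ennreal (2 * 4 * (hi - lo)\<^sup>2) * (\<integral>\<^sup>+c. indicator {lo<..<hi} c * (ennreal (\<omega> c y) * ennreal (grad_sq u (sph3 (\<iota> c y)))) \<partial>lborel)"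
  proof (intro add_mono order_refl mult_left_mono[OF nn_integral_mono])
   fix c
   show "indicator {lo<..<hi} c * (ennreal (\<omega> c y) * ennreal ((w' c)\<^sup>2))
    <= indicator {lo<..<hi} c * (ennreal (\<omega> c y) * ennreal (grad_sq u (sph3 (\<iota> c y))))"
    using directional_le_grad_sq[OF ud \<tau>1[OF y]]
    by (cases "lo < c \<and> c < hi") (auto simp: w'_def intro!: mult_left_mono ennreal_leI)
  qed auto
  finally show ?thesis unfolding w_def by simp
 qed
 have "(\<integral>\<^sup>+x. indicator Z x * ennreal ((u x)\<^sup>2) \<partial>lborel)
  = (\<integral>\<^sup>+y. indicator E y * (\<integral>\<^sup>+c. indicator {lo<..<hi} c * (ennreal (\<omega> c y) * ennreal ((u (sph3 (\<iota> c y)))\<^sup>2)) \<partial>lborel) \<partial>lborel)"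
  by (rule conv) measurable
 also have "\<dots> <= (\<integral>\<^sup>+y. ennreal (8 * (hi - lo)) * (indicator E y * (ennreal (B y) * ennreal ((u (sph3 (\<iota> c0 y)))\<^sup>2)))
    + ennreal (8 * (hi - lo)\<^sup>2) * (indicator E y * (\<integral>\<^sup>+c. indicator {lo<..<hi} c * (ennreal (\<omega> c y) * ennreal (grad_sq u (sph3 (\<iota> c y)))) \<partial>lborel)) \<partial>lborel)"
 proof (rule nn_integral_mono)
  fix y
  show "indicator E y * (\<integral>\<^sup>+c. indicator {lo<..<hi} c * (ennreal (\<omega> c y) * ennreal ((u (sph3 (\<iota> c y)))\<^sup>2)) \<partial>lborel)
   <= ennreal (8 * (hi - lo)) * (indicator E y * (ennreal (B y) * ennreal ((u (sph3 (\<iota> c0 y)))\<^sup>2)))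
    + ennreal (8 * (hi - lo)\<^sup>2) * (indicator E y * (\<integral>\<^sup>+c. indicator {lo<..<hi} c * (ennreal (\<omega> c y) * ennreal (grad_sq u (sph3 (\<iota> c y)))) \<partial>lborel))"
   using inner[of y] by (cases "y \<in> E") auto
 qed
 also have "\<dots> = ennreal (8 * (hi - lo)) * (\<integral>\<^sup>+y. indicator E y * (ennreal (B y) * ennreal ((u (sph3 (\<iota> c0 y)))\<^sup>2)) \<partial>lborel)
    + ennreal (8 * (hi - lo)\<^sup>2) * (\<integral>\<^sup>+y. indicator E y * (\<integral>\<^sup>+c. indicator {lo<..<hi} c * (ennreal (\<omega> c y) * ennreal (grad_sq u (sph3 (\<iota> c y)))) \<partial>lborel) \<partial>lborel)"
 proof -
  have [measurable]: "(%y. \<integral>\<^sup>+c. indicator {lo<..<hi} c * (ennreal (\<omega> c y) * ennreal (grad_sq u (sph3 (\<iota> c y)))) \<partial>lborel) \<in> borel_measurable borel"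
   by (rule mm) measurable
  show ?thesis by (subst nn_integral_add, measurable, subst nn_integral_cmult, measurable, subst nn_integral_cmult, measurable)
 qed
 also have "(\<integral>\<^sup>+y. indicator E y * (ennreal (B y) * ennreal ((u (sph3 (\<iota> c0 y)))\<^sup>2)) \<partial>lborel) = (\<integral>\<^sup>+x. ennreal ((u x)\<^sup>2) \<partial>\<sigma>)"
  by (rule \<sigma>[symmetric]) measurable
 also have "(\<integral>\<^sup>+y. indicator E y * (\<integral>\<^sup>+c. indicator {lo<..<hi} c * (ennreal (\<omega> c y) * ennreal (grad_sq u (sph3 (\<iota> c y)))) \<partial>lborel) \<partial>lborel)
  = (\<integral>\<^sup>+x. indicator Z x * ennreal (grad_sq u x) \<partial>lborel)"
  by (rule conv[symmetric]) measurable
 finally show ?thesis .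
qed

end


context conical_shell
begin

lemma sin_lower: assumes "pi/2 - \<alpha> <= c" "c <= pi/2 + \<alpha>" shows "1/2 <= sin c"
proof -
 have "cos \<alpha> <= cos \<bar>c - pi/2\<bar>"
  using assms \<alpha>_pos \<alpha>_le pi_gt_zero by (intro cos_monotone_0_pi_le) (auto simp: abs_le_iff)
 also have "cos \<bar>c - pi/2\<bar> = sin c" by (simp add: cos_diff)
 finally show ?thesis using cos_\<alpha> by linarith
qed

lemma norm_sph3'_1: "norm (sph3' y (ax 1)) = 1"
proof -
 have t: "(sin (y $ 2))\<^sup>2 + (cos (y $ 2))\<^sup>2 = 1" "(sin (y $ 3))\<^sup>2 + (cos (y $ 3))\<^sup>2 = 1" by simp_all
 have "(norm (sph3' y (ax 1)))\<^sup>2 = 1\<^sup>2"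
  by (simp add: power2_norm_real3 sph3'_def axis_def) (use t in algebra)
 then show ?thesis by (simp only: power2_eq_iff_nonneg norm_ge_zero zero_le_one)
qed

lemma norm_sph3'_2: "norm (sph3' y (ax 2)) = \<bar>y $ 1\<bar>"
proof -
 have t: "(sin (y $ 2))\<^sup>2 + (cos (y $ 2))\<^sup>2 = 1" "(sin (y $ 3))\<^sup>2 + (cos (y $ 3))\<^sup>2 = 1" by simp_all
 have "(norm (sph3' y (ax 2)))\<^sup>2 = \<bar>y $ 1\<bar>\<^sup>2"
  by (simp add: power2_norm_real3 sph3'_def axis_def) (use t in algebra)
 then show ?thesis by (simp only: power2_eq_iff_nonneg norm_ge_zero abs_ge_zero)
qed

lemma sph3_curve:
 assumes "\<And>c. ((%c. g c) has_vector_derivative ax i) (at c)"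
 shows "((%c. sph3 (g c)) has_vector_derivative sph3' (g c) (ax i)) (at c)"
  and "continuous_on UNIV (%c. sph3' (g c) (ax i))"
proof -
 have lin: "linear (sph3' y)" for y
  using sph3_has_derivative has_derivative_linear by blast
 have "((%c. sph3 (g c)) has_derivative (%h. sph3' (g c) (h *\<^sub>R ax i))) (at c)"
  by (rule has_derivative_compose[OF assms[unfolded has_vector_derivative_def] sph3_has_derivative])
 then show "((%c. sph3 (g c)) has_vector_derivative sph3' (g c) (ax i)) (at c)"
  unfolding has_vector_derivative_def by (simp only: linear_cmul[OF lin])
 have cg: "continuous_on UNIV g"
  by (intro continuous_at_imp_continuous_on ballI has_vector_derivative_continuous[OF assms])
 have "continuous_on UNIV (%c. sph3' (g c) (ax i) \<bullet> b)" if "b \<in> Basis" for b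
 proof -
  have "continuous_on UNIV (%c. sph3' (g c) (ax i) $ k)" if "k \<in> {1, 2, 3}" for k
   using that unfolding sph3'_def by (elim insertE emptyE) (simp_all, (intro continuous_intros cg)+)
  then show ?thesis using that unfolding Basis_real3 by (auto simp only: insert_iff empty_iff cart_eq_inner_axis)
 qed
 then show "continuous_on UNIV (%c. sph3' (g c) (ax i))"
  using continuous_on_componentwise by blast
qed

lemma ax_nth: "ax i $ j = (if i = j then 1 else 0)"
 by (simp add: axis_def)

lemma curve_ax:
 fixes p q :: real
 shows curve_ax1: "((%c. vector [c, p, q]) has_vector_derivative (ax 1)) (at c)"
  and curve_ax2: "((%c. vector [p, c, q]) has_vector_derivative (ax 2)) (at c)"
proof -
 have "((%c. vector [c, p, q] \<bullet> b) has_derivative (%h. (h *\<^sub>R ax 1) \<bullet> b)) (at c)" if "b \<in> Basis" for b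
  using that unfolding Basis_real3
  by (elim insertE emptyE) (simp_all add: inner_axis ax_nth has_derivative_ident)
 then show "((%c. vector [c, p, q]) has_vector_derivative (ax 1)) (at c)"
  unfolding has_vector_derivative_def by (intro has_derivative_componentwise_within[THEN iffD2]) auto
 have "((%c. vector [p, c, q] \<bullet> b) has_derivative (%h. (h *\<^sub>R ax 2) \<bullet> b)) (at c)" if "b \<in> Basis" for b
  using that unfolding Basis_real3
  by (elim insertE emptyE) (simp_all add: inner_axis ax_nth has_derivative_ident)
 then show "((%c. vector [p, c, q]) has_vector_derivative (ax 2)) (at c)"
  unfolding has_vector_derivative_def by (intro has_derivative_componentwise_within[THEN iffD2]) auto
qed

lemma vector3_measurable:
 assumes "f \<in> borel_measurable N" "g \<in> borel_measurable N" "h \<in> borel_measurable N"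
 shows "(%x. vector [f x, g x, h x] :: real^3) \<in> borel_measurable N"
proof -
 have "(%x. vector [f x, g x, h x] \<bullet> b) \<in> borel_measurable N" if "b \<in> Basis" for b :: "real^3"
  using that assms unfolding Basis_real3 by (auto simp: inner_axis)
 then show ?thesis using borel_measurable_euclidean_space by blast
qed

lemma coords_measurable:
 "(%z. vector [snd z, fst (fst z), snd (fst z)] :: real^3) \<in> (borel :: ((real \<times> real) \<times> real) measure) \<rightarrow>\<^sub>M borel"
 "(%z. vector [fst (fst z), snd z, snd (fst z)] :: real^3) \<in> (borel :: ((real \<times> real) \<times> real) measure) \<rightarrow>\<^sub>M borel"
 by (intro vector3_measurable borel_measurable_continuous_onI continuous_intros)+

lemma sphere_rect_borel: "{p1<..<p2} \<times> {0..<2*pi} \<in> sets (borel :: (real \<times> real) measure)" for p1 p2 :: real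
 unfolding borel_prod[symmetric] by (intro pair_measureI) auto

lemma nn_integral_sphere_piece:
 assumes [measurable]: "f \<in> borel_measurable borel"
 shows "(\<integral>\<^sup>+x. f x \<partial>sphere_piece \<alpha> r) = (\<integral>\<^sup>+y. indicator ({pi/2 - \<alpha><..<pi/2 + \<alpha>} \<times> {0..<2*pi}) y *
   (ennreal (r\<^sup>2 * sin (fst y)) * f (sph3 (vector [r, fst y, snd y]))) \<partial>lborel)"
proof -
 let ?E = "{pi/2 - \<alpha><..<pi/2 + \<alpha>} \<times> {0..<2*pi}"
 have m[measurable]: "(%y. sph r (fst y) (snd y)) \<in> borel \<rightarrow>\<^sub>M borel"
  unfolding sph_def by (intro vector3_measurable borel_measurable_continuous_onI continuous_intros)
 have [measurable]: "(%y::real \<times> real. ennreal (r\<^sup>2 * sin (fst y))) \<in> borel_measurable borel"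
  by (intro measurable_compose[OF _ measurable_ennreal] borel_measurable_continuous_onI continuous_intros)
 have "(\<integral>\<^sup>+x. f x \<partial>sphere_piece \<alpha> r)
   = (\<integral>\<^sup>+y. f (sph r (fst y) (snd y)) \<partial>density (lborel_on ?E) (%y. ennreal (r\<^sup>2 * sin (fst y))))"
  unfolding sphere_piece_def split_beta'
  by (rule nn_integral_distr) (auto intro!: measurable_restrict_space1)
 also have "\<dots> = (\<integral>\<^sup>+y. ennreal (r\<^sup>2 * sin (fst y)) * f (sph r (fst y) (snd y)) \<partial>lborel_on ?E)"
  by (rule nn_integral_density) (auto intro!: measurable_restrict_space1)
 also have "\<dots> = (\<integral>\<^sup>+y. ennreal (r\<^sup>2 * sin (fst y)) * f (sph r (fst y) (snd y)) * indicator ?E y \<partial>lborel)"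
  by (rule nn_integral_restrict_space) (use sphere_rect_borel in simp)
 finally show ?thesis by (simp add: sph3_def mult_ac)
qed

lemma nn_integral_cone_piece:
 assumes [measurable]: "f \<in> borel_measurable borel"
 shows "(\<integral>\<^sup>+x. f x \<partial>cone_piece m p) = (\<integral>\<^sup>+y. indicator ({a<..<1} \<times> {0..<2*pi}) y *
   (ennreal (fst y * sin p) * f (sph3 (vector [fst y, p, snd y]))) \<partial>lborel)"
proof -
 let ?E = "{a<..<1} \<times> {0..<2*pi}"
 have m[measurable]: "(%y. sph (fst y) p (snd y)) \<in> borel \<rightarrow>\<^sub>M borel"
  unfolding sph_def by (intro vector3_measurable borel_measurable_continuous_onI continuous_intros)
 have [measurable]: "(%y::real \<times> real. ennreal (fst y * sin p)) \<in> borel_measurable borel"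
  by (intro measurable_compose[OF _ measurable_ennreal] borel_measurable_continuous_onI continuous_intros)
 have "(\<integral>\<^sup>+x. f x \<partial>cone_piece m p)
   = (\<integral>\<^sup>+y. f (sph (fst y) p (snd y)) \<partial>density (lborel_on ?E) (%y. ennreal (fst y * sin p)))"
  unfolding cone_piece_def split_beta' a_def[symmetric]
  by (rule nn_integral_distr) (auto intro!: measurable_restrict_space1)
 also have "\<dots> = (\<integral>\<^sup>+y. ennreal (fst y * sin p) * f (sph (fst y) p (snd y)) \<partial>lborel_on ?E)"
  by (rule nn_integral_density) (auto intro!: measurable_restrict_space1)
 also have "\<dots> = (\<integral>\<^sup>+y. ennreal (fst y * sin p) * f (sph (fst y) p (snd y)) * indicator ?E y \<partial>lborel)"
  by (rule nn_integral_restrict_space) (use sphere_rect_borel in simp)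
 finally show ?thesis by (simp add: sph3_def mult_ac)
qed

text \<open>The two terms scale differently in the width. For functions whose boundary term tends to
  0 only the second one survives, and it is \<delta>^2 times the gradient mass of the same shrinking
  strip.\<close>

definition strip_bound :: "(real => (real^3) set) => (real^3) measure => real => bool" where
 "strip_bound Z \<sigma> \<delta>\<^sub>0 \<longleftrightarrow> (\<forall>u \<delta>. smooth u --> 0 < \<delta> --> \<delta> <= \<delta>\<^sub>0 -->
  (\<integral>\<^sup>+x. indicator (Z \<delta>) x * ennreal ((u x)\<^sup>2) \<partial>lborel)
  <= ennreal (8 * \<delta>) * (\<integral>\<^sup>+x. ennreal ((u x)\<^sup>2) \<partial>\<sigma>)
   + ennreal (8 * \<delta>\<^sup>2) * (\<integral>\<^sup>+x. indicator (Z \<delta>) x * ennreal (grad_sq u x) \<partial>lborel))"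

definition strip_A1 :: "real => (real^3) set" where "strip_A1 \<delta> = {x \<in> D. rho x < a + \<delta>}"
definition strip_A2 :: "real => (real^3) set" where "strip_A2 \<delta> = {x \<in> D. 1 - \<delta> < rho x}"
definition strip_R1 :: "real => (real^3) set" where "strip_R1 \<delta> = {x \<in> D. phi x < pi/2 - \<alpha> + \<delta>}"
definition strip_R2 :: "real => (real^3) set" where "strip_R2 \<delta> = {x \<in> D. pi/2 + \<alpha> - \<delta> < phi x}"

lemma rho_measurable [measurable]: "rho \<in> borel_measurable borel"
 unfolding rho_def[abs_def] by measurable

lemma phi_measurable [measurable]: "phi \<in> borel_measurable borel"
proof -
 have "x $ 3 / norm x \<in> {-1..1}" for x :: "real^3"
  using abs_component_le_norm[of x] by (cases "x = 0") (auto simp: field_simps)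
 then have "(%x::real^3. x $ 3 / norm x) \<in> borel \<rightarrow>\<^sub>M restrict_space borel {-1..1}"
  by (intro measurable_restrict_space2) auto
 from measurable_compose[OF this borel_measurable_continuous_on_restrict[OF continuous_on_arccos']]
 show ?thesis unfolding phi_def[abs_def] by simp
qed

lemma Dm_borel [measurable]: "D \<in> sets borel"
 by (simp add: borel_open)

lemma strips_borel [measurable]:
 "strip_A1 \<delta> \<in> sets borel" "strip_A2 \<delta> \<in> sets borel" "strip_R1 \<delta> \<in> sets borel" "strip_R2 \<delta> \<in> sets borel"
 unfolding strip_A1_def strip_A2_def strip_R1_def strip_R2_def by measurable

lemma strips_subset: "strip_A1 \<delta> \<subseteq> D" "strip_A2 \<delta> \<subseteq> D" "strip_R1 \<delta> \<subseteq> D" "strip_R2 \<delta> \<subseteq> D"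
 by (auto simp: strip_A1_def strip_A2_def strip_R1_def strip_R2_def)

lemma box3_iff: "y \<in> box3 ==> sph3 y \<in> {x \<in> D. Q (rho x) (phi x)} \<longleftrightarrow> Q (y $ 1) (y $ 2)"
 using sph3_in_Dm by auto

text \<open>For widths up to 1/2 the radius stays in [1/2,1], so the density
  \<open>c\<^sup>2 * sin p\<close> is between \<open>sin p / 4\<close> and
  \<open>sin p\<close>.\<close>

lemma strip_bound_A2: "strip_bound strip_A2 (A2 \<alpha> m) (1/2)"
 unfolding strip_bound_def
proof (intro allI impI)
 fix u :: "real^3 => real" and \<delta> :: real assume u: "smooth u" and \<delta>: "0 < \<delta>" "\<delta> <= 1/2"
 have E: "1/2 <= sin (fst y)" "sin (fst y) <= 1" if "y \<in> {pi/2 - \<alpha><..<pi/2 + \<alpha>} \<times> {0..<2*pi}" for y :: "real \<times> real"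
  using that sin_lower[of "fst y"] by (cases y, auto)+
 have "(\<integral>\<^sup>+x. indicator (strip_A2 \<delta>) x * ennreal ((u x)\<^sup>2) \<partial>lborel)
  <= ennreal (8 * (1 - (1 - \<delta>))) * (\<integral>\<^sup>+x. ennreal ((u x)\<^sup>2) \<partial>A2 \<alpha> m)
   + ennreal (8 * (1 - (1 - \<delta>))\<^sup>2) * (\<integral>\<^sup>+x. indicator (strip_A2 \<delta>) x * ennreal (grad_sq u x) \<partial>lborel)"
 proof (rule strip_estimate_general[OF u nn_integral_real3_1 coords_measurable(1)[simplified] sphere_rect_borel strips_borel(2) strips_subset(2),
    where ?c0.0=1 and \<tau>="%c y. sph3' (vector [c, fst y, snd y]) (ax 1)" and W="%y. sin (fst y)" and B="%y. 1\<^sup>2 * sin (fst y)"])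
  fix c and y :: "real \<times> real"
  show "vector [c, fst y, snd y] \<in> box3 \<and> sph3 (vector [c, fst y, snd y]) \<in> strip_A2 \<delta>
   \<longleftrightarrow> y \<in> {pi/2 - \<alpha><..<pi/2 + \<alpha>} \<times> {0..<2*pi} \<and> 1 - \<delta> < c \<and> c < 1"
   using box3_iff[of "vector [c, fst y, snd y]" "%r p. 1 - \<delta> < r"] \<delta> a_le
   by (cases y) (auto simp: strip_A2_def box3_def)
  assume y: "y \<in> {pi/2 - \<alpha><..<pi/2 + \<alpha>} \<times> {0..<2*pi}" and c: "1 - \<delta> < c" "c < 1"
  have "c\<^sup>2 <= 1" "(1/2)\<^sup>2 <= c\<^sup>2"
   using c \<delta> power_le_one[of c 2] power_mono[of "1/2" c 2] by auto
  then have "c\<^sup>2 * sin (fst y) <= 1 * sin (fst y)" "(1/2)\<^sup>2 * sin (fst y) <= c\<^sup>2 * sin (fst y)"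
   using E[OF y] by (auto intro!: mult_right_mono simp del: mult_1)
  then show "((vector [c, fst y, snd y] :: real^3) $ 1)\<^sup>2 * sin ((vector [c, fst y, snd y] :: real^3) $ 2) <= sin (fst y) \<and>
   sin (fst y) <= 4 * (((vector [c, fst y, snd y] :: real^3) $ 1)\<^sup>2 * sin ((vector [c, fst y, snd y] :: real^3) $ 2))"
   by (simp add: power2_eq_square)
 next
  fix f :: "real^3 => ennreal" assume "f \<in> borel_measurable borel"
  then show "(\<integral>\<^sup>+x. f x \<partial>A2 \<alpha> m) = (\<integral>\<^sup>+y. indicator ({pi/2 - \<alpha><..<pi/2 + \<alpha>} \<times> {0..<2*pi}) y *
    (ennreal (1\<^sup>2 * sin (fst y)) * f (sph3 (vector [1, fst y, snd y]))) \<partial>lborel)"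
   unfolding A2_def by (rule nn_integral_sphere_piece)
 next
  fix y :: "real \<times> real" assume "y \<in> {pi/2 - \<alpha><..<pi/2 + \<alpha>} \<times> {0..<2*pi}"
  from E[OF this] show "0 <= 1\<^sup>2 * sin (fst y) \<and> sin (fst y) <= 4 * (1\<^sup>2 * sin (fst y))" by simp
 next
  show "(%y::real \<times> real. 1\<^sup>2 * sin (fst y)) \<in> borel_measurable borel"
   by (intro borel_measurable_continuous_onI continuous_intros)
 qed (use \<delta> sph3_curve[OF curve_ax1] norm_sph3'_1 in auto)
 then show "(\<integral>\<^sup>+x. indicator (strip_A2 \<delta>) x * ennreal ((u x)\<^sup>2) \<partial>lborel)
  <= ennreal (8 * \<delta>) * (\<integral>\<^sup>+x. ennreal ((u x)\<^sup>2) \<partial>A2 \<alpha> m)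
   + ennreal (8 * \<delta>\<^sup>2) * (\<integral>\<^sup>+x. indicator (strip_A2 \<delta>) x * ennreal (grad_sq u x) \<partial>lborel)" by simp
qed

text \<open>For widths up to \<open>a\<close> the radius at most doubles, so the density changes at
  most by the factor 4.\<close>

lemma strip_bound_A1: "strip_bound strip_A1 (A1 \<alpha> m) a"
 unfolding strip_bound_def
proof (intro allI impI)
 fix u :: "real^3 => real" and \<delta> :: real assume u: "smooth u" and \<delta>: "0 < \<delta>" "\<delta> <= a"
 have E: "1/2 <= sin (fst y)" "sin (fst y) <= 1" if "y \<in> {pi/2 - \<alpha><..<pi/2 + \<alpha>} \<times> {0..<2*pi}" for y :: "real \<times> real"
  using that sin_lower[of "fst y"] by (cases y, auto)+
 have "(\<integral>\<^sup>+x. indicator (strip_A1 \<delta>) x * ennreal ((u x)\<^sup>2) \<partial>lborel)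
  <= ennreal (8 * ((a + \<delta>) - a)) * (\<integral>\<^sup>+x. ennreal ((u x)\<^sup>2) \<partial>A1 \<alpha> m)
   + ennreal (8 * ((a + \<delta>) - a)\<^sup>2) * (\<integral>\<^sup>+x. indicator (strip_A1 \<delta>) x * ennreal (grad_sq u x) \<partial>lborel)"
 proof (rule strip_estimate_general[OF u nn_integral_real3_1 coords_measurable(1)[simplified] sphere_rect_borel strips_borel(1) strips_subset(1),
    where ?c0.0=a and \<tau>="%c y. sph3' (vector [c, fst y, snd y]) (ax 1)" and W="%y. 4 * a\<^sup>2 * sin (fst y)" and B="%y. a\<^sup>2 * sin (fst y)"])
  fix c and y :: "real \<times> real"
  show "vector [c, fst y, snd y] \<in> box3 \<and> sph3 (vector [c, fst y, snd y]) \<in> strip_A1 \<delta>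
   \<longleftrightarrow> y \<in> {pi/2 - \<alpha><..<pi/2 + \<alpha>} \<times> {0..<2*pi} \<and> a < c \<and> c < a + \<delta>"
   using box3_iff[of "vector [c, fst y, snd y]" "%r p. r < a + \<delta>"] \<delta> a_le
   by (cases y) (auto simp: strip_A1_def box3_def)
  assume y: "y \<in> {pi/2 - \<alpha><..<pi/2 + \<alpha>} \<times> {0..<2*pi}" and c: "a < c" "c < a + \<delta>"
  have "c\<^sup>2 <= (2 * a)\<^sup>2" "a\<^sup>2 <= c\<^sup>2" using power_mono[of c "2 * a" 2] power_mono[of a c 2] c \<delta> a_pos by auto
  then have "c\<^sup>2 * sin (fst y) <= (2 * a)\<^sup>2 * sin (fst y)" "a\<^sup>2 * sin (fst y) <= c\<^sup>2 * sin (fst y)"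
   using E[OF y] by (auto intro!: mult_right_mono)
  then show "((vector [c, fst y, snd y] :: real^3) $ 1)\<^sup>2 * sin ((vector [c, fst y, snd y] :: real^3) $ 2) <= 4 * a\<^sup>2 * sin (fst y) \<and>
   4 * a\<^sup>2 * sin (fst y) <= 4 * (((vector [c, fst y, snd y] :: real^3) $ 1)\<^sup>2 * sin ((vector [c, fst y, snd y] :: real^3) $ 2))"
   by (simp add: power_mult_distrib)
 next
  fix f :: "real^3 => ennreal" assume "f \<in> borel_measurable borel"
  then show "(\<integral>\<^sup>+x. f x \<partial>A1 \<alpha> m) = (\<integral>\<^sup>+y. indicator ({pi/2 - \<alpha><..<pi/2 + \<alpha>} \<times> {0..<2*pi}) y *
    (ennreal (a\<^sup>2 * sin (fst y)) * f (sph3 (vector [a, fst y, snd y]))) \<partial>lborel)"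
   unfolding A1_def a_def[symmetric] by (rule nn_integral_sphere_piece)
 next
  fix y :: "real \<times> real" assume "y \<in> {pi/2 - \<alpha><..<pi/2 + \<alpha>} \<times> {0..<2*pi}"
  from E[OF this] show "0 <= a\<^sup>2 * sin (fst y) \<and> 4 * a\<^sup>2 * sin (fst y) <= 4 * (a\<^sup>2 * sin (fst y))" by simp
 next
  show "(%y::real \<times> real. a\<^sup>2 * sin (fst y)) \<in> borel_measurable borel"
   by (intro borel_measurable_continuous_onI continuous_intros)
 qed (use \<delta> sph3_curve[OF curve_ax1] norm_sph3'_1 in auto)
 then show "(\<integral>\<^sup>+x. indicator (strip_A1 \<delta>) x * ennreal ((u x)\<^sup>2) \<partial>lborel)
  <= ennreal (8 * \<delta>) * (\<integral>\<^sup>+x. ennreal ((u x)\<^sup>2) \<partial>A1 \<alpha> m)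
   + ennreal (8 * \<delta>\<^sup>2) * (\<integral>\<^sup>+x. indicator (strip_A1 \<delta>) x * ennreal (grad_sq u x) \<partial>lborel)" by simp
qed

text \<open>The width is measured in the polar angle; the coordinate line then has speed equal to
  the radius, which is below 1. The sine is at least 1/2 on the whole range, and the surface density
  \<open>r * sin p0\<close> dominates \<open>r\<^sup>2 / 2\<close> because the radius is below
  1.\<close>

lemma strip_bound_cone:
 assumes p0: "pi/2 - \<alpha> <= p0" "p0 <= pi/2 + \<alpha>" and lh: "pi/2 - \<alpha> <= lo" "hi <= pi/2 + \<alpha>" "lo < hi" "lo <= p0" "p0 <= hi"
  and Z: "Z = {x \<in> D. lo < phi x \<and> phi x < hi}" and Zm: "Z \<in> sets borel" and u: "smooth u"
 shows "(\<integral>\<^sup>+x. indicator Z x * ennreal ((u x)\<^sup>2) \<partial>lborel)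
  <= ennreal (8 * (hi - lo)) * (\<integral>\<^sup>+x. ennreal ((u x)\<^sup>2) \<partial>cone_piece m p0)
   + ennreal (8 * (hi - lo)\<^sup>2) * (\<integral>\<^sup>+x. indicator Z x * ennreal (grad_sq u x) \<partial>lborel)"
proof -
 have ZD: "Z \<subseteq> D" using Z by auto
 have s0: "1/2 <= sin p0" using sin_lower p0 by blast
 show ?thesis
 proof (rule strip_estimate_general[OF u nn_integral_real3_2 coords_measurable(2)[simplified] sphere_rect_borel Zm ZD,
    where ?c0.0=p0 and \<tau>="%c y. sph3' (vector [fst y, c, snd y]) (ax 2)" and W="%y. (fst y)\<^sup>2" and B="%y. fst y * sin p0"])
  fix c and y :: "real \<times> real"
  show "vector [fst y, c, snd y] \<in> box3 \<and> sph3 (vector [fst y, c, snd y]) \<in> Z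
   \<longleftrightarrow> y \<in> {a<..<1} \<times> {0..<2*pi} \<and> lo < c \<and> c < hi"
   using box3_iff[of "vector [fst y, c, snd y]" "%r p. lo < p \<and> p < hi"] lh
   by (cases y) (auto simp: Z box3_def)
  assume y: "y \<in> {a<..<1} \<times> {0..<2*pi}" and c: "lo < c" "c < hi"
  show "norm (sph3' (vector [fst y, c, snd y]) (ax 2)) <= 1" using y a_pos by (auto simp: norm_sph3'_2)
  have sc: "1/2 <= sin c" using sin_lower c lh by simp
  have "(fst y)\<^sup>2 * sin c <= (fst y)\<^sup>2 * 1" "(fst y)\<^sup>2 * (1/2) <= (fst y)\<^sup>2 * sin c"
   using sc by (intro mult_left_mono; simp)+
  then show "((vector [fst y, c, snd y] :: real^3) $ 1)\<^sup>2 * sin ((vector [fst y, c, snd y] :: real^3) $ 2) <= (fst y)\<^sup>2 \<and>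
   (fst y)\<^sup>2 <= 4 * (((vector [fst y, c, snd y] :: real^3) $ 1)\<^sup>2 * sin ((vector [fst y, c, snd y] :: real^3) $ 2))"
   using zero_le_power2[of "fst y"] by simp
 next
  fix f :: "real^3 => ennreal" assume "f \<in> borel_measurable borel"
  then show "(\<integral>\<^sup>+x. f x \<partial>cone_piece m p0) = (\<integral>\<^sup>+y. indicator ({a<..<1} \<times> {0..<2*pi}) y *
    (ennreal (fst y * sin p0) * f (sph3 (vector [fst y, p0, snd y]))) \<partial>lborel)"
   by (rule nn_integral_cone_piece)
 next
  fix y :: "real \<times> real" assume "y \<in> {a<..<1} \<times> {0..<2*pi}"
  then have y: "0 < fst y" "fst y < 1" using a_pos by (auto intro: less_trans)
  have "(fst y)\<^sup>2 <= fst y * 1" unfolding power2_eq_square using y by (intro mult_left_mono) auto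
  moreover have "fst y * (1/2) <= fst y * sin p0" using s0 y by (intro mult_left_mono) auto
  ultimately have "0 <= fst y * sin p0" "(fst y)\<^sup>2 <= 4 * (fst y * sin p0)" using y by linarith+
  then show "0 <= fst y * sin p0 \<and> (fst y)\<^sup>2 <= 4 * (fst y * sin p0)" by blast
 next
  show "(%y::real \<times> real. fst y * sin p0) \<in> borel_measurable borel"
   by (intro borel_measurable_continuous_onI continuous_intros)
 qed (use lh sph3_curve[OF curve_ax2] in auto)
qed

lemma strip_bound_R1: "strip_bound strip_R1 (R1 \<alpha> m) \<alpha>"
 unfolding strip_bound_def
proof (intro allI impI)
 fix u :: "real^3 => real" and \<delta> :: real assume u: "smooth u" and \<delta>: "0 < \<delta>" "\<delta> <= \<alpha>"
 have e: "strip_R1 \<delta> = {x \<in> D. pi/2 - \<alpha> < phi x \<and> phi x < pi/2 - \<alpha> + \<delta>}"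
  unfolding strip_R1_def by (auto simp: Dm_def)
 show "(\<integral>\<^sup>+x. indicator (strip_R1 \<delta>) x * ennreal ((u x)\<^sup>2) \<partial>lborel)
  <= ennreal (8 * \<delta>) * (\<integral>\<^sup>+x. ennreal ((u x)\<^sup>2) \<partial>R1 \<alpha> m)
   + ennreal (8 * \<delta>\<^sup>2) * (\<integral>\<^sup>+x. indicator (strip_R1 \<delta>) x * ennreal (grad_sq u x) \<partial>lborel)"
  using strip_bound_cone[OF _ _ _ _ _ _ _ e strips_borel(3) u, of "pi/2 - \<alpha>"] \<delta> \<alpha>_pos by (simp add: R1_def)
qed

lemma strip_bound_R2: "strip_bound strip_R2 (R2 \<alpha> m) \<alpha>"
 unfolding strip_bound_def
proof (intro allI impI)
 fix u :: "real^3 => real" and \<delta> :: real assume u: "smooth u" and \<delta>: "0 < \<delta>" "\<delta> <= \<alpha>"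
 have e: "strip_R2 \<delta> = {x \<in> D. pi/2 + \<alpha> - \<delta> < phi x \<and> phi x < pi/2 + \<alpha>}"
  unfolding strip_R2_def by (auto simp: Dm_def)
 show "(\<integral>\<^sup>+x. indicator (strip_R2 \<delta>) x * ennreal ((u x)\<^sup>2) \<partial>lborel)
  <= ennreal (8 * \<delta>) * (\<integral>\<^sup>+x. ennreal ((u x)\<^sup>2) \<partial>R2 \<alpha> m)
   + ennreal (8 * \<delta>\<^sup>2) * (\<integral>\<^sup>+x. indicator (strip_R2 \<delta>) x * ennreal (grad_sq u x) \<partial>lborel)"
  using strip_bound_cone[OF _ _ _ _ _ _ _ e strips_borel(4) u, of "pi/2 + \<alpha>"] \<delta> \<alpha>_pos by (simp add: R2_def)
qed


text \<open>What makes every continuous function square integrable for the surface measure: finite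
  mass, carried by the closed unit ball.\<close>

definition tame :: "(real^3) measure => bool" where
 "tame \<sigma> \<longleftrightarrow> sets \<sigma> = sets borel \<and> finite_measure \<sigma> \<and> (AE x in \<sigma>. norm x <= 1)"

lemma tameI:
 assumes s: "sets \<sigma> = sets borel" and E[measurable]: "E \<in> sets borel" and bE: "bounded (E :: (real \<times> real) set)"
  and \<sigma>: "\<And>f. f \<in> borel_measurable borel ==>
   (\<integral>\<^sup>+x. f x \<partial>\<sigma>) = (\<integral>\<^sup>+y. indicator E y * (ennreal (B y) * f (sph3 (g y))) \<partial>lborel)"
  and B: "\<And>y. y \<in> E ==> B y <= 1" and g: "\<And>y. y \<in> E ==> norm (sph3 (g y)) <= 1"
 shows "tame \<sigma>"
proof -
 have sp: "space \<sigma> = UNIV" using sets_eq_imp_space_eq[OF s] by simp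
 have "emeasure \<sigma> (space \<sigma>) = (\<integral>\<^sup>+x. 1 \<partial>\<sigma>)" by simp
 also have "\<dots> = (\<integral>\<^sup>+y. indicator E y * (ennreal (B y) * 1) \<partial>lborel)" by (rule \<sigma>) simp
 also have "\<dots> <= (\<integral>\<^sup>+y. indicator E y \<partial>lborel)"
  using B by (intro nn_integral_mono) (auto simp: indicator_def intro!: ennreal_le_1[THEN iffD2])
 also have "\<dots> = emeasure lborel E" by simp
 also have "\<dots> < \<infinity>" by (rule emeasure_bounded_finite[OF bE])
 finally have fin: "finite_measure \<sigma>" by (intro finite_measureI) auto
 have m: "{x. \<not> norm x <= 1} \<in> sets (borel :: (real^3) measure)" by measurable
 have "emeasure \<sigma> {x. \<not> norm x <= 1} = (\<integral>\<^sup>+x. indicator {x. \<not> norm x <= 1} x \<partial>\<sigma>)" using m s by simp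
 also have "\<dots> = (\<integral>\<^sup>+y. indicator E y * (ennreal (B y) * indicator {x. \<not> norm x <= 1} (sph3 (g y))) \<partial>lborel)"
  by (rule \<sigma>) (use m in measurable)
 also have "\<dots> = (\<integral>\<^sup>+y. 0 \<partial>(lborel :: (real \<times> real) measure))"
  using g by (intro nn_integral_cong) (auto simp: indicator_def)
 finally have "emeasure \<sigma> {x. \<not> norm x <= 1} = 0" by simp
 then have "AE x in \<sigma>. norm x <= 1" using m s by (intro AE_I[of _ _ "{x. \<not> norm x <= 1}"]) auto
 then show ?thesis using s fin by (simp add: tame_def)
qed

lemma bounded_rect: "bounded ({p1<..<p2} \<times> {0..<2*pi})" for p1 p2 :: real
 by (intro bounded_Times) (auto intro: bounded_subset[OF bounded_closed_interval[of p1 p2]] bounded_subset[OF bounded_closed_interval[of 0 "2*pi"]]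
   simp: box_real)

lemma tame_sphere_piece: assumes "0 <= r" "r <= 1" shows "tame (sphere_piece \<alpha> r)"
proof (rule tameI[OF _ sphere_rect_borel bounded_rect nn_integral_sphere_piece])
 show "sets (sphere_piece \<alpha> r) = sets borel" by (simp add: sphere_piece_def)
 show "r\<^sup>2 * sin (fst y) <= 1" for y :: "real \<times> real"
  using mult_mono[of "r\<^sup>2" 1 "sin (fst y)" 1] assms by (cases "sin (fst y) \<ge> 0") (auto simp: power_le_one mult_nonneg_nonpos intro: order_trans[OF mult_nonneg_nonpos])
qed (use assms in \<open>auto simp: sph3_def norm_sph\<close>)

lemma tame_cone_piece: "tame (cone_piece m p)"
proof (rule tameI[OF _ sphere_rect_borel bounded_rect nn_integral_cone_piece])
 show "sets (cone_piece m p) = sets borel" by (simp add: cone_piece_def)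
 fix y :: "real \<times> real" assume "y \<in> {a<..<1} \<times> {0..<2*pi}"
 then have y: "0 < fst y" "fst y < 1" using a_pos by (auto intro: less_trans)
 have "fst y * sin p <= fst y * 1" using y by (intro mult_left_mono) auto
 then show "fst y * sin p <= 1" using y by linarith
 show "norm (sph3 (vector [fst y, p, snd y])) <= 1" using y by (simp add: sph3_def norm_sph)
qed

lemma tame_pieces: "tame (A1 \<alpha> m)" "tame (A2 \<alpha> m)" "tame (R1 \<alpha> m)" "tame (R2 \<alpha> m)"
 using a_pos a_le by (auto simp: A1_def A2_def R1_def R2_def a_def[symmetric] intro!: tame_sphere_piece tame_cone_piece)

end


context conical_shell
begin

section \<open>Functions with traces\<close>

text \<open>The weak gradient is an argument, so that any convenient representative can be used
  instead of the one chosen by \<open>weak_deriv\<close>.\<close>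

definition H1 :: "(real^3 => real) => (real^3 => real^3 => real) => bool" where
 "H1 f fb \<longleftrightarrow> L2 M f \<and> (\<forall>b\<in>Basis. has_weak_deriv D b f (fb b) \<and> L2 M (fb b))"

lemma H1D:
 assumes "H1 f fb"
 shows "L2 M f" "b \<in> Basis ==> has_weak_deriv D b f (fb b)" "b \<in> Basis ==> L2 M (fb b)"
 using assms by (auto simp: H1_def)

lemma borel_measurable_M: "f \<in> borel_measurable borel ==> f \<in> borel_measurable M"
 by (rule measurable_restrict_space1) simp

lemma space_M: "space M = D"
 by (simp add: space_restrict_space)

lemma smooth_on_measurable_M:
 assumes "smooth_on D u" shows "u \<in> borel_measurable M"
 by (rule locally_integrable_borel[OF open_Dm locally_integrable_smooth[OF open_Dm smooth_on_imp_continuous[OF assms]]])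

lemma continuous_bounded_Dm:
 fixes u :: "real^3 => real"
 assumes "continuous_on UNIV u"
 obtains C where "\<And>x. x \<in> D ==> \<bar>u x\<bar> <= C" "\<And>x. norm x <= 1 ==> \<bar>u x\<bar> <= C"
proof -
 have "compact (u ` cball 0 1)" using assms by (intro compact_continuous_image compact_cball) (auto intro: continuous_on_subset)
 then obtain C where C: "\<And>y. y \<in> u ` cball 0 1 ==> \<bar>y\<bar> <= C" using compact_imp_bounded bounded_iff by (metis real_norm_def)
 show thesis
 proof (rule that[of C])
  fix x
  show "\<bar>u x\<bar> <= C" if "x \<in> D" using norm_Dm(2)[OF that] by (intro C imageI) simp
  show "\<bar>u x\<bar> <= C" if "norm x <= 1" using that by (intro C imageI) simp
 qed
qed

lemma L2_continuous:
 fixes u :: "real^3 => real"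
 assumes "continuous_on UNIV u" shows "L2 M u"
proof -
 obtain C where C: "\<And>x. x \<in> D ==> \<bar>u x\<bar> <= C" using continuous_bounded_Dm[OF assms] by metis
 show ?thesis
  by (rule L2_bounded[OF finite_measure_Dm borel_measurable_M[OF borel_measurable_continuous_onI[OF assms]], where C=C])
   (use C space_M in auto)
qed

lemma H1_smooth:
 assumes "smooth u" shows "H1 u (%b x. FD u x b)"
proof -
 have s: "smooth_on UNIV u" using assms by (simp add: smooth_iff_smooth_on)
 have "has_weak_deriv D b u (%x. FD u x b)" if "b \<in> Basis" for b
  using has_weak_deriv_smooth[OF open_Dm that smooth_on_subset[OF s]] by simp
 then show ?thesis unfolding H1_def
  using L2_continuous smooth_on_imp_continuous[OF s] smooth_on_imp_continuous[OF smooth_on_deriv[OF s]] by blast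
qed

lemma H1_diff:
 assumes "H1 f fb" "H1 g gb" shows "H1 (%x. f x - g x) (%b x. fb b x - gb b x)"
 using assms unfolding H1_def by (auto intro: L2_diff has_weak_deriv_diff[OF open_Dm])

lemma H1_weak_deriv:
 assumes "H1 f fb" "b \<in> Basis"
 shows "has_weak_deriv D b f (weak_deriv D b f)" "AE x in M. weak_deriv D b f x = fb b x" "L2 M (weak_deriv D b f)"
proof -
 have h: "has_weak_deriv D b f (fb b)" "L2 M (fb b)" using assms by (auto simp: H1_def)
 show w: "has_weak_deriv D b f (weak_deriv D b f)" unfolding weak_deriv_def by (rule someI[of "has_weak_deriv D b f", OF h(1)])
 show ae: "AE x in M. weak_deriv D b f x = fb b x" by (rule has_weak_deriv_unique[OF open_Dm w h(1)])
 have "weak_deriv D b f \<in> borel_measurable M"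
  using w locally_integrable_borel[OF open_Dm] by (auto simp: has_weak_deriv_def)
 then show "L2 M (weak_deriv D b f)" using ae by (intro L2_cong_AE[OF h(2)]) auto
qed

lemma sobolev_H1:
 fixes f :: "real^3 => real"
 assumes "sobolev_H 1 D f" shows "\<exists>fb. H1 f fb"
proof -
 have "L2 M f" "\<forall>b\<in>Basis. \<exists>g. has_weak_deriv D b f g \<and> L2 M g" using assms by (auto simp: One_nat_def)
 then show ?thesis unfolding H1_def by (metis (no_types))
qed

lemma sobolev_H1_weak: "sobolev_H 1 D f ==> H1 f (%b. weak_deriv D b f)" for f :: "real^3 => real"
 using sobolev_H1[of f] H1_weak_deriv unfolding H1_def by blast

lemma sobolev_sqnorm_1:
 assumes "H1 f fb"
 shows "sobolev_sqnorm 1 D f = (L2_norm M f)\<^sup>2 + (\<Sum>b\<in>Basis. (L2_norm M (fb b))\<^sup>2)"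
proof -
 have "L2_norm M (weak_deriv D b f) = L2_norm M (fb b)" if "b \<in> Basis" for b
  using H1_weak_deriv[OF assms that] assms that by (intro L2_norm_cong_AE) (auto simp: H1_def L2_def)
 then show ?thesis by (simp add: One_nat_def)
qed

text \<open>The norm in \<open>has_trace\<close> contains chosen weak derivatives of
  \<open>u k - f\<close>. By uniqueness these are the classical derivatives of \<open>u k\<close>
  minus those of \<open>f\<close>, so function and each partial derivative converge
  separately.\<close>

lemma has_trace_approx:
 assumes "has_trace D \<sigma> f g" "tame \<sigma>"
 shows "\<exists>u fb. (\<forall>k. smooth (u k)) \<and> H1 f fb \<and> (%k. L2_norm M (%x. u k x - f x)) \<longlonglongrightarrow> 0 \<and>
  (\<forall>b\<in>Basis. (%k. L2_norm M (%x. FD (u k) x b - fb b x)) \<longlonglongrightarrow> 0) \<and>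
  (%k. L2_norm \<sigma> (%x. u k x - g x)) \<longlonglongrightarrow> 0 \<and> L2 \<sigma> g"
proof -
 obtain u where u: "sobolev_H 1 D f" "L2 \<sigma> g" "\<And>k. smooth (u k)"
  "(%k. sobolev_sqnorm 1 D (%x. u k x - f x)) \<longlonglongrightarrow> 0" "(%k. L2_norm \<sigma> (%x. u k x - g x)) \<longlonglongrightarrow> 0"
  using assms(1) unfolding has_trace_def by blast
 obtain fb where fb: "H1 f fb" using sobolev_H1[OF u(1)] by blast
 have e: "sobolev_sqnorm 1 D (%x. u k x - f x) = (L2_norm M (%x. u k x - f x))\<^sup>2
  + (\<Sum>b\<in>Basis. (L2_norm M (%x. FD (u k) x b - fb b x))\<^sup>2)" for k
  by (rule sobolev_sqnorm_1[OF H1_diff[OF H1_smooth[OF u(3)] fb]])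
 have sq: "g \<longlonglongrightarrow> 0" if "\<And>k. 0 <= g k" "\<And>k. (g k)\<^sup>2 <= sobolev_sqnorm 1 D (%x. u k x - f x)" for g :: "nat => real"
 proof -
  have "(%k. (g k)\<^sup>2) \<longlonglongrightarrow> 0"
   by (rule tendsto_sandwich[OF _ _ tendsto_const u(4)]) (use that in auto)
  from tendsto_real_sqrt[OF this] show ?thesis using that(1) by simp
 qed
 show ?thesis
 proof (intro exI conjI allI ballI)
  show "smooth (u k)" for k by (rule u(3))
  show "H1 f fb" "(%k. L2_norm \<sigma> (%x. u k x - g x)) \<longlonglongrightarrow> 0" "L2 \<sigma> g" by (rule fb u)+
  show "(%k. L2_norm M (%x. u k x - f x)) \<longlonglongrightarrow> 0"
   by (rule sq) (auto simp: e intro!: sum_nonneg)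
  fix b :: "real^3" assume b: "b \<in> Basis"
  show "(%k. L2_norm M (%x. FD (u k) x b - fb b x)) \<longlonglongrightarrow> 0"
  proof (rule sq)
   fix k
   have "(L2_norm M (%x. FD (u k) x b - fb b x))\<^sup>2
    <= (\<Sum>b\<in>Basis. (L2_norm M (%x. FD (u k) x b - fb b x))\<^sup>2)"
    using b by (intro member_le_sum) auto
   then show "(L2_norm M (%x. FD (u k) x b - fb b x))\<^sup>2 <= sobolev_sqnorm 1 D (%x. u k x - f x)"
    unfolding e using zero_le_power2[of "L2_norm M (%x. u k x - f x)"] by linarith
  qed simp
 qed
qed

lemma L2_norm_lim:
 assumes "\<And>k. L2 N (g k)" "L2 N (f :: 'a => real)" "(%k. L2_norm N (%x. g k x - f x)) \<longlonglongrightarrow> 0"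
 shows "(%k. L2_norm N (g k)) \<longlonglongrightarrow> L2_norm N f"
proof (rule LIM_zero_cancel, rule Lim_null_comparison[OF _ assms(3)], rule always_eventually, rule allI)
 fix k
 have d: "L2 N (%x. g k x - f x)" "L2 N (%x. (-1) * (g k x - f x))"
  by (rule L2_diff[OF assms(1)[of k] assms(2)] L2_scale[OF L2_diff[OF assms(1)[of k] assms(2)]])+
 have "L2_norm N (g k) <= L2_norm N f + L2_norm N (%x. g k x - f x)"
  using L2_norm_triangle[OF assms(2) d(1)] by simp
 moreover have "L2_norm N f <= L2_norm N (g k) + L2_norm N (%x. (-1) * (g k x - f x))"
  using L2_norm_triangle[OF assms(1)[of k] d(2)] by simp
 ultimately show "norm (L2_norm N (g k) - L2_norm N f) <= L2_norm N (%x. g k x - f x)"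
  unfolding L2_norm_scale by simp
qed

lemma L2_integral_lim:
 assumes "\<And>k. L2 N (g k)" "L2 N (f :: 'a => real)" "(%k. L2_norm N (%x. g k x - f x)) \<longlonglongrightarrow> 0" "L2 N q"
 shows "(%k. \<integral>x. g k x * q x \<partial>N) \<longlonglongrightarrow> (\<integral>x. f x * q x \<partial>N)"
proof (rule LIM_zero_cancel, rule Lim_null_comparison[OF _ tendsto_mult_left_zero[OF assms(3), of "L2_norm N q"]],
  rule always_eventually, rule allI)
 fix k
 have "(\<integral>x. g k x * q x \<partial>N) - (\<integral>x. f x * q x \<partial>N) = (\<integral>x. (g k x - f x) * q x \<partial>N)"
  using L2_integrable_mult[OF assms(1)[of k] assms(4)] L2_integrable_mult[OF assms(2,4)]
  by (simp add: left_diff_distrib)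
 then show "norm ((\<integral>x. g k x * q x \<partial>N) - (\<integral>x. f x * q x \<partial>N)) <= L2_norm N (%x. g k x - f x) * L2_norm N q"
  using L2_cauchy_schwarz[OF L2_diff[OF assms(1)[of k] assms(2)] assms(4)] by simp
qed

lemma L2_norm_mult_bounded_lim:
 fixes f :: "real^3 => real"
 assumes "\<And>k. L2 N (g k)" "L2 N f" "(%k. L2_norm N (%x. g k x - f x)) \<longlonglongrightarrow> 0"
  "w \<in> borel_measurable N" "AE x in N. \<bar>w x\<bar> <= C"
 shows "(%k. L2_norm N (%x. w x * g k x - w x * f x)) \<longlonglongrightarrow> 0"
proof (rule Lim_null_comparison[OF _ tendsto_mult_right_zero[OF assms(3), of "\<bar>C\<bar>"]], rule always_eventually, rule allI)
 fix k
 have d: "L2 N (%x. g k x - f x)" using assms(1,2) L2_diff by blast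
 have m: "(%x. w x * g k x - w x * f x) \<in> borel_measurable N" using assms(1)[of k] assms(2,4) by (auto simp: L2_def)
 have "L2_norm N (%x. w x * g k x - w x * f x) <= L2_norm N (%x. C * (g k x - f x))"
 proof (rule L2_norm_mono[OF L2_scale[OF d] m])
  show "AE x in N. \<bar>w x * g k x - w x * f x\<bar> <= \<bar>C * (g k x - f x)\<bar>"
   using assms(5) by (rule AE_mp) (auto simp: abs_mult simp flip: right_diff_distrib intro!: mult_right_mono)
 qed
 then show "norm (L2_norm N (%x. w x * g k x - w x * f x)) <= \<bar>C\<bar> * L2_norm N (%x. g k x - f x)"
  by (simp add: L2_norm_scale)
qed

lemma L2_tame: "tame \<sigma> ==> continuous_on UNIV u ==> L2 \<sigma> (u :: real^3 => real)"
proof -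
 assume t: "tame \<sigma>" and c: "continuous_on UNIV u"
 obtain C where C: "\<And>x. norm x <= 1 ==> \<bar>u x\<bar> <= C" using continuous_bounded_Dm[OF c] by metis
 have "u \<in> borel_measurable \<sigma>"
  using borel_measurable_continuous_onI[OF c] t measurable_cong_sets[of \<sigma> borel borel borel] by (auto simp: tame_def)
 moreover have "AE x in \<sigma>. norm x <= 1" using t by (simp add: tame_def)
 then have "AE x in \<sigma>. \<bar>u x\<bar> <= C" by (rule AE_mp) (use C in auto)
 ultimately show "L2 \<sigma> u" using t by (intro L2_bounded[where C=C]) (auto simp: tame_def)
qed

lemma nn_integral_L2_norm:
 assumes "L2 N (f :: 'a => real)" shows "(\<integral>\<^sup>+x. ennreal ((f x)\<^sup>2) \<partial>N) = ennreal ((L2_norm N f)\<^sup>2)"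
 using assms by (subst nn_integral_eq_integral) (auto simp: L2_real_iff L2_norm_power2)

lemma nn_integral_M_indicator:
 assumes Z: "Z \<in> sets borel" "Z \<subseteq> D" and f: "L2 M f"
 shows "(\<integral>\<^sup>+x. indicator Z x * ennreal ((f x)\<^sup>2) \<partial>lborel) = ennreal ((L2_norm M (%x. indicator Z x * f x))\<^sup>2)"
  and "L2 M (%x. indicator Z x * f x)"
proof -
 show L: "L2 M (%x. indicator Z x * f x)"
  by (rule L2_mult_bounded[OF f borel_measurable_M[OF borel_measurable_indicator[OF Z(1)]], where C=1])
   (simp add: indicator_def)
 have "(\<integral>\<^sup>+x. indicator Z x * ennreal ((f x)\<^sup>2) \<partial>lborel)
  = (\<integral>\<^sup>+x. ennreal ((indicator Z x * f x)\<^sup>2) * indicator D x \<partial>lborel)"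
  using Z(2) by (intro nn_integral_cong) (auto simp: indicator_def)
 also have "\<dots> = (\<integral>\<^sup>+x. ennreal ((indicator Z x * f x)\<^sup>2) \<partial>M)"
  by (rule nn_integral_restrict_space[symmetric]) simp
 finally show "(\<integral>\<^sup>+x. indicator Z x * ennreal ((f x)\<^sup>2) \<partial>lborel) = ennreal ((L2_norm M (%x. indicator Z x * f x))\<^sup>2)"
  unfolding nn_integral_L2_norm[OF L] .
qed

text \<open>The differences of the two approximating sequences are smooth and their boundary norms
  tend to 0 because both traces are the same function. The strip estimate for them passes to the
  limit, losing its boundary term.\<close>

lemma trace_eq_strip:
 fixes f g :: "real^3 => real"
 assumes tr: "trace_eq D \<sigma> f g" and t: "tame \<sigma>" and sb: "strip_bound Z \<sigma> \<delta>\<^sub>0"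
  and Z: "\<And>\<delta>. Z \<delta> \<in> sets borel" "\<And>\<delta>. Z \<delta> \<subseteq> D"
 obtains hb :: "real^3 => real^3 => real" where "\<And>b. b \<in> Basis ==> L2 M (hb b)"
  "\<And>\<delta>. 0 < \<delta> ==> \<delta> <= \<delta>\<^sub>0 ==> (L2_norm M (%x. indicator (Z \<delta>) x * (f x - g x)))\<^sup>2
   <= 8 * \<delta>\<^sup>2 * (\<Sum>b\<in>Basis. (L2_norm M (%x. indicator (Z \<delta>) x * hb b x))\<^sup>2)"
proof -
 obtain h where h: "has_trace D \<sigma> f h" "has_trace D \<sigma> g h" using tr unfolding trace_eq_def by blast
 obtain u fb where u: "\<And>k. smooth (u k)" "H1 f fb" "(%k. L2_norm M (%x. u k x - f x)) \<longlonglongrightarrow> 0"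
  "\<And>b. b \<in> Basis ==> (%k. L2_norm M (%x. FD (u k) x b - fb b x)) \<longlonglongrightarrow> 0"
  "(%k. L2_norm \<sigma> (%x. u k x - h x)) \<longlonglongrightarrow> 0" "L2 \<sigma> h"
  using has_trace_approx[OF h(1) t] by blast
 obtain v gb where v: "\<And>k. smooth (v k)" "H1 g gb" "(%k. L2_norm M (%x. v k x - g x)) \<longlonglongrightarrow> 0"
  "\<And>b. b \<in> Basis ==> (%k. L2_norm M (%x. FD (v k) x b - gb b x)) \<longlonglongrightarrow> 0"
  "(%k. L2_norm \<sigma> (%x. v k x - h x)) \<longlonglongrightarrow> 0" "L2 \<sigma> h"
  using has_trace_approx[OF h(2) t] by blast
 define U where "U k x = u k x - v k x" for k x
 define hb where "hb b x = fb b x - gb b x" for b x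
 have su: "smooth_on UNIV (u k)" "smooth_on UNIV (v k)" for k using u(1) v(1) by (simp_all add: smooth_iff_smooth_on)
 have sU: "smooth_on UNIV (U k)" for k unfolding U_def by (intro smooth_on_diff su) simp
 have U: "smooth (U k)" for k using sU by (simp add: smooth_iff_smooth_on)
 have cU: "continuous_on UNIV (U k)" "continuous_on UNIV (u k)" "continuous_on UNIV (v k)" for k
  by (rule smooth_on_imp_continuous[OF sU] smooth_on_imp_continuous[OF su(1)] smooth_on_imp_continuous[OF su(2)])+
 have HU: "H1 (U k) (%b x. FD (U k) x b)" for k using H1_smooth[OF U] .
 have Hu: "H1 (u k) (%b x. FD (u k) x b)" "H1 (v k) (%b x. FD (v k) x b)" for k
  by (rule H1_smooth[OF u(1)] H1_smooth[OF v(1)])+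
 have Lf: "L2 M f" "L2 M g" "L2 M (%x. f x - g x)" "\<And>k. L2 M (U k)" "\<And>k. L2 M (u k)" "\<And>k. L2 M (v k)"
  by (rule H1D(1)[OF u(2)] H1D(1)[OF v(2)] L2_diff[OF H1D(1)[OF u(2)] H1D(1)[OF v(2)]]
    H1D(1)[OF HU] H1D(1)[OF Hu(1)] H1D(1)[OF Hu(2)])+
 have Lb: "L2 M (fb b)" "L2 M (gb b)" "L2 M (hb b)" "\<And>k. L2 M (%x. FD (U k) x b)"
  "\<And>k. L2 M (%x. FD (u k) x b)" "\<And>k. L2 M (%x. FD (v k) x b)"
  if "b \<in> Basis" for b
  unfolding hb_def
  by (rule H1D(3)[OF u(2) that] H1D(3)[OF v(2) that] L2_diff[OF H1D(3)[OF u(2) that] H1D(3)[OF v(2) that]]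
    H1D(3)[OF HU that] H1D(3)[OF Hu(1) that] H1D(3)[OF Hu(2) that])+
 have conv: "(%k. L2_norm N (%x. (p k x - q k x) - (p0 x - q0 x))) \<longlonglongrightarrow> 0"
  if "\<And>k. L2 N (p k)" "\<And>k. L2 N (q k)" "L2 N p0" "L2 N q0" "(%k. L2_norm N (%x. p k x - p0 x)) \<longlonglongrightarrow> 0"
   "(%k. L2_norm N (%x. q k x - q0 x)) \<longlonglongrightarrow> 0" for N :: "(real^3) measure" and p q and p0 q0 :: "real^3 => real"
 proof (rule Lim_null_comparison[OF _ tendsto_add_zero[OF that(5,6)]], rule always_eventually, rule allI)
  fix k
  have d: "L2 N (%x. p k x - p0 x)" "L2 N (%x. (-1) * (q k x - q0 x))"
   by (rule L2_diff[OF that(1)[of k] that(3)] L2_scale[OF L2_diff[OF that(2)[of k] that(4)]])+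
  have "L2_norm N (%x. (p k x - p0 x) + (-1) * (q k x - q0 x)) <= L2_norm N (%x. p k x - p0 x) + L2_norm N (%x. q k x - q0 x)"
   using L2_norm_triangle[OF d] unfolding L2_norm_scale by simp
  moreover have "(%x. (p k x - p0 x) + (-1) * (q k x - q0 x)) = (%x. (p k x - q k x) - (p0 x - q0 x))" by (simp add: fun_eq_iff)
  ultimately show "norm (L2_norm N (%x. (p k x - q k x) - (p0 x - q0 x))) <= L2_norm N (%x. p k x - p0 x) + L2_norm N (%x. q k x - q0 x)"
   by simp
 qed
 have c0: "(%k. L2_norm M (%x. U k x - (f x - g x))) \<longlonglongrightarrow> 0"
  unfolding U_def by (rule conv[OF Lf(5,6,1,2) u(3) v(3)])
 have fU: "FD (U k) x b = FD (u k) x b - FD (v k) x b" for k x b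
 proof -
  have "(U k has_derivative (%h. FD (u k) x h - FD (v k) x h)) (at x)"
   unfolding U_def using smooth_on_has_derivative[OF su(1)] smooth_on_has_derivative[OF su(2)] by (intro has_derivative_diff) auto
  from frechet_derivative_at[OF this] show ?thesis by metis
 qed
 have cb: "(%k. L2_norm M (%x. FD (U k) x b - hb b x)) \<longlonglongrightarrow> 0" if "b \<in> Basis" for b
  unfolding fU hb_def by (rule conv[OF Lb(5,6,1,2)[OF that] u(4)[OF that] v(4)[OF that]])
 have "(%k. L2_norm \<sigma> (%x. (u k x - v k x) - (h x - h x))) \<longlonglongrightarrow> 0"
  by (rule conv[OF L2_tame[OF t cU(2)] L2_tame[OF t cU(3)] u(6) u(6) u(5) v(5)])
 then have cs: "(%k. L2_norm \<sigma> (U k)) \<longlonglongrightarrow> 0" by (simp add: U_def[abs_def])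
 show thesis
 proof (rule that[of hb])
  show "L2 M (hb b)" if "b \<in> Basis" for b using Lb(3)[OF that] .
  fix \<delta> assume \<delta>: "0 < \<delta>" "\<delta> <= \<delta>\<^sub>0"
  note I2 = nn_integral_M_indicator(2)[OF Z] and I1 = nn_integral_M_indicator(1)[OF Z]
  have lim: "(%k. (L2_norm M (%x. indicator (Z \<delta>) x * p k x))\<^sup>2) \<longlonglongrightarrow> (L2_norm M (%x. indicator (Z \<delta>) x * q x))\<^sup>2"
   if "\<And>k. L2 M (p k)" "L2 M q" "(%k. L2_norm M (%x. p k x - q x)) \<longlonglongrightarrow> 0"
   for p and q :: "real^3 => real"
  proof -
   have "AE x in M. \<bar>indicator (Z \<delta>) x :: real\<bar> <= 1" by (simp add: indicator_def)
   from L2_norm_mult_bounded_lim[OF that borel_measurable_M[OF borel_measurable_indicator[OF Z(1)]] this]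
   have "(%k. L2_norm M (%x. indicator (Z \<delta>) x * p k x - indicator (Z \<delta>) x * q x)) \<longlonglongrightarrow> 0" .
   from tendsto_power[OF L2_norm_lim[OF I2[OF that(1)] I2[OF that(2)] this]] show ?thesis .
  qed
  have est: "(L2_norm M (%x. indicator (Z \<delta>) x * U k x))\<^sup>2 <= 8 * \<delta> * (L2_norm \<sigma> (U k))\<^sup>2
   + 8 * \<delta>\<^sup>2 * (\<Sum>b\<in>Basis. (L2_norm M (%x. indicator (Z \<delta>) x * FD (U k) x b))\<^sup>2)" for k
  proof -
   have gs: "(\<integral>\<^sup>+x. indicator (Z \<delta>) x * ennreal (grad_sq (U k) x) \<partial>lborel)
    = ennreal (\<Sum>b\<in>Basis. (L2_norm M (%x. indicator (Z \<delta>) x * FD (U k) x b))\<^sup>2)"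
   proof -
    have m: "(%x. FD (U k) x b) \<in> borel_measurable borel" if "b \<in> Basis" for b
     using smooth_on_imp_continuous[OF smooth_on_deriv[OF sU that]] by (rule borel_measurable_continuous_onI)
    have "(\<integral>\<^sup>+x. indicator (Z \<delta>) x * ennreal (grad_sq (U k) x) \<partial>lborel)
     = (\<integral>\<^sup>+x. (\<Sum>b\<in>Basis. indicator (Z \<delta>) x * ennreal ((FD (U k) x b)\<^sup>2)) \<partial>lborel)"
    proof (rule nn_integral_cong)
     fix x
     have "ennreal (grad_sq (U k) x) = (\<Sum>b\<in>Basis. ennreal ((FD (U k) x b)\<^sup>2))"
      unfolding grad_sq_def by (rule sum_ennreal[symmetric]) simp
     then show "indicator (Z \<delta>) x * ennreal (grad_sq (U k) x)
      = (\<Sum>b\<in>Basis. indicator (Z \<delta>) x * ennreal ((FD (U k) x b)\<^sup>2))"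
      by (simp only: sum_distrib_left)
    qed
    also have "\<dots> = (\<Sum>b\<in>Basis. \<integral>\<^sup>+x. indicator (Z \<delta>) x * ennreal ((FD (U k) x b)\<^sup>2) \<partial>lborel)"
     by (rule nn_integral_sum) (use Z(1) m in measurable)
    also have "\<dots> = (\<Sum>b\<in>Basis. ennreal ((L2_norm M (%x. indicator (Z \<delta>) x * FD (U k) x b))\<^sup>2))"
     by (intro sum.cong refl I1 Lb(4))
    finally show ?thesis by (simp add: sum_ennreal)
   qed
   have "ennreal ((L2_norm M (%x. indicator (Z \<delta>) x * U k x))\<^sup>2) <= ennreal (8 * \<delta>) * ennreal ((L2_norm \<sigma> (U k))\<^sup>2)
    + ennreal (8 * \<delta>\<^sup>2) * ennreal (\<Sum>b\<in>Basis. (L2_norm M (%x. indicator (Z \<delta>) x * FD (U k) x b))\<^sup>2)"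
    using sb[unfolded strip_bound_def, rule_format, OF U \<delta>, of k]
    unfolding gs I1[OF Lf(4)] nn_integral_L2_norm[OF L2_tame[OF t cU(1)]] .
   also have "\<dots> = ennreal (8 * \<delta> * (L2_norm \<sigma> (U k))\<^sup>2
    + 8 * \<delta>\<^sup>2 * (\<Sum>b\<in>Basis. (L2_norm M (%x. indicator (Z \<delta>) x * FD (U k) x b))\<^sup>2))"
    using \<delta> by (simp add: ennreal_mult ennreal_plus sum_nonneg)
   finally show ?thesis by (rule ennreal_le_iff[THEN iffD1, rotated]) (use \<delta> in \<open>auto intro!: add_nonneg_nonneg mult_nonneg_nonneg sum_nonneg\<close>)
  qed
  have "(%k. 8 * \<delta> * (L2_norm \<sigma> (U k))\<^sup>2
   + 8 * \<delta>\<^sup>2 * (\<Sum>b\<in>Basis. (L2_norm M (%x. indicator (Z \<delta>) x * FD (U k) x b))\<^sup>2))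
   \<longlonglongrightarrow> 8 * \<delta> * 0\<^sup>2 + 8 * \<delta>\<^sup>2 * (\<Sum>b\<in>Basis. (L2_norm M (%x. indicator (Z \<delta>) x * hb b x))\<^sup>2)"
   by (intro tendsto_intros cs lim Lb(3,4) cb)
  from LIMSEQ_le[OF lim[OF Lf(4,3) c0] this] est
  show "(L2_norm M (%x. indicator (Z \<delta>) x * (f x - g x)))\<^sup>2
   <= 8 * \<delta>\<^sup>2 * (\<Sum>b\<in>Basis. (L2_norm M (%x. indicator (Z \<delta>) x * hb b x))\<^sup>2)" by simp
 qed
qed

end


context conical_shell
begin

section \<open>Cutoff functions\<close>

definition eps :: "nat => real" where "eps n = 1 / real (Suc n)"

lemma eps_pos: "0 < eps n" by (simp add: eps_def)

lemma eps_tendsto: "eps \<longlonglongrightarrow> 0" unfolding eps_def[abs_def] by (rule LIMSEQ_Suc[OF lim_1_over_n])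

text \<open>Defining functions of the outer sphere, the inner sphere and the double cone. They are
  polynomials, positive together exactly on \<open>D\<close>, and the third handles both conical
  pieces at once.\<close>

definition d :: "3 => real^3 => real" where
 "d i x = (if i = 1 then 1 - (norm x)\<^sup>2 else if i = 2 then (norm x)\<^sup>2 - a\<^sup>2 else (sin \<alpha>)\<^sup>2 * (norm x)\<^sup>2 - (x $ 3)\<^sup>2)"

lemma Dm_d: "x \<in> D \<longleftrightarrow> (\<forall>i. 0 < d i x)"
 unfolding Dm_iff d_def forall_3 by auto

lemma smooth_on_norm_power2: "open S ==> smooth_on S (%x::real^3. (norm x)\<^sup>2)"
 unfolding power2_norm_real3 by (intro smooth_on_add smooth_on_power smooth_on_vec_nth)

lemma smooth_on_d: "open S ==> smooth_on S (d i)"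
 unfolding d_def[abs_def]
 by (cases "i = 1"; cases "i = 2"; simp; intro smooth_on_diff smooth_on_mult smooth_on_const smooth_on_norm_power2 smooth_on_power smooth_on_vec_nth)

lemma d_measurable [measurable]: "d i \<in> borel_measurable borel"
 using smooth_on_imp_continuous[OF smooth_on_d[OF open_UNIV]] by (rule borel_measurable_continuous_onI)

definition d' :: "3 => real^3 => real^3 => real" where
 "d' i x h = (if i = 1 then - (2 * (x \<bullet> h)) else if i = 2 then 2 * (x \<bullet> h)
  else 2 * (sin \<alpha>)\<^sup>2 * (x \<bullet> h) - 2 * (x $ 3) * (h $ 3))"

lemma d_has_derivative: "(d i has_derivative d' i x) (at x)"
proof -
 have n: "((%x::real^3. (norm x)\<^sup>2) has_derivative (%h. 2 * (x \<bullet> h))) (at x)"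
  unfolding power2_norm_eq_inner by (auto intro!: derivative_eq_intros simp: inner_commute)
 have t: "((%x::real^3. (x $ 3)\<^sup>2) has_derivative (%h. 2 * (x $ 3) * (h $ 3))) (at x)"
 proof -
  have n: "((%x::real^3. x $ 3) has_derivative (%h. h $ 3)) (at x)"
   by (rule bounded_linear_imp_has_derivative[OF bounded_linear_vec_nth])
  show ?thesis unfolding power2_eq_square
   by (rule has_derivative_eq_rhs[OF has_derivative_mult[OF n n]]) (simp add: fun_eq_iff)
 qed
 consider "i = 1" | "i = 2" | "i = 3" using exhaust_3 by blast
 then show ?thesis
 proof cases
  case 1
  have "((%x. 1 - (norm x)\<^sup>2) has_derivative (%h. 0 - 2 * (x \<bullet> h))) (at x)"
   by (intro has_derivative_diff has_derivative_const n)
  then show ?thesis using 1 by (simp add: d_def[abs_def] d'_def[abs_def])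
 next
  case 2
  have "((%x. (norm x)\<^sup>2 - a\<^sup>2) has_derivative (%h. 2 * (x \<bullet> h) - 0)) (at x)"
   by (intro has_derivative_diff has_derivative_const n)
  then show ?thesis using 2 by (simp add: d_def[abs_def] d'_def[abs_def])
 next
  case 3
  have "((%x. (sin \<alpha>)\<^sup>2 * (norm x)\<^sup>2 - (x $ 3)\<^sup>2) has_derivative (%h. (sin \<alpha>)\<^sup>2 * (2 * (x \<bullet> h)) - 2 * (x $ 3) * (h $ 3))) (at x)"
   by (intro has_derivative_diff has_derivative_mult_right n t)
  then show ?thesis using 3 by (simp add: d_def[abs_def] d'_def[abs_def] mult_ac)
 qed
qed

definition cut :: "3 => nat => real^3 => real" where "cut i n x = smooth_step (d i x / eps n)"

definition \<eta> :: "nat => real^3 => real" where "\<eta> n x = cut 1 n x * (cut 2 n x * cut 3 n x)"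

definition cut_rest :: "3 => nat => real^3 => real" where
 "cut_rest i n x = (if i = 1 then cut 2 n x * cut 3 n x else if i = 2 then cut 1 n x * cut 3 n x else cut 1 n x * cut 2 n x)"

text \<open>The coefficient of the gradient of \<open>d i\<close> in the gradient of the cutoff
  \<eta>. It has size 1/eps and lives where \<open>d i\<close> lies between eps and 2 eps.\<close>

definition cc :: "3 => nat => real^3 => real" where
 "cc i n x = smooth_step' (d i x / eps n) / eps n * cut_rest i n x"

lemma cut_01: "0 <= cut i n x" "cut i n x <= 1"
 by (simp_all add: cut_def smooth_step_nonneg smooth_step_le_1)

lemma \<eta>_01: "0 <= \<eta> n x" "\<eta> n x <= 1"
 unfolding \<eta>_def by (auto intro!: mult_nonneg_nonneg mult_le_one cut_01)

lemma cut_has_derivative: "(cut i n has_derivative (%h. smooth_step' (d i x / eps n) / eps n * d' i x h)) (at x)"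
proof -
 have "((%x. d i x / eps n) has_derivative (%h. d' i x h / eps n)) (at x)"
  by (rule bounded_linear.has_derivative[OF bounded_linear_divide d_has_derivative])
 from has_derivative_compose[OF this smooth_step_has_derivative[unfolded has_field_derivative_def]]
 show ?thesis unfolding cut_def[abs_def] by (simp add: mult_ac)
qed

lemma \<eta>_derivative: "FD (\<eta> n) x h = cc 1 n x * d' 1 x h + cc 2 n x * d' 2 x h + cc 3 n x * d' 3 x h"
proof -
 have "(\<eta> n has_derivative (%h. cc 1 n x * d' 1 x h + cc 2 n x * d' 2 x h + cc 3 n x * d' 3 x h)) (at x)"
  unfolding \<eta>_def[abs_def]
  by (rule has_derivative_eq_rhs[OF has_derivative_mult[OF cut_has_derivative has_derivative_mult[OF cut_has_derivative cut_has_derivative]]])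
   (simp add: fun_eq_iff cc_def cut_rest_def algebra_simps)
 from frechet_derivative_at[OF this, symmetric] show ?thesis by simp
qed

lemma \<eta>_test: "test_function D (\<eta> n)"
proof (rule test_functionI[OF open_Dm])
 have "smooth_on D (cut i n)" for i
  unfolding cut_def[abs_def] by (rule smooth_on_compose[OF open_Dm smooth_on_smooth_step])
   (auto intro!: smooth_on_divide smooth_on_const smooth_on_d simp: eps_pos)
 then show "smooth_on D (\<eta> n)" unfolding \<eta>_def[abs_def] by (intro smooth_on_mult open_Dm)
 \<comment> \<open>Each \<open>cut i n\<close> vanishes where \<open>d i\<close> is at most
   \<open>eps n\<close>, so the support is a closed bounded set contained in
   \<open>D\<close>.\<close>
 define K where "K = {x. \<forall>i. eps n <= d i x}"
 have cd: "continuous_on UNIV (d i)" for i using smooth_on_imp_continuous[OF smooth_on_d[OF open_UNIV]] .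
 have "K = {x. eps n <= d 1 x} \<inter> {x. eps n <= d 2 x} \<inter> {x. eps n <= d 3 x}"
  unfolding K_def forall_3 by auto
 then have "closed K" using closed_Collect_le[OF continuous_on_const cd] by auto
 show KD: "K \<subseteq> D" 
 proof
  fix x assume "x \<in> K"
  then have "eps n <= d i x" for i by (simp add: K_def)
  then show "x \<in> D" unfolding Dm_d using eps_pos[of n] less_le_trans by metis
 qed
 show "compact K" using \<open>closed K\<close> bounded_subset[OF bounded_Dm KD] by (simp add: compact_eq_bounded_closed)
 show "\<eta> n x = 0" if "x \<notin> K" for x
 proof -
  have "\<not> (\<forall>i. eps n <= d i x)" using that by (simp add: K_def)
  then obtain i where "\<not> eps n <= d i x" by blast
  then have "cut i n x = 0" unfolding cut_def using eps_pos[of n] by (intro smooth_step_eq_0) simp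
  then show ?thesis using exhaust_3[of i] by (auto simp: \<eta>_def)
 qed
qed

lemma \<eta>_tendsto: assumes "x \<in> D" shows "(%n. \<eta> n x) \<longlonglongrightarrow> 1"
proof -
 have "eventually (%n. 2 * eps n < d i x) sequentially" for i
 proof -
  have "(%n. 2 * eps n) \<longlonglongrightarrow> 2 * 0" by (intro tendsto_intros eps_tendsto)
  then show ?thesis using assms order_tendstoD(2)[of "%n. 2 * eps n" 0 sequentially "d i x"] unfolding Dm_d by simp
 qed
 then have "eventually (%n. \<forall>i. 2 * eps n < d i x) sequentially" by (simp add: eventually_all_finite)
 then have "eventually (%n. \<eta> n x = 1) sequentially"
 proof eventually_elim
  case (elim n)
  have "cut i n x = 1" for i
   unfolding cut_def using elim eps_pos[of n] by (intro smooth_step_eq_1) (simp add: field_simps less_imp_le)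
  then show ?case by (simp add: \<eta>_def)
 qed
 then show ?thesis by (rule tendsto_eventually)
qed

definition layer :: "3 => nat => (real^3) set" where "layer i n = {x \<in> D. d i x <= 2 * eps n}"

lemma layer_borel [measurable]: "layer i n \<in> sets borel"
 unfolding layer_def by measurable

lemma cc_bound:
 obtains C where "C > 0" "\<And>i n x. x \<in> D ==> \<bar>cc i n x\<bar> <= C / eps n * indicator (layer i n) x"
proof -
 obtain C where C: "C > 0" "\<And>t. \<bar>smooth_step' t\<bar> <= C" using smooth_step'_bounded by metis
 show thesis
 proof (rule that[OF C(1)])
  fix i n x assume x: "x \<in> D"
  have p: "0 <= cut_rest i n x" "cut_rest i n x <= 1"
   by (auto simp: cut_rest_def intro!: mult_nonneg_nonneg mult_le_one cut_01)
  show "\<bar>cc i n x\<bar> <= C / eps n * indicator (layer i n) x"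
  proof (cases "x \<in> layer i n")
   case True
   have "\<bar>cc i n x\<bar> = \<bar>smooth_step' (d i x / eps n)\<bar> / eps n * cut_rest i n x"
    using eps_pos[of n] p by (simp add: cc_def abs_mult)
   also have "\<dots> <= C / eps n * 1" using p C eps_pos[of n] by (intro mult_mono divide_right_mono) auto
   finally show ?thesis using True by simp
  next
   case False
   then have "d i x / eps n > 2" using x eps_pos[of n] by (simp add: layer_def field_simps)
   then have "smooth_step' (d i x / eps n) = 0" by (intro smooth_step'_eq_0) simp
   then show ?thesis using False by (simp add: cc_def)
  qed
 qed
qed

lemma cc_measurable: "cc i n \<in> borel_measurable M"
proof (rule borel_measurable_M)
 have "continuous_on UNIV smooth_step'"
  using smooth_on_imp_continuous[OF smooth_on_deriv[OF smooth_on_smooth_step, of 1]] by (simp add: smooth_step'_def[abs_def])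
 then have [measurable]: "smooth_step' \<in> borel_measurable borel" by (rule borel_measurable_continuous_onI)
 have [measurable]: "smooth_step \<in> borel_measurable borel"
  using smooth_on_imp_continuous[OF smooth_on_smooth_step] by (rule borel_measurable_continuous_onI)
 show "cc i n \<in> borel_measurable borel" unfolding cc_def[abs_def] cut_rest_def cut_def by measurable
qed

text \<open>Functions whose mass near the boundary piece \<open>d i = 0\<close> is small enough to compensate the
 gradient of the cutoff functions.\<close>

definition vanishes :: "3 => (real^3 => real) => bool" where
 "vanishes i f \<longleftrightarrow> L2 M f \<and> (%n. L2_norm M (%x. indicator (layer i n) x * f x) / eps n) \<longlonglongrightarrow> 0"

text \<open>The factor 1/eps of the cutoff gradient is exactly what the decay demanded in
  \<open>vanishes\<close> compensates; the other factor is handled by the Cauchy-Schwarz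
  inequality.\<close>

lemma vanishes_cutoff_limit:
 assumes f: "vanishes i f" and q: "L2 M q"
 shows "(%n. \<integral>x. cc i n x * (f x * q x) \<partial>M) \<longlonglongrightarrow> 0"
proof -
 obtain C where C: "C > 0" "\<And>i n x. x \<in> D ==> \<bar>cc i n x\<bar> <= C / eps n * indicator (layer i n) x"
  using cc_bound by metis
 have Lf: "L2 M f" using f by (simp add: vanishes_def)
 have lim: "(%n. L2_norm M (%x. indicator (layer i n) x * f x) / eps n) \<longlonglongrightarrow> 0" using f by (simp add: vanishes_def)
 show ?thesis
 proof (rule Lim_null_comparison[OF _ tendsto_mult_right_zero[OF lim, of "C * L2_norm M q"]], rule always_eventually, rule allI)
  fix n
  have sub: "layer i n \<subseteq> D" by (auto simp: layer_def)
  have Ll: "L2 M (%x. C / eps n * (indicator (layer i n) x * f x))"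
   by (rule L2_scale[OF nn_integral_M_indicator(2)[OF layer_borel sub Lf]])
  have m: "(%x. cc i n x * f x) \<in> borel_measurable M" using cc_measurable Lf by (auto simp: L2_def)
  have b: "AE x in M. \<bar>cc i n x * f x\<bar> <= \<bar>C / eps n * (indicator (layer i n) x * f x)\<bar>"
  proof (rule AE_I2)
   fix x assume "x \<in> space M"
   then have "\<bar>cc i n x\<bar> <= C / eps n * indicator (layer i n) x" using C(2) space_M by blast
   then have "\<bar>cc i n x\<bar> * \<bar>f x\<bar> <= C / eps n * indicator (layer i n) x * \<bar>f x\<bar>" by (rule mult_right_mono) simp
   then show "\<bar>cc i n x * f x\<bar> <= \<bar>C / eps n * (indicator (layer i n) x * f x)\<bar>"
    using C(1) eps_pos[of n] by (simp add: abs_mult mult.assoc)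
  qed
  have Lc: "L2 M (%x. cc i n x * f x)"
   by (rule L2_mult_bounded[OF Lf cc_measurable, where C="C / eps n"])
    (use C eps_pos[of n] space_M in \<open>auto intro!: AE_I2 order_trans[OF C(2)] simp: indicator_def\<close>)
  have "\<bar>\<integral>x. cc i n x * f x * q x \<partial>M\<bar> <= L2_norm M (%x. cc i n x * f x) * L2_norm M q"
   by (rule L2_cauchy_schwarz[OF Lc q])
  also have "\<dots> <= L2_norm M (%x. C / eps n * (indicator (layer i n) x * f x)) * L2_norm M q"
   by (intro mult_right_mono L2_norm_mono[OF Ll m b]) simp
  also have "\<dots> = C * L2_norm M q * (L2_norm M (%x. indicator (layer i n) x * f x) / eps n)"
   unfolding L2_norm_scale using C(1) eps_pos[of n] by (simp add: mult_ac)
  finally show "norm (\<integral>x. cc i n x * (f x * q x) \<partial>M) <= C * L2_norm M q * (L2_norm M (%x. indicator (layer i n) x * f x) / eps n)"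
   by (simp add: mult.assoc)
 qed
qed

lemma vanishes_mult_bounded:
 assumes f: "vanishes i f" and w: "w \<in> borel_measurable M" "\<And>x. x \<in> D ==> \<bar>w x\<bar> <= C"
 shows "vanishes i (%x. w x * f x)"
 unfolding vanishes_def
proof
 have Lf: "L2 M f" using f by (simp add: vanishes_def)
 have lim: "(%n. L2_norm M (%x. indicator (layer i n) x * f x) / eps n) \<longlonglongrightarrow> 0" using f by (simp add: vanishes_def)
 show L: "L2 M (%x. w x * f x)" by (rule L2_mult_bounded[OF Lf w(1), where C=C]) (use w(2) space_M in auto)
 show "(%n. L2_norm M (%x. indicator (layer i n) x * (w x * f x)) / eps n) \<longlonglongrightarrow> 0"
 proof (rule Lim_null_comparison[OF _ tendsto_mult_right_zero[OF lim, of "\<bar>C\<bar>"]], rule always_eventually, rule allI)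
  fix n
  have sub: "layer i n \<subseteq> D" by (auto simp: layer_def)
  have "L2_norm M (%x. indicator (layer i n) x * (w x * f x)) <= L2_norm M (%x. C * (indicator (layer i n) x * f x))"
  proof (rule L2_norm_mono[OF L2_scale[OF nn_integral_M_indicator(2)[OF layer_borel sub Lf]] L2D(1)[OF nn_integral_M_indicator(2)[OF layer_borel sub L]]], rule AE_I2)
   fix x assume "x \<in> space M"
   then have "\<bar>w x\<bar> * \<bar>f x\<bar> <= \<bar>C\<bar> * \<bar>f x\<bar>" using w(2)[of x] space_M by (intro mult_right_mono) auto
   then show "\<bar>indicator (layer i n) x * (w x * f x)\<bar> <= \<bar>C * (indicator (layer i n) x * f x)\<bar>"
    by (auto simp: indicator_def abs_mult)
  qed
  then show "norm (L2_norm M (%x. indicator (layer i n) x * (w x * f x)) / eps n)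
   <= \<bar>C\<bar> * (L2_norm M (%x. indicator (layer i n) x * f x) / eps n)"
   unfolding L2_norm_scale using eps_pos[of n] by (simp add: divide_right_mono)
 qed
qed

lemma vanishes_add:
 assumes f: "vanishes i f" and g: "vanishes i g"
 shows "vanishes i (%x. f x + g x)"
 unfolding vanishes_def
proof
 have Lf: "L2 M f" "L2 M g" using f g by (simp_all add: vanishes_def)
 show L: "L2 M (%x. f x + g x)" by (rule L2_add[OF Lf])
 have lim: "(%n. L2_norm M (%x. indicator (layer i n) x * f x) / eps n + L2_norm M (%x. indicator (layer i n) x * g x) / eps n) \<longlonglongrightarrow> 0"
  using f g by (intro tendsto_add_zero) (simp_all add: vanishes_def)
 show "(%n. L2_norm M (%x. indicator (layer i n) x * (f x + g x)) / eps n) \<longlonglongrightarrow> 0"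
 proof (rule Lim_null_comparison[OF _ lim], rule always_eventually, rule allI)
  fix n
  have sub: "layer i n \<subseteq> D" by (auto simp: layer_def)
  have "L2_norm M (%x. indicator (layer i n) x * (f x + g x))
   <= L2_norm M (%x. indicator (layer i n) x * f x) + L2_norm M (%x. indicator (layer i n) x * g x)"
   unfolding distrib_left
   by (rule L2_norm_triangle[OF nn_integral_M_indicator(2)[OF layer_borel sub Lf(1)] nn_integral_M_indicator(2)[OF layer_borel sub Lf(2)]])
  then show "norm (L2_norm M (%x. indicator (layer i n) x * (f x + g x)) / eps n)
   <= L2_norm M (%x. indicator (layer i n) x * f x) / eps n + L2_norm M (%x. indicator (layer i n) x * g x) / eps n"
   using eps_pos[of n] by (simp add: divide_right_mono flip: add_divide_distrib)
 qed
qed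

text \<open>Dominated convergence: each interior point leaves the strips eventually, so an
  integrable mass in them tends to 0 without any rate.\<close>

lemma shrinking_indicator_L2:
 fixes f :: "real^3 => real"
 assumes f: "L2 M f" and Z: "\<And>n. Z n \<in> sets borel" "\<And>n. Z n \<subseteq> D"
  and out: "\<And>x. x \<in> D ==> eventually (%n. x \<notin> Z n) sequentially"
 shows "(%n. L2_norm M (%x. indicator (Z n) x * f x)) \<longlonglongrightarrow> 0"
proof -
 have "(%n. \<integral>x. (norm (indicator (Z n) x * f x))\<^sup>2 \<partial>M) \<longlonglongrightarrow> (\<integral>x. 0 \<partial>M)"
 proof (rule integral_dominated_convergence[where w="%x. (f x)\<^sup>2"])
  show "integrable M (%x. (f x)\<^sup>2)" using f by (simp add: L2_real_iff)
  show "(%x. (norm (indicator (Z n) x * f x))\<^sup>2) \<in> borel_measurable M" for n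
   using L2D(1)[OF nn_integral_M_indicator(2)[OF Z f]] by measurable
  show "AE x in M. (%n. (norm (indicator (Z n) x * f x))\<^sup>2) \<longlonglongrightarrow> 0"
  proof (rule AE_I2)
   fix x assume "x \<in> space M"
   then have "eventually (%n. x \<notin> Z n) sequentially" using out space_M by blast
   then have "eventually (%n. (norm (indicator (Z n) x * f x))\<^sup>2 = 0) sequentially" by eventually_elim simp
   then show "(%n. (norm (indicator (Z n) x * f x))\<^sup>2) \<longlonglongrightarrow> 0" by (rule tendsto_eventually)
  qed
  show "AE x in M. norm ((norm (indicator (Z n) x * f x))\<^sup>2) <= (f x)\<^sup>2" for n by (auto simp: indicator_def)
 qed simp
 then show ?thesis unfolding L2_norm_def using tendsto_real_sqrt by fastforce
qed

lemma layer_eventually: "x \<in> D ==> eventually (%n. x \<notin> layer i n) sequentially"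
proof -
 assume x: "x \<in> D"
 have "(%n. 2 * eps n) \<longlonglongrightarrow> 2 * 0" by (intro tendsto_intros eps_tendsto)
 then have "eventually (%n. 2 * eps n < d i x) sequentially"
  using x order_tendstoD(2)[of "%n. 2 * eps n" 0 sequentially "d i x"] unfolding Dm_d by simp
 then show ?thesis by eventually_elim (simp add: layer_def)
qed

text \<open>On the layer the factor \<open>d i\<close> is at most 2 eps, which cancels the division
  by eps. No trace of \<open>g\<close> is needed, so correction terms carrying such a factor cost
  nothing.\<close>

lemma vanishes_distance_mult:
 assumes g: "L2 M g" shows "vanishes i (%x. d i x * g x)"
 unfolding vanishes_def
proof
 obtain C where C: "\<And>x. x \<in> D ==> \<bar>d i x\<bar> <= C"
  using continuous_bounded_Dm[OF smooth_on_imp_continuous[OF smooth_on_d[OF open_UNIV]]] by metis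
 show L: "L2 M (%x. d i x * g x)"
  by (rule L2_mult_bounded[OF g borel_measurable_M[OF d_measurable], where C=C]) (use C space_M in auto)
 have sub: "layer i n \<subseteq> D" for n by (auto simp: layer_def)
 have lim: "(%n. L2_norm M (%x. indicator (layer i n) x * g x)) \<longlonglongrightarrow> 0"
  by (rule shrinking_indicator_L2[OF g layer_borel sub layer_eventually])
 show "(%n. L2_norm M (%x. indicator (layer i n) x * (d i x * g x)) / eps n) \<longlonglongrightarrow> 0"
 proof (rule Lim_null_comparison[OF _ tendsto_mult_right_zero[OF lim, of 2]], rule always_eventually, rule allI)
  fix n
  have "L2_norm M (%x. indicator (layer i n) x * (d i x * g x)) <= L2_norm M (%x. (2 * eps n) * (indicator (layer i n) x * g x))"
  proof (rule L2_norm_mono[OF L2_scale[OF nn_integral_M_indicator(2)[OF layer_borel sub g]] L2D(1)[OF nn_integral_M_indicator(2)[OF layer_borel sub L]]], rule AE_I2)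
   fix x assume "x \<in> space M"
   then have "0 < d i x" using space_M Dm_d by blast
   then show "\<bar>indicator (layer i n) x * (d i x * g x)\<bar> <= \<bar>2 * eps n * (indicator (layer i n) x * g x)\<bar>"
    using eps_pos[of n] by (auto simp: indicator_def abs_mult layer_def intro!: mult_right_mono)
  qed
  then show "norm (L2_norm M (%x. indicator (layer i n) x * (d i x * g x)) / eps n) <= 2 * L2_norm M (%x. indicator (layer i n) x * g x)"
   unfolding L2_norm_scale using eps_pos[of n] by (simp add: divide_le_eq mult_ac)
 qed
qed

text \<open>The analogue of smallness on a layer for strips measured in rho or \<phi>. The constant
  \<open>C\<close> is there because \<open>d i\<close> is only comparable with the coordinate
  distance to the boundary.\<close>

definition strip_small :: "(real => (real^3) set) => (real^3 => real) => real => bool" where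
 "strip_small Z f C \<longleftrightarrow> (%n. L2_norm M (%x. indicator (Z (C * eps n)) x * f x) / eps n) \<longlonglongrightarrow> 0"

text \<open>Division by \<open>(eps n)\<^sup>2\<close> leaves a constant times the mass of the fixed
  gradient \<open>hb\<close> in shrinking strips.\<close>

lemma trace_eq_strip_small:
 fixes f g :: "real^3 => real"
 assumes tr: "trace_eq D \<sigma> f g" and t: "tame \<sigma>" and sb: "strip_bound Z \<sigma> \<delta>\<^sub>0" and \<delta>0: "0 < \<delta>\<^sub>0"
  and Z: "\<And>\<delta>. Z \<delta> \<in> sets borel" "\<And>\<delta>. Z \<delta> \<subseteq> D" and C: "C > 0"
  and out: "\<And>x. x \<in> D ==> eventually (%n. x \<notin> Z (C * eps n)) sequentially"
 shows "strip_small Z (%x. f x - g x) C"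
proof -
 obtain hb :: "real^3 => real^3 => real" where hb: "\<And>b. b \<in> Basis ==> L2 M (hb b)"
  "\<And>\<delta>. 0 < \<delta> ==> \<delta> <= \<delta>\<^sub>0 ==> (L2_norm M (%x. indicator (Z \<delta>) x * (f x - g x)))\<^sup>2
   <= 8 * \<delta>\<^sup>2 * (\<Sum>b\<in>Basis. (L2_norm M (%x. indicator (Z \<delta>) x * hb b x))\<^sup>2)"
  using trace_eq_strip[OF tr t sb Z] by blast
 define R where "R n = (\<Sum>b\<in>Basis. (L2_norm M (%x. indicator (Z (C * eps n)) x * hb b x))\<^sup>2)" for n
 have "R \<longlonglongrightarrow> (\<Sum>b\<in>(Basis :: (real^3) set). 0\<^sup>2)"
  unfolding R_def by (intro tendsto_intros shrinking_indicator_L2 hb(1) Z out)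
 then have "(%n. sqrt (8 * C\<^sup>2 * R n)) \<longlonglongrightarrow> sqrt (8 * C\<^sup>2 * 0)" by (intro tendsto_intros) simp
 then have lim: "(%n. sqrt (8 * C\<^sup>2 * R n)) \<longlonglongrightarrow> 0" by simp
 have "(%n. C * eps n) \<longlonglongrightarrow> C * 0" by (intro tendsto_intros eps_tendsto)
 then have ev: "eventually (%n. C * eps n < \<delta>\<^sub>0) sequentially"
  using \<delta>0 order_tendstoD(2)[of "%n. C * eps n" 0 sequentially \<delta>\<^sub>0] by simp
 show ?thesis unfolding strip_small_def
 proof (rule Lim_null_comparison[OF _ lim], use ev in eventually_elim)
  case (elim n)
  have "(L2_norm M (%x. indicator (Z (C * eps n)) x * (f x - g x)))\<^sup>2 <= 8 * (C * eps n)\<^sup>2 * R n"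
   unfolding R_def using C eps_pos[of n] elim by (intro hb(2)) auto
  then have "(L2_norm M (%x. indicator (Z (C * eps n)) x * (f x - g x)) / eps n)\<^sup>2 <= 8 * C\<^sup>2 * R n"
   using eps_pos[of n] by (simp add: power_divide power_mult_distrib divide_le_eq mult_ac)
  then show ?case using real_le_rsqrt eps_pos[of n] by simp
 qed
qed

lemma vanishes_strips:
 assumes f: "L2 M f" and s: "strip_small Z1 f C1" "strip_small Z2 f C2"
  and Z: "\<And>\<delta>. Z1 \<delta> \<in> sets borel" "\<And>\<delta>. Z1 \<delta> \<subseteq> D" "\<And>\<delta>. Z2 \<delta> \<in> sets borel" "\<And>\<delta>. Z2 \<delta> \<subseteq> D"
  and l: "\<And>n. layer i n \<subseteq> Z1 (C1 * eps n) \<union> Z2 (C2 * eps n)"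
 shows "vanishes i f"
 unfolding vanishes_def
proof
 have lim: "(%n. L2_norm M (%x. indicator (Z1 (C1 * eps n)) x * f x) / eps n + L2_norm M (%x. indicator (Z2 (C2 * eps n)) x * f x) / eps n) \<longlonglongrightarrow> 0"
  using s unfolding strip_small_def by (rule tendsto_add_zero)
 show "(%n. L2_norm M (%x. indicator (layer i n) x * f x) / eps n) \<longlonglongrightarrow> 0"
 proof (rule Lim_null_comparison[OF _ lim], rule always_eventually, rule allI)
  fix n
  have sub: "layer i n \<subseteq> D" by (auto simp: layer_def)
  note I = nn_integral_M_indicator(2)[OF Z(1,2) f, of "C1 * eps n"] nn_integral_M_indicator(2)[OF Z(3,4) f, of "C2 * eps n"]
   nn_integral_M_indicator(2)[OF layer_borel sub f]
  have A: "L2 M (%x. indicator (Z1 (C1 * eps n)) x * \<bar>f x\<bar>)" "L2 M (%x. indicator (Z2 (C2 * eps n)) x * \<bar>f x\<bar>)"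
  proof -
   have "L2 M (%x. \<bar>f x\<bar>)" using f by (auto simp: L2_real_iff)
   from nn_integral_M_indicator(2)[OF Z(1,2) this] nn_integral_M_indicator(2)[OF Z(3,4) this]
   show "L2 M (%x. indicator (Z1 (C1 * eps n)) x * \<bar>f x\<bar>)" "L2 M (%x. indicator (Z2 (C2 * eps n)) x * \<bar>f x\<bar>)" .
  qed
  have "L2_norm M (%x. indicator (layer i n) x * f x) <= L2_norm M (%x. indicator (Z1 (C1 * eps n)) x * \<bar>f x\<bar> + indicator (Z2 (C2 * eps n)) x * \<bar>f x\<bar>)"
   by (rule L2_norm_mono[OF L2_add[OF A] L2D(1)[OF I(3)]]) (use l[of n] in \<open>auto simp: indicator_def\<close>)
  also have "\<dots> <= L2_norm M (%x. indicator (Z1 (C1 * eps n)) x * \<bar>f x\<bar>) + L2_norm M (%x. indicator (Z2 (C2 * eps n)) x * \<bar>f x\<bar>)"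
   by (rule L2_norm_triangle[OF A])
  also have "\<dots> = L2_norm M (%x. indicator (Z1 (C1 * eps n)) x * f x) + L2_norm M (%x. indicator (Z2 (C2 * eps n)) x * f x)"
   by (simp add: L2_norm_def power_mult_distrib)
  finally show "norm (L2_norm M (%x. indicator (layer i n) x * f x) / eps n)
   <= L2_norm M (%x. indicator (Z1 (C1 * eps n)) x * f x) / eps n + L2_norm M (%x. indicator (Z2 (C2 * eps n)) x * f x) / eps n"
   using eps_pos[of n] by (simp add: divide_right_mono flip: add_divide_distrib)
 qed
qed (rule f)

lemma strip_eventually:
 assumes "C > 0" "x \<in> D"
 shows "eventually (%n. x \<notin> strip_A1 (C * eps n)) sequentially" "eventually (%n. x \<notin> strip_A2 (C * eps n)) sequentially"
  "eventually (%n. x \<notin> strip_R1 (C * eps n)) sequentially" "eventually (%n. x \<notin> strip_R2 (C * eps n)) sequentially"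
proof -
 have "(%n. C * eps n) \<longlonglongrightarrow> C * 0" by (intro tendsto_intros eps_tendsto)
 then have ev: "eventually (%n. C * eps n < r) sequentially" if "0 < r" for r
  using that order_tendstoD(2)[of "%n. C * eps n" 0 sequentially r] by simp
 have x: "a < rho x" "rho x < 1" "pi/2 - \<alpha> < phi x" "phi x < pi/2 + \<alpha>" using assms(2) by (auto simp: Dm_def a_def)
 show "eventually (%n. x \<notin> strip_A1 (C * eps n)) sequentially"
  using ev[of "rho x - a"] x by (auto simp: strip_A1_def elim: eventually_mono)
 show "eventually (%n. x \<notin> strip_A2 (C * eps n)) sequentially"
  using ev[of "1 - rho x"] x by (auto simp: strip_A2_def elim: eventually_mono)
 show "eventually (%n. x \<notin> strip_R1 (C * eps n)) sequentially"
  using ev[of "phi x - (pi/2 - \<alpha>)"] x by (auto simp: strip_R1_def elim: eventually_mono)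
 show "eventually (%n. x \<notin> strip_R2 (C * eps n)) sequentially"
  using ev[of "pi/2 + \<alpha> - phi x"] x by (auto simp: strip_R2_def elim: eventually_mono)
qed

lemma vanishes_A2:
 fixes f g :: "real^3 => real"
 assumes tr: "trace_eq D (A2 \<alpha> m) f g" and L: "L2 M (%x. f x - g x)" shows "vanishes 1 (%x. f x - g x)"
proof -
 \<comment> \<open>On the layer \<open>1 - norm x\<close> is at most
   \<open>1 - (norm x)\<^sup>2\<close>, hence at most 2 eps; 3 makes the inequality strict.\<close>
 have s: "strip_small strip_A2 (%x. f x - g x) 3"
  by (rule trace_eq_strip_small[OF tr tame_pieces(2) strip_bound_A2 _ strips_borel(2) strips_subset(2)]) (use strip_eventually in auto)
 show ?thesis
 proof (rule vanishes_strips[OF L s s strips_borel(2) strips_subset(2) strips_borel(2) strips_subset(2)])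
  fix n
  show "layer 1 n \<subseteq> strip_A2 (3 * eps n) \<union> strip_A2 (3 * eps n)"
  proof
   fix x assume "x \<in> layer 1 n"
   then have x: "x \<in> D" "1 - (norm x)\<^sup>2 <= 2 * eps n" by (auto simp: layer_def d_def)
   have "(norm x)\<^sup>2 <= norm x" using norm_Dm(2)[OF x(1)] by (simp add: power2_eq_square mult_left_le)
   then have "1 - norm x <= 2 * eps n" using x(2) by linarith
   then show "x \<in> strip_A2 (3 * eps n) \<union> strip_A2 (3 * eps n)" using x eps_pos[of n] by (simp add: strip_A2_def rho_def)
  qed
 qed
qed

lemma vanishes_A1:
 fixes f g :: "real^3 => real"
 assumes tr: "trace_eq D (A1 \<alpha> m) f g" and L: "L2 M (%x. f x - g x)" shows "vanishes 2 (%x. f x - g x)"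
proof -
 \<comment> \<open>The inequality
   \<open>a * (norm x - a) < (norm x)\<^sup>2 - a\<^sup>2 <= 2 * eps n\<close> on the layer gives
   the constant 2/a.\<close>
 have s: "strip_small strip_A1 (%x. f x - g x) (2 / a)"
  by (rule trace_eq_strip_small[OF tr tame_pieces(1) strip_bound_A1 a_pos strips_borel(1) strips_subset(1)])
   (use strip_eventually(1)[of "2 / a"] a_pos in auto)
 show ?thesis
 proof (rule vanishes_strips[OF L s s strips_borel(1) strips_subset(1) strips_borel(1) strips_subset(1)])
  fix n
  show "layer 2 n \<subseteq> strip_A1 (2 / a * eps n) \<union> strip_A1 (2 / a * eps n)"
  proof
   fix x assume "x \<in> layer 2 n"
   then have x: "x \<in> D" "(norm x)\<^sup>2 - a\<^sup>2 <= 2 * eps n" by (auto simp: layer_def d_def)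
   have n: "a < norm x" using norm_Dm(1)[OF x(1)] .
   have "a * (norm x - a) < (norm x + a) * (norm x - a)" using n a_pos by (intro mult_strict_right_mono) auto
   also have "\<dots> = (norm x)\<^sup>2 - a\<^sup>2" by (simp add: power2_eq_square algebra_simps)
   finally have "a * (norm x - a) < 2 * eps n" using x(2) by linarith
   then have "norm x < a + 2 / a * eps n" using a_pos by (simp add: field_simps)
   then show "x \<in> strip_A1 (2 / a * eps n) \<union> strip_A1 (2 / a * eps n)" using x by (simp add: strip_A1_def rho_def)
  qed
 qed
qed

text \<open>The sine is at least 1/2 on this range, so the cosine decreases with at least that
  speed.\<close>

lemma cos_phi_gap:
 assumes "pi/2 - \<alpha> <= p" "p < q" "q <= pi/2 + \<alpha>"
 shows "(q - p) / 2 <= cos p - cos q"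
proof -
 have "\<exists>z. p < z \<and> z < q \<and> cos q - cos p = (q - p) * - sin z"
  by (rule MVT2[OF assms(2)]) (auto intro: DERIV_cos)
 then obtain z where z: "p < z" "z < q" "cos q - cos p = (q - p) * - sin z" by blast
 have "1/2 <= sin z" using sin_lower z assms by simp
 then have "(q - p) * (1/2) <= (q - p) * sin z" using assms(2) by (intro mult_left_mono) auto
 then show ?thesis using z(3) by simp
qed

lemma vanishes_R:
 fixes f g :: "real^3 => real"
 assumes tr: "trace_eq D (R1 \<alpha> m) f g" "trace_eq D (R2 \<alpha> m) f g" and L: "L2 M (%x. f x - g x)"
 shows "vanishes 3 (%x. f x - g x)"
proof -
 \<comment> \<open>On the layer the product of sin \<alpha> - c and sin \<alpha> + c, with c the
   cosine of the polar angle, is at most 2 eps/a^2. The larger factor is at least sin \<alpha>, so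
   the smaller one is at most 2 eps/(a^2 sin \<alpha>). Passing from cosines to angles doubles this,
   and 5 in place of 4 makes it strict.\<close>
 define C where "C = 5 / (a\<^sup>2 * sin \<alpha>)"
 have Cpos: "C > 0" using a_pos sin_\<alpha> by (simp add: C_def)
 have s1: "strip_small strip_R1 (%x. f x - g x) C"
  by (rule trace_eq_strip_small[OF tr(1) tame_pieces(3) strip_bound_R1 \<alpha>_pos strips_borel(3) strips_subset(3) Cpos strip_eventually(3)[OF Cpos]])
 have s2: "strip_small strip_R2 (%x. f x - g x) C"
  by (rule trace_eq_strip_small[OF tr(2) tame_pieces(4) strip_bound_R2 \<alpha>_pos strips_borel(4) strips_subset(4) Cpos strip_eventually(4)[OF Cpos]])
 show ?thesis
 proof (rule vanishes_strips[OF L s1 s2 strips_borel(3) strips_subset(3) strips_borel(4) strips_subset(4)])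
  fix n
  show "layer 3 n \<subseteq> strip_R1 (C * eps n) \<union> strip_R2 (C * eps n)"
  proof
   fix x assume "x \<in> layer 3 n"
   then have x: "x \<in> D" "(sin \<alpha>)\<^sup>2 * (norm x)\<^sup>2 - (x $ 3)\<^sup>2 <= 2 * eps n" by (auto simp: layer_def d_def)
   have n: "a < norm x" "norm x > 0" using norm_Dm(1)[OF x(1)] a_pos by auto
   define c where "c = cos (phi x)"
   have c: "x $ 3 = norm x * c" using cos_phi[OF Dm_nonzero[OF x(1)]] n by (simp add: c_def)
   have p: "pi/2 - \<alpha> < phi x" "phi x < pi/2 + \<alpha>" using x(1) by (auto simp: Dm_def)
   have g1: "(phi x - (pi/2 - \<alpha>)) / 2 <= sin \<alpha> - c"
    using cos_phi_gap[OF _ p(1)] p by (simp add: c_def cos_diff)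
   have g2: "((pi/2 + \<alpha>) - phi x) / 2 <= c + sin \<alpha>"
    using cos_phi_gap[OF _ p(2)] p by (simp add: c_def cos_add)
   have c0: "0 < sin \<alpha> - c" "0 < sin \<alpha> + c" using g1 g2 p by auto
   have "(sin \<alpha> - c) * (sin \<alpha> + c) * (norm x)\<^sup>2 <= 2 * eps n"
    using x(2) unfolding c by (simp add: power2_eq_square algebra_simps)
   moreover have "(sin \<alpha> - c) * (sin \<alpha> + c) * a\<^sup>2 <= (sin \<alpha> - c) * (sin \<alpha> + c) * (norm x)\<^sup>2"
    using c0 n a_pos by (intro mult_left_mono power_mono) auto
   ultimately have pr: "(sin \<alpha> - c) * (sin \<alpha> + c) <= 2 * eps n / a\<^sup>2" using a_pos by (simp add: field_simps)
   have Ce: "C * eps n = 5 * eps n / a\<^sup>2 / sin \<alpha>" by (simp add: C_def)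
   show "x \<in> strip_R1 (C * eps n) \<union> strip_R2 (C * eps n)"
   proof (cases "c \<ge> 0")
    case True
    have "(sin \<alpha> - c) * sin \<alpha> <= (sin \<alpha> - c) * (sin \<alpha> + c)" using c0 True by (intro mult_left_mono) auto
    then have "(sin \<alpha> - c) * sin \<alpha> <= 2 * eps n / a\<^sup>2" using pr by linarith
    then have "sin \<alpha> - c <= 2 * eps n / a\<^sup>2 / sin \<alpha>" by (simp only: pos_le_divide_eq[OF sin_\<alpha>(1)])
    then have "phi x - (pi/2 - \<alpha>) <= 4 * eps n / a\<^sup>2 / sin \<alpha>" using g1 by simp
    also have "\<dots> < C * eps n" unfolding Ce using eps_pos[of n] a_pos sin_\<alpha> by (intro divide_strict_right_mono) auto
    finally show ?thesis using x(1) by (simp add: strip_R1_def)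
   next
    case False
    have "sin \<alpha> * (sin \<alpha> + c) <= (sin \<alpha> - c) * (sin \<alpha> + c)" using c0 False by (intro mult_right_mono) auto
    then have "(sin \<alpha> + c) * sin \<alpha> <= 2 * eps n / a\<^sup>2" using pr by (simp only: mult.commute[of "sin \<alpha> + c"])
    then have "sin \<alpha> + c <= 2 * eps n / a\<^sup>2 / sin \<alpha>" by (simp only: pos_le_divide_eq[OF sin_\<alpha>(1)])
    then have "(pi/2 + \<alpha>) - phi x <= 4 * eps n / a\<^sup>2 / sin \<alpha>" using g2 by simp
    also have "\<dots> < C * eps n" unfolding Ce using eps_pos[of n] a_pos sin_\<alpha> by (intro divide_strict_right_mono) auto
    finally show ?thesis using x(1) by (simp add: strip_R2_def)
   qed
  qed
 qed
qed

end


context conical_shell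
begin

section \<open>Testing with gradients\<close>

text \<open>The product rule expression for the derivative of \<open>\<zeta> * f\<close> in
  direction \<open>b\<close>.\<close>

definition DZ :: "(real^3 => real) => (real^3 => real) => (real^3 => real^3 => real) => real^3 => real^3 => real" where
 "DZ \<zeta> f fb b x = FD \<zeta> x b * f x + \<zeta> x * fb b x"

text \<open>The two integration by parts formulas hold for every \<open>H\<^sup>1\<close> function \<open>f\<close>; they are immediate
 for limits of smooth functions, which is all we need as traces come with such approximations.\<close>

definition adm :: "(real^3 => real) => (real^3 => real^3 => real) => bool" where
 "adm f fb \<longleftrightarrow> (\<forall>b\<in>Basis. has_weak_deriv D b f (fb b)) \<and>
  (\<forall>\<zeta>. test_function D \<zeta> --> L2 M (%x. \<zeta> x * f x) \<and> (\<forall>b\<in>Basis. L2 M (DZ \<zeta> f fb b) \<and>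
   (\<forall>Q q. H1 Q q --> (\<integral>x. (\<zeta> x * f x) * q b x \<partial>M) = - (\<integral>x. DZ \<zeta> f fb b x * Q x \<partial>M) \<and>
    (\<forall>c\<in>Basis. (\<integral>x. DZ \<zeta> f fb b x * q c x \<partial>M) = (\<integral>x. DZ \<zeta> f fb c x * q b x \<partial>M)))))"

lemma admD:
 assumes "adm f fb"
 shows "b \<in> Basis ==> has_weak_deriv D b f (fb b)"
  and "test_function D \<zeta> ==> L2 M (%x. \<zeta> x * f x)"
  and "test_function D \<zeta> ==> b \<in> Basis ==> L2 M (DZ \<zeta> f fb b)"
  and "test_function D \<zeta> ==> b \<in> Basis ==> H1 Q q ==>
   (\<integral>x. (\<zeta> x * f x) * q b x \<partial>M) = - (\<integral>x. DZ \<zeta> f fb b x * Q x \<partial>M)"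
  and "test_function D \<zeta> ==> b \<in> Basis ==> c \<in> Basis ==> H1 Q q ==>
   (\<integral>x. DZ \<zeta> f fb b x * q c x \<partial>M) = (\<integral>x. DZ \<zeta> f fb c x * q b x \<partial>M)"
 using assms unfolding adm_def by (blast+)

lemma test_measurable_M: "test_function D \<zeta> ==> \<zeta> \<in> borel_measurable M"
 by (intro borel_measurable_M borel_measurable_continuous_onI test_functionD(2))

lemma L2_test_mult:
 assumes "test_function D \<zeta>" "L2 M f" shows "L2 M (%x. \<zeta> x * f x)"
proof -
 obtain C where "\<And>x. \<bar>\<zeta> x\<bar> <= C" using test_function_bounded[OF assms(1)] by metis
 then show ?thesis using L2_mult_bounded[OF assms(2) test_measurable_M[OF assms(1)], of C] by simp
qed

text \<open>For a smooth approximant the product with \<zeta> is a test function. The first formula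
  is then the definition of the weak derivative of \<open>Q\<close>, and the second is the symmetry
  of the second derivatives of that test function. In the limit only square integrable products
  remain, so \<open>Q\<close> needs one weak derivative.\<close>

lemma adm_of_trace:
 assumes tr: "has_trace D \<sigma> f g" and t: "tame \<sigma>"
 shows "\<exists>fb. H1 f fb \<and> adm f fb"
proof -
 obtain u fb where u: "\<And>k. smooth (u k)" and H: "H1 f fb" and l0: "(%k. L2_norm M (%x. u k x - f x)) \<longlonglongrightarrow> 0"
  and l1: "\<And>b. b \<in> Basis ==> (%k. L2_norm M (%x. FD (u k) x b - fb b x)) \<longlonglongrightarrow> 0"
  using has_trace_approx[OF tr t] by blast
 have su: "smooth_on S (u k)" for k S using u smooth_on_subset unfolding smooth_iff_smooth_on by blast
 have Lu: "L2 M (u k)" for k using H1D(1)[OF H1_smooth[OF u]] .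
 have Lub: "L2 M (%x. FD (u k) x b)" if "b \<in> Basis" for k b using H1D(3)[OF H1_smooth[OF u] that] .
 have Lf: "L2 M f" "\<And>b. b \<in> Basis ==> L2 M (fb b)" using H1D[OF H] by blast+
 have "L2 M (%x. \<zeta> x * f x) \<and> (\<forall>b\<in>Basis. L2 M (DZ \<zeta> f fb b) \<and>
   (\<forall>Q q. H1 Q q --> (\<integral>x. (\<zeta> x * f x) * q b x \<partial>M) = - (\<integral>x. DZ \<zeta> f fb b x * Q x \<partial>M) \<and>
    (\<forall>c\<in>Basis. (\<integral>x. DZ \<zeta> f fb b x * q c x \<partial>M) = (\<integral>x. DZ \<zeta> f fb c x * q b x \<partial>M))))"
  if z: "test_function D \<zeta>" for \<zeta>
 proof -
  obtain C where C: "\<And>x. \<bar>\<zeta> x\<bar> <= C" using test_function_bounded[OF z] by metis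
  have zb: "test_function D (%x. FD \<zeta> x b)" if "b \<in> Basis" for b using test_function_deriv[OF z that] .
  have DLf: "L2 M (DZ \<zeta> f fb b)" if "b \<in> Basis" for b
   unfolding DZ_def[abs_def] by (intro L2_add L2_test_mult zb z that Lf)
  have DLu: "L2 M (DZ \<zeta> (u k) (%b x. FD (u k) x b) b)" if "b \<in> Basis" for b k
   unfolding DZ_def[abs_def] by (intro L2_add L2_test_mult zb z that Lu Lub)
  have lz: "(%k. L2_norm M (%x. \<zeta> x * u k x - \<zeta> x * f x)) \<longlonglongrightarrow> 0"
   by (rule L2_norm_mult_bounded_lim[OF Lu Lf(1) l0 test_measurable_M[OF z], where C=C]) (use C in auto)
  have lD: "(%k. L2_norm M (%x. DZ \<zeta> (u k) (%b x. FD (u k) x b) b x - DZ \<zeta> f fb b x)) \<longlonglongrightarrow> 0"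
   if b: "b \<in> Basis" for b
  proof -
   obtain E where E: "\<And>x. \<bar>FD \<zeta> x b\<bar> <= E" using test_function_bounded[OF zb[OF b]] by metis
   have 1: "(%k. L2_norm M (%x. FD \<zeta> x b * u k x - FD \<zeta> x b * f x)) \<longlonglongrightarrow> 0"
    by (rule L2_norm_mult_bounded_lim[OF Lu Lf(1) l0 test_measurable_M[OF zb[OF b]], where C=E]) (use E in auto)
   have 2: "(%k. L2_norm M (%x. \<zeta> x * FD (u k) x b - \<zeta> x * fb b x)) \<longlonglongrightarrow> 0"
    by (rule L2_norm_mult_bounded_lim[OF Lub[OF b] Lf(2)[OF b] l1[OF b] test_measurable_M[OF z], where C=C]) (use C in auto)
   show ?thesis
   proof (rule Lim_null_comparison[OF _ tendsto_add_zero[OF 1 2]], rule always_eventually, rule allI)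
    fix k
    have e: "DZ \<zeta> (u k) (%b x. FD (u k) x b) b x - DZ \<zeta> f fb b x
     = (FD \<zeta> x b * u k x - FD \<zeta> x b * f x)
      + (\<zeta> x * FD (u k) x b - \<zeta> x * fb b x)" for x
     by (simp add: DZ_def)
    show "norm (L2_norm M (%x. DZ \<zeta> (u k) (%b x. FD (u k) x b) b x - DZ \<zeta> f fb b x))
     <= L2_norm M (%x. FD \<zeta> x b * u k x - FD \<zeta> x b * f x)
      + L2_norm M (%x. \<zeta> x * FD (u k) x b - \<zeta> x * fb b x)"
     unfolding e using L2_norm_triangle[OF L2_diff[OF L2_test_mult[OF zb[OF b] Lu[of k]] L2_test_mult[OF zb[OF b] Lf(1)]]
       L2_diff[OF L2_test_mult[OF z Lub[OF b, of k]] L2_test_mult[OF z Lf(2)[OF b]]]] by simp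
   qed
  qed
  have tk: "test_function D (%x. u k x * \<zeta> x)" for k by (rule test_function_mult[OF open_Dm z su])
  have dk: "FD (%x. u k x * \<zeta> x) x b = DZ \<zeta> (u k) (%b x. FD (u k) x b) b x" for k b x
   using frechet_derivative_mult[of "u k" x \<zeta> b] smooth_on_differentiable[OF su[of UNIV]] test_functionD(3)[OF z]
   by (simp add: DZ_def mult.commute)
  show ?thesis
  proof (intro conjI ballI allI impI)
   show "L2 M (%x. \<zeta> x * f x)" by (rule L2_test_mult[OF z Lf(1)])
   fix b :: "real^3" assume b: "b \<in> Basis"
   show "L2 M (DZ \<zeta> f fb b)" by (rule DLf[OF b])
   fix Q q assume Q: "H1 Q q"
   have ibp: "(\<integral>x. \<psi> x * q c x \<partial>M) = - (\<integral>x. FD \<psi> x c * Q x \<partial>M)"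
    if "test_function D \<psi>" "c \<in> Basis" for \<psi> c
    using H1D(2)[OF Q that(2)] that(1) unfolding has_weak_deriv_def by simp
   have A: "(%k. \<integral>x. (\<zeta> x * u k x) * q b x \<partial>M) \<longlonglongrightarrow> (\<integral>x. (\<zeta> x * f x) * q b x \<partial>M)"
    by (rule L2_integral_lim[OF L2_test_mult[OF z Lu] L2_test_mult[OF z Lf(1)] lz H1D(3)[OF Q b]])
   have B: "(%k. \<integral>x. DZ \<zeta> (u k) (%b x. FD (u k) x b) c x * w x \<partial>M) \<longlonglongrightarrow> (\<integral>x. DZ \<zeta> f fb c x * w x \<partial>M)"
    if "c \<in> Basis" "L2 M w" for c w
    by (rule L2_integral_lim[OF DLu[OF that(1)] DLf[OF that(1)] lD[OF that(1)] that(2)])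
   have "(\<integral>x. (\<zeta> x * u k x) * q b x \<partial>M) = - (\<integral>x. DZ \<zeta> (u k) (%b x. FD (u k) x b) b x * Q x \<partial>M)" for k
    using ibp[OF tk b] unfolding dk by (simp add: mult.commute)
   with A have "(%k. - (\<integral>x. DZ \<zeta> (u k) (%b x. FD (u k) x b) b x * Q x \<partial>M)) \<longlonglongrightarrow> (\<integral>x. (\<zeta> x * f x) * q b x \<partial>M)"
    by simp
   from LIMSEQ_unique[OF this tendsto_minus[OF B[OF b H1D(1)[OF Q]]]]
   show "(\<integral>x. (\<zeta> x * f x) * q b x \<partial>M) = - (\<integral>x. DZ \<zeta> f fb b x * Q x \<partial>M)" .
   fix c :: "real^3" assume c: "c \<in> Basis"
   have "(\<integral>x. DZ \<zeta> (u k) (%b x. FD (u k) x b) b x * q c x \<partial>M)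
    = (\<integral>x. DZ \<zeta> (u k) (%b x. FD (u k) x b) c x * q b x \<partial>M)" for k
   proof -
    have "FD (%y. FD (%x. u k x * \<zeta> x) y b) x c
     = FD (%y. FD (%x. u k x * \<zeta> x) y c) x b" for x
     by (rule frechet_derivative_commute[OF test_functionD(1)[OF tk] b c])
    then show ?thesis
     using ibp[OF test_function_deriv[OF tk b] c, of k] ibp[OF test_function_deriv[OF tk c] b, of k] unfolding dk by simp
   qed
   with B[OF b H1D(3)[OF Q c]] have "(%k. \<integral>x. DZ \<zeta> (u k) (%b x. FD (u k) x b) c x * q b x \<partial>M) \<longlonglongrightarrow> (\<integral>x. DZ \<zeta> f fb b x * q c x \<partial>M)"
    by simp
   from LIMSEQ_unique[OF this B[OF c H1D(3)[OF Q b]]]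
   show "(\<integral>x. DZ \<zeta> f fb b x * q c x \<partial>M) = (\<integral>x. DZ \<zeta> f fb c x * q b x \<partial>M)" .
  qed
 qed
 then have "adm f fb" unfolding adm_def using H1D(2)[OF H] by blast
 then show ?thesis using H by blast
qed

text \<open>The two formulas see \<open>f\<close> only through its products with test functions.
  Whenever each product of \<open>g\<close> with a test function is one of \<open>f\<close> with
  another, they carry over.\<close>

lemma adm_transfer:
 assumes f: "adm f fb" and w: "\<And>b. b \<in> Basis ==> has_weak_deriv D b g (gb b)"
  and e: "\<And>\<zeta>. test_function D \<zeta> ==> \<exists>\<zeta>'. test_function D \<zeta>' \<and> (\<forall>x\<in>D. \<zeta> x * g x = \<zeta>' x * f x) \<and>
   (\<forall>b\<in>Basis. AE x in M. DZ \<zeta> g gb b x = DZ \<zeta>' f fb b x)"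
 shows "adm g gb"
 unfolding adm_def
proof (intro conjI ballI allI impI w)
 fix \<zeta> assume z: "test_function D \<zeta>"
 then obtain \<zeta>' where z': "test_function D \<zeta>'" and e1: "\<And>x. x \<in> D ==> \<zeta> x * g x = \<zeta>' x * f x"
  and e2: "\<And>b. b \<in> Basis ==> AE x in M. DZ \<zeta> g gb b x = DZ \<zeta>' f fb b x" using e[OF z] by blast
 have m: "(%x. \<zeta> x * g x) \<in> borel_measurable M" "\<And>b. b \<in> Basis ==> DZ \<zeta> g gb b \<in> borel_measurable M"
 proof -
  have gm: "g \<in> borel_measurable M"
   using w[OF ax_Basis] locally_integrable_borel[OF open_Dm] by (auto simp: has_weak_deriv_def)
  have gbm: "gb b \<in> borel_measurable M" if "b \<in> Basis" for b
   using w[OF that] locally_integrable_borel[OF open_Dm] by (auto simp: has_weak_deriv_def)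
  show "(%x. \<zeta> x * g x) \<in> borel_measurable M" using gm test_measurable_M[OF z] by measurable
  show "DZ \<zeta> g gb b \<in> borel_measurable M" if "b \<in> Basis" for b
   unfolding DZ_def[abs_def] using gm gbm[OF that] test_measurable_M[OF z] test_measurable_M[OF test_function_deriv[OF z that]] by measurable
 qed
 have ae1: "AE x in M. \<zeta>' x * f x = \<zeta> x * g x" by (rule AE_I2) (use e1 space_M in auto)
 show "L2 M (%x. \<zeta> x * g x)" by (rule L2_cong_AE[OF admD(2)[OF f z'] ae1 m(1)])
 fix b :: "real^3" assume b: "b \<in> Basis"
 have ae2: "AE x in M. DZ \<zeta>' f fb b x = DZ \<zeta> g gb b x" if "b \<in> Basis" for b using e2[OF that] by (rule AE_mp) auto
 note Lf = admD(3)[OF f z']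
 show Lg: "L2 M (DZ \<zeta> g gb b)" by (rule L2_cong_AE[OF Lf[OF b] ae2[OF b] m(2)[OF b]])
 have cong: "(\<integral>x. DZ \<zeta> g gb c x * w x \<partial>M) = (\<integral>x. DZ \<zeta>' f fb c x * w x \<partial>M)" if "c \<in> Basis" "L2 M w" for c w
  by (rule integral_cong_AE) (use m(2)[OF that(1)] Lf[OF that(1)] that(2) e2[OF that(1)] in \<open>auto simp: L2_def\<close>)
 fix Q q assume Q: "H1 Q q"
 have "(\<integral>x. (\<zeta> x * g x) * q b x \<partial>M) = (\<integral>x. (\<zeta>' x * f x) * q b x \<partial>M)"
  by (rule Bochner_Integration.integral_cong) (use e1 space_M in auto)
 then show "(\<integral>x. (\<zeta> x * g x) * q b x \<partial>M) = - (\<integral>x. DZ \<zeta> g gb b x * Q x \<partial>M)"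
  using admD(4)[OF f z' b Q] cong[OF b H1D(1)[OF Q]] by simp
 fix c :: "real^3" assume c: "c \<in> Basis"
 show "(\<integral>x. DZ \<zeta> g gb b x * q c x \<partial>M) = (\<integral>x. DZ \<zeta> g gb c x * q b x \<partial>M)"
  using admD(5)[OF f z' b c Q] cong[OF b H1D(3)[OF Q c]] cong[OF c H1D(3)[OF Q b]] by simp
qed

text \<open>The smooth factor is absorbed into the test function, so nothing is asked of it near the
  boundary.\<close>

lemma adm_mult:
 assumes f: "adm f fb" and w: "smooth_on D w"
 shows "adm (%x. w x * f x) (%b x. FD w x b * f x + w x * fb b x)"
proof (rule adm_transfer[OF f])
 show "has_weak_deriv D b (%x. w x * f x) (%x. FD w x b * f x + w x * fb b x)" if "b \<in> Basis" for b
  by (rule has_weak_deriv_mult_smooth[OF open_Dm that admD(1)[OF f that] w])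
 fix \<zeta> assume z: "test_function D \<zeta>"
 have "DZ \<zeta> (%x. w x * f x) (%b x. FD w x b * f x + w x * fb b x) b x = DZ (%x. w x * \<zeta> x) f fb b x"
  if "x \<in> D" for b x
  using frechet_derivative_mult[OF smooth_on_differentiable[OF w that] test_functionD(3)[OF z], of b]
  by (simp add: DZ_def algebra_simps)
 then show "\<exists>\<zeta>'. test_function D \<zeta>' \<and> (\<forall>x\<in>D. \<zeta> x * (w x * f x) = \<zeta>' x * f x) \<and>
   (\<forall>b\<in>Basis. AE x in M. DZ \<zeta> (%x. w x * f x) (%b x. FD w x b * f x + w x * fb b x) b x = DZ \<zeta>' f fb b x)"
  by (intro exI[of _ "%x. w x * \<zeta> x"] conjI test_function_mult[OF open_Dm z w]) (auto simp: space_M)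
qed

text \<open>Weak gradients of one function agree almost everywhere, so a representation of
  \<open>g\<close> by other admissible functions proves admissibility with the gradient that
  \<open>g\<close> already carries.\<close>

lemma adm_cong_deriv:
 assumes f: "adm f fb" and e: "\<And>x. x \<in> D ==> f x = g x" and w: "\<And>b. b \<in> Basis ==> has_weak_deriv D b g (gb b)"
 shows "adm g gb" and "b \<in> Basis ==> AE x in M. fb b x = gb b x"
proof -
 have ae: "AE x in M. fb b x = gb b x" if "b \<in> Basis" for b
 proof -
  have "has_weak_deriv D b g (fb b)" by (rule has_weak_deriv_cong[OF open_Dm that admD(1)[OF f that] e]) auto
  from has_weak_deriv_unique[OF open_Dm this w[OF that]] show ?thesis .
 qed
 then show "b \<in> Basis ==> AE x in M. fb b x = gb b x" .
 show "adm g gb"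
 proof (rule adm_transfer[OF f w])
  fix \<zeta> assume z: "test_function D \<zeta>"
  show "\<exists>\<zeta>'. test_function D \<zeta>' \<and> (\<forall>x\<in>D. \<zeta> x * g x = \<zeta>' x * f x) \<and> (\<forall>b\<in>Basis. AE x in M. DZ \<zeta> g gb b x = DZ \<zeta>' f fb b x)"
  proof (intro exI[of _ \<zeta>] conjI ballI z)
   fix b :: "real^3" assume "b \<in> Basis"
   from ae[OF this] AE_space show "AE x in M. DZ \<zeta> g gb b x = DZ \<zeta> f fb b x"
    by eventually_elim (simp add: DZ_def e space_M)
  qed (simp add: e)
 qed
qed

lemma adm_add:
 assumes f: "adm f fb" and g: "adm g gb"
 shows "adm (%x. f x + g x) (%b x. fb b x + gb b x)"
 unfolding adm_def
proof (intro conjI ballI allI impI)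
 show "has_weak_deriv D b (%x. f x + g x) (%x. fb b x + gb b x)" if "b \<in> Basis" for b
  by (rule has_weak_deriv_add[OF open_Dm that admD(1)[OF f that] admD(1)[OF g that]])
 fix \<zeta> assume z: "test_function D \<zeta>"
 have e: "DZ \<zeta> (%x. f x + g x) (%b x. fb b x + gb b x) b = (%x. DZ \<zeta> f fb b x + DZ \<zeta> g gb b x)" for b
  by (simp add: fun_eq_iff DZ_def algebra_simps)
 note Lf = admD(2)[OF f z] admD(3)[OF f z] and Lg = admD(2)[OF g z] admD(3)[OF g z]
 show "L2 M (%x. \<zeta> x * (f x + g x))" unfolding distrib_left by (rule L2_add[OF Lf(1) Lg(1)])
 fix b :: "real^3" assume b: "b \<in> Basis"
 show "L2 M (DZ \<zeta> (%x. f x + g x) (%b x. fb b x + gb b x) b)" unfolding e by (rule L2_add[OF Lf(2)[OF b] Lg(2)[OF b]])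
 fix Q q assume Q: "H1 Q q"
 show "(\<integral>x. (\<zeta> x * (f x + g x)) * q b x \<partial>M) = - (\<integral>x. DZ \<zeta> (%x. f x + g x) (%b x. fb b x + gb b x) b x * Q x \<partial>M)"
  unfolding e distrib_left distrib_right
  using admD(4)[OF f z b Q] admD(4)[OF g z b Q] L2_integrable_mult[OF Lf(1) H1D(3)[OF Q b]] L2_integrable_mult[OF Lg(1) H1D(3)[OF Q b]]
   L2_integrable_mult[OF Lf(2)[OF b] H1D(1)[OF Q]] L2_integrable_mult[OF Lg(2)[OF b] H1D(1)[OF Q]] by simp
 fix c :: "real^3" assume c: "c \<in> Basis"
 show "(\<integral>x. DZ \<zeta> (%x. f x + g x) (%b x. fb b x + gb b x) b x * q c x \<partial>M)
   = (\<integral>x. DZ \<zeta> (%x. f x + g x) (%b x. fb b x + gb b x) c x * q b x \<partial>M)"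
  unfolding e distrib_right
  using admD(5)[OF f z b c Q] admD(5)[OF g z b c Q] L2_integrable_mult[OF Lf(2)[OF b] H1D(3)[OF Q c]] L2_integrable_mult[OF Lg(2)[OF b] H1D(3)[OF Q c]]
   L2_integrable_mult[OF Lf(2)[OF c] H1D(3)[OF Q b]] L2_integrable_mult[OF Lg(2)[OF c] H1D(3)[OF Q b]] by simp
qed

lemma integral_\<eta>_lim:
 assumes "integrable M (K :: real^3 => real)" shows "(%n. \<integral>x. \<eta> n x * K x \<partial>M) \<longlonglongrightarrow> (\<integral>x. K x \<partial>M)"
proof (rule integral_dominated_convergence[where w="%x. \<bar>K x\<bar>"])
 show "K \<in> borel_measurable M" using assms by simp
 then show "(%x. \<eta> n x * K x) \<in> borel_measurable M" for n using test_measurable_M[OF \<eta>_test[of n]] by measurable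
 show "integrable M (%x. \<bar>K x\<bar>)" using assms by (rule integrable_abs)
 show "AE x in M. (%n. \<eta> n x * K x) \<longlonglongrightarrow> K x"
 proof (rule AE_I2)
  fix x assume "x \<in> space M"
  then have "(%n. \<eta> n x) \<longlonglongrightarrow> 1" using \<eta>_tendsto space_M by blast
  from tendsto_mult_right[OF this, of "K x"] show "(%n. \<eta> n x * K x) \<longlonglongrightarrow> K x" by simp
 qed
 show "AE x in M. norm (\<eta> n x * K x) <= \<bar>K x\<bar>" for n
  using \<eta>_01 by (auto simp: abs_mult intro!: mult_left_le_one_le)
qed

text \<open>Inserting the cutoff \<eta> and integrating by parts, the divergence drops out and the
  remaining terms are \<open>cc j\<close> times the component of \<open>V\<close> along the gradient
  of \<open>d j\<close>, times \<open>Q\<close>. The assumption on these components makes the terms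
  tend to 0, which replaces the normal boundary condition.\<close>

lemma orthogonal_gradient:
 assumes V: "\<And>i. adm (V i) (Vd i)" "\<And>i. L2 M (V i)"
  and div: "AE x in M. (\<Sum>i\<in>UNIV. Vd i (ax i) x) = 0"
  and van: "\<And>j. vanishes j (%x. \<Sum>i\<in>UNIV. d' j x (ax i) * V i x)" and Q: "H1 Q q"
 shows "(\<integral>x. (\<Sum>i\<in>(UNIV::3 set). V i x * q (ax i) x) \<partial>M) = 0"
proof -
 let ?F = "%j x. \<Sum>i\<in>UNIV. d' j x (ax i) * V i x"
 have Vq: "integrable M (%x. V i x * q (ax i) x)" for i by (rule L2_integrable_mult[OF V(2) H1D(3)[OF Q ax_Basis]])
 have DQ: "integrable M (%x. DZ (\<eta> n) (V i) (Vd i) (ax i) x * Q x)" for i n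
  by (rule L2_integrable_mult[OF admD(3)[OF V(1) \<eta>_test ax_Basis] H1D(1)[OF Q]])
 have eV: "integrable M (%x. (\<eta> n x * V i x) * q (ax i) x)" for i n
  by (rule L2_integrable_mult[OF admD(2)[OF V(1) \<eta>_test] H1D(3)[OF Q ax_Basis]])
 have cF: "integrable M (%x. cc j n x * (?F j x * Q x))" for j n
 proof -
  obtain C where C: "C > 0" "\<And>i n x. x \<in> D ==> \<bar>cc i n x\<bar> <= C / eps n * indicator (layer i n) x" using cc_bound by metis
  have "L2 M (%x. cc j n x * ?F j x)"
  proof (rule L2_mult_bounded[OF _ cc_measurable, where C="C / eps n"])
   show "L2 M (?F j)" using van by (simp add: vanishes_def)
   show "AE x in M. \<bar>cc j n x\<bar> <= C / eps n"
    using C eps_pos[of n] space_M by (auto intro!: AE_I2 order_trans[OF C(2)] simp: indicator_def)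
  qed
  from L2_integrable_mult[OF this H1D(1)[OF Q]] show ?thesis by (simp only: mult.assoc)
 qed
 have "(\<integral>x. \<eta> n x * (\<Sum>i\<in>UNIV. V i x * q (ax i) x) \<partial>M) = - (\<Sum>j\<in>UNIV. \<integral>x. cc j n x * (?F j x * Q x) \<partial>M)" for n
 proof -
  have "(\<integral>x. \<eta> n x * (\<Sum>i\<in>UNIV. V i x * q (ax i) x) \<partial>M) = (\<integral>x. (\<Sum>i\<in>UNIV. (\<eta> n x * V i x) * q (ax i) x) \<partial>M)"
   by (simp add: sum_distrib_left mult.assoc)
  also have "\<dots> = (\<Sum>i\<in>UNIV. \<integral>x. (\<eta> n x * V i x) * q (ax i) x \<partial>M)" by (rule Bochner_Integration.integral_sum) (rule eV)
  also have "\<dots> = (\<Sum>i\<in>UNIV. - (\<integral>x. DZ (\<eta> n) (V i) (Vd i) (ax i) x * Q x \<partial>M))"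
   by (intro sum.cong refl admD(4)[OF V(1) \<eta>_test ax_Basis Q])
  also have "\<dots> = - (\<integral>x. (\<Sum>i\<in>UNIV. DZ (\<eta> n) (V i) (Vd i) (ax i) x * Q x) \<partial>M)"
   using DQ by (subst Bochner_Integration.integral_sum) (auto simp: sum_negf)
  also have "(\<integral>x. (\<Sum>i\<in>UNIV. DZ (\<eta> n) (V i) (Vd i) (ax i) x * Q x) \<partial>M) = (\<integral>x. (\<Sum>j\<in>UNIV. cc j n x * (?F j x * Q x)) \<partial>M)"
  proof (rule integral_cong_AE)
   show "(%x. \<Sum>i\<in>UNIV. DZ (\<eta> n) (V i) (Vd i) (ax i) x * Q x) \<in> borel_measurable M"
    using borel_measurable_integrable[OF DQ] by (intro borel_measurable_sum)
   show "(%x. \<Sum>j\<in>UNIV. cc j n x * (?F j x * Q x)) \<in> borel_measurable M"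
    using borel_measurable_integrable[OF cF] by (intro borel_measurable_sum)
   show "AE x in M. (\<Sum>i\<in>UNIV. DZ (\<eta> n) (V i) (Vd i) (ax i) x * Q x) = (\<Sum>j\<in>UNIV. cc j n x * (?F j x * Q x))"
    using div
   proof eventually_elim
    case (elim x)
    have "(\<Sum>i\<in>UNIV. DZ (\<eta> n) (V i) (Vd i) (ax i) x * Q x)
     = (\<Sum>i\<in>UNIV. FD (\<eta> n) x (ax i) * V i x) * Q x + \<eta> n x * (\<Sum>i\<in>UNIV. Vd i (ax i) x) * Q x"
     by (simp add: DZ_def sum_3 algebra_simps)
    then show ?case unfolding elim \<eta>_derivative by (simp add: sum_3 algebra_simps)
   qed
  qed
  also have "\<dots> = (\<Sum>j\<in>UNIV. \<integral>x. cc j n x * (?F j x * Q x) \<partial>M)" by (rule Bochner_Integration.integral_sum) (rule cF)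
  finally show ?thesis .
 qed
 moreover have "(%n. - (\<Sum>j\<in>UNIV. \<integral>x. cc j n x * (?F j x * Q x) \<partial>M)) \<longlonglongrightarrow> - (\<Sum>j\<in>(UNIV::3 set). 0)"
  by (intro tendsto_minus tendsto_sum vanishes_cutoff_limit van H1D(1)[OF Q])
 ultimately have "(%n. \<integral>x. \<eta> n x * (\<Sum>i\<in>UNIV. V i x * q (ax i) x) \<partial>M) \<longlonglongrightarrow> 0" by simp
 moreover have "(%n. \<integral>x. \<eta> n x * (\<Sum>i\<in>UNIV. V i x * q (ax i) x) \<partial>M) \<longlonglongrightarrow> (\<integral>x. (\<Sum>i\<in>UNIV. V i x * q (ax i) x) \<partial>M)"
  by (rule integral_\<eta>_lim) (intro Bochner_Integration.integrable_sum Vq)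
 ultimately show ?thesis using LIMSEQ_unique by blast
qed

lemma L2_continuous_mult:
 assumes "continuous_on UNIV w" "L2 M f" shows "L2 M (%x. (w x :: real) * f x)"
proof -
 obtain C where C: "\<And>x. x \<in> D ==> \<bar>w x\<bar> <= C" using continuous_bounded_Dm[OF assms(1)] by metis
 show ?thesis
  by (rule L2_mult_bounded[OF assms(2) borel_measurable_M[OF borel_measurable_continuous_onI[OF assms(1)]], where C=C]) (use C space_M in auto)
qed

text \<open>The integrand is the curl of (-x2 g, x1 g, 0), that is of s g e_theta, paired with a
  gradient. Each pair of mixed derivatives cancels by the second formula of \<open>adm\<close> once
  the potential is cut off; the terms with a derivative on the cutoff tend to 0 because
  \<open>g\<close> vanishes on the boundary.\<close>

lemma orthogonal_curl:
 assumes g: "adm g gb" "L2 M g" "\<And>i. L2 M (gb (ax i))" and van: "\<And>j. vanishes j g" and P: "H1 P p"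
 shows "(\<integral>x. - (x $ 1 * gb (ax 3) x * p (ax 1) x) - x $ 2 * gb (ax 3) x * p (ax 2) x
   + (2 * g x + x $ 1 * gb (ax 1) x + x $ 2 * gb (ax 2) x) * p (ax 3) x \<partial>M) = 0" (is "integral\<^sup>L M ?K = 0")
proof -
 note Lp = H1D(3)[OF P ax_Basis]
 \<comment> \<open>The cross product of the gradient of \<open>d j\<close> with the potential
   direction, paired with the gradient: the factor left over when a derivative falls on the
   cutoff.\<close>
 define R where "R j x = - (x $ 2 * d' j x (ax 3)) * p (ax 2) x + (x $ 2 * d' j x (ax 2)) * p (ax 3) x
   + (x $ 1 * d' j x (ax 1)) * p (ax 3) x + - (x $ 1 * d' j x (ax 3)) * p (ax 1) x" for j x
 have cd': "continuous_on UNIV (%x. d' j x (ax i))" for i j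
  by (cases "j = 1"; cases "j = 2"; simp add: d'_def; intro continuous_intros)
 have LR: "L2 M (R j)" for j
  unfolding R_def[abs_def] by (intro L2_add L2_continuous_mult Lp continuous_intros cd')
 have Ki: "integrable M ?K"
 proof -
  have c: "L2 M (%x. x $ i * f x)" if "L2 M f" for i f by (rule L2_continuous_mult[OF _ that]) (intro continuous_intros)
  show ?thesis
   by (intro Bochner_Integration.integrable_add Bochner_Integration.integrable_diff integrable_minus L2_integrable_mult L2_add L2_scale c g Lp)
 qed
 have cR: "integrable M (%x. cc j n x * (g x * R j x))" for j n
 proof -
  obtain C where C: "C > 0" "\<And>i n x. x \<in> D ==> \<bar>cc i n x\<bar> <= C / eps n * indicator (layer i n) x" using cc_bound by metis
  have "L2 M (%x. cc j n x * g x)"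
   by (rule L2_mult_bounded[OF g(2) cc_measurable, where C="C / eps n"])
    (use C eps_pos[of n] space_M in \<open>auto intro!: AE_I2 order_trans[OF C(2)] simp: indicator_def\<close>)
  from L2_integrable_mult[OF this LR] show ?thesis by (simp only: mult.assoc)
 qed
 have "(\<integral>x. \<eta> n x * ?K x \<partial>M) = - (\<Sum>j\<in>UNIV. \<integral>x. cc j n x * (g x * R j x) \<partial>M)" for n
 proof -
  \<comment> \<open>The two nonzero components of the potential with the cutoff and without
    \<open>g\<close>. Being test functions, they can take the role of \<zeta> in
    \<open>adm\<close>.\<close>
  define z1 z2 where "z1 x = - (x $ 2) * \<eta> n x" and "z2 x = x $ 1 * \<eta> n x" for x :: "real^3"
  have s: "smooth_on S (%x::real^3. - (x $ 2))" "smooth_on S (%x::real^3. x $ 1)" if "open S" for S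
   by (intro smooth_on_uminus smooth_on_vec_nth that)+
  have t1: "test_function D z1" and t2: "test_function D z2"
   unfolding z1_def[abs_def] z2_def[abs_def] using test_function_mult[OF open_Dm \<eta>_test] s[OF open_Dm] by blast+
  have fm: "FD (%x::real^3. - (x $ 2)) x h = - (h $ 2)" for x h
  proof -
   have "((%x::real^3. - (x $ 2)) has_derivative (%h. - (h $ 2))) (at x)"
    by (intro has_derivative_minus bounded_linear_imp_has_derivative[OF bounded_linear_vec_nth])
   from frechet_derivative_at[OF this, symmetric] show ?thesis by simp
  qed
  have D1: "DZ z1 g gb (ax b) x = (- (ax b $ 2) * \<eta> n x - x $ 2 * FD (\<eta> n) x (ax b)) * g x - x $ 2 * \<eta> n x * gb (ax b) x" for b x
  proof -
   have "FD z1 x (ax b) = - (x $ 2) * FD (\<eta> n) x (ax b) + - (ax b $ 2) * \<eta> n x"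
    using frechet_derivative_mult[OF smooth_on_differentiable[OF s(1)[OF open_UNIV]] test_functionD(3)[OF \<eta>_test], of x n "ax b"]
    unfolding z1_def[abs_def] fm by blast
   moreover have "z1 x = - (x $ 2) * \<eta> n x" by (simp add: z1_def)
   ultimately show ?thesis unfolding DZ_def by algebra
  qed
  have D2: "DZ z2 g gb (ax b) x = ((ax b $ 1) * \<eta> n x + x $ 1 * FD (\<eta> n) x (ax b)) * g x + x $ 1 * \<eta> n x * gb (ax b) x" for b x
  proof -
   have "FD z2 x (ax b) = x $ 1 * FD (\<eta> n) x (ax b) + (ax b $ 1) * \<eta> n x"
    using frechet_derivative_mult[OF smooth_on_differentiable[OF s(2)[OF open_UNIV]] test_functionD(3)[OF \<eta>_test], of x n "ax b"]
    unfolding z2_def[abs_def] frechet_derivative_vec_nth by blast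
   moreover have "z2 x = x $ 1 * \<eta> n x" by (simp add: z2_def)
   ultimately show ?thesis unfolding DZ_def by algebra
  qed
  note I1 = L2_integrable_mult[OF admD(3)[OF g(1) t1 ax_Basis] Lp] and I2 = L2_integrable_mult[OF admD(3)[OF g(1) t2 ax_Basis] Lp]
  have "0 = (\<integral>x. DZ z1 g gb (ax 3) x * p (ax 2) x \<partial>M) - (\<integral>x. DZ z1 g gb (ax 2) x * p (ax 3) x \<partial>M)
   + ((\<integral>x. DZ z2 g gb (ax 1) x * p (ax 3) x \<partial>M) - (\<integral>x. DZ z2 g gb (ax 3) x * p (ax 1) x \<partial>M))"
   using admD(5)[OF g(1) t1 ax_Basis ax_Basis P, of 3 2] admD(5)[OF g(1) t2 ax_Basis ax_Basis P, of 1 3] by simp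
  also have "\<dots> = (\<integral>x. (DZ z1 g gb (ax 3) x * p (ax 2) x - DZ z1 g gb (ax 2) x * p (ax 3) x)
    + (DZ z2 g gb (ax 1) x * p (ax 3) x - DZ z2 g gb (ax 3) x * p (ax 1) x) \<partial>M)"
   using I1[of 3 2] I1[of 2 3] I2[of 1 3] I2[of 3 1] by simp
  also have "\<dots> = (\<integral>x. \<eta> n x * ?K x + (\<Sum>j\<in>UNIV. cc j n x * (g x * R j x)) \<partial>M)"
  proof (rule Bochner_Integration.integral_cong[OF refl])
   fix x
   show "(DZ z1 g gb (ax 3) x * p (ax 2) x - DZ z1 g gb (ax 2) x * p (ax 3) x)
    + (DZ z2 g gb (ax 1) x * p (ax 3) x - DZ z2 g gb (ax 3) x * p (ax 1) x)
    = \<eta> n x * ?K x + (\<Sum>j\<in>UNIV. cc j n x * (g x * R j x))"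
    unfolding D1 D2 \<eta>_derivative R_def sum_3 ax_nth by (simp add: algebra_simps)
  qed
  also have "\<dots> = (\<integral>x. \<eta> n x * ?K x \<partial>M) + (\<Sum>j\<in>UNIV. \<integral>x. cc j n x * (g x * R j x) \<partial>M)"
  proof -
   have "integrable M (%x. \<eta> n x * ?K x)"
    by (rule Bochner_Integration.integrable_bound[OF Ki])
     (use test_measurable_M[OF \<eta>_test[of n]] borel_measurable_integrable[OF Ki] \<eta>_01 in \<open>auto simp: abs_mult intro!: mult_left_le_one_le\<close>)
   then show ?thesis using cR
    by (subst Bochner_Integration.integral_add) (auto intro!: Bochner_Integration.integrable_sum Bochner_Integration.integral_sum)
  qed
  finally show ?thesis by linarith
 qed
 moreover have "(%n. - (\<Sum>j\<in>UNIV. \<integral>x. cc j n x * (g x * R j x) \<partial>M)) \<longlonglongrightarrow> - (\<Sum>j\<in>(UNIV::3 set). 0)"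
  by (intro tendsto_minus tendsto_sum vanishes_cutoff_limit van LR)
 ultimately have "(%n. \<integral>x. \<eta> n x * ?K x \<partial>M) \<longlonglongrightarrow> 0" by simp
 then show ?thesis using LIMSEQ_unique integral_\<eta>_lim[OF Ki] by blast
qed

end


section \<open>Pointwise identities\<close>

text \<open>A single point is frozen so that identities between derivatives become polynomial
  identities between real numbers; \<open>r\<close> and \<open>s\<close> are known through their
  squares. In what follows \<open>Vij\<close> is the j-th derivative of the i-th component and
  \<open>Vijk\<close> its k-th derivative; \<open>cr\<close>, \<open>cp\<close>, \<open>ct\<close>
  are the spherical components.\<close>

locale coords =
 fixes x1 x2 x3 r s :: real
 assumes rp: "0 < r" and sp: "0 < s" and r2: "r\<^sup>2 = s\<^sup>2 + x3\<^sup>2" and s2: "s\<^sup>2 = x1\<^sup>2 + x2\<^sup>2"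
begin

text \<open>For a function with Cartesian gradient (f1,f2,f3), \<open>R\<close> is its derivative in
  rho and \<open>T\<close> its derivative in the polar angle.\<close>

definition R :: "real => real => real => real" where "R f1 f2 f3 = (x1 * f1 + x2 * f2 + x3 * f3) / r"
definition T :: "real => real => real => real" where "T f1 f2 f3 = x3 * (x1 * f1 + x2 * f2) / s - s * f3"

lemma rR: "r * R f1 f2 f3 = x1 * f1 + x2 * f2 + x3 * f3" and sT: "s * T f1 f2 f3 = x3 * (x1 * f1 + x2 * f2) - s\<^sup>2 * f3"
 using rp sp by (simp_all add: R_def T_def field_simps power2_eq_square)

text \<open>The assumptions say that the horizontal radial part x1 V1 + x2 V2 and the swirl x1 V2 -
  x2 V1 have no rotational derivative. In the two expressions of the conclusion they form a linear
  system of determinant \<open>s\<^sup>2\<close>.\<close>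

lemma theta_relations:
 assumes A: "x1 * (V2 + x1 * V12 + x2 * V22) = x2 * (V1 + x1 * V11 + x2 * V21)"
  and B: "x1 * (x1 * V22 - V1 - x2 * V12) = x2 * (V2 + x1 * V21 - x2 * V11)"
 shows "x1 * V12 - x2 * V11 + V2 = 0" "x1 * V22 - x2 * V21 - V1 = 0"
proof -
 let ?X = "x1 * V12 - x2 * V11 + V2" and ?Y = "x1 * V22 - x2 * V21 - V1"
 have "s\<^sup>2 * ?X = 0" "s\<^sup>2 * ?Y = 0" using A B unfolding s2 by algebra+
 then show "?X = 0" "?Y = 0" using sp by auto
qed

text \<open>The left side is \<open>s\<close> times the definition of \<open>omega_theta\<close>,
  the right side the Cartesian curl paired with s e_theta. The assumptions E1 and E2 are the
  derivatives of the products \<open>r * cr\<close> and \<open>r * s * cp\<close>, so the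
  derivatives of the components enter linearly.\<close>

lemma vorticity:
 assumes cr: "r * cr = x1 * V1 + x2 * V2 + x3 * V3" and cp: "r * s * cp = x3 * (x1 * V1 + x2 * V2) - s\<^sup>2 * V3"
  and E1: "x1 / r * cr + r * cr1 = V1 + x1 * V11 + x2 * V21 + x3 * V31"
   "x2 / r * cr + r * cr2 = V2 + x1 * V12 + x2 * V22 + x3 * V32"
   "x3 / r * cr + r * cr3 = x1 * V13 + x2 * V23 + V3 + x3 * V33"
  and E2: "(x1 / r * s + r * (x1 / s)) * cp + r * s * cp1 = x3 * (V1 + x1 * V11 + x2 * V21) - 2 * x1 * V3 - s\<^sup>2 * V31"
   "(x2 / r * s + r * (x2 / s)) * cp + r * s * cp2 = x3 * (V2 + x1 * V12 + x2 * V22) - 2 * x2 * V3 - s\<^sup>2 * V32"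
   "(x3 / r * s) * cp + r * s * cp3 = (x1 * V1 + x2 * V2) + x3 * (x1 * V13 + x2 * V23) - s\<^sup>2 * V33"
 shows "s * (1 / r * R (x1 / r * cp + r * cp1) (x2 / r * cp + r * cp2) (x3 / r * cp + r * cp3) - 1 / r * T cr1 cr2 cr3)
  = x1 * V13 + x2 * V23 - x1 * V31 - x2 * V32"
proof -
 have r0: "r ~= 0" "s ~= 0" using rp sp by auto
 \<comment> \<open>The reciprocals become variables with \<open>i * r = 1\<close> and
   \<open>j * s = 1\<close>, which turns the goal into a polynomial identity.\<close>
 define i where "i = 1 / r"
 define j where "j = 1 / s"
 have ij: "i * r = 1" "j * s = 1" using r0 by (simp_all add: i_def j_def)
 have "s * (i * ((x1 * (x1 * i * cp + r * cp1) + x2 * (x2 * i * cp + r * cp2) + x3 * (x3 * i * cp + r * cp3)) * i)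
   - i * (x3 * (x1 * cr1 + x2 * cr2) * j - s * cr3)) = x1 * V13 + x2 * V23 - x1 * V31 - x2 * V32"
 proof -
  have e1: "x1 * cr + r\<^sup>2 * cr1 = r * (V1 + x1 * V11 + x2 * V21 + x3 * V31)"
   "x2 * cr + r\<^sup>2 * cr2 = r * (V2 + x1 * V12 + x2 * V22 + x3 * V32)"
   "x3 * cr + r\<^sup>2 * cr3 = r * (x1 * V13 + x2 * V23 + V3 + x3 * V33)"
   using E1 r0 by (simp_all add: field_simps power2_eq_square)
  have RR: "2 * (s * r * cp) + r * s * (x1 * cp1 + x2 * cp2 + x3 * cp3)
   = x1 * (x3 * (V1 + x1 * V11 + x2 * V21) - 2 * x1 * V3 - s\<^sup>2 * V31)
   + x2 * (x3 * (V2 + x1 * V12 + x2 * V22) - 2 * x2 * V3 - s\<^sup>2 * V32)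
   + x3 * ((x1 * V1 + x2 * V2) + x3 * (x1 * V13 + x2 * V23) - s\<^sup>2 * V33)"
  proof -
   have "x1 * (x1 / r * s + r * (x1 / s)) + x2 * (x2 / r * s + r * (x2 / s)) + x3 * (x3 / r * s)
    = (x1\<^sup>2 + x2\<^sup>2 + x3\<^sup>2) / r * s + r * ((x1\<^sup>2 + x2\<^sup>2) / s)"
    by (simp add: power2_eq_square add_divide_distrib algebra_simps)
   also have "\<dots> = r\<^sup>2 / r * s + r * (s\<^sup>2 / s)" unfolding r2 s2 ..
   also have "\<dots> = 2 * (s * r)" using r0 by (simp add: power2_eq_square)
   finally have k: "x1 * (x1 / r * s + r * (x1 / s)) + x2 * (x2 / r * s + r * (x2 / s)) + x3 * (x3 / r * s) = 2 * (s * r)" .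
   have "(x1 * (x1 / r * s + r * (x1 / s)) + x2 * (x2 / r * s + r * (x2 / s)) + x3 * (x3 / r * s)) * cp
     + r * s * (x1 * cp1 + x2 * cp2 + x3 * cp3)
    = x1 * ((x1 / r * s + r * (x1 / s)) * cp + r * s * cp1) + x2 * ((x2 / r * s + r * (x2 / s)) * cp + r * s * cp2)
     + x3 * ((x3 / r * s) * cp + r * s * cp3)" by (simp only: distrib_left distrib_right mult_ac add_ac)
   then show ?thesis unfolding k E2 by (simp add: mult_ac)
  qed
  have TT: "r * (x3 * (x1 * cr1 + x2 * cr2) - s\<^sup>2 * cr3)
   = x3 * (x1 * (V1 + x1 * V11 + x2 * V21 + x3 * V31) + x2 * (V2 + x1 * V12 + x2 * V22 + x3 * V32))
    - s\<^sup>2 * (x1 * V13 + x2 * V23 + V3 + x3 * V33)"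
  proof -
   have "r * (r * (x3 * (x1 * cr1 + x2 * cr2) - s\<^sup>2 * cr3))
   = r * (x3 * (x1 * (V1 + x1 * V11 + x2 * V21 + x3 * V31) + x2 * (V2 + x1 * V12 + x2 * V22 + x3 * V32))
    - s\<^sup>2 * (x1 * V13 + x2 * V23 + V3 + x3 * V33))"
    using e1 s2 by algebra
   then show ?thesis using r0 by simp
  qed
  have l: "r\<^sup>2 * (s * (r * cp + r * (x1 * cp1 + x2 * cp2 + x3 * cp3)) - r * (x3 * (x1 * cr1 + x2 * cr2) - s\<^sup>2 * cr3))
   = r\<^sup>2 * (r\<^sup>2 * (x1 * V13 + x2 * V23 - x1 * V31 - x2 * V32))"
   using RR TT cp r2 s2 by algebra
  have "s * (r * cp + r * (x1 * cp1 + x2 * cp2 + x3 * cp3)) - r * (x3 * (x1 * cr1 + x2 * cr2) - s\<^sup>2 * cr3)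
   = r\<^sup>2 * (x1 * V13 + x2 * V23 - x1 * V31 - x2 * V32)"
   by (rule mult_left_cancel[THEN iffD1, OF _ l]) (use r0 in simp)
  then show ?thesis using ij r2 s2 by algebra
 qed
 then show ?thesis by (simp add: R_def T_def i_def j_def)
qed

text \<open>With W = x1 V13 + x2 V23 - x1 V31 - x2 V32, that is s times the azimuthal vorticity, the
  right sides are the derivatives d_3 W and x1 d_1 W + x2 d_2 W. X, Y and Z are derivatives of the
  rotation relations, dv of the divergence, and sy is the symmetry of second derivatives.\<close>

lemma laplacian_curl:
 assumes X: "x1 * V121 + V12 - x2 * V111 + V21 = 0" "x1 * V122 - V11 - x2 * V112 + V22 = 0" "x1 * V123 - x2 * V113 + V23 = 0"
  and Y: "V22 + x1 * V221 - x2 * V211 - V11 = 0" "x1 * V222 - V21 - x2 * V212 - V12 = 0" "x1 * V223 - x2 * V213 - V13 = 0"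
  and Z: "V32 + x1 * V321 - x2 * V311 = 0" "x1 * V322 - V31 - x2 * V312 = 0"
  and dv: "V111 + V221 + V331 = 0" "V112 + V222 + V332 = 0" "V113 + V223 + V333 = 0"
  and sy: "V121 = V112" "V131 = V113" "V132 = V123" "V221 = V212" "V231 = V213" "V232 = V223" "V321 = V312" "V331 = V313" "V332 = V323"
 shows "x1 * (V111 + V122 + V133) + x2 * (V211 + V222 + V233) = x1 * V133 + x2 * V233 - x1 * V313 - x2 * V323"
  and "- (s\<^sup>2 * (V311 + V322 + V333)) = x1 * (V13 - V31 + x1 * V131 + x2 * V231 - x1 * V311 - x2 * V321)
   + x2 * (V23 - V32 + x1 * V132 + x2 * V232 - x1 * V312 - x2 * V322)"
 using X Y Z dv sy s2 by algebra+

text \<open>The horizontal part of the gradient is parallel to (x1,x2), so only x1 l1 + x2 l2 and l3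
  matter. \<open>u\<close> is the vorticity and \<open>W1\<close>, \<open>W2\<close>,
  \<open>W3\<close> are the derivatives of \<open>s * u\<close>.\<close>

lemma laplacian_dot_gradient:
 assumes L: "x1 * l1 + x2 * l2 = W3" "- (s\<^sup>2 * l3) = x1 * W1 + x2 * W2"
  and W: "W1 = x1 / s * u + s * u1" "W2 = x2 / s * u + s * u2" "W3 = s * u3" and p: "x1 * p2 = x2 * p1"
 shows "l1 * p1 + l2 * p2 + l3 * p3 = - (- (x1 * p1 + x2 * p2) * u3 + (u + x1 * u1 + x2 * u2) * p3) / s"
proof -
 have "x1 * W1 + x2 * W2 = (x1\<^sup>2 + x2\<^sup>2) / s * u + s * (x1 * u1 + x2 * u2)"
  unfolding W by (simp add: power2_eq_square add_divide_distrib algebra_simps)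
 also have "(x1\<^sup>2 + x2\<^sup>2) / s = s" using sp unfolding s2[symmetric] by (simp add: power2_eq_square)
 also have "s * u + s * (x1 * u1 + x2 * u2) = s * (u + x1 * u1 + x2 * u2)" by (simp add: algebra_simps)
 finally have w: "- (s\<^sup>2 * l3) = s * (u + x1 * u1 + x2 * u2)" using L(2) by simp
 have "s * (s * (l1 * p1 + l2 * p2 + l3 * p3)) = s * (- (- (x1 * p1 + x2 * p2) * u3 + (u + x1 * u1 + x2 * u2) * p3))"
  using w L(1) W(3) p s2 by algebra
 then have "s * (l1 * p1 + l2 * p2 + l3 * p3) = - (- (x1 * p1 + x2 * p2) * u3 + (u + x1 * u1 + x2 * u2) * p3)" using sp by simp
 then show ?thesis using sp by (simp add: field_simps)
qed

text \<open>The integrand of \<open>orthogonal_curl\<close> for g = u / s; the derivative of 1/s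
  removes one of the two copies of \<open>g\<close>.\<close>

lemma curl_integrand_quotient:
 assumes g: "g = u / s" "g1 = u1 / s - x1 / s ^ 3 * u" "g2 = u2 / s - x2 / s ^ 3 * u" "g3 = u3 / s"
 shows "- (x1 * g3 * p1) - x2 * g3 * p2 + (2 * g + x1 * g1 + x2 * g2) * p3
  = (- (x1 * p1 + x2 * p2) * u3 + (u + x1 * u1 + x2 * u2) * p3) / s"
proof -
 have "x1 * (x1 / s ^ 3 * u) + x2 * (x2 / s ^ 3 * u) = (x1\<^sup>2 + x2\<^sup>2) / s ^ 3 * u"
  by (simp add: power2_eq_square add_divide_distrib algebra_simps)
 also have "\<dots> = u / s" using sp unfolding s2[symmetric] by (simp add: power3_eq_cube power2_eq_square)
 finally have "2 * g + x1 * g1 + x2 * g2 = (u + x1 * u1 + x2 * u2) / s"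
  unfolding g by (simp add: algebra_simps add_divide_distrib)
 moreover define U where "U = u + x1 * u1 + x2 * u2"
 ultimately have e: "2 * g + x1 * g1 + x2 * g2 = U / s" by simp
 show ?thesis unfolding e g(4) U_def[symmetric] using sp by (simp add: field_simps)
qed

text \<open>The components of (p1,p2,p3) along e_rho and e_phi: \<open>R\<close> and
  \<open>T / r\<close> in expanded form, as they come out of \<open>d_rho\<close> and
  \<open>d_phi\<close>.\<close>

definition prr :: "real => real => real => real" where "prr p1 p2 p3 = p1 * (x1 / r) + p2 * (x2 / r) + p3 * (x3 / r)"
definition pff :: "real => real => real => real" where "pff p1 p2 p3 = p1 * (x1 * x3 / (r * s)) + p2 * (x2 * x3 / (r * s)) - p3 * (s / r)"

text \<open>By the assumption the vector has no e_theta component, so its e_rho and e_phi components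
  determine it and carry its whole length.\<close>

lemma frame:
 assumes p: "x1 * p2 = x2 * p1"
 shows "x1 * p1 + x2 * p2 = s / r * (s * prr p1 p2 p3 + x3 * pff p1 p2 p3)" "p3 = (x3 * prr p1 p2 p3 - s * pff p1 p2 p3) / r"
  "p1\<^sup>2 + p2\<^sup>2 + p3\<^sup>2 = (prr p1 p2 p3)\<^sup>2 + (pff p1 p2 p3)\<^sup>2"
proof -
 have a: "r * prr p1 p2 p3 = x1 * p1 + x2 * p2 + x3 * p3" and b: "r * s * pff p1 p2 p3 = x3 * (x1 * p1 + x2 * p2) - s\<^sup>2 * p3"
  using rp sp by (simp_all add: prr_def pff_def field_simps power2_eq_square)
 have "r * (r * (x1 * p1 + x2 * p2)) = r * (s * (s * prr p1 p2 p3 + x3 * pff p1 p2 p3))"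
  using a b r2 by algebra
 then have 1: "r * (x1 * p1 + x2 * p2) = s * (s * prr p1 p2 p3 + x3 * pff p1 p2 p3)" using rp by simp
 then show "x1 * p1 + x2 * p2 = s / r * (s * prr p1 p2 p3 + x3 * pff p1 p2 p3)" using rp by (simp add: field_simps)
 have "r * (s * (r * p3)) = r * (s * (x3 * prr p1 p2 p3 - s * pff p1 p2 p3))" using a b r2 by algebra
 then have 2: "r * p3 = x3 * prr p1 p2 p3 - s * pff p1 p2 p3" using rp sp by simp
 then show "p3 = (x3 * prr p1 p2 p3 - s * pff p1 p2 p3) / r" using rp by (simp add: field_simps)
 have "r\<^sup>2 * s\<^sup>2 * (p1\<^sup>2 + p2\<^sup>2 + p3\<^sup>2) = r\<^sup>2 * s\<^sup>2 * ((prr p1 p2 p3)\<^sup>2 + (pff p1 p2 p3)\<^sup>2)"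
 proof -
  have "s\<^sup>2 * (p1\<^sup>2 + p2\<^sup>2) = (x1 * p1 + x2 * p2)\<^sup>2" using p s2 by algebra
  then show ?thesis using 1 2 r2 by algebra
 qed
 then show "p1\<^sup>2 + p2\<^sup>2 + p3\<^sup>2 = (prr p1 p2 p3)\<^sup>2 + (pff p1 p2 p3)\<^sup>2" using rp sp by simp
qed

text \<open>The curl of h c e_theta in spherical coordinates paired with a gradient, for a radial
  factor \<open>h\<close> whose radial derivative is \<kappa>: the e_rho component is d_phi(sin
  \<phi> h c) / (rho sin \<phi>), the e_phi component is -d_rho(rho h c) / rho.\<close>

lemma curl_integrand_spherical:
 assumes p: "x1 * p2 = x2 * p1"
  and u: "u = h * c" "u1 = \<kappa> * (x1 / r) * c + h * c1" "u2 = \<kappa> * (x2 / r) * c + h * c2" "u3 = \<kappa> * (x3 / r) * c + h * c3"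
 shows "(- (x1 * p1 + x2 * p2) * u3 + (u + x1 * u1 + x2 * u2) * p3) / s
  = prr p1 p2 p3 * (h * (T c1 c2 c3 / r) + h * (x3 / (s * r)) * c) - pff p1 p2 p3 * (h * R c1 c2 c3 + (\<kappa> + h / r) * c)"
proof -
 let ?a = "prr p1 p2 p3" and ?b = "pff p1 p2 p3"
 define i where "i = 1 / r"
 define j where "j = 1 / s"
 have ij: "i * r = 1" "j * s = 1" using rp sp by (simp_all add: i_def j_def)
 have f: "x1 * p1 + x2 * p2 = s * i * (s * ?a + x3 * ?b)" "p3 = (x3 * ?a - s * ?b) * i"
  using frame[OF p, of p3] by (simp_all add: i_def)
 have u': "u1 = \<kappa> * (x1 * i) * c + h * c1" "u2 = \<kappa> * (x2 * i) * c + h * c2" "u3 = \<kappa> * (x3 * i) * c + h * c3"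
  using u by (simp_all add: i_def)
 have "(- (x1 * p1 + x2 * p2) * u3 + (u + x1 * u1 + x2 * u2) * p3) * j
  = ?a * (h * ((x3 * (x1 * c1 + x2 * c2) * j - s * c3) * i) + h * (x3 * (j * i)) * c)
   - ?b * (h * ((x1 * c1 + x2 * c2 + x3 * c3) * i) + (\<kappa> + h * i) * c)"
  using f u(1) u' ij r2 s2 by algebra
 then show ?thesis by (simp add: i_def j_def R_def T_def)
qed

text \<open>The e_rho and e_phi components of the convection: transport of \<open>cr\<close> and
  \<open>cp\<close>, with the centrifugal terms that come from the turning frame. The e_theta
  component is not computed, since the gradient it would be paired with has none.\<close>

lemma convection_spherical:
 assumes cr: "r * cr = x1 * V1 + x2 * V2 + x3 * V3" and cp: "r * s * cp = x3 * (x1 * V1 + x2 * V2) - s\<^sup>2 * V3"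
  and ct: "s * ct = x1 * V2 - x2 * V1"
  and E1: "x1 / r * cr + r * cr1 = V1 + x1 * V11 + x2 * V21 + x3 * V31"
   "x2 / r * cr + r * cr2 = V2 + x1 * V12 + x2 * V22 + x3 * V32"
   "x3 / r * cr + r * cr3 = x1 * V13 + x2 * V23 + V3 + x3 * V33"
  and E2: "(x1 / r * s + r * (x1 / s)) * cp + r * s * cp1 = x3 * (V1 + x1 * V11 + x2 * V21) - 2 * x1 * V3 - s\<^sup>2 * V31"
   "(x2 / r * s + r * (x2 / s)) * cp + r * s * cp2 = x3 * (V2 + x1 * V12 + x2 * V22) - 2 * x2 * V3 - s\<^sup>2 * V32"
   "(x3 / r * s) * cp + r * s * cp3 = (x1 * V1 + x2 * V2) + x3 * (x1 * V13 + x2 * V23) - s\<^sup>2 * V33"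
  and tr: "x1 * cr2 = x2 * cr1" and tp: "x1 * cp2 = x2 * cp1" and p: "x1 * p2 = x2 * p1"
 shows "(V1 * V11 + V2 * V12 + V3 * V13) * p1 + (V1 * V21 + V2 * V22 + V3 * V23) * p2 + (V1 * V31 + V2 * V32 + V3 * V33) * p3
  = prr p1 p2 p3 * ((cr * R cr1 cr2 cr3 + 1 / r * cp * T cr1 cr2 cr3) - 1 / r * (cp\<^sup>2 + ct\<^sup>2))
   + pff p1 p2 p3 * ((cr * (R cp1 cp2 cp3 + 1 / r * cp) + 1 / r * cp * T cp1 cp2 cp3) - x3 / s * (1 / r * ct\<^sup>2))"
proof -
 let ?a = "prr p1 p2 p3" and ?b = "pff p1 p2 p3"
 define i where "i = 1 / r"
 define j where "j = 1 / s"
 have ij: "i * r = 1" "j * s = 1" using rp sp by (simp_all add: i_def j_def)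
 define C1 C2 C3 where "C1 = V1 * V11 + V2 * V12 + V3 * V13" and "C2 = V1 * V21 + V2 * V22 + V3 * V23" and "C3 = V1 * V31 + V2 * V32 + V3 * V33"
 define Gr where "Gr = V1 * cr1 + V2 * cr2 + V3 * cr3"
 define Gp where "Gp = V1 * cp1 + V2 * cp2 + V3 * cp3"
 have nV: "V1\<^sup>2 + V2\<^sup>2 + V3\<^sup>2 = cr\<^sup>2 + cp\<^sup>2 + ct\<^sup>2" and nH: "s\<^sup>2 * (V1\<^sup>2 + V2\<^sup>2) = (x1 * V1 + x2 * V2)\<^sup>2 + s\<^sup>2 * ct\<^sup>2"
 proof -
  show h: "s\<^sup>2 * (V1\<^sup>2 + V2\<^sup>2) = (x1 * V1 + x2 * V2)\<^sup>2 + s\<^sup>2 * ct\<^sup>2" using ct s2 by algebra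
  have "r\<^sup>2 * s\<^sup>2 * (V1\<^sup>2 + V2\<^sup>2 + V3\<^sup>2) = r\<^sup>2 * s\<^sup>2 * (cr\<^sup>2 + cp\<^sup>2 + ct\<^sup>2)" using h cr cp r2 by algebra
  then show "V1\<^sup>2 + V2\<^sup>2 + V3\<^sup>2 = cr\<^sup>2 + cp\<^sup>2 + ct\<^sup>2" using rp sp by simp
 qed
 \<comment> \<open>For a rotation invariant function the swirl contributes nothing to the derivative
   along the velocity.\<close>
 have grad: "r * (V1 * f1 + V2 * f2 + V3 * f3) = r * cr * R f1 f2 f3 + cp * T f1 f2 f3" if f: "x1 * f2 = x2 * f1" for f1 f2 f3
 proof -
  have "s * (s * (r * (r * (V1 * f1 + V2 * f2 + V3 * f3)))) = s * (s * (r * (r * cr * R f1 f2 f3 + cp * T f1 f2 f3)))"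
  proof -
   have "s\<^sup>2 * (V1 * f1 + V2 * f2) = (x1 * V1 + x2 * V2) * (x1 * f1 + x2 * f2)" using f s2 by algebra
   then show ?thesis using rR[of f1 f2 f3] sT[of f1 f2 f3] cr cp r2 by algebra
  qed
  then show ?thesis using rp sp by simp
 qed
 have e1: "x1 * (i * cr) + r * cr1 = V1 + x1 * V11 + x2 * V21 + x3 * V31"
   "x2 * (i * cr) + r * cr2 = V2 + x1 * V12 + x2 * V22 + x3 * V32"
   "x3 * (i * cr) + r * cr3 = x1 * V13 + x2 * V23 + V3 + x3 * V33"
  using E1 by (simp_all add: i_def)
 \<comment> \<open>Differentiating x . V along V produces x paired with the convection plus the
   squared length of V; here x . V is \<open>r * cr\<close>.\<close>
 have rho: "x1 * C1 + x2 * C2 + x3 * C3 = cr\<^sup>2 + r * Gr - (cr\<^sup>2 + cp\<^sup>2 + ct\<^sup>2)"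
  unfolding C1_def C2_def C3_def Gr_def using e1 cr ij(1) nV by algebra
 have e2: "(x1 * (i * s) + r * (x1 * j)) * cp + r * s * cp1 = x3 * (V1 + x1 * V11 + x2 * V21) - 2 * x1 * V3 - s\<^sup>2 * V31"
   "(x2 * (i * s) + r * (x2 * j)) * cp + r * s * cp2 = x3 * (V2 + x1 * V12 + x2 * V22) - 2 * x2 * V3 - s\<^sup>2 * V32"
   "(x3 * (i * s)) * cp + r * s * cp3 = (x1 * V1 + x2 * V2) + x3 * (x1 * V13 + x2 * V23) - s\<^sup>2 * V33"
  using E2 by (simp_all add: i_def j_def)
 \<comment> \<open>The same for \<open>r * s * cp\<close>: the derivative along V of its expression
   in Cartesian components, with the terms hitting the coefficients moved to the right.\<close>
 have phi0: "x3 * (x1 * C1 + x2 * C2) - s\<^sup>2 * C3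
  = (i * s * (r * cr) + r * j * (x1 * V1 + x2 * V2)) * cp + r * s * Gp + (x1 * V1 + x2 * V2) * V3 - x3 * (V1\<^sup>2 + V2\<^sup>2)"
  unfolding C1_def C2_def C3_def Gp_def using e2 cr by algebra
 have Ah: "r * (x1 * V1 + x2 * V2) = s * (s * cr + x3 * cp)" "r * V3 = x3 * cr - s * cp"
 proof -
  have "r * (r * (x1 * V1 + x2 * V2)) = r * (s * (s * cr + x3 * cp))" using cr cp r2 by algebra
  then show "r * (x1 * V1 + x2 * V2) = s * (s * cr + x3 * cp)" using rp by simp
  have "r * (s * (r * V3)) = r * (s * (x3 * cr - s * cp))" using cr cp r2 by algebra
  then show "r * V3 = x3 * cr - s * cp" using rp sp by simp
 qed
 have phi: "x3 * (x1 * C1 + x2 * C2) - s\<^sup>2 * C3 = s * cr * cp + r * s * Gp - x3 * ct\<^sup>2"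
 proof -
  have h: "s * s * (V1\<^sup>2 + V2\<^sup>2) = (x1 * V1 + x2 * V2)\<^sup>2 + s\<^sup>2 * ct\<^sup>2" using nH by algebra
  have "r * r * s * s * (x3 * (x1 * C1 + x2 * C2) - s\<^sup>2 * C3) = r * r * s * s * (s * cr * cp + r * s * Gp - x3 * ct\<^sup>2)"
   unfolding phi0 using h Ah ij r2 by algebra
  then show ?thesis using rp sp by simp
 qed
 have Gr: "r * Gr = r * cr * R cr1 cr2 cr3 + cp * T cr1 cr2 cr3" unfolding Gr_def by (rule grad[OF tr])
 have Gp: "r * Gp = r * cr * R cp1 cp2 cp3 + cp * T cp1 cp2 cp3" unfolding Gp_def by (rule grad[OF tp])
 have "s * (r * (s * (r * (C1 * p1 + C2 * p2 + C3 * p3)))) = s * (r * (s * (?a * (x1 * C1 + x2 * C2 + x3 * C3)) + ?b * (x3 * (x1 * C1 + x2 * C2) - s\<^sup>2 * C3)))"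
 proof -
  have a: "s\<^sup>2 * (C1 * p1 + C2 * p2) = (x1 * C1 + x2 * C2) * (x1 * p1 + x2 * p2)" using p s2 by algebra
  have f: "r * (x1 * p1 + x2 * p2) = s * (s * ?a + x3 * ?b)" "r * p3 = x3 * ?a - s * ?b"
   using frame[OF p, of p3] rp by (simp_all add: field_simps)
  show ?thesis using a f by algebra
 qed
 then have "s * (r * (C1 * p1 + C2 * p2 + C3 * p3)) = s * (?a * (x1 * C1 + x2 * C2 + x3 * C3)) + ?b * (x3 * (x1 * C1 + x2 * C2) - s\<^sup>2 * C3)"
  using sp rp by simp
 then have "C1 * p1 + C2 * p2 + C3 * p3 = ?a * ((cr * R cr1 cr2 cr3 + i * cp * T cr1 cr2 cr3) - i * (cp\<^sup>2 + ct\<^sup>2))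
   + ?b * ((cr * (R cp1 cp2 cp3 + i * cp) + i * cp * T cp1 cp2 cp3) - x3 * j * (i * ct\<^sup>2))"
  unfolding rho phi using Gr Gp ij by algebra
 then show ?thesis by (simp add: C1_def C2_def C3_def i_def j_def)
qed

end


section \<open>Derivatives of the coordinates and transfer of weak derivatives\<close>

context conical_shell
begin

lemma coords_Dm: "x \<in> D ==> coords (x $ 1) (x $ 2) (x $ 3) (norm x) (s x)"
 using s_pos Dm_nonzero norm_s s_power2 by unfold_locales auto

lemma smooth_on_norm: "smooth_on D norm"
proof (rule smooth_on_cong[OF open_Dm _ smooth_on_sqrt[OF open_Dm smooth_on_norm_power2[OF open_Dm]]])
 show "0 < (norm x)\<^sup>2" if "x \<in> D" for x using Dm_nonzero[OF that] by simp
qed simp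

lemma smooth_on_s: "smooth_on D s"
 unfolding s_def[abs_def]
 by (intro smooth_on_sqrt open_Dm smooth_on_add smooth_on_power smooth_on_vec_nth s_pos2)

lemma norm_derivative: "x \<in> D ==> FD norm x (ax k) = x $ k / norm x"
proof -
 assume "x \<in> D"
 then have "(norm has_derivative (%h. inner h (sgn x))) (at x)" by (intro has_derivative_norm Dm_nonzero)
 from frechet_derivative_at[OF this, symmetric] show ?thesis
  by (simp add: sgn_div_norm inner_axis' divide_inverse mult.commute)
qed

lemma s_derivative: "x \<in> D ==> FD s x (ax k) = (if k = 3 then 0 else x $ k / s x)"
proof -
 assume x: "x \<in> D"
 have n: "((%x::real^3. x $ i) has_derivative (%h. h $ i)) (at x)" for i
  by (rule bounded_linear_imp_has_derivative[OF bounded_linear_vec_nth])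
 have 1: "((%x::real^3. (x $ 1)\<^sup>2 + (x $ 2)\<^sup>2) has_derivative (%h. 2 * (x $ 1 * h $ 1 + x $ 2 * h $ 2))) (at x)"
  unfolding power2_eq_square
  by (rule has_derivative_eq_rhs[OF has_derivative_add[OF has_derivative_mult[OF n n] has_derivative_mult[OF n n]]])
   (simp add: fun_eq_iff algebra_simps)
 have "DERIV sqrt ((x $ 1)\<^sup>2 + (x $ 2)\<^sup>2) :> inverse (s x) / 2"
  unfolding s_def by (rule DERIV_real_sqrt[OF s_pos2[OF x]])
 from has_derivative_compose[OF 1 this[unfolded has_field_derivative_def]]
 have "(s has_derivative (%h. inverse (s x) / 2 * (2 * (x $ 1 * h $ 1 + x $ 2 * h $ 2)))) (at x)"
  unfolding s_def[abs_def] .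
 from fun_cong[OF frechet_derivative_at[OF this], of "ax k"]
 have "FD s x (ax k) = inverse (s x) / 2 * (2 * (x $ 1 * ax k $ 1 + x $ 2 * ax k $ 2))" by (rule sym)
 also have "\<dots> = (x $ 1 * ax k $ 1 + x $ 2 * ax k $ 2) / s x" unfolding divide_inverse mult.commute[of "inverse (s x)"] by simp
 finally have e: "FD s x (ax k) = (x $ 1 * ax k $ 1 + x $ 2 * ax k $ 2) / s x" .
 consider "k = 1" | "k = 2" | "k = 3" using exhaust_3 by blast
 then show ?thesis unfolding e by cases (simp_all add: ax_nth)
qed

text \<open>A chosen derivative is meaningful once some weak derivative exists, and then differs
  from it on a null set only.\<close>

lemma has_weak_deriv_weak_deriv:
 fixes f :: "real^3 => 'b::euclidean_space"
 assumes "has_weak_deriv D b f g"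
 shows "has_weak_deriv D b f (weak_deriv D b f)" "AE x in M. weak_deriv D b f x = g x" "weak_deriv D b f \<in> borel_measurable M"
proof -
 show w: "has_weak_deriv D b f (weak_deriv D b f)" unfolding weak_deriv_def by (rule someI[of "has_weak_deriv D b f", OF assms])
 show "AE x in M. weak_deriv D b f x = g x" by (rule has_weak_deriv_unique[OF open_Dm w assms])
 show "weak_deriv D b f \<in> borel_measurable M" using w locally_integrable_borel[OF open_Dm] by (auto simp: has_weak_deriv_def)
qed

lemma L2_inner:
 fixes f :: "real^3 => 'b::euclidean_space"
 assumes "L2 N f" shows "L2 N (%x. f x \<bullet> c)"
proof -
 have n: "L2 N (%x. norm (f x))" using assms by (auto simp: L2_def)
 have "integrable N (%x. (f x \<bullet> c)\<^sup>2)"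
 proof (rule Bochner_Integration.integrable_bound)
  show "integrable N (%x. (norm c)\<^sup>2 * (norm (f x))\<^sup>2)" using assms by (simp add: L2_def)
  show "(%x. (f x \<bullet> c)\<^sup>2) \<in> borel_measurable N" using assms by (auto simp: L2_def)
  show "AE x in N. norm ((f x \<bullet> c)\<^sup>2) <= norm ((norm c)\<^sup>2 * (norm (f x))\<^sup>2)"
  proof (rule AE_I2)
   fix x
   have "(f x \<bullet> c)\<^sup>2 <= (norm (f x) * norm c)\<^sup>2"
    using Cauchy_Schwarz_ineq2[of "f x" c] by (metis abs_ge_zero power2_abs power_mono)
   then show "norm ((f x \<bullet> c)\<^sup>2) <= norm ((norm c)\<^sup>2 * (norm (f x))\<^sup>2)" by (simp add: power_mult_distrib mult.commute)
  qed
 qed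
 then show ?thesis using assms by (auto simp: L2_def)
qed

lemma adm_weak_deriv: "adm f fb ==> adm f (%b. weak_deriv D b f)"
 by (rule adm_cong_deriv(1)[of f fb f]) (use has_weak_deriv_weak_deriv(1) admD(1) in blast)+

text \<open>A trace condition is also a regularity statement: each side of it has smooth
  approximants, hence lies in \<open>H1\<close> and is admissible.\<close>

lemma adm_of_trace_eq:
 assumes "trace_eq D \<sigma> f g" "tame \<sigma>"
 shows "H1 f (%b. weak_deriv D b f)" "adm f (%b. weak_deriv D b f)" "H1 g (%b. weak_deriv D b g)" "adm g (%b. weak_deriv D b g)"
proof -
 obtain h where h: "has_trace D \<sigma> f h" "has_trace D \<sigma> g h" using assms(1) unfolding trace_eq_def by blast
 have "H1 u (%b. weak_deriv D b u) \<and> adm u (%b. weak_deriv D b u)" if u: "has_trace D \<sigma> u h" for u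
 proof -
  obtain ub where ub: "H1 u ub" "adm u ub" using adm_of_trace[OF u assms(2)] by blast
  show ?thesis using adm_weak_deriv[OF ub(2)] H1_weak_deriv[OF ub(1)] H1D(1)[OF ub(1)] unfolding H1_def by blast
 qed
 then show "H1 f (%b. weak_deriv D b f)" "adm f (%b. weak_deriv D b f)" "H1 g (%b. weak_deriv D b g)" "adm g (%b. weak_deriv D b g)"
  using h by blast+
qed

lemma has_weak_deriv_eq_on:
 fixes f g :: "real^3 => real"
 assumes "\<And>x. x \<in> D ==> f x = g x" "has_weak_deriv D b f f'" "has_weak_deriv D b g g'" "b \<in> Basis"
 shows "AE x in M. f' x = g' x"
proof -
 have "has_weak_deriv D b g f'" by (rule has_weak_deriv_cong[OF open_Dm assms(4,2,1)]) auto
 from has_weak_deriv_unique[OF open_Dm this assms(3)] show ?thesis .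
qed

text \<open>This is how relations valid almost everywhere, such as vanishing divergence or the
  rotation relations, are differentiated.\<close>

lemma has_weak_deriv_AE_0:
 fixes f :: "real^3 => real"
 assumes "has_weak_deriv D b f f'" "AE x in M. f x = 0" "b \<in> Basis"
 shows "AE x in M. f' x = 0"
proof -
 have "f' \<in> borel_measurable M" using assms(1) locally_integrable_borel[OF open_Dm] by (auto simp: has_weak_deriv_def)
 then have "has_weak_deriv D b (%x. 0) f'"
  by (intro has_weak_deriv_cong_AE[OF open_Dm assms(3,1) assms(2)]) auto
 from has_weak_deriv_unique[OF open_Dm this has_weak_deriv_0[OF open_Dm assms(3)]] show ?thesis .
qed

lemma vanishes_cong:
 assumes "vanishes i f" "\<And>x. x \<in> D ==> f x = g x" shows "vanishes i g"
proof -
 have e: "L2_norm M (%x. indicator (layer i n) x * g x) = L2_norm M (%x. indicator (layer i n) x * f x)" for n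
  unfolding L2_norm_def by (intro arg_cong[where f=sqrt] Bochner_Integration.integral_cong) (auto simp: space_M assms(2))
 have "L2 M g"
 proof -
  have f: "L2 M f" using assms(1) by (simp add: vanishes_def)
  have "g \<in> borel_measurable M \<longleftrightarrow> f \<in> borel_measurable M" by (rule measurable_cong) (simp add: space_M assms(2))
  then show ?thesis by (intro L2_cong_AE[OF f]) (use f in \<open>auto simp: L2_def space_M assms(2)\<close>)
 qed
 then show ?thesis using assms(1) unfolding vanishes_def e by simp
qed

lemma weak_deriv_nth_mult:
 assumes "has_weak_deriv D (ax k) f f'"
 shows "has_weak_deriv D (ax k) (%x. x $ i * f x) (%x. (if k = i then 1 else 0) * f x + x $ i * f' x)"
 using has_weak_deriv_mult_smooth[OF open_Dm ax_Basis assms smooth_on_vec_nth[OF open_Dm, of i]]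
 by (simp add: frechet_derivative_vec_nth ax_nth)

lemma finite_M_integrable: "L2 M f ==> integrable M f" for f :: "real^3 => real"
 by (rule L2_integrable[OF finite_measure_Dm])

lemma theta_indep_deriv:
 assumes "H1 f fb" "theta_indep D f"
 shows "AE x in M. x $ 1 * fb (ax 2) x = x $ 2 * fb (ax 1) x"
 by (rule theta_indep_weak_deriv[OF open_Dm bounded_Dm rot_Dm finite_M_integrable[OF H1D(1)[OF assms(1)]] assms(2) H1D(2)[OF assms(1) ax_Basis] H1D(2)[OF assms(1) ax_Basis]])

end

section \<open>The velocity at a fixed time\<close>

text \<open>One time slice of the flow. The bound on \<open>w\<close> makes products of a velocity
  component with a first derivative square integrable.\<close>

locale velocity = conical_shell +
 fixes w :: "real^3 => real^3"
 assumes w_H2: "sobolev_H 2 D w" and w_axi: "axisymmetric D w" and w_div: "AE x in M. weak_div D w x = 0"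
  and w_bc: "boundary_condition \<alpha> m w" and w_bounded: "\<exists>C. AE x in M. norm (w x) <= C"
begin

definition V :: "3 => real^3 => real" where "V i x = w x \<bullet> ax i"
text \<open>Components of the chosen derivative of the vector field, and not chosen derivatives of
  components: divergence, convection and Laplacian in the equation unfold to these.\<close>

definition Vb :: "3 => real^3 => real^3 => real" where "Vb i b x = weak_deriv D b w x \<bullet> ax i"
definition Vbc :: "3 => real^3 => real^3 => real^3 => real" where
 "Vbc i b c x = weak_deriv D c (weak_deriv D b w) x \<bullet> ax i"

abbreviation cr where "cr \<equiv> c_rho w"
abbreviation cp where "cp \<equiv> c_phi w"
abbreviation ct where "ct \<equiv> c_theta w"
abbreviation \<omega> where "\<omega> \<equiv> omega_theta D w"

lemma w_derivs:
 assumes b: "b \<in> Basis"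
 shows "has_weak_deriv D b w (weak_deriv D b w)" "L2 M w" "L2 M (weak_deriv D b w)"
  and "c \<in> Basis ==> has_weak_deriv D c (weak_deriv D b w) (weak_deriv D c (weak_deriv D b w))"
  and "c \<in> Basis ==> L2 M (weak_deriv D c (weak_deriv D b w))"
proof -
 have H: "L2 M w" "\<forall>b\<in>Basis. \<exists>g. has_weak_deriv D b w g \<and> L2 M g \<and> (\<forall>c\<in>Basis. \<exists>h. has_weak_deriv D c g h \<and> L2 M h)"
  using w_H2 by (simp_all add: numeral_2_eq_2)
 then obtain g where g: "has_weak_deriv D b w g" "L2 M g" "\<forall>c\<in>Basis. \<exists>h. has_weak_deriv D c g h \<and> L2 M h" using b by blast
 note W = has_weak_deriv_weak_deriv[OF g(1)]
 show "has_weak_deriv D b w (weak_deriv D b w)" "L2 M w" by (rule W H)+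
 have ae: "AE x in M. g x = weak_deriv D b w x" using W(2) by (rule AE_mp) auto
 show "L2 M (weak_deriv D b w)" by (rule L2_cong_AE[OF g(2) ae W(3)])
 assume c: "c \<in> Basis"
 then obtain h where h: "has_weak_deriv D c g h" "L2 M h" using g(3) by blast
 have hm: "h \<in> borel_measurable M" using h(2) by (simp add: L2_def)
 have "has_weak_deriv D c (weak_deriv D b w) h" by (rule has_weak_deriv_cong_AE[OF open_Dm c h(1) ae W(3) _ hm]) simp
 note X = has_weak_deriv_weak_deriv[OF this]
 show "has_weak_deriv D c (weak_deriv D b w) (weak_deriv D c (weak_deriv D b w))" by (rule X)
 have "AE x in M. h x = weak_deriv D c (weak_deriv D b w) x" using X(2) by (rule AE_mp) auto
 from L2_cong_AE[OF h(2) this X(3)] show "L2 M (weak_deriv D c (weak_deriv D b w))" .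
qed

lemma H1_V: "H1 (V i) (Vb i)"
 unfolding H1_def V_def[abs_def] Vb_def[abs_def]
 using L2_inner[OF w_derivs(2)[OF ax_Basis]] has_weak_deriv_inner[OF open_Dm _ w_derivs(1)] L2_inner[OF w_derivs(3)] by blast

lemma H1_Vb: "b \<in> Basis ==> H1 (Vb i b) (Vbc i b)"
 unfolding H1_def Vb_def[abs_def] Vbc_def[abs_def]
 using L2_inner[OF w_derivs(3)] has_weak_deriv_inner[OF open_Dm _ w_derivs(4)] L2_inner[OF w_derivs(5)] by blast

lemmas L2_V = H1D(1)[OF H1_V] and L2_Vb = H1D(3)[OF H1_V ax_Basis] and wd_V = H1D(2)[OF H1_V ax_Basis]
 and wd_Vb = H1D(2)[OF H1_Vb[OF ax_Basis] ax_Basis] and L2_Vbc = H1D(3)[OF H1_Vb[OF ax_Basis] ax_Basis]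

lemma V_nth: "V i x = w x $ i"
 by (simp add: V_def inner_axis)

text \<open>Written without denominators, so that differentiating and eliminating stay
  polynomial.\<close>

lemma components:
 assumes x: "x \<in> D"
 shows "norm x * cr x = x $ 1 * V 1 x + x $ 2 * V 2 x + x $ 3 * V 3 x"
  "norm x * s x * cp x = x $ 3 * (x $ 1 * V 1 x + x $ 2 * V 2 x) - (s x)\<^sup>2 * V 3 x"
  "s x * ct x = x $ 1 * V 2 x - x $ 2 * V 1 x"
 using s_pos[OF x] Dm_nonzero[OF x]
 by (simp_all add: c_rho_def c_phi_def c_theta_def e_rho_Dm[OF x] e_phi_Dm[OF x] e_theta_Dm[OF x] inner_real3 V_nth field_simps power2_eq_square)

lemma V_components:
 assumes x: "x \<in> D"
 shows "V 1 x = x $ 1 / norm x * cr x + x $ 1 * x $ 3 / (norm x * s x) * cp x - x $ 2 / s x * ct x"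
  "V 2 x = x $ 2 / norm x * cr x + x $ 2 * x $ 3 / (norm x * s x) * cp x + x $ 1 / s x * ct x"
  "V 3 x = x $ 3 / norm x * cr x - s x / norm x * cp x"
proof -
 interpret coords "x $ 1" "x $ 2" "x $ 3" "norm x" "s x" by (rule coords_Dm[OF x])
 define i j where "i = 1 / norm x" and "j = 1 / s x"
 have ij: "i * norm x = 1" "j * s x = 1" using rp sp by (simp_all add: i_def j_def)
 note c = components[OF x]
 have "V 1 x = x $ 1 * i * cr x + x $ 1 * x $ 3 * (i * j) * cp x - x $ 2 * j * ct x"
  "V 2 x = x $ 2 * i * cr x + x $ 2 * x $ 3 * (i * j) * cp x + x $ 1 * j * ct x"
  "V 3 x = x $ 3 * i * cr x - s x * i * cp x"
  using c r2 s2 ij by algebra+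
 then show "V 1 x = x $ 1 / norm x * cr x + x $ 1 * x $ 3 / (norm x * s x) * cp x - x $ 2 / s x * ct x"
  "V 2 x = x $ 2 / norm x * cr x + x $ 2 * x $ 3 / (norm x * s x) * cp x + x $ 1 / s x * ct x"
  "V 3 x = x $ 3 / norm x * cr x - s x / norm x * cp x" by (simp_all add: i_def j_def)
qed

lemma bc:
 shows "trace_eq D (A1 \<alpha> m) cr (%_. 0)" "trace_eq D (A2 \<alpha> m) cr (%_. 0)"
  "trace_eq D (R1 \<alpha> m) cp (%_. 0)" "trace_eq D (R2 \<alpha> m) cp (%_. 0)"
  "trace_eq D (A2 \<alpha> m) (d_rho D ct) (%x. 1 / rho x * ct x)"
  "trace_eq D (R1 \<alpha> m) \<omega> (%_. 0)" "trace_eq D (R2 \<alpha> m) \<omega> (%_. 0)"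
  "trace_eq D (A1 \<alpha> m) \<omega> (%_. 0)" "trace_eq D (A2 \<alpha> m) \<omega> (%x. 2 / rho x * cp x)"
 using w_bc unfolding boundary_condition_def Let_def by blast+

text \<open>No trace condition has \<open>ct\<close> itself as a side, so its regularity is taken
  from the right side of the one for its radial derivative; \<open>adm_ct\<close> therefore concerns
  \<open>1 / rho * ct\<close>.\<close>

lemmas H1_cr = adm_of_trace_eq(1)[OF bc(1) tame_pieces(1)] and adm_cr = adm_of_trace_eq(2)[OF bc(1) tame_pieces(1)]
 and H1_cp = adm_of_trace_eq(1)[OF bc(3) tame_pieces(3)] and adm_cp = adm_of_trace_eq(2)[OF bc(3) tame_pieces(3)]
 and adm_ct = adm_of_trace_eq(4)[OF bc(5) tame_pieces(2)]
 and H1_\<omega> = adm_of_trace_eq(1)[OF bc(6) tame_pieces(3)] and adm_\<omega> = adm_of_trace_eq(2)[OF bc(6) tame_pieces(3)]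

lemma smooth_on_coeffs:
 "smooth_on D (%x. x $ i / norm x)" "smooth_on D (%x. x $ i * x $ 3 / (norm x * s x))" "smooth_on D (%x. x $ i / s x)" "smooth_on D (%x. s x / norm x)"
 by (intro smooth_on_divide smooth_on_mult smooth_on_vec_nth open_Dm smooth_on_norm smooth_on_s; use s_pos Dm_nonzero in auto)+

text \<open>The boundary condition supplies approximants for the spherical components, while
  integration by parts is Cartesian. The coefficients passing from one to the other are smooth on
  \<open>D\<close>.\<close>

lemma adm_V: "adm (V i) (Vb i)"
proof -
 note a = adm_mult[OF adm_cr] adm_mult[OF adm_cp] adm_mult[OF adm_ct]
 have wd: "has_weak_deriv D b (V i) (Vb i b)" if "b \<in> Basis" for b using H1D(2)[OF H1_V that] .
 have r: "0 < rho x" if "x \<in> D" for x using Dm_nonzero[OF that] by (simp add: rho_def)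
 \<comment> \<open>The factor \<open>norm x\<close> undoes the division by rho in
   \<open>adm_ct\<close>.\<close>
 have sr: "smooth_on D (%x. - (norm x * (x $ 2 / s x)))" "smooth_on D (%x. norm x * (x $ 1 / s x))"
  by (intro smooth_on_uminus smooth_on_mult open_Dm smooth_on_norm smooth_on_coeffs)+
 consider "i = 1" | "i = 2" | "i = 3" using exhaust_3 by blast
 then show ?thesis
 proof cases
  case 1
  show ?thesis unfolding 1
   by (rule adm_cong_deriv(1)[OF adm_add[OF adm_add[OF a(1)[OF smooth_on_coeffs(1)[of 1]] a(2)[OF smooth_on_coeffs(2)[of 1]]] a(3)[OF sr(1)]]])
    (use wd[unfolded 1] r in \<open>auto simp: V_components rho_def\<close>)
 next
  case 2
  show ?thesis unfolding 2
   by (rule adm_cong_deriv(1)[OF adm_add[OF adm_add[OF a(1)[OF smooth_on_coeffs(1)[of 2]] a(2)[OF smooth_on_coeffs(2)[of 2]]] a(3)[OF sr(2)]]])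
    (use wd[unfolded 2] r in \<open>auto simp: V_components rho_def\<close>)
 next
  case 3
  show ?thesis unfolding 3
   by (rule adm_cong_deriv(1)[OF adm_add[OF a(1)[OF smooth_on_coeffs(1)[of 3]] a(2)[OF smooth_on_uminus[OF open_Dm smooth_on_coeffs(4)]]]])
    (use wd[unfolded 3] in \<open>auto simp: V_components\<close>)
 qed
qed

lemma div_V: "AE x in M. (\<Sum>i\<in>UNIV. Vb i (ax i) x) = 0"
 using w_div by (rule AE_mp) (auto simp: weak_div_def sum_Basis_real3 sum_3 Vb_def)

lemma vanishes_cr: "vanishes 1 cr" "vanishes 2 cr" and vanishes_cp: "vanishes 3 cp"
 using vanishes_A2[OF bc(2)] vanishes_A1[OF bc(1)] vanishes_R[OF bc(3,4)] H1D(1)[OF H1_cr] H1D(1)[OF H1_cp] by simp_all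

lemma smooth_on_M: "smooth_on D u ==> u \<in> borel_measurable M"
 by (rule smooth_on_measurable_M)

text \<open>On the spheres the gradient of \<open>d j\<close> is radial and the trace of
  \<open>cr\<close> is 0. On the cones the gradient of \<open>d 3\<close> is not exactly along e_phi
  inside \<open>D\<close>; its radial part is 2 d_3 / rho, so that \<open>cr\<close>, whose trace is
  free there, enters with a factor vanishing on the cones.\<close>

lemma vanishes_normal: "vanishes j (%x. \<Sum>i\<in>UNIV. d' j x (ax i) * V i x)"
proof -
 have e: "(\<Sum>i\<in>UNIV. x $ i * V i x) = norm x * cr x" if "x \<in> D" for x using components(1)[OF that] by (simp add: sum_3)
 consider "j = 1" | "j = 2" | "j = 3" using exhaust_3 by blast
 then show ?thesis
 proof cases
  case 1
  have "vanishes 1 (%x. (- 2 * norm x) * cr x)"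
   by (rule vanishes_mult_bounded[OF vanishes_cr(1), where C=2])
    (use norm_Dm(2) in \<open>auto intro!: smooth_on_M smooth_on_mult smooth_on_const smooth_on_norm less_imp_le simp: abs_mult\<close>)
  then show ?thesis unfolding 1
  proof (rule vanishes_cong)
   fix x assume "x \<in> D"
   from e[OF this] have "- 2 * (norm x * cr x) = - 2 * (\<Sum>i\<in>UNIV. x $ i * V i x)" by simp
   then show "- 2 * norm x * cr x = (\<Sum>i\<in>UNIV. d' 1 x (ax i) * V i x)" by (simp add: d'_def sum_3 inner_axis algebra_simps)
  qed
 next
  case 2
  have "vanishes 2 (%x. (2 * norm x) * cr x)"
   by (rule vanishes_mult_bounded[OF vanishes_cr(2), where C=2])
    (use norm_Dm(2) in \<open>auto intro!: smooth_on_M smooth_on_mult smooth_on_const smooth_on_norm less_imp_le simp: abs_mult\<close>)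
  then show ?thesis unfolding 2
  proof (rule vanishes_cong)
   fix x assume "x \<in> D"
   from e[OF this] have "2 * (norm x * cr x) = 2 * (\<Sum>i\<in>UNIV. x $ i * V i x)" by simp
   then show "(2 * norm x) * cr x = (\<Sum>i\<in>UNIV. d' 2 x (ax i) * V i x)" by (simp add: d'_def sum_3 inner_axis algebra_simps)
  qed
 next
  case 3
  have b1: "\<bar>2 / norm x\<bar> <= 2 / a" if "x \<in> D" for x
   using norm_Dm(1)[OF that] a_pos by (auto intro!: divide_left_mono mult_pos_pos)
  have b2: "\<bar>2 * x $ 3 * (s x / norm x)\<bar> <= 2" if "x \<in> D" for x
  proof -
   have "(s x)\<^sup>2 <= (norm x)\<^sup>2" using norm_s[of x] by simp
   then have "s x <= norm x" by (rule power2_le_imp_le) simp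
   then have "s x / norm x <= 1" using Dm_nonzero[OF that] by simp
   moreover have "\<bar>x $ 3\<bar> <= 1" using abs_component_le_norm[of x] norm_Dm(2)[OF that] by linarith
   ultimately have "\<bar>x $ 3\<bar> * (s x / norm x) <= 1 * 1" using s_pos[OF that] by (intro mult_mono) auto
   then show ?thesis using s_pos[OF that] by (simp add: abs_mult)
  qed
  have sm: "(%x. 2 / norm x) \<in> borel_measurable M" "(%x. 2 * x $ 3 * (s x / norm x)) \<in> borel_measurable M"
   by (intro smooth_on_M smooth_on_divide smooth_on_mult smooth_on_const smooth_on_vec_nth smooth_on_norm smooth_on_s open_Dm; use Dm_nonzero in auto)+
  have "vanishes 3 (%x. 2 / norm x * (d 3 x * cr x) + 2 * x $ 3 * (s x / norm x) * cp x)"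
   by (rule vanishes_add[OF vanishes_mult_bounded[OF vanishes_distance_mult[OF H1D(1)[OF H1_cr]] sm(1) b1] vanishes_mult_bounded[OF vanishes_cp sm(2) b2]])
  then show ?thesis unfolding 3
  proof (rule vanishes_cong)
   fix x assume x: "x \<in> D"
   have n: "norm x ~= 0" using Dm_nonzero[OF x] by simp
   have "(\<Sum>i\<in>UNIV. d' 3 x (ax i) * V i x) = 2 * (sin \<alpha>)\<^sup>2 * (norm x * cr x) - 2 * x $ 3 * V 3 x"
    unfolding e[OF x, symmetric] by (simp add: d'_def sum_3 inner_axis ax_nth algebra_simps)
   also have "\<dots> = 2 / norm x * (d 3 x * cr x) + 2 * x $ 3 * (s x / norm x) * cp x"
    unfolding V_components(3)[OF x] using n by (simp add: d_def field_simps power2_eq_square)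
   finally show "2 / norm x * (d 3 x * cr x) + 2 * x $ 3 * (s x / norm x) * cp x = (\<Sum>i\<in>UNIV. d' 3 x (ax i) * V i x)" ..
  qed
 qed
qed

theorem velocity_orthogonal:
 "H1 Q q ==> (\<integral>x. (\<Sum>i\<in>UNIV. V i x * q (ax i) x) \<partial>M) = 0"
 by (rule orthogonal_gradient[OF adm_V L2_V div_V vanishes_normal])

text \<open>\<open>V 1\<close> and \<open>V 2\<close> do vary with the azimuth for an axisymmetric
  field; their radial and swirl combinations do not.\<close>

lemma theta_indep_components:
 shows "theta_indep D (V 3)" "theta_indep D (%x. x $ 1 * V 1 x + x $ 2 * V 2 x)" "theta_indep D (%x. x $ 1 * V 2 x - x $ 2 * V 1 x)"
  "theta_indep D cr" "theta_indep D cp"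
proof -
 show t: "theta_indep D cr" "theta_indep D cp" using w_axi by (auto simp: axisymmetric_def)
 obtain Gr Gp Gt where G: "AE x in M. cr x = Gr (rho x) (phi x)" "AE x in M. cp x = Gp (rho x) (phi x)" "AE x in M. ct x = Gt (rho x) (phi x)"
  using w_axi unfolding axisymmetric_def theta_indep_def by blast
 have co: "x $ 3 / norm x = cos (phi x)" "s x / norm x = sin (phi x)" "s x = rho x * sin (phi x)" "x $ 3 = rho x * cos (phi x)" if "x \<in> D" for x
  using cos_phi[OF Dm_nonzero[OF that]] sin_phi[OF that] Dm_nonzero[OF that] by (simp_all add: rho_def)
 show "theta_indep D (V 3)" unfolding theta_indep_def
 proof (rule exI[of _ "%r p. cos p * Gr r p - sin p * Gp r p"])
  show "AE x in M. V 3 x = cos (phi x) * Gr (rho x) (phi x) - sin (phi x) * Gp (rho x) (phi x)"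
   using G(1,2) AE_space by eventually_elim (simp add: space_M V_components(3) co(1,2) del: times_divide_eq_left)
 qed
 show "theta_indep D (%x. x $ 1 * V 1 x + x $ 2 * V 2 x)" unfolding theta_indep_def
 proof (rule exI[of _ "%r p. r * sin p * (sin p * Gr r p + cos p * Gp r p)"])
  show "AE x in M. x $ 1 * V 1 x + x $ 2 * V 2 x = rho x * sin (phi x) * (sin (phi x) * Gr (rho x) (phi x) + cos (phi x) * Gp (rho x) (phi x))"
   using G(1,2) AE_space
  proof eventually_elim
   case (elim x)
   then have x: "x \<in> D" by (simp add: space_M)
   interpret coords "x $ 1" "x $ 2" "x $ 3" "norm x" "s x" by (rule coords_Dm[OF x])
   have "norm x * (x $ 1 * V 1 x + x $ 2 * V 2 x) = s x * (s x * cr x + x $ 3 * cp x)"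
   proof -
    have "norm x * (norm x * (x $ 1 * V 1 x + x $ 2 * V 2 x)) = norm x * (s x * (s x * cr x + x $ 3 * cp x))"
     using components(1,2)[OF x] r2 by algebra
    then show ?thesis using rp by simp
   qed
   then have "x $ 1 * V 1 x + x $ 2 * V 2 x = s x * (s x / norm x * cr x + x $ 3 / norm x * cp x)"
    using rp by (simp add: field_simps)
   then show ?case using elim by (simp add: co(1,2)[OF x]) (simp add: co(3)[OF x])
  qed
 qed
 show "theta_indep D (%x. x $ 1 * V 2 x - x $ 2 * V 1 x)" unfolding theta_indep_def
 proof (rule exI[of _ "%r p. r * sin p * Gt r p"])
  show "AE x in M. x $ 1 * V 2 x - x $ 2 * V 1 x = rho x * sin (phi x) * Gt (rho x) (phi x)"
   using G(3) AE_space by eventually_elim (simp add: space_M components(3)[symmetric] co(3))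
 qed
qed

end


context conical_shell
begin

lemma d_rho_Dm:
 "x \<in> D ==> d_rho D f x = weak_deriv D (ax 1) f x * (x $ 1 / norm x) + weak_deriv D (ax 2) f x * (x $ 2 / norm x) + weak_deriv D (ax 3) f x * (x $ 3 / norm x)"
 and d_phi_Dm:
 "x \<in> D ==> d_phi D f x / norm x = weak_deriv D (ax 1) f x * (x $ 1 * x $ 3 / (norm x * s x)) + weak_deriv D (ax 2) f x * (x $ 2 * x $ 3 / (norm x * s x)) - weak_deriv D (ax 3) f x * (s x / norm x)"
 using Dm_nonzero[of x]
 by (simp_all add: d_rho_def d_phi_def weak_grad_def sum_Basis_real3 rho_def e_rho_Dm e_phi_Dm inner_real3 ax_nth diff_divide_distrib add_divide_distrib mult_ac)

end

section \<open>Consequences of axial symmetry and incompressibility for derivatives\<close>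

context velocity
begin

abbreviation Vd :: "3 => 3 => real^3 => real" where "Vd i j \<equiv> Vb i (ax j)"
abbreviation Vdd :: "3 => 3 => 3 => real^3 => real" where "Vdd i j k \<equiv> Vbc i (ax j) (ax k)"
abbreviation dc :: "3 => (real^3 => real) => real^3 => real" where "dc k f \<equiv> weak_deriv D (ax k) f"

lemmas wd_add = has_weak_deriv_add[OF open_Dm ax_Basis] and wd_diff = has_weak_deriv_diff[OF open_Dm ax_Basis]

lemma mixed: "AE x in M. Vdd i j k x = Vdd i k j x"
 by (rule has_weak_deriv_mixed[OF open_Dm ax_Basis ax_Basis wd_V wd_Vb wd_V wd_Vb])

text \<open>Under rotation the horizontal components turn with the point and the vertical one is
  unchanged; this is the infinitesimal form.\<close>

lemma theta_first:
 shows "AE x in M. x $ 1 * Vd 1 2 x - x $ 2 * Vd 1 1 x + V 2 x = 0"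
  and "AE x in M. x $ 1 * Vd 2 2 x - x $ 2 * Vd 2 1 x - V 1 x = 0"
  and "AE x in M. x $ 1 * Vd 3 2 x - x $ 2 * Vd 3 1 x = 0"
proof -
 have c: "continuous_on UNIV (%x::real^3. x $ i)" for i by (intro continuous_intros)
 have d1: "has_weak_deriv D (ax k) (%x. x $ 1 * V 1 x + x $ 2 * V 2 x)
   (%x. ((if k = 1 then 1 else 0) * V 1 x + x $ 1 * Vd 1 k x) + ((if k = 2 then 1 else 0) * V 2 x + x $ 2 * Vd 2 k x))" for k
  by (intro wd_add weak_deriv_nth_mult wd_V)
 have d2: "has_weak_deriv D (ax k) (%x. x $ 1 * V 2 x - x $ 2 * V 1 x)
   (%x. ((if k = 1 then 1 else 0) * V 2 x + x $ 1 * Vd 2 k x) - ((if k = 2 then 1 else 0) * V 1 x + x $ 2 * Vd 1 k x))" for k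
  by (intro wd_diff weak_deriv_nth_mult wd_V)
 note t = theta_indep_weak_deriv[OF open_Dm bounded_Dm rot_Dm finite_M_integrable]
 have A: "AE x in M. x $ 1 * (V 2 x + x $ 1 * Vd 1 2 x + x $ 2 * Vd 2 2 x) = x $ 2 * (V 1 x + x $ 1 * Vd 1 1 x + x $ 2 * Vd 2 1 x)"
  using t[OF L2_add[OF L2_continuous_mult[OF c L2_V] L2_continuous_mult[OF c L2_V]] theta_indep_components(2) d1 d1]
  by (rule AE_mp) (simp add: add_ac)
 have B: "AE x in M. x $ 1 * (x $ 1 * Vd 2 2 x - V 1 x - x $ 2 * Vd 1 2 x) = x $ 2 * (V 2 x + x $ 1 * Vd 2 1 x - x $ 2 * Vd 1 1 x)"
  using t[OF L2_diff[OF L2_continuous_mult[OF c L2_V] L2_continuous_mult[OF c L2_V]] theta_indep_components(3) d2 d2]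
  by (rule AE_mp) (simp add: diff_diff_eq)
 show "AE x in M. x $ 1 * Vd 1 2 x - x $ 2 * Vd 1 1 x + V 2 x = 0"
  using A B AE_space
 proof eventually_elim
  case (elim x)
  then have "x \<in> D" by (simp add: space_M)
  from coords.theta_relations(1)[OF coords_Dm[OF this] elim(1,2)] show ?case .
 qed
 show "AE x in M. x $ 1 * Vd 2 2 x - x $ 2 * Vd 2 1 x - V 1 x = 0"
  using A B AE_space
 proof eventually_elim
  case (elim x)
  then have "x \<in> D" by (simp add: space_M)
  from coords.theta_relations(2)[OF coords_Dm[OF this] elim(1,2)] show ?case .
 qed
 show "AE x in M. x $ 1 * Vd 3 2 x - x $ 2 * Vd 3 1 x = 0"
  using theta_indep_deriv[OF H1_V theta_indep_components(1)] by (rule AE_mp) simp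
qed

text \<open>The derivatives of the relations in \<open>theta_first\<close> and of the vanishing
  divergence.\<close>

lemma theta_second:
 shows "AE x in M. ((if k = 1 then 1 else 0) * Vd 1 2 x + x $ 1 * Vdd 1 2 k x) - ((if k = 2 then 1 else 0) * Vd 1 1 x + x $ 2 * Vdd 1 1 k x) + Vd 2 k x = 0"
  and "AE x in M. ((if k = 1 then 1 else 0) * Vd 2 2 x + x $ 1 * Vdd 2 2 k x) - ((if k = 2 then 1 else 0) * Vd 2 1 x + x $ 2 * Vdd 2 1 k x) - Vd 1 k x = 0"
  and "AE x in M. ((if k = 1 then 1 else 0) * Vd 3 2 x + x $ 1 * Vdd 3 2 k x) - ((if k = 2 then 1 else 0) * Vd 3 1 x + x $ 2 * Vdd 3 1 k x) = 0"
  and "AE x in M. Vdd 1 1 k x + Vdd 2 2 k x + Vdd 3 3 k x = 0"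
proof -
 have "AE x in M. Vd 1 1 x + Vd 2 2 x + Vd 3 3 x = 0" using div_V by (simp add: sum_3)
 note z = theta_first this
 show "AE x in M. ((if k = 1 then 1 else 0) * Vd 1 2 x + x $ 1 * Vdd 1 2 k x) - ((if k = 2 then 1 else 0) * Vd 1 1 x + x $ 2 * Vdd 1 1 k x) + Vd 2 k x = 0"
  by (rule has_weak_deriv_AE_0[OF _ z(1) ax_Basis[of k]]) (intro wd_add wd_diff weak_deriv_nth_mult wd_Vb wd_V)
 show "AE x in M. ((if k = 1 then 1 else 0) * Vd 2 2 x + x $ 1 * Vdd 2 2 k x) - ((if k = 2 then 1 else 0) * Vd 2 1 x + x $ 2 * Vdd 2 1 k x) - Vd 1 k x = 0"
  by (rule has_weak_deriv_AE_0[OF _ z(2) ax_Basis[of k]]) (intro wd_add wd_diff weak_deriv_nth_mult wd_Vb wd_V)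
 show "AE x in M. ((if k = 1 then 1 else 0) * Vd 3 2 x + x $ 1 * Vdd 3 2 k x) - ((if k = 2 then 1 else 0) * Vd 3 1 x + x $ 2 * Vdd 3 1 k x) = 0"
  by (rule has_weak_deriv_AE_0[OF _ z(3) ax_Basis[of k]]) (intro wd_add wd_diff weak_deriv_nth_mult wd_Vb wd_V)
 show "AE x in M. Vdd 1 1 k x + Vdd 2 2 k x + Vdd 3 3 k x = 0"
  by (rule has_weak_deriv_AE_0[OF _ z(4) ax_Basis[of k]]) (intro wd_add wd_diff wd_Vb wd_V)
qed

lemma laplacian_eq_curl:
 shows "AE x in M. x $ 1 * (Vdd 1 1 1 x + Vdd 1 2 2 x + Vdd 1 3 3 x) + x $ 2 * (Vdd 2 1 1 x + Vdd 2 2 2 x + Vdd 2 3 3 x)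
   = x $ 1 * Vdd 1 3 3 x + x $ 2 * Vdd 2 3 3 x - x $ 1 * Vdd 3 1 3 x - x $ 2 * Vdd 3 2 3 x" (is "AE x in M. ?P x")
  and "AE x in M. - ((s x)\<^sup>2 * (Vdd 3 1 1 x + Vdd 3 2 2 x + Vdd 3 3 3 x))
   = x $ 1 * (Vd 1 3 x - Vd 3 1 x + x $ 1 * Vdd 1 3 1 x + x $ 2 * Vdd 2 3 1 x - x $ 1 * Vdd 3 1 1 x - x $ 2 * Vdd 3 2 1 x)
   + x $ 2 * (Vd 2 3 x - Vd 3 2 x + x $ 1 * Vdd 1 3 2 x + x $ 2 * Vdd 2 3 2 x - x $ 1 * Vdd 3 1 2 x - x $ 2 * Vdd 3 2 2 x)" (is "AE x in M. ?Q x")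
proof -
 have "AE x in M. ?P x \<and> ?Q x"
  using theta_second(1)[of 1] theta_second(1)[of 2] theta_second(1)[of 3]
   theta_second(2)[of 1] theta_second(2)[of 2] theta_second(2)[of 3] theta_second(3)[of 1] theta_second(3)[of 2]
   theta_second(4)[of 1] theta_second(4)[of 2] theta_second(4)[of 3]
   mixed[of 1 2 1] mixed[of 1 3 1] mixed[of 1 3 2] mixed[of 2 2 1] mixed[of 2 3 1] mixed[of 2 3 2] mixed[of 3 2 1] mixed[of 3 3 1] mixed[of 3 3 2]
   AE_space
 proof eventually_elim
  case (elim x)
  then have "x \<in> D" by (simp add: space_M)
  interpret coords "x $ 1" "x $ 2" "x $ 3" "norm x" "s x" by (rule coords_Dm) fact
  have e: "x $ 1 * Vdd 1 2 1 x + Vd 1 2 x - x $ 2 * Vdd 1 1 1 x + Vd 2 1 x = 0"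
   "x $ 1 * Vdd 1 2 2 x - Vd 1 1 x - x $ 2 * Vdd 1 1 2 x + Vd 2 2 x = 0"
   "x $ 1 * Vdd 1 2 3 x - x $ 2 * Vdd 1 1 3 x + Vd 2 3 x = 0"
   "Vd 2 2 x + x $ 1 * Vdd 2 2 1 x - x $ 2 * Vdd 2 1 1 x - Vd 1 1 x = 0"
   "x $ 1 * Vdd 2 2 2 x - Vd 2 1 x - x $ 2 * Vdd 2 1 2 x - Vd 1 2 x = 0"
   "x $ 1 * Vdd 2 2 3 x - x $ 2 * Vdd 2 1 3 x - Vd 1 3 x = 0"
   "Vd 3 2 x + x $ 1 * Vdd 3 2 1 x - x $ 2 * Vdd 3 1 1 x = 0"
   "x $ 1 * Vdd 3 2 2 x - Vd 3 1 x - x $ 2 * Vdd 3 1 2 x = 0"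
   using elim(1-8) by (simp_all add: algebra_simps)
  from laplacian_curl[OF e elim(9-20)] show ?case by blast
 qed
 then show "AE x in M. ?P x" "AE x in M. ?Q x" by auto
qed

text \<open>Differentiating the products in \<open>components\<close>, not formulas for
  \<open>cr\<close> and \<open>cp\<close>, keeps the right sides free of denominators; both sides
  are weak derivatives of functions equal on \<open>D\<close>.\<close>

lemma component_derivs:
 shows "AE x in M. x $ k / norm x * cr x + norm x * dc k cr x
   = ((if k = 1 then 1 else 0) * V 1 x + x $ 1 * Vd 1 k x) + ((if k = 2 then 1 else 0) * V 2 x + x $ 2 * Vd 2 k x) + ((if k = 3 then 1 else 0) * V 3 x + x $ 3 * Vd 3 k x)"
  and "AE x in M. (x $ k / norm x * s x + norm x * (if k = 3 then 0 else x $ k / s x)) * cp x + norm x * s x * dc k cp x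
   = ((if k = 3 then 1 else 0) * (x $ 1 * V 1 x + x $ 2 * V 2 x)
     + x $ 3 * (((if k = 1 then 1 else 0) * V 1 x + x $ 1 * Vd 1 k x) + ((if k = 2 then 1 else 0) * V 2 x + x $ 2 * Vd 2 k x)))
    - ((if k = 3 then 0 else 2 * x $ k) * V 3 x + (s x)\<^sup>2 * Vd 3 k x)"
proof -
 have wr: "has_weak_deriv D (ax k) cr (dc k cr)" and wp: "has_weak_deriv D (ax k) cp (dc k cp)"
  using H1D(2)[OF H1_cr ax_Basis] H1D(2)[OF H1_cp ax_Basis] by blast+
 have ns: "smooth_on D (%x. norm x * s x)" by (intro smooth_on_mult open_Dm smooth_on_norm smooth_on_s)
 have ss: "smooth_on D (%x. (s x)\<^sup>2)" by (intro smooth_on_power open_Dm smooth_on_s)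
 have dns: "FD (%x. norm x * s x) x (ax k) = x $ k / norm x * s x + norm x * (if k = 3 then 0 else x $ k / s x)" if "x \<in> D" for x
  using frechet_derivative_mult[OF smooth_on_differentiable[OF smooth_on_norm that] smooth_on_differentiable[OF smooth_on_s that], of "ax k"]
   norm_derivative[OF that, of k] s_derivative[OF that, of k] by (simp add: mult.commute add.commute)
 have dss: "FD (%x. (s x)\<^sup>2) x (ax k) = (if k = 3 then 0 else 2 * x $ k)" if "x \<in> D" for x
  using frechet_derivative_mult[OF smooth_on_differentiable[OF smooth_on_s that] smooth_on_differentiable[OF smooth_on_s that], of "ax k"]
   s_derivative[OF that, of k] s_pos[OF that] by (auto simp: power2_eq_square)
 have "AE x in M. FD norm x (ax k) * cr x + norm x * dc k cr x
   = ((if k = 1 then 1 else 0) * V 1 x + x $ 1 * Vd 1 k x) + ((if k = 2 then 1 else 0) * V 2 x + x $ 2 * Vd 2 k x) + ((if k = 3 then 1 else 0) * V 3 x + x $ 3 * Vd 3 k x)"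
  by (rule has_weak_deriv_eq_on[OF components(1) has_weak_deriv_mult_smooth[OF open_Dm ax_Basis wr smooth_on_norm] _ ax_Basis])
   (assumption, intro wd_add weak_deriv_nth_mult wd_V)
 then show "AE x in M. x $ k / norm x * cr x + norm x * dc k cr x
   = ((if k = 1 then 1 else 0) * V 1 x + x $ 1 * Vd 1 k x) + ((if k = 2 then 1 else 0) * V 2 x + x $ 2 * Vd 2 k x) + ((if k = 3 then 1 else 0) * V 3 x + x $ 3 * Vd 3 k x)"
  using AE_space by eventually_elim (simp add: space_M norm_derivative)
 have v3: "has_weak_deriv D (ax k) (%x. (s x)\<^sup>2 * V 3 x) (%x. FD (%x. (s x)\<^sup>2) x (ax k) * V 3 x + (s x)\<^sup>2 * Vd 3 k x)"
  by (rule has_weak_deriv_mult_smooth[OF open_Dm ax_Basis wd_V ss])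
 have v12: "has_weak_deriv D (ax k) (%x. x $ 3 * (x $ 1 * V 1 x + x $ 2 * V 2 x)) (%x. (if k = 3 then 1 else 0) * (x $ 1 * V 1 x + x $ 2 * V 2 x)
     + x $ 3 * (((if k = 1 then 1 else 0) * V 1 x + x $ 1 * Vd 1 k x) + ((if k = 2 then 1 else 0) * V 2 x + x $ 2 * Vd 2 k x)))"
  by (intro wd_add weak_deriv_nth_mult wd_V)
 have "AE x in M. FD (%x. norm x * s x) x (ax k) * cp x + norm x * s x * dc k cp x
   = ((if k = 3 then 1 else 0) * (x $ 1 * V 1 x + x $ 2 * V 2 x)
     + x $ 3 * (((if k = 1 then 1 else 0) * V 1 x + x $ 1 * Vd 1 k x) + ((if k = 2 then 1 else 0) * V 2 x + x $ 2 * Vd 2 k x)))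
    - (FD (%x. (s x)\<^sup>2) x (ax k) * V 3 x + (s x)\<^sup>2 * Vd 3 k x)"
  by (rule has_weak_deriv_eq_on[OF components(2) has_weak_deriv_mult_smooth[OF open_Dm ax_Basis wp ns] wd_diff[OF v12 v3] ax_Basis])
 then show "AE x in M. (x $ k / norm x * s x + norm x * (if k = 3 then 0 else x $ k / s x)) * cp x + norm x * s x * dc k cp x
   = ((if k = 3 then 1 else 0) * (x $ 1 * V 1 x + x $ 2 * V 2 x)
     + x $ 3 * (((if k = 1 then 1 else 0) * V 1 x + x $ 1 * Vd 1 k x) + ((if k = 2 then 1 else 0) * V 2 x + x $ 2 * Vd 2 k x)))
    - ((if k = 3 then 0 else 2 * x $ k) * V 3 x + (s x)\<^sup>2 * Vd 3 k x)"
  using AE_space by eventually_elim (simp add: space_M dns dss)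
qed

lemma component_relations:
 "AE x in M. (x $ 1 / norm x * cr x + norm x * dc 1 cr x = V 1 x + x $ 1 * Vd 1 1 x + x $ 2 * Vd 2 1 x + x $ 3 * Vd 3 1 x \<and>
   x $ 2 / norm x * cr x + norm x * dc 2 cr x = V 2 x + x $ 1 * Vd 1 2 x + x $ 2 * Vd 2 2 x + x $ 3 * Vd 3 2 x \<and>
   x $ 3 / norm x * cr x + norm x * dc 3 cr x = x $ 1 * Vd 1 3 x + x $ 2 * Vd 2 3 x + V 3 x + x $ 3 * Vd 3 3 x) \<and>
  ((x $ 1 / norm x * s x + norm x * (x $ 1 / s x)) * cp x + norm x * s x * dc 1 cp x
    = x $ 3 * (V 1 x + x $ 1 * Vd 1 1 x + x $ 2 * Vd 2 1 x) - 2 * x $ 1 * V 3 x - (s x)\<^sup>2 * Vd 3 1 x \<and>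
   (x $ 2 / norm x * s x + norm x * (x $ 2 / s x)) * cp x + norm x * s x * dc 2 cp x
    = x $ 3 * (V 2 x + x $ 1 * Vd 1 2 x + x $ 2 * Vd 2 2 x) - 2 * x $ 2 * V 3 x - (s x)\<^sup>2 * Vd 3 2 x \<and>
   (x $ 3 / norm x * s x) * cp x + norm x * s x * dc 3 cp x
    = (x $ 1 * V 1 x + x $ 2 * V 2 x) + x $ 3 * (x $ 1 * Vd 1 3 x + x $ 2 * Vd 2 3 x) - (s x)\<^sup>2 * Vd 3 3 x)"
proof -
 have "AE x in M. x $ 1 / norm x * cr x + norm x * dc 1 cr x = V 1 x + x $ 1 * Vd 1 1 x + x $ 2 * Vd 2 1 x + x $ 3 * Vd 3 1 x"
  using component_derivs(1)[of 1] by (rule AE_mp) simp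
 moreover have "AE x in M. x $ 2 / norm x * cr x + norm x * dc 2 cr x = V 2 x + x $ 1 * Vd 1 2 x + x $ 2 * Vd 2 2 x + x $ 3 * Vd 3 2 x"
  using component_derivs(1)[of 2] by (rule AE_mp) simp
 moreover have "AE x in M. x $ 3 / norm x * cr x + norm x * dc 3 cr x = x $ 1 * Vd 1 3 x + x $ 2 * Vd 2 3 x + V 3 x + x $ 3 * Vd 3 3 x"
  using component_derivs(1)[of 3] by (rule AE_mp) simp
 moreover have "AE x in M. (x $ 1 / norm x * s x + norm x * (x $ 1 / s x)) * cp x + norm x * s x * dc 1 cp x
    = x $ 3 * (V 1 x + x $ 1 * Vd 1 1 x + x $ 2 * Vd 2 1 x) - 2 * x $ 1 * V 3 x - (s x)\<^sup>2 * Vd 3 1 x"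
  using component_derivs(2)[of 1] by (rule AE_mp) (simp add: diff_diff_eq)
 moreover have "AE x in M. (x $ 2 / norm x * s x + norm x * (x $ 2 / s x)) * cp x + norm x * s x * dc 2 cp x
    = x $ 3 * (V 2 x + x $ 1 * Vd 1 2 x + x $ 2 * Vd 2 2 x) - 2 * x $ 2 * V 3 x - (s x)\<^sup>2 * Vd 3 2 x"
  using component_derivs(2)[of 2] by (rule AE_mp) (simp add: diff_diff_eq algebra_simps)
 moreover have "AE x in M. (x $ 3 / norm x * s x) * cp x + norm x * s x * dc 3 cp x
    = (x $ 1 * V 1 x + x $ 2 * V 2 x) + x $ 3 * (x $ 1 * Vd 1 3 x + x $ 2 * Vd 2 3 x) - (s x)\<^sup>2 * Vd 3 3 x"
  using component_derivs(2)[of 3] by (rule AE_mp) simp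
 ultimately show ?thesis by eventually_elim (rule conjI; blast)
qed

lemma vorticity_eq:
 "AE x in M. s x * \<omega> x - (x $ 1 * Vd 1 3 x + x $ 2 * Vd 2 3 x - x $ 1 * Vd 3 1 x - x $ 2 * Vd 3 2 x) = 0"
proof -
 \<comment> \<open>The vorticity contains the chosen derivative of the product
   \<open>rho * cp\<close>, which agrees with the product rule only almost everywhere.\<close>
 have q: "AE x in M. dc k (%y. rho y * cp y) x = x $ k / norm x * cp x + norm x * dc k cp x" for k
 proof -
  have "has_weak_deriv D (ax k) cp (dc k cp)" using H1D(2)[OF H1_cp ax_Basis] by blast
  from has_weak_deriv_weak_deriv(2)[OF has_weak_deriv_mult_smooth[OF open_Dm ax_Basis this smooth_on_norm]]
  have "AE x in M. dc k (%y. norm y * cp y) x = FD norm x (ax k) * cp x + norm x * dc k cp x" .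
  then show ?thesis unfolding rho_def[abs_def] using AE_space by eventually_elim (simp add: space_M norm_derivative)
 qed
 show ?thesis using component_relations q[of 1] q[of 2] q[of 3] AE_space
 proof eventually_elim
  case (elim x)
  then have x: "x \<in> D" by (simp add: space_M)
  interpret coords "x $ 1" "x $ 2" "x $ 3" "norm x" "s x" by (rule coords_Dm[OF x])
  let ?u = "%k. x $ k / norm x * cp x + norm x * dc k cp x"
  have p: "1 / norm x * d_phi D cr x = 1 / norm x * T (dc 1 cr x) (dc 2 cr x) (dc 3 cr x)"
   using d_phi_Dm[OF x, of cr] by (simp add: T_def diff_divide_distrib add_divide_distrib distrib_left mult_ac)
  have r: "d_rho D (%y. rho y * cp y) x = R (?u 1) (?u 2) (?u 3)"
   using d_rho_Dm[OF x, of "%y. rho y * cp y"] unfolding elim(2-4) R_def by (simp add: add_divide_distrib mult.commute)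
  have "\<omega> x = 1 / norm x * R (?u 1) (?u 2) (?u 3) - 1 / norm x * T (dc 1 cr x) (dc 2 cr x) (dc 3 cr x)"
   unfolding omega_theta_def rho_def[of x] p r ..
  then show ?case
   using vorticity[OF components(1,2)[OF x] elim(1)[THEN conjunct1, THEN conjunct1] elim(1)[THEN conjunct1, THEN conjunct2, THEN conjunct1]
    elim(1)[THEN conjunct1, THEN conjunct2, THEN conjunct2] elim(1)[THEN conjunct2, THEN conjunct1] elim(1)[THEN conjunct2, THEN conjunct2, THEN conjunct1]
    elim(1)[THEN conjunct2, THEN conjunct2, THEN conjunct2]] by simp
 qed
qed

lemma vorticity_derivs:
 "AE x in M. (if k = 3 then 0 else x $ k / s x) * \<omega> x + s x * dc k \<omega> x
  = ((if k = 1 then 1 else 0) * Vd 1 3 x + x $ 1 * Vdd 1 3 k x) + ((if k = 2 then 1 else 0) * Vd 2 3 x + x $ 2 * Vdd 2 3 k x)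
   - ((if k = 1 then 1 else 0) * Vd 3 1 x + x $ 1 * Vdd 3 1 k x) - ((if k = 2 then 1 else 0) * Vd 3 2 x + x $ 2 * Vdd 3 2 k x)"
proof -
 have w: "has_weak_deriv D (ax k) \<omega> (dc k \<omega>)" using H1D(2)[OF H1_\<omega> ax_Basis] by blast
 have "AE x in M. (FD s x (ax k) * \<omega> x + s x * dc k \<omega> x)
  - (((if k = 1 then 1 else 0) * Vd 1 3 x + x $ 1 * Vdd 1 3 k x) + ((if k = 2 then 1 else 0) * Vd 2 3 x + x $ 2 * Vdd 2 3 k x)
   - ((if k = 1 then 1 else 0) * Vd 3 1 x + x $ 1 * Vdd 3 1 k x) - ((if k = 2 then 1 else 0) * Vd 3 2 x + x $ 2 * Vdd 3 2 k x)) = 0"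
  by (rule has_weak_deriv_AE_0[OF _ vorticity_eq ax_Basis[of k]])
   (intro wd_diff[OF has_weak_deriv_mult_smooth[OF open_Dm ax_Basis w smooth_on_s]] wd_add wd_diff weak_deriv_nth_mult wd_Vb)
 then show ?thesis using AE_space by eventually_elim (simp add: space_M s_derivative)
qed

text \<open>The Laplacian of a divergence free field is minus its double curl; paired with the gradient of an
 axisymmetric function only the azimuthal component of the vorticity enters.\<close>

lemma laplacian_inner_gradient:
 assumes p: "AE x in M. x $ 1 * p2 x = x $ 2 * p1 x"
 shows "AE x in M. (Vdd 1 1 1 x + Vdd 1 2 2 x + Vdd 1 3 3 x) * p1 x + (Vdd 2 1 1 x + Vdd 2 2 2 x + Vdd 2 3 3 x) * p2 x + (Vdd 3 1 1 x + Vdd 3 2 2 x + Vdd 3 3 3 x) * p3 x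
  = - (- (x $ 1 * p1 x + x $ 2 * p2 x) * dc 3 \<omega> x + (\<omega> x + x $ 1 * dc 1 \<omega> x + x $ 2 * dc 2 \<omega> x) * p3 x) / s x"
 using laplacian_eq_curl vorticity_derivs[of 1] vorticity_derivs[of 2] vorticity_derivs[of 3] p AE_space
proof eventually_elim
 case (elim x)
 then have x: "x \<in> D" by (simp add: space_M)
 interpret coords "x $ 1" "x $ 2" "x $ 3" "norm x" "s x" by (rule coords_Dm[OF x])
 show ?case
  by (rule laplacian_dot_gradient[OF elim(1,2) _ _ _ elim(6)]) (use elim(3-5) in simp_all)
qed

end


section \<open>Bounds on the domain and the radial correction\<close>

context conical_shell
begin

lemma norm_frame: "norm (e_rho x) = 1" "norm (e_phi x) = 1" "norm (e_theta x) = 1"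
proof -
 have "(norm (e_rho x))\<^sup>2 = 1" "(norm (e_phi x))\<^sup>2 = 1" "(norm (e_theta x))\<^sup>2 = 1"
  unfolding power2_norm_real3 e_rho_def e_phi_def e_theta_def vector_3
  using sin_cos_squared_add[of "phi x"] sin_cos_squared_add[of "theta x"] by (algebra, algebra, simp)
 then show "norm (e_rho x) = 1" "norm (e_phi x) = 1" "norm (e_theta x) = 1"
  by (simp_all add: abs_square_eq_1)
qed

text \<open>The quotient is cot \<phi>, at most tan \<alpha> in absolute value on \<open>D\<close>;
  and tan \<alpha> <= cot \<alpha> because sin \<alpha> <= 1/2 <= cos \<alpha>.\<close>

lemma x3_s: "x \<in> D ==> \<bar>x $ 3 / s x\<bar> <= cot \<alpha>"
proof -
 assume x: "x \<in> D"
 have sc: "sin \<alpha> <= cos \<alpha>" "0 < sin \<alpha>" "0 < cos \<alpha>" using sin_\<alpha> cos_\<alpha> by linarith+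
 have "(x $ 3)\<^sup>2 < (sin \<alpha>)\<^sup>2 * ((s x)\<^sup>2 + (x $ 3)\<^sup>2)" using x norm_s[of x] by (simp add: Dm_iff)
 then have "(cos \<alpha>)\<^sup>2 * (x $ 3)\<^sup>2 <= (sin \<alpha>)\<^sup>2 * (s x)\<^sup>2" by (simp add: cos_squared_eq algebra_simps)
 moreover have q: "(sin \<alpha>)\<^sup>2 <= (cos \<alpha>)\<^sup>2" using sc by (intro power_mono) auto
 then have "(sin \<alpha>)\<^sup>2 * (x $ 3)\<^sup>2 <= (cos \<alpha>)\<^sup>2 * (x $ 3)\<^sup>2" "(sin \<alpha>)\<^sup>2 * (s x)\<^sup>2 <= (cos \<alpha>)\<^sup>2 * (s x)\<^sup>2" by (intro mult_right_mono; simp)+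
 ultimately have "(sin \<alpha> * \<bar>x $ 3\<bar>)\<^sup>2 <= (cos \<alpha> * s x)\<^sup>2" by (simp add: power_mult_distrib)
 then have "sin \<alpha> * \<bar>x $ 3\<bar> <= cos \<alpha> * s x" by (rule power2_le_imp_le) (use sc s_pos[OF x] in simp)
 then show ?thesis using sc s_pos[OF x] by (simp add: cot_def field_simps)
qed

lemma inverse_bounds: "x \<in> D ==> \<bar>1 / norm x\<bar> <= 1 / a" "x \<in> D ==> \<bar>1 / s x\<bar> <= 2 / a"
proof -
 assume x: "x \<in> D"
 have n: "a < norm x" "a / 2 < s x" using norm_Dm(1)[OF x] s_lower[OF x] by linarith+
 show "\<bar>1 / norm x\<bar> <= 1 / a" using n a_pos by (simp add: frac_le)
 have "1 / s x <= 1 / (a / 2)" using n a_pos by (intro frac_le) auto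
 then show "\<bar>1 / s x\<bar> <= 2 / a" using s_pos[OF x] by simp
qed

lemma inverse_s_derivative:
 "x \<in> D ==> FD (%x. 1 / s x) x (ax k) = (if k = 3 then 0 else - (x $ k / s x ^ 3))"
proof -
 assume x: "x \<in> D"
 have "(s has_derivative FD s x) (at x)"
  using smooth_on_differentiable[OF smooth_on_s x] by (simp add: frechet_derivative_works)
 from Deriv.has_derivative_inverse[OF _ this] s_pos[OF x]
 have "((%x. 1 / s x) has_derivative (%h. - (inverse (s x) * FD s x h * inverse (s x)))) (at x)"
  by (simp add: inverse_eq_divide)
 from fun_cong[OF frechet_derivative_at[OF this], of "ax k"] s_derivative[OF x, of k] show ?thesis
  by (auto simp: inverse_eq_divide power3_eq_cube)
qed

lemma L2_cong_on: "L2 M f ==> (\<And>x. x \<in> D ==> f x = g x) ==> L2 M g" for f :: "real^3 => real"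
proof -
 assume f: "L2 M f" and e: "\<And>x. x \<in> D ==> f x = g x"
 have "g \<in> borel_measurable M \<longleftrightarrow> f \<in> borel_measurable M" by (rule measurable_cong) (simp add: space_M e)
 then show ?thesis by (intro L2_cong_AE[OF f]) (use f e in \<open>auto simp: L2_def space_M\<close>)
qed

lemma L2_mult_smooth:
 fixes f :: "real^3 => real"
 assumes "L2 M f" "smooth_on D u" "\<And>x. x \<in> D ==> \<bar>u x\<bar> <= C" shows "L2 M (%x. u x * f x)"
 by (rule L2_mult_bounded[OF assms(1) smooth_on_measurable_M[OF assms(2)], where C=C]) (use assms(3) space_M in auto)

lemma L2_norm_mult_smooth:
 fixes f :: "real^3 => real"
 assumes f: "L2 M f" "smooth_on D u" and u: "\<And>x. x \<in> D ==> \<bar>u x\<bar> <= C" and C: "0 <= C"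
 shows "L2_norm M (%x. u x * f x) <= C * L2_norm M f"
proof -
 have "L2_norm M (%x. u x * f x) <= L2_norm M (%x. C * f x)"
 proof (rule L2_norm_mono[OF L2_scale[OF f(1)]])
  show "(%x. u x * f x) \<in> borel_measurable M" using L2_mult_smooth[OF f u] by (simp add: L2_def)
  show "AE x in M. \<bar>u x * f x\<bar> <= \<bar>C * f x\<bar>"
   using u C by (intro AE_I2) (auto simp: space_M abs_mult intro!: mult_right_mono)
 qed
 then show ?thesis using C by (simp add: L2_norm_scale)
qed

lemma L2_norm_diff_le:
 fixes f g :: "real^3 => real"
 assumes "L2 M f" "L2 M g" shows "L2_norm M (%x. f x - g x) <= L2_norm M f + L2_norm M g"
 using L2_norm_triangle[OF assms(1) L2_scale[OF assms(2), of "-1"]] L2_norm_scale[of M "-1" g] by simp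

lemma frame_coefficient_bounds:
 assumes x: "x \<in> D"
 shows "\<bar>x $ i / norm x\<bar> <= 1" "\<bar>x $ i * x $ 3 / (norm x * s x)\<bar> <= cot \<alpha>" "\<bar>s x / norm x\<bar> <= 1"
proof -
 have n: "0 < norm x" using Dm_nonzero[OF x] by simp
 show 1: "\<bar>x $ i / norm x\<bar> <= 1" using component_le_norm_cart[of x i] n by simp
 have "\<bar>x $ i / norm x\<bar> * \<bar>x $ 3 / s x\<bar> <= 1 * cot \<alpha>" by (intro mult_mono 1 x3_s x) auto
 then show "\<bar>x $ i * x $ 3 / (norm x * s x)\<bar> <= cot \<alpha>" by (simp add: abs_mult)
 have "(s x)\<^sup>2 <= (norm x)\<^sup>2" using norm_s[of x] by simp
 then have "s x <= norm x" by (rule power2_le_imp_le) simp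
 then show "\<bar>s x / norm x\<bar> <= 1" using s_pos[OF x] n by simp
qed

lemma smooth_on_frame:
 "smooth_on D (%x. x $ i / norm x)" "smooth_on D (%x. x $ i * x $ 3 / (norm x * s x))" "smooth_on D (%x. x $ i / s x)" "smooth_on D (%x. s x / norm x)"
 "smooth_on D (%x. 1 / norm x)" "smooth_on D (%x. 1 / s x)"
 by (intro smooth_on_divide smooth_on_mult smooth_on_vec_nth smooth_on_const open_Dm smooth_on_norm smooth_on_s; use s_pos Dm_nonzero in auto)+

lemma L2_spherical_derivs:
 assumes "\<And>k. L2 M (weak_deriv D (ax k) f)"
 shows "L2 M (d_rho D f)" "L2 M (%x. d_phi D f x / rho x)"
proof -
 note u = L2_mult_smooth[OF assms smooth_on_frame(1) frame_coefficient_bounds(1)]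
  L2_mult_smooth[OF assms smooth_on_frame(2) frame_coefficient_bounds(2)] L2_mult_smooth[OF assms smooth_on_frame(4) frame_coefficient_bounds(3)]
 show "L2 M (d_rho D f)"
  by (rule L2_cong_on[OF L2_add[OF L2_add[OF u(1)[of 1 1] u(1)[of 2 2]] u(1)[of 3 3]]]) (simp_all add: d_rho_Dm mult.commute)
 show "L2 M (%x. d_phi D f x / rho x)"
  by (rule L2_cong_on[OF L2_diff[OF L2_add[OF u(2)[of 1 1] u(2)[of 2 2]] u(3)[of 3]]]) (simp_all add: rho_def d_phi_Dm mult.commute)
qed

text \<open>The slope is forced by the requirement \<open>hh = -2\<close> on the unit sphere, where
  the vorticity has trace 2 \<open>cp\<close>; the factor \<open>a - norm x\<close> switches the
  correction off on the inner sphere, where the vorticity has trace 0.\<close>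

definition \<kappa> :: real where "\<kappa> = 2 / (1 - a)"
definition hh :: "real^3 => real" where "hh x = \<kappa> * (a - norm x)"

lemma \<kappa>_bounds: "0 < \<kappa>" "\<kappa> <= 3" "\<kappa> * (1 - a) = 2"
 using a_le by (simp_all add: \<kappa>_def field_simps)

text \<open>The second bound uses that \<open>norm x - a\<close> is at most \<open>norm x\<close>.
  It does not involve \<open>a\<close>, which is why the correction causes no negative power of the
  inner radius.\<close>

lemma hh_bounds: assumes "x \<in> D" shows "\<bar>hh x\<bar> <= 2" "\<bar>hh x / norm x\<bar> <= \<kappa>"
proof -
 note n = norm_Dm[OF assms]
 have "\<kappa> * (norm x - a) <= \<kappa> * (1 - a)" using n \<kappa>_bounds(1) by (intro mult_left_mono) auto
 then show "\<bar>hh x\<bar> <= 2" using n \<kappa>_bounds by (simp add: hh_def abs_mult)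
 have "\<kappa> * (norm x - a) <= \<kappa> * norm x" using a_pos \<kappa>_bounds(1) by (intro mult_left_mono) auto
 then show "\<bar>hh x / norm x\<bar> <= \<kappa>" using n \<kappa>_bounds(1) a_pos by (simp add: hh_def abs_mult divide_le_eq)
qed

lemma smooth_on_hh: "smooth_on D hh"
 unfolding hh_def[abs_def] by (intro smooth_on_mult smooth_on_diff smooth_on_const smooth_on_norm open_Dm)

lemma hh_derivative: "x \<in> D ==> FD hh x (ax k) = - \<kappa> * (x $ k / norm x)"
proof -
 assume x: "x \<in> D"
 have "(norm has_derivative FD norm x) (at x)"
  using smooth_on_differentiable[OF smooth_on_norm x] by (simp add: frechet_derivative_works)
 then have "(hh has_derivative (%h. \<kappa> * (0 - FD norm x h))) (at x)"
  unfolding hh_def[abs_def] by (intro has_derivative_mult_right has_derivative_diff has_derivative_const)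
 from fun_cong[OF frechet_derivative_at[OF this], of "ax k"] norm_derivative[OF x, of k] show ?thesis by simp
qed

end

section \<open>The corrected vorticity and the pressure estimate\<close>

context velocity
begin

lemmas L2_cr = H1D(1)[OF H1_cr] and L2_cp = H1D(1)[OF H1_cp] and L2_\<omega> = H1D(1)[OF H1_\<omega>]
 and L2_dcr = H1D(3)[OF H1_cr ax_Basis] and L2_dcp = H1D(3)[OF H1_cp ax_Basis] and L2_d\<omega> = H1D(3)[OF H1_\<omega> ax_Basis]

definition ff :: "real^3 => real" where "ff x = \<omega> x + hh x * cp x"
definition ffb :: "real^3 => real^3 => real" where
 "ffb b x = weak_deriv D b \<omega> x + (FD hh x b * cp x + hh x * weak_deriv D b cp x)"
text \<open>Division by \<open>s\<close> because the potential in \<open>orthogonal_curl\<close> is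
  s g e_theta, and it should equal \<open>ff\<close> e_theta here.\<close>

definition gg :: "real^3 => real" where "gg x = 1 / s x * ff x"
definition ggb :: "real^3 => real^3 => real" where
 "ggb b x = FD (%x. 1 / s x) x b * ff x + 1 / s x * ffb b x"

text \<open>By the choice of \<^const>\<open>hh\<close> the vorticity plus \<open>hh * cp\<close> has zero trace on all of the boundary.\<close>

lemma vanishes_ff: "vanishes j ff"
proof -
 have lr: "L2 M (%x. 2 / rho x * cp x)"
  by (rule L2_cong_on[OF L2_scale[OF L2_mult_smooth[OF L2_cp smooth_on_frame(5) inverse_bounds(1)], of 2]]) (simp_all add: rho_def)
 have v1: "vanishes 1 (%x. \<omega> x - 2 / rho x * cp x)" by (rule vanishes_A2[OF bc(9) L2_diff[OF L2_\<omega> lr]])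
 have v2: "vanishes 2 \<omega>" using vanishes_A1[OF bc(8)] L2_\<omega> by simp
 have v3: "vanishes 3 \<omega>" using vanishes_R[OF bc(6,7)] L2_\<omega> by simp
 consider "j = 1" | "j = 2" | "j = 3" using exhaust_3 by blast
 then show ?thesis
 proof cases
  case 1
  \<comment> \<open>The quotient of \<open>2 / norm x + hh x\<close> by \<open>d 1 x\<close>. Since
    \<kappa> (1 - a) = 2, the numerator is (2 / norm x + \<kappa>) (1 - norm x), so the factor 1 -
    norm x cancels. Then \<open>ff\<close> is the function with zero trace
    \<open>\<omega> - 2 / rho * cp\<close> plus a bounded multiple of
    \<open>d 1 * cp\<close>.\<close>
  let ?w = "%x. (2 / norm x + \<kappa>) / (1 + norm x)"
  have p: "0 < 1 + norm x" for x :: "real^3" using norm_ge_zero[of x] by linarith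
  have sm: "smooth_on D ?w"
   by (intro smooth_on_divide smooth_on_add smooth_on_const smooth_on_norm open_Dm) (use Dm_nonzero p in auto)
  have b: "\<bar>?w x\<bar> <= 2 / a + \<kappa>" if "x \<in> D" for x
  proof -
   have n: "a < norm x" using norm_Dm(1)[OF that] .
   have "0 <= 2 / norm x + \<kappa>" using \<kappa>_bounds(1) by simp
   then have "?w x <= (2 / norm x + \<kappa>) / 1" "0 <= ?w x" using p[of x] by (intro divide_left_mono divide_nonneg_pos; simp)+
   moreover have "2 / norm x <= 2 / a" using n a_pos by (simp add: frac_le)
   ultimately show ?thesis by simp
  qed
  have "vanishes 1 (%x. (\<omega> x - 2 / rho x * cp x) + ?w x * (d 1 x * cp x))"
   by (rule vanishes_add[OF v1 vanishes_mult_bounded[OF vanishes_distance_mult[OF L2_cp] smooth_on_M[OF sm] b]])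
  then show ?thesis unfolding 1
  proof (rule vanishes_cong)
   fix x assume x: "x \<in> D"
   define n where "n = norm x"
   have n: "n ~= 0" "1 + n ~= 0" using Dm_nonzero[OF x] p[of x] unfolding n_def by simp_all
   have c: "y / u * (u * z) = y * z" if "u ~= 0" for y u z :: real using that by simp
   have "1 - n\<^sup>2 = (1 + n) * (1 - n)" by (simp add: power2_eq_square algebra_simps)
   then have "(2 / n + \<kappa>) / (1 + n) * (1 - n\<^sup>2) = (2 / n + \<kappa>) * (1 - n)" by (simp only: c[OF n(2)])
   also have "\<dots> = 2 / n + \<kappa> * (a - n)"
   proof -
    have g: "(q + k) * (1 - n) = q + k * (b - n)" if "q * n = 2" "k * (1 - b) = 2" for q k b n :: real
    proof -
     have "(q + k) * (1 - n) - (q + k * (b - n)) = k * (1 - b) - q * n" by (simp add: algebra_simps)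
     then show ?thesis using that by simp
    qed
    show ?thesis by (rule g[OF _ \<kappa>_bounds(3)]) (use n in simp)
   qed
   finally have "(2 / n + \<kappa>) / (1 + n) * (1 - n\<^sup>2) = 2 / n + \<kappa> * (a - n)" .
   then have e: "?w x * d 1 x = 2 / rho x + hh x" by (simp add: n_def d_def hh_def rho_def)
   have "?w x * (d 1 x * cp x) = (?w x * d 1 x) * cp x" by (simp only: mult.assoc)
   then show "(\<omega> x - 2 / rho x * cp x) + ?w x * (d 1 x * cp x) = ff x" unfolding e ff_def by (simp add: algebra_simps)
  qed
 next
  case 2
  \<comment> \<open>The quotient of \<open>hh\<close> by \<open>d 2\<close>: the factor norm x - a
    cancels, so near the inner sphere the correction is a bounded multiple of
    \<open>d 2 * cp\<close>.\<close>
  let ?w = "%x. - \<kappa> / (norm x + a)"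
  have p: "norm x + a > a" if "x \<in> D" for x :: "real^3" using Dm_nonzero[OF that] by simp
  have sm: "smooth_on D ?w"
   by (intro smooth_on_divide smooth_on_add smooth_on_const smooth_on_norm open_Dm order.strict_trans[OF a_pos p])
  have b: "\<bar>?w x\<bar> <= \<kappa> / a" if "x \<in> D" for x
   using p[OF that] order.strict_trans[OF a_pos p[OF that]] a_pos \<kappa>_bounds(1) by (auto intro!: divide_left_mono mult_pos_pos)
  have "vanishes 2 (%x. \<omega> x + ?w x * (d 2 x * cp x))"
   by (rule vanishes_add[OF v2 vanishes_mult_bounded[OF vanishes_distance_mult[OF L2_cp] smooth_on_M[OF sm] b]])
  then show ?thesis unfolding 2
  proof (rule vanishes_cong)
   fix x assume x: "x \<in> D"
   define n where "n = norm x"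
   have n: "n + a ~= 0" using order.strict_trans[OF a_pos p[OF x]] unfolding n_def by simp
   have c: "- k / u * (u * z) = - k * z" if "u ~= 0" for k u z :: real using that by simp
   have "n\<^sup>2 - a\<^sup>2 = (n + a) * (n - a)" by (simp add: power2_eq_square algebra_simps)
   then have "- \<kappa> / (n + a) * (n\<^sup>2 - a\<^sup>2) = - \<kappa> * (n - a)" by (simp only: c[OF n])
   also have "\<dots> = \<kappa> * (a - n)" by (simp only: mult_minus_left mult_minus_right[symmetric] minus_diff_eq)
   finally have e: "?w x * d 2 x = hh x" by (simp add: n_def d_def hh_def)
   have "?w x * (d 2 x * cp x) = (?w x * d 2 x) * cp x" by (simp only: mult.assoc)
   then show "\<omega> x + ?w x * (d 2 x * cp x) = ff x" unfolding e ff_def by simp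
  qed
 next
  case 3
  show ?thesis unfolding 3 ff_def[abs_def]
   by (rule vanishes_add[OF v3 vanishes_mult_bounded[OF vanishes_cp smooth_on_M[OF smooth_on_hh] hh_bounds(1)]])
 qed
qed

lemma adm_gg: "adm gg ggb"
 unfolding gg_def[abs_def] ggb_def[abs_def]
 by (rule adm_mult[OF _ smooth_on_frame(6)], unfold ff_def[abs_def] ffb_def[abs_def], rule adm_add[OF adm_\<omega> adm_mult[OF adm_cp smooth_on_hh]])

lemma L2_gg: "L2 M ff" "L2 M (ffb (ax i))" "L2 M gg" "L2 M (ggb (ax i))"
proof -
 show f: "L2 M ff" unfolding ff_def[abs_def] by (rule L2_add[OF L2_\<omega> L2_mult_smooth[OF L2_cp smooth_on_hh hh_bounds(1)]])
 have "\<bar>FD hh x (ax i)\<bar> <= \<kappa> * 1" if "x \<in> D" for x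
  unfolding hh_derivative[OF that] abs_mult by (rule mult_mono[OF _ frame_coefficient_bounds(1)[OF that]]) (use \<kappa>_bounds in auto)
 from L2_mult_smooth[OF L2_cp smooth_on_deriv[OF smooth_on_hh ax_Basis] this]
 show fb: "L2 M (ffb (ax i))" unfolding ffb_def[abs_def]
  by (intro L2_add L2_d\<omega> L2_mult_smooth[OF L2_dcp smooth_on_hh hh_bounds(1)])
 show "L2 M gg" unfolding gg_def[abs_def] by (rule L2_mult_smooth[OF f smooth_on_frame(6) inverse_bounds(2)])
 have b: "\<bar>FD (%x. 1 / s x) x (ax i)\<bar> <= 1 * (2 / a) ^ 3" if "x \<in> D" for x
 proof -
  have "\<bar>x $ i\<bar> <= 1" using component_le_norm_cart[of x i] norm_Dm(2)[OF that] by linarith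
  then have "\<bar>x $ i\<bar> * \<bar>1 / s x\<bar> ^ 3 <= 1 * (2 / a) ^ 3" by (intro mult_mono power_mono inverse_bounds that) auto
  then show ?thesis unfolding inverse_s_derivative[OF that] using s_pos[OF that] a_pos by (simp add: power_divide)
 qed
 show "L2 M (ggb (ax i))" unfolding ggb_def[abs_def]
  by (rule L2_add[OF L2_mult_smooth[OF f smooth_on_deriv[OF smooth_on_frame(6) ax_Basis] b] L2_mult_smooth[OF fb smooth_on_frame(6) inverse_bounds(2)]])
qed

definition curl_integrand :: "(real^3 => real) => (real^3 => real) => (real^3 => real) => real^3 => real" where
 "curl_integrand p1 p2 p3 x = - (x $ 1 * ggb (ax 3) x * p1 x) - x $ 2 * ggb (ax 3) x * p2 x
   + (2 * gg x + x $ 1 * ggb (ax 1) x + x $ 2 * ggb (ax 2) x) * p3 x"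

lemma integral_curl_integrand:
 assumes "H1 Q q"
 shows "integrable M (curl_integrand (q (ax 1)) (q (ax 2)) (q (ax 3)))" "(\<integral>x. curl_integrand (q (ax 1)) (q (ax 2)) (q (ax 3)) x \<partial>M) = 0"
proof -
 note p = H1D(3)[OF assms ax_Basis]
 have c: "L2 M (%x. x $ i * ggb (ax j) x)" for i j by (intro L2_continuous_mult L2_gg continuous_intros)
 show "integrable M (curl_integrand (q (ax 1)) (q (ax 2)) (q (ax 3)))" unfolding curl_integrand_def[abs_def]
  by (intro Bochner_Integration.integrable_add Bochner_Integration.integrable_diff Bochner_Integration.integrable_minus L2_integrable_mult p L2_add c L2_scale L2_gg)
 show "(\<integral>x. curl_integrand (q (ax 1)) (q (ax 2)) (q (ax 3)) x \<partial>M) = 0" unfolding curl_integrand_def[abs_def]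
  by (rule orthogonal_curl[OF adm_gg L2_gg(3) L2_gg(4) _ assms])
   (unfold gg_def[abs_def], rule vanishes_mult_bounded[OF vanishes_ff smooth_on_M[OF smooth_on_frame(6)] inverse_bounds(2)])
qed

definition Tr :: "real^3 => real" where "Tr x = cr x * d_rho D cr x + 1 / rho x * cp x * d_phi D cr x"
definition Tp :: "real^3 => real" where "Tp x = cr x * (d_rho D cp x + 1 / rho x * cp x) + 1 / rho x * cp x * d_phi D cp x"
definition Bq :: "real^3 => real" where "Bq x = 1 / rho x * ((cp x)\<^sup>2 + (ct x)\<^sup>2)"
definition Bt :: "real^3 => real" where "Bt x = 1 / rho x * (ct x)\<^sup>2"
text \<open>With \<open>Fp\<close>, the e_rho and e_phi components of what remains of the equation
  once the time derivative and the curl of \<open>ff\<close> e_theta are removed: the curl of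
  \<open>hh * cp\<close> e_theta minus the convection.\<close>

definition Fr :: "real^3 => real" where
 "Fr x = hh x * (d_phi D cp x / rho x) + hh x / norm x * (x $ 3 / s x) * cp x - Tr x + Bq x"
definition Fp :: "real^3 => real" where
 "Fp x = - hh x * d_rho D cp x + (\<kappa> - hh x / norm x) * cp x - Tp x + x $ 3 / s x * Bt x"

text \<open>The scalar product of the equation with the gradient. The Laplacian contributes minus
  the curl of the vorticity, and \<omega> = \<open>ff\<close> - \<open>hh * cp\<close> splits it
  into the part that integrates to 0 and an explicit part with first derivatives of
  \<open>cp\<close>. \<open>G\<close> stands for the time derivative, in whichever representative is
  at hand.\<close>

lemma pressure_identity:
 assumes eq: "AE x in M. weak_laplacian D w x - convection D w w x - weak_grad D Q x - G x = 0"
  and q: "AE x in M. x $ 1 * dc 2 Q x = x $ 2 * dc 1 Q x"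
 shows "AE x in M. (norm (weak_grad D Q x))\<^sup>2 = - curl_integrand (dc 1 Q) (dc 2 Q) (dc 3 Q) x - G x \<bullet> weak_grad D Q x
  + d_rho D Q x * Fr x + d_phi D Q x / rho x * Fp x"
proof -
 have tr: "AE x in M. x $ 1 * dc 2 cr x = x $ 2 * dc 1 cr x" by (rule theta_indep_deriv[OF H1_cr theta_indep_components(4)])
 have tp: "AE x in M. x $ 1 * dc 2 cp x = x $ 2 * dc 1 cp x" by (rule theta_indep_deriv[OF H1_cp theta_indep_components(5)])
 show ?thesis using eq laplacian_inner_gradient[OF q, of "dc 3 Q"] component_relations tr tp q AE_space
 proof eventually_elim
  case (elim x)
  then have x: "x \<in> D" by (simp add: space_M)
  interpret coords "x $ 1" "x $ 2" "x $ 3" "norm x" "s x" by (rule coords_Dm[OF x])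
  define p where "p k = dc k Q x" for k
  have RP: "R f1 f2 f3 = prr f1 f2 f3" "T f1 f2 f3 / norm x = pff f1 f2 f3" for f1 f2 f3
   using sp by (simp_all add: R_def prr_def T_def pff_def diff_divide_distrib add_divide_distrib distrib_left mult_ac)
  have dr: "d_rho D f x = R (dc 1 f x) (dc 2 f x) (dc 3 f x)" for f unfolding RP d_rho_Dm[OF x] prr_def ..
  have df: "d_phi D f x = T (dc 1 f x) (dc 2 f x) (dc 3 f x)" for f
  proof -
   have "d_phi D f x / norm x = T (dc 1 f x) (dc 2 f x) (dc 3 f x) / norm x" unfolding RP d_phi_Dm[OF x] pff_def ..
   then show ?thesis using rp by simp
  qed
  have Q1: "prr (p 1) (p 2) (p 3) = d_rho D Q x" "pff (p 1) (p 2) (p 3) = d_phi D Q x / rho x"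
   unfolding p_def dr df RP(1)[symmetric] RP(2)[symmetric] rho_def by (rule refl)+
  have gQ: "weak_grad D Q x $ i = p i" for i
   using exhaust_3[of i] by (auto simp: weak_grad_def sum_Basis_real3 p_def ax_nth)
  have Gi: "G x $ i = (Vdd i 1 1 x + Vdd i 2 2 x + Vdd i 3 3 x) - (V 1 x * Vd i 1 x + V 2 x * Vd i 2 x + V 3 x * Vd i 3 x) - p i" for i
  proof -
   have "weak_laplacian D w x $ i = Vdd i 1 1 x + Vdd i 2 2 x + Vdd i 3 3 x"
    by (simp add: weak_laplacian_def sum_Basis_real3 Vbc_def inner_axis)
   moreover have "convection D w w x $ i = V 1 x * Vd i 1 x + V 2 x * Vd i 2 x + V 3 x * Vd i 3 x"
    by (simp add: convection_def sum_Basis_real3 Vb_def V_def inner_axis)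
   moreover have "(weak_laplacian D w x - convection D w w x - weak_grad D Q x - G x) $ i = 0" using elim(1) by simp
   ultimately show ?thesis by (simp add: gQ)
  qed
  have p: "x $ 1 * p 2 = x $ 2 * p 1" using elim(6) by (simp add: p_def)
  define Lp where "Lp = (Vdd 1 1 1 x + Vdd 1 2 2 x + Vdd 1 3 3 x) * p 1 + (Vdd 2 1 1 x + Vdd 2 2 2 x + Vdd 2 3 3 x) * p 2 + (Vdd 3 1 1 x + Vdd 3 2 2 x + Vdd 3 3 3 x) * p 3"
  define Cp where "Cp = (V 1 x * Vd 1 1 x + V 2 x * Vd 1 2 x + V 3 x * Vd 1 3 x) * p 1 + (V 1 x * Vd 2 1 x + V 2 x * Vd 2 2 x + V 3 x * Vd 2 3 x) * p 2 + (V 1 x * Vd 3 1 x + V 2 x * Vd 3 2 x + V 3 x * Vd 3 3 x) * p 3"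
  have n: "(norm (weak_grad D Q x))\<^sup>2 = Lp - Cp - G x \<bullet> weak_grad D Q x"
   unfolding power2_norm_real3 inner_real3 gQ Gi Lp_def Cp_def by (simp add: algebra_simps power2_eq_square)
  have C: "Cp = d_rho D Q x * (Tr x - Bq x) + d_phi D Q x / rho x * (Tp x - x $ 3 / s x * Bt x)"
   unfolding Q1[symmetric] unfolding Cp_def Tr_def Tp_def Bq_def Bt_def dr[of cr] dr[of cp] df[of cr] df[of cp] rho_def
   by (rule convection_spherical[OF components(1-3)[OF x] elim(3)[THEN conjunct1, THEN conjunct1] elim(3)[THEN conjunct1, THEN conjunct2, THEN conjunct1]
    elim(3)[THEN conjunct1, THEN conjunct2, THEN conjunct2] elim(3)[THEN conjunct2, THEN conjunct1] elim(3)[THEN conjunct2, THEN conjunct2, THEN conjunct1]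
    elim(3)[THEN conjunct2, THEN conjunct2, THEN conjunct2] elim(4,5) p])
  define u where "u k = FD hh x (ax k) * cp x + hh x * dc k cp x" for k
  have f: "ffb (ax k) x = dc k \<omega> x + u k" for k by (simp add: ffb_def u_def)
  have gd: "gg x = ff x / s x" "ggb (ax 1) x = ffb (ax 1) x / s x - x $ 1 / s x ^ 3 * ff x" "ggb (ax 2) x = ffb (ax 2) x / s x - x $ 2 / s x ^ 3 * ff x" "ggb (ax 3) x = ffb (ax 3) x / s x"
   by (simp_all add: gg_def ggb_def inverse_s_derivative[OF x])
  have K: "curl_integrand (dc 1 Q) (dc 2 Q) (dc 3 Q) x = (- (x $ 1 * p 1 + x $ 2 * p 2) * ffb (ax 3) x + (ff x + x $ 1 * ffb (ax 1) x + x $ 2 * ffb (ax 2) x) * p 3) / s x"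
   unfolding curl_integrand_def p_def[symmetric] by (rule curl_integrand_quotient[OF gd])
  have S: "(- (x $ 1 * p 1 + x $ 2 * p 2) * u 3 + (hh x * cp x + x $ 1 * u 1 + x $ 2 * u 2) * p 3) / s x
   = prr (p 1) (p 2) (p 3) * (hh x * (T (dc 1 cp x) (dc 2 cp x) (dc 3 cp x) / norm x) + hh x * (x $ 3 / (s x * norm x)) * cp x)
    - pff (p 1) (p 2) (p 3) * (hh x * R (dc 1 cp x) (dc 2 cp x) (dc 3 cp x) + (- \<kappa> + hh x / norm x) * cp x)"
   by (rule curl_integrand_spherical[OF p refl]) (simp_all add: u_def hh_derivative[OF x])
  have L: "Lp = - curl_integrand (dc 1 Q) (dc 2 Q) (dc 3 Q) x + d_rho D Q x * (Fr x + Tr x - Bq x) + d_phi D Q x / rho x * (Fp x + Tp x - x $ 3 / s x * Bt x)"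
  proof -
   have "Lp = - (- (x $ 1 * p 1 + x $ 2 * p 2) * dc 3 \<omega> x + (\<omega> x + x $ 1 * dc 1 \<omega> x + x $ 2 * dc 2 \<omega> x) * p 3) / s x"
    using elim(2) unfolding Lp_def p_def .
   also have "\<dots> = - curl_integrand (dc 1 Q) (dc 2 Q) (dc 3 Q) x + (- (x $ 1 * p 1 + x $ 2 * p 2) * u 3 + (hh x * cp x + x $ 1 * u 1 + x $ 2 * u 2) * p 3) / s x"
    unfolding K f ff_def using sp by (simp add: field_simps)
   also have "(- (x $ 1 * p 1 + x $ 2 * p 2) * u 3 + (hh x * cp x + x $ 1 * u 1 + x $ 2 * u 2) * p 3) / s x
     = d_rho D Q x * (Fr x + Tr x - Bq x) + d_phi D Q x / rho x * (Fp x + Tp x - x $ 3 / s x * Bt x)"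
    unfolding S Q1 dr[symmetric] df[symmetric] Fr_def Fp_def rho_def by (simp add: algebra_simps)
   finally show ?thesis by (simp only: add.assoc)
  qed
  show ?case unfolding n L C by (simp add: algebra_simps)
 qed
qed

lemma components_bounded:
 obtains C where "0 <= C" "AE x in M. \<bar>cr x\<bar> <= C" "AE x in M. \<bar>cp x\<bar> <= C" "AE x in M. \<bar>ct x\<bar> <= C"
proof -
 obtain C where C: "AE x in M. norm (w x) <= C" using w_bounded by blast
 have le: "\<bar>cr x\<bar> <= norm (w x)" "\<bar>cp x\<bar> <= norm (w x)" "\<bar>ct x\<bar> <= norm (w x)" for x
  using Cauchy_Schwarz_ineq2[of "w x" "e_rho x"] Cauchy_Schwarz_ineq2[of "w x" "e_phi x"] Cauchy_Schwarz_ineq2[of "w x" "e_theta x"]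
  by (simp_all add: c_rho_def c_phi_def c_theta_def norm_frame)
 have "AE x in M. \<bar>cr x\<bar> <= max 0 C" "AE x in M. \<bar>cp x\<bar> <= max 0 C" "AE x in M. \<bar>ct x\<bar> <= max 0 C"
  using C by (eventually_elim; use le order_trans in fastforce)+
 then show thesis using that[of "max 0 C"] by simp
qed

lemma L2_ct: "L2 M ct"
proof -
 have e: "1 / s x * (x $ 1 * V 2 x) - 1 / s x * (x $ 2 * V 1 x) = ct x" if "x \<in> D" for x
 proof -
  have "1 / s x * (x $ 1 * V 2 x) - 1 / s x * (x $ 2 * V 1 x) = s x * ct x / s x"
   unfolding components(3)[OF that] by (simp add: diff_divide_distrib)
  then show ?thesis using s_pos[OF that] by simp
 qed
 show ?thesis
 by (rule L2_cong_on[OF L2_diff[OF L2_mult_smooth[OF L2_continuous_mult[OF continuous_on_component[OF continuous_on_id, of _ 1] L2_V[of 2]] smooth_on_frame(6) inverse_bounds(2)]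
   L2_mult_smooth[OF L2_continuous_mult[OF continuous_on_component[OF continuous_on_id, of _ 2] L2_V[of 1]] smooth_on_frame(6) inverse_bounds(2)]]])
  (assumption | rule e)+
qed

text \<open>Each product has one factor bounded by the bound on the velocity and one square
  integrable factor; 1 / rho is bounded on \<open>D\<close>.\<close>

lemma L2_forces: "L2 M Tr" "L2 M Tp" "L2 M Bq" "L2 M Bt"
proof -
 obtain C where C: "AE x in M. \<bar>cr x\<bar> <= C" "AE x in M. \<bar>cp x\<bar> <= C" "AE x in M. \<bar>ct x\<bar> <= C" using components_bounded by blast
 note b = L2_mult_bounded[OF _ L2D(1)[OF L2_cr] C(1)] L2_mult_bounded[OF _ L2D(1)[OF L2_cp] C(2)] L2_mult_bounded[OF _ L2D(1)[OF L2_ct] C(3)]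
 note r = L2_mult_smooth[OF L2_cp smooth_on_frame(5) inverse_bounds(1)] L2_mult_smooth[OF L2_ct smooth_on_frame(5) inverse_bounds(1)]
 have e: "cr x * (d_rho D cp x + 1 / norm x * cp x) + cp x * (d_phi D cp x / rho x) = Tp x" for x
  unfolding Tp_def rho_def by simp
 have e2: "cp x * (1 / norm x * cp x) + ct x * (1 / norm x * ct x) = Bq x" and e3: "ct x * (1 / norm x * ct x) = Bt x" for x
  unfolding Bq_def Bt_def rho_def by (simp_all add: power2_eq_square add_divide_distrib)
 note dr = L2_spherical_derivs[of cr, OF L2_dcr] and dp = L2_spherical_derivs[of cp, OF L2_dcp]
 show "L2 M Tr"
  by (rule L2_cong_on[OF L2_add[OF b(1)[OF dr(1)] b(2)[OF dr(2)]]]) (simp add: Tr_def algebra_simps)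
 show "L2 M Tp"
  by (rule L2_cong_on[OF L2_add[OF b(1)[OF L2_add[OF dp(1) r(1)]] b(2)[OF dp(2)]]]) (assumption | rule e)+
 show "L2 M Bq"
  by (rule L2_cong_on[OF L2_add[OF b(2)[OF r(1)] b(3)[OF r(2)]]]) (assumption | rule e2)+
 show "L2 M Bt"
  by (rule L2_cong_on[OF b(3)[OF r(2)]]) (assumption | rule e3)+
qed

lemma cot_nonneg: "0 <= cot \<alpha>"
 using sin_\<alpha> cos_\<alpha> by (simp add: cot_def)

text \<open>The constants come from |hh| <= 2, from |hh| / rho <= \<kappa> <= 3, whence \<kappa> -
  hh / rho is at most 6, and from |x3 / s| <= cot \<alpha>. The swirl term is bounded by the full
  quadratic term.\<close>

lemma L2_Fr_Fp:
 shows "L2 M Fr" "L2_norm M Fr <= 2 * L2_norm M (%x. d_phi D cp x / rho x) + 3 * cot \<alpha> * L2_norm M cp + L2_norm M Tr + L2_norm M Bq"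
  and "L2 M Fp" "L2_norm M Fp <= 2 * L2_norm M (d_rho D cp) + 6 * L2_norm M cp + L2_norm M Tp + cot \<alpha> * L2_norm M Bq"
proof -
 note dp = L2_spherical_derivs[of cp, OF L2_dcp]
 have sm: "smooth_on D (%x. hh x / norm x * (x $ 3 / s x))" "smooth_on D (%x. - hh x)" "smooth_on D (%x. \<kappa> - hh x / norm x)"
  by (intro smooth_on_mult smooth_on_uminus smooth_on_diff smooth_on_const smooth_on_divide[OF open_Dm smooth_on_hh smooth_on_norm] smooth_on_hh smooth_on_frame open_Dm; use Dm_nonzero in simp)+
 have b1: "\<bar>hh x / norm x * (x $ 3 / s x)\<bar> <= 3 * cot \<alpha>" if "x \<in> D" for x
  unfolding abs_mult using hh_bounds(2)[OF that] \<kappa>_bounds(2) by (intro mult_mono x3_s that) auto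
 have b2: "\<bar>- hh x\<bar> <= 2" if "x \<in> D" for x using hh_bounds(1)[OF that] by simp
 have b3: "\<bar>\<kappa> - hh x / norm x\<bar> <= 6" if "x \<in> D" for x using hh_bounds(2)[OF that] \<kappa>_bounds(1,2) by linarith
 have A: "L2 M (%x. hh x * (d_phi D cp x / rho x))" "L2_norm M (%x. hh x * (d_phi D cp x / rho x)) <= 2 * L2_norm M (%x. d_phi D cp x / rho x)"
  by (rule L2_mult_smooth[OF dp(2) smooth_on_hh hh_bounds(1)] L2_norm_mult_smooth[OF dp(2) smooth_on_hh hh_bounds(1)]; simp)+
 have B: "L2 M (%x. hh x / norm x * (x $ 3 / s x) * cp x)" "L2_norm M (%x. hh x / norm x * (x $ 3 / s x) * cp x) <= 3 * cot \<alpha> * L2_norm M cp"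
  using L2_mult_smooth[OF L2_cp sm(1) b1] L2_norm_mult_smooth[OF L2_cp sm(1) b1] cot_nonneg by simp_all
 have A': "L2 M (%x. - hh x * d_rho D cp x)" "L2_norm M (%x. - hh x * d_rho D cp x) <= 2 * L2_norm M (d_rho D cp)"
  using L2_mult_smooth[OF dp(1) sm(2) b2] L2_norm_mult_smooth[OF dp(1) sm(2) b2] by simp_all
 have B': "L2 M (%x. (\<kappa> - hh x / norm x) * cp x)" "L2_norm M (%x. (\<kappa> - hh x / norm x) * cp x) <= 6 * L2_norm M cp"
  using L2_mult_smooth[OF L2_cp sm(3) b3] L2_norm_mult_smooth[OF L2_cp sm(3) b3] by simp_all
 have C': "L2 M (%x. x $ 3 / s x * Bt x)" by (rule L2_mult_smooth[OF L2_forces(4) smooth_on_frame(3) x3_s])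
 have "L2_norm M Bt <= L2_norm M Bq"
  by (rule L2_norm_mono[OF L2_forces(3) L2D(1)[OF L2_forces(4)]])
   (auto simp: Bt_def Bq_def rho_def abs_mult intro!: AE_I2 divide_right_mono)
 then have C2: "L2_norm M (%x. x $ 3 / s x * Bt x) <= cot \<alpha> * L2_norm M Bq"
  using L2_norm_mult_smooth[OF L2_forces(4) smooth_on_frame(3) x3_s cot_nonneg] mult_left_mono[OF _ cot_nonneg] by fastforce
 note D1 = L2_add[OF A(1) B(1)] L2_diff[OF L2_add[OF A(1) B(1)] L2_forces(1)] and D2 = L2_add[OF A'(1) B'(1)] L2_diff[OF L2_add[OF A'(1) B'(1)] L2_forces(2)]
 show "L2 M Fr" unfolding Fr_def[abs_def] by (rule L2_add[OF D1(2) L2_forces(3)])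
 show "L2 M Fp" unfolding Fp_def[abs_def] by (rule L2_add[OF D2(2) C'])
 show "L2_norm M Fr <= 2 * L2_norm M (%x. d_phi D cp x / rho x) + 3 * cot \<alpha> * L2_norm M cp + L2_norm M Tr + L2_norm M Bq"
  using L2_norm_triangle[OF D1(2) L2_forces(3)] L2_norm_diff_le[OF D1(1) L2_forces(1)] L2_norm_triangle[OF A(1) B(1)] A(2) B(2)
  unfolding Fr_def[abs_def] by linarith
 show "L2_norm M Fp <= 2 * L2_norm M (d_rho D cp) + 6 * L2_norm M cp + L2_norm M Tp + cot \<alpha> * L2_norm M Bq"
  using L2_norm_triangle[OF D2(2) C'] L2_norm_diff_le[OF D2(1) L2_forces(2)] L2_norm_triangle[OF A'(1) B'(1)] A'(2) B'(2) C2
  unfolding Fp_def[abs_def] by linarith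
qed

text \<open>After integration of the identity the curl and the time derivative disappear. Both
  components of the pressure gradient have norm at most \<open>N\<close>, so N^2 is at most N times
  the sum of the two force norms.\<close>

theorem pressure_estimate:
 assumes Q: "sobolev_H 1 D Q" "theta_indep D Q"
  and G: "integrable M (%x. G x \<bullet> weak_grad D Q x)" "(\<integral>x. G x \<bullet> weak_grad D Q x \<partial>M) = 0"
  and eq: "AE x in M. weak_laplacian D w x - convection D w w x - weak_grad D Q x - G x = 0"
 shows "L2_norm M (weak_grad D Q) <= (1 + cot \<alpha>) * L2_norm M Bq + 6 * L2_norm M (d_rho D cp) + 6 * L2_norm M (%x. d_phi D cp x / rho x)
  + 18 * (2 + cot \<alpha>) * L2_norm M cp + L2_norm M Tr + L2_norm M Tp"
proof -
 note H = sobolev_H1_weak[OF Q(1)]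
 note q = H1D(3)[OF H ax_Basis]
 note K = integral_curl_integrand[OF H]
 note dQ = L2_spherical_derivs[of Q, OF q]
 define N where "N = L2_norm M (weak_grad D Q)"
 have qm: "(%x. weak_grad D Q x) \<in> borel_measurable M"
  unfolding weak_grad_def[abs_def] sum_Basis_real3 using L2D(1)[OF q] by measurable
 have n2: "(norm (weak_grad D Q x))\<^sup>2 = (dc 1 Q x)\<^sup>2 + (dc 2 Q x)\<^sup>2 + (dc 3 Q x)\<^sup>2" for x
  by (simp add: power2_norm_real3 weak_grad_def sum_Basis_real3 ax_nth)
 have Ln: "L2 M (%x. norm (weak_grad D Q x))"
  unfolding L2_real_iff n2 using qm q by (auto simp: L2_real_iff)
 have Nn: "L2_norm M (%x. norm (weak_grad D Q x)) = N" by (simp add: N_def L2_norm_def)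
 have le: "L2_norm M (d_rho D Q) <= N" "L2_norm M (%x. d_phi D Q x / rho x) <= N"
 proof -
  have dr: "\<bar>d_rho D Q x\<bar> <= norm (weak_grad D Q x)" and df: "\<bar>d_phi D Q x / rho x\<bar> <= norm (weak_grad D Q x)" if "x \<in> D" for x
   using Cauchy_Schwarz_ineq2[of "weak_grad D Q x" "e_rho x"] Cauchy_Schwarz_ineq2[of "weak_grad D Q x" "e_phi x"] Dm_nonzero[OF that]
   by (simp_all add: d_rho_def d_phi_def norm_frame rho_def)
  show "L2_norm M (d_rho D Q) <= N" unfolding Nn[symmetric]
   by (rule L2_norm_mono[OF Ln L2D(1)[OF dQ(1)]]) (use dr space_M in \<open>auto intro!: AE_I2\<close>)
  show "L2_norm M (%x. d_phi D Q x / rho x) <= N" unfolding Nn[symmetric]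
   by (rule L2_norm_mono[OF Ln L2D(1)[OF dQ(2)]]) (use df space_M in \<open>auto intro!: AE_I2\<close>)
 qed
 have i: "integrable M (%x. d_rho D Q x * Fr x)" "integrable M (%x. d_phi D Q x / rho x * Fp x)"
  by (rule L2_integrable_mult[OF dQ(1) L2_Fr_Fp(1)] L2_integrable_mult[OF dQ(2) L2_Fr_Fp(3)])+
 have "N\<^sup>2 = (\<integral>x. (norm (weak_grad D Q x))\<^sup>2 \<partial>M)" unfolding N_def by (rule L2_norm_power2)
 also have "\<dots> = (\<integral>x. - curl_integrand (dc 1 Q) (dc 2 Q) (dc 3 Q) x - G x \<bullet> weak_grad D Q x + d_rho D Q x * Fr x + d_phi D Q x / rho x * Fp x \<partial>M)"
  by (rule integral_cong_AE[OF _ _ pressure_identity[OF eq theta_indep_deriv[OF H Q(2)]]])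
   (use qm K(1) G(1) i in \<open>auto intro: borel_measurable_integrable\<close>)
 also have "\<dots> = (\<integral>x. d_rho D Q x * Fr x \<partial>M) + (\<integral>x. d_phi D Q x / rho x * Fp x \<partial>M)"
  using K G i by simp
 also have "\<dots> <= L2_norm M (d_rho D Q) * L2_norm M Fr + L2_norm M (%x. d_phi D Q x / rho x) * L2_norm M Fp"
  using L2_cauchy_schwarz[OF dQ(1) L2_Fr_Fp(1)] L2_cauchy_schwarz[OF dQ(2) L2_Fr_Fp(3)] by linarith
 also have "\<dots> <= N * L2_norm M Fr + N * L2_norm M Fp" by (intro add_mono mult_right_mono le) auto
 finally have "N * N <= N * (L2_norm M Fr + L2_norm M Fp)" by (simp add: power2_eq_square distrib_left)
 moreover have "0 <= N" by (simp add: N_def)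
 ultimately have "N <= L2_norm M Fr + L2_norm M Fp"
  using L2_norm_nonneg[of M Fr] L2_norm_nonneg[of M Fp] by (cases "N = 0") auto
 \<comment> \<open>Nonnegativity is what allows the constants 2, 2 and
   \<open>6 + 3 * cot \<alpha>\<close> to be enlarged to those claimed.\<close>
 moreover have "0 <= L2_norm M (d_rho D cp)" "0 <= L2_norm M (%x. d_phi D cp x / rho x)" "0 <= L2_norm M cp" "0 <= cot \<alpha> * L2_norm M cp"
  using cot_nonneg by simp_all
 ultimately show ?thesis using L2_Fr_Fp(2,4) unfolding N_def[symmetric] distrib_right distrib_left by linarith
qed

end


section \<open>Separability of \<open>L\<^sup>2\<close>\<close>

text \<open>Finite intersections of a countable basis; the empty intersection supplies
  \<open>UNIV\<close>.\<close>

lemma borel_countable_Int_stable_generator: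
 obtains G :: "'a::second_countable_topology set set"
 where "countable G" "Int_stable G" "UNIV \<in> G" "sets borel = sigma_sets UNIV G"
proof -
 obtain B :: "'a set set" where B: "countable B" "topological_basis B" using ex_countable_basis by blast
 define G where "G = Inter ` {F. finite F \<and> F \<subseteq> B}"
 have o: "open A" if "A \<in> G" for A
  using that topological_basis_open[OF B(2)] by (auto simp: G_def intro!: open_Inter)
 have BG: "B \<subseteq> G" unfolding G_def by (auto intro!: image_eqI[of _ Inter "{b}" for b])
 have "sets borel = sigma_sets UNIV B" by (simp add: borel_eq_countable_basis[OF B])
 moreover have "sigma_sets UNIV B \<subseteq> sigma_sets UNIV G" by (rule sigma_sets_mono'[OF BG])
 moreover have "sigma_sets UNIV G \<subseteq> sets borel"
 proof -
  have "G \<subseteq> sets borel" using o by auto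
  from sets.sigma_sets_subset[OF this] show ?thesis by simp
 qed
 ultimately have "sets borel = sigma_sets UNIV G" by blast
 moreover have "countable G" unfolding G_def by (intro countable_image countable_Collect_finite_subset B)
 moreover have "Int_stable G"
 proof (rule Int_stableI)
  fix a b assume "a \<in> G" "b \<in> G"
  then obtain F F' where F: "a = \<Inter>F" "b = \<Inter>F'" "finite F" "finite F'" "F \<subseteq> B" "F' \<subseteq> B" by (auto simp: G_def)
  then have "a \<inter> b = \<Inter>(F \<union> F')" by auto
  then show "a \<inter> b \<in> G" unfolding G_def using F by (intro image_eqI[of _ Inter "F \<union> F'"]) auto
 qed
 moreover have "UNIV \<in> G" unfolding G_def by (intro image_eqI[of _ Inter "{}"]) auto
 ultimately show thesis using that by blast
qed

lemma L2_dominated: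
 fixes u :: "nat => 'a => real"
 assumes u: "\<And>n. u n \<in> borel_measurable N" and f: "f \<in> borel_measurable N"
  and l: "\<And>x. x \<in> space N ==> (%n. u n x) \<longlonglongrightarrow> f x" and h: "L2 N h"
  and b: "\<And>n x. x \<in> space N ==> \<bar>u n x - f x\<bar> <= \<bar>h x\<bar>"
 shows "(%n. L2_norm N (%x. u n x - f x)) \<longlonglongrightarrow> 0"
proof -
 have "(%n. \<integral>x. (u n x - f x)\<^sup>2 \<partial>N) \<longlonglongrightarrow> (\<integral>x. 0 \<partial>N)"
 proof (rule integral_dominated_convergence[where w="%x. (h x)\<^sup>2"])
  show "integrable N (%x. (h x)\<^sup>2)" using h by (simp add: L2_real_iff)
  show "AE x in N. (%n. (u n x - f x)\<^sup>2) \<longlonglongrightarrow> 0"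
  proof (rule AE_I2)
   fix x assume "x \<in> space N"
   from tendsto_power[OF tendsto_diff[OF l[OF this] tendsto_const[of "f x"]], of 2] show "(%n. (u n x - f x)\<^sup>2) \<longlonglongrightarrow> 0" by simp
  qed
  show "AE x in N. norm ((u n x - f x)\<^sup>2) <= (h x)\<^sup>2" for n
   using b by (intro AE_I2) (simp add: abs_le_square_iff)
 qed (use u f in measurable)
 from tendsto_real_sqrt[OF this] show ?thesis by (simp add: L2_norm_def)
qed

text \<open>Scalars are rational so that \<open>E\<close> can be countable. Its closure, expressed
  by \<open>appr\<close>, turns out to be closed under real scalars and limits.\<close>

locale L2_approx = finite_measure N for N :: "'a measure" +
 fixes E :: "('a => real) set"
 assumes E_L2: "e \<in> E ==> L2 N e"
  and E_0: "(%x. 0) \<in> E"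
  and E_add: "e \<in> E ==> e' \<in> E ==> (%x. e x + e' x) \<in> E"
  and E_scale: "e \<in> E ==> (%x. of_rat q * e x) \<in> E"
begin

definition appr :: "('a => real) => bool" where
 "appr f \<longleftrightarrow> L2 N f \<and> (\<forall>\<epsilon>>0. \<exists>e\<in>E. L2_norm N (%x. f x - e x) < \<epsilon>)"

lemma appr_L2: "appr f ==> L2 N f"
 by (simp add: appr_def)

lemma L2_norm_triangle_diff:
 fixes f g h :: "'a => real"
 assumes "L2 N f" "L2 N g" "L2 N h"
 shows "L2_norm N (%x. f x - h x) <= L2_norm N (%x. f x - g x) + L2_norm N (%x. g x - h x)"
 using L2_norm_triangle[OF L2_diff[OF assms(1,2)] L2_diff[OF assms(2,3)]] by simp

lemma appr_lim:
 assumes u: "\<And>n::nat. appr (u n)" and f: "L2 N f" and l: "(%n. L2_norm N (%x. u n x - f x)) \<longlonglongrightarrow> 0"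
 shows "appr f"
 unfolding appr_def
proof (intro conjI allI impI f)
 fix \<epsilon> :: real assume e: "\<epsilon> > 0"
 obtain n where n: "L2_norm N (%x. u n x - f x) < \<epsilon> / 2"
  using order_tendstoD(2)[OF l, of "\<epsilon> / 2"] e by (auto simp: eventually_sequentially)
 obtain g where g: "g \<in> E" "L2_norm N (%x. u n x - g x) < \<epsilon> / 2" using u[of n] e unfolding appr_def by (meson half_gt_zero)
 have "L2_norm N (%x. f x - u n x) = L2_norm N (%x. u n x - f x)" by (simp add: L2_norm_def power2_commute)
 then show "\<exists>e\<in>E. L2_norm N (%x. f x - e x) < \<epsilon>"
  using L2_norm_triangle_diff[OF f appr_L2[OF u[of n]] E_L2[OF g(1)]] g n by (intro bexI[of _ g]) auto
qed

lemma appr_E: "e \<in> E ==> appr e"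
 unfolding appr_def using E_L2 by (auto intro!: bexI[of _ e] simp: L2_norm_def)

lemma appr_add:
 assumes "appr f" "appr g" shows "appr (%x. f x + g x)"
 unfolding appr_def
proof (intro conjI allI impI L2_add appr_L2 assms)
 fix \<epsilon> :: real assume "\<epsilon> > 0"
 then obtain e e' where e: "e \<in> E" "L2_norm N (%x. f x - e x) < \<epsilon> / 2" "e' \<in> E" "L2_norm N (%x. g x - e' x) < \<epsilon> / 2"
  using assms unfolding appr_def by (meson half_gt_zero)
 have "L2_norm N (%x. (f x - e x) + (g x - e' x)) <= L2_norm N (%x. f x - e x) + L2_norm N (%x. g x - e' x)"
  by (intro L2_norm_triangle L2_diff appr_L2 assms E_L2 e)
 then show "\<exists>e\<in>E. L2_norm N (%x. f x + g x - e x) < \<epsilon>" using e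
  by (intro bexI[OF _ E_add[OF e(1,3)]]) (simp add: add_diff_add)
qed

lemma appr_scale:
 assumes "appr f" shows "appr (%x. c * f x)"
 unfolding appr_def
proof (intro conjI allI impI L2_scale appr_L2 assms)
 fix \<epsilon> :: real assume e: "\<epsilon> > 0"
 then have "\<epsilon> / (2 * (\<bar>c\<bar> + 1)) > 0" by (intro divide_pos_pos) auto
 then obtain g where g: "g \<in> E" "L2_norm N (%x. f x - g x) < \<epsilon> / (2 * (\<bar>c\<bar> + 1))" using assms unfolding appr_def by blast
 have pos: "0 < 2 * (L2_norm N g + 1)" by (rule mult_pos_pos[OF _ add_nonneg_pos]) simp_all
 have "c < c + \<epsilon> / (2 * (L2_norm N g + 1))" using divide_pos_pos[OF e pos] by (metis less_add_same_cancel1)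
 then obtain q where q: "c < of_rat q" "of_rat q < c + \<epsilon> / (2 * (L2_norm N g + 1))" using of_rat_dense by blast
 have n: "0 <= L2_norm N g" by simp
 have "\<bar>c\<bar> * L2_norm N (%x. f x - g x) <= \<bar>c\<bar> * (\<epsilon> / (2 * (\<bar>c\<bar> + 1)))" using g(2) by (intro mult_left_mono) auto
 also have "\<dots> <= (\<bar>c\<bar> + 1) * (\<epsilon> / (2 * (\<bar>c\<bar> + 1)))" using e by (intro mult_right_mono) auto
 also have "\<dots> = \<epsilon> / 2" using abs_ge_zero[of c] by (simp add: field_simps)
 finally have 1: "L2_norm N (%x. c * (f x - g x)) <= \<epsilon> / 2" by (simp add: L2_norm_scale)
 \<comment> \<open>The error of the rational coefficient is scaled by the norm of \<open>g\<close>;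
   adding 1 in the denominator avoids division by 0.\<close>
 have "\<bar>c - of_rat q\<bar> * L2_norm N g <= \<epsilon> / (2 * (L2_norm N g + 1)) * L2_norm N g" using q n by (intro mult_right_mono) auto
 also have "\<dots> < \<epsilon> / (2 * (L2_norm N g + 1)) * (L2_norm N g + 1)" by (intro mult_strict_left_mono divide_pos_pos[OF e pos]) simp
 also have "\<dots> = \<epsilon> / 2"
 proof -
  have c: "\<epsilon> / (2 * u) * u = \<epsilon> / 2" if "0 < 2 * u" for u :: real using that by simp
  show ?thesis by (rule c[OF pos])
 qed
 finally have 2: "L2_norm N (%x. (c - of_rat q) * g x) < \<epsilon> / 2" by (simp add: L2_norm_scale)
 have "L2_norm N (%x. c * (f x - g x) + (c - of_rat q) * g x) < \<epsilon>"
  using L2_norm_triangle[OF L2_scale[OF L2_diff[OF appr_L2[OF assms] E_L2[OF g(1)]]] L2_scale[OF E_L2[OF g(1)]], of c "c - of_rat q"] 1 2 by linarith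
 moreover have "c * (f x - g x) + (c - of_rat q) * g x = c * f x - of_rat q * g x" for x by (simp add: algebra_simps)
 ultimately show "\<exists>e\<in>E. L2_norm N (%x. c * f x - e x) < \<epsilon>" by (intro bexI[OF _ E_scale[OF g(1), of q]]) simp
qed

text \<open>Measurable induction for nonnegative functions, then positive and negative parts. Square
  integrability is a premise inside the induction and is recovered for the summands and for the
  approximating sequence by domination.\<close>

lemma appr_if_indicators:
 assumes ind: "\<And>A. A \<in> sets N ==> appr (indicator A)" and f: "L2 N f"
 shows "appr f"
proof -
 have nn: "L2 N u --> appr u" if m: "u \<in> borel_measurable N" and p: "\<And>x. 0 <= u x" for u :: "'a => real"
  using m p
 proof (induction u rule: borel_measurable_induct_real)
  case (set A)
  then show ?case using ind by simp
 next
  case (mult u c)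
  show ?case
  proof
   assume c: "L2 N (%x. c * u x)"
   show "appr (%x. c * u x)"
   \<comment> \<open>Square integrability of \<open>c * u\<close> says something about
     \<open>u\<close> only for nonzero \<open>c\<close>.\<close>
   proof (cases "c = 0")
    case True
    then show ?thesis using appr_E[OF E_0] by simp
   next
    case False
    then have "L2 N u" using L2_scale[OF c, of "1 / c"] by simp
    then show ?thesis using mult appr_scale by blast
   qed
  qed
 next
  case (add u v)
  show ?case
  proof
   assume s: "L2 N (%x. v x + u x)"
   have "L2 N u" "L2 N v"
    unfolding L2_real_iff
    by (intro conjI add Bochner_Integration.integrable_bound[OF L2D(2)[OF s]] borel_measurable_power AE_I2; use add in \<open>auto intro!: power_mono\<close>)+
   then show "appr (%x. v x + u x)" using add appr_add by blast
  qed
 next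
  case (seq U)
  show ?case
  proof
   assume Lu: "L2 N u"
   have le: "U i x <= u x" if "x \<in> space N" for i x
    by (rule incseq_le[OF _ seq(4)[OF that]]) (use seq(3) in \<open>auto simp: incseq_def le_fun_def\<close>)
   have LU: "L2 N (U i)" for i
    unfolding L2_real_iff
    by (intro conjI seq Bochner_Integration.integrable_bound[OF L2D(2)[OF Lu]] borel_measurable_power AE_I2; use seq le in \<open>auto intro!: power_mono\<close>)
   have "appr (U i)" for i using seq LU by blast
   then show "appr u"
   proof (rule appr_lim[OF _ Lu L2_dominated[OF _ _ seq(4) Lu]])
    show "\<bar>U n x - u x\<bar> <= \<bar>u x\<bar>" if "x \<in> space N" for n x using le[OF that, of n] seq(2)[of n x] by linarith
   qed (use seq(1) Lu in \<open>auto simp: L2_def\<close>)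
  qed
 qed
 have fm: "f \<in> borel_measurable N" using f by (simp add: L2_def)
 have L: "L2 N (%x. max 0 (f x))" "L2 N (%x. max 0 (- f x))"
  unfolding L2_real_iff using fm
  by (intro conjI Bochner_Integration.integrable_bound[OF L2D(2)[OF f]] AE_I2; auto simp: max_def abs_le_square_iff intro!: power_mono)+
 have "appr (%x. max 0 (f x))" "appr (%x. max 0 (- f x))" using nn L fm by (auto simp: L2_def)
 from appr_add[OF this(1) appr_scale[OF this(2), of "-1"]]
 have "appr (%x. max 0 (f x) + -1 * max 0 (- f x))" .
 moreover have "max 0 (f x) + -1 * max 0 (- f x) = f x" for x by (simp add: max_def)
 ultimately show ?thesis by simp
qed

text \<open>Dynkin's lemma: the sets with approximable indicator are closed under complements and,
  by dominated convergence of the partial sums, under disjoint unions.\<close>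

lemma appr_sigma_sets:
 assumes G: "Int_stable G" "UNIV \<in> G" and s: "\<And>A. A \<in> sigma_sets UNIV G ==> (indicator A :: _ => real) \<in> borel_measurable N"
  and i: "\<And>A. A \<in> G ==> appr (indicator A)" and A: "A \<in> sigma_sets UNIV G"
 shows "appr (indicator A)"
proof -
 have L: "L2 N (indicator A :: 'a => real)" if "A \<in> sigma_sets UNIV G" for A
  by (rule L2_bounded[OF finite_measure_axioms s[OF that], of 1]) (auto simp: indicator_def)
 have "G \<subseteq> Pow UNIV" by simp
 show ?thesis using G(1) \<open>G \<subseteq> Pow UNIV\<close> A
 proof (induction rule: sigma_sets_induct_disjoint)
  case (basic A)
  then show ?case by (rule i)
 next
  case empty
  show ?case using appr_E[OF E_0] by (simp add: indicator_def[abs_def])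
 next
  case (compl A)
  from appr_add[OF i[OF G(2)] appr_scale[OF compl(2), of "-1"]]
  have "appr (%x. indicator UNIV x + -1 * indicator A x)" .
  moreover have "(%x. indicator UNIV x + -1 * indicator A x) = (indicator (UNIV - A) :: 'a => real)" by (auto simp: indicator_def)
  ultimately show ?case by simp
 next
  case (union F)
  have U: "(\<Union>i. F i) \<in> sigma_sets UNIV G" using union(2) by (intro sigma_sets.Union) auto
  have p: "appr (%x. \<Sum>i<n. indicator (F i) x)" for n
   by (induction n) (use appr_E[OF E_0] union(3) in \<open>auto intro: appr_add\<close>)
  have v: "(\<Sum>i<n. indicator (F i) x) = (indicator (\<Union>i<n. F i) x :: real)" for n x
   by (rule indicator_UN_disjoint[symmetric]) (use union(1) in \<open>auto simp: disjoint_family_on_def\<close>)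
  have "appr (indicator (\<Union>i. F i))"
  proof (rule appr_lim[OF p L[OF U] L2_dominated[OF _ _ _ L[OF U]]])
   show "(%x. \<Sum>i<n. indicator (F i) x :: real) \<in> borel_measurable N" for n using appr_L2[OF p[of n]] by (simp add: L2_def)
   show "(indicator (\<Union>i. F i) :: 'a => real) \<in> borel_measurable N" by (rule s[OF U])
   show "(%n. \<Sum>i<n. indicator (F i) x) \<longlonglongrightarrow> (indicator (\<Union>i. F i) x :: real)" for x unfolding v by (rule LIMSEQ_indicator_UN)
   show "\<bar>(\<Sum>i<n. indicator (F i) x) - indicator (\<Union>i. F i) x\<bar> <= \<bar>indicator (\<Union>i. F i) x :: real\<bar>" for n x unfolding v by (auto simp: indicator_def)
  qed
  then show ?case .
 qed
qed

end

text \<open>The dense set consists of rational combinations of indicators from a countable generator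
  that is closed under intersections.\<close>

theorem L2_separable:
 fixes \<Omega> :: "'a::euclidean_space set"
 assumes fin: "finite_measure (lborel_on \<Omega>)"
 obtains E :: "('a => real) set" where "countable E" "\<And>e. e \<in> E ==> L2 (lborel_on \<Omega>) e"
  "\<And>f \<epsilon>. L2 (lborel_on \<Omega>) f ==> \<epsilon> > 0 ==> \<exists>e\<in>E. L2_norm (lborel_on \<Omega>) (%x. f x - e x) < \<epsilon>"
proof -
 let ?N = "lborel_on \<Omega>"
 obtain G :: "'a set set" where G: "countable G" "Int_stable G" "UNIV \<in> G" "sets borel = sigma_sets UNIV G"
  using borel_countable_Int_stable_generator by blast
 have Gb: "A \<in> sets borel" if "A \<in> G" for A unfolding G(4) using that by (rule sigma_sets.Basic)
 \<comment> \<open>Combinations are coded by lists: concatenation is addition, mapping the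
   coefficients is scaling, and countability of lists gives that of \<open>E\<close>.\<close>
 define c :: "(rat \<times> 'a set) list => 'a => real" where "c l x = (\<Sum>(q, A)\<leftarrow>l. of_rat q * indicator A x)" for l x
 define E where "E = c ` lists (UNIV \<times> G)"
 have m: "(indicator A :: 'a => real) \<in> borel_measurable ?N" if "A \<in> sets borel" for A
  using that by (intro measurable_restrict_space1) auto
 have Li: "L2 ?N (indicator A :: 'a => real)" if "A \<in> sets borel" for A
  by (rule L2_bounded[OF fin m[OF that], of 1]) (auto simp: indicator_def)
 have L: "L2 ?N (c l)" if "l \<in> lists (UNIV \<times> G)" for l
  using that
 proof (induction l)
  case Nil
  show ?case using L2_scale[OF Li[of UNIV], of 0] by (simp add: c_def[abs_def])
 next
  case (Cons p l)
  have "c (p # l) = (%x. of_rat (fst p) * indicator (snd p) x + c l x)" by (simp add: c_def fun_eq_iff case_prod_beta)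
  then show ?case using Cons Li[OF Gb] by (auto intro!: L2_add L2_scale)
 qed
 interpret L2_approx ?N E
 proof (rule L2_approx.intro[OF fin])
  show "L2_approx_axioms ?N E"
  proof
   show "L2 ?N e" if "e \<in> E" for e using that L by (auto simp: E_def)
   show "(%x. 0) \<in> E" unfolding E_def by (rule image_eqI[of _ _ "[]"]) (auto simp: c_def)
   show "(%x. e x + e' x) \<in> E" if ee: "e \<in> E" "e' \<in> E" for e e'
   proof -
    obtain l l' where l: "e = c l" "e' = c l'" "l \<in> lists (UNIV \<times> G)" "l' \<in> lists (UNIV \<times> G)" using ee unfolding E_def by blast
    then have "(%x. e x + e' x) = c (l @ l')" by (simp add: c_def fun_eq_iff)
    then show ?thesis unfolding E_def using l by (intro image_eqI[of _ _ "l @ l'"]) auto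
   qed
   show "(%x. of_rat q * e x) \<in> E" if ee: "e \<in> E" for e q
   proof -
    obtain l where l: "e = c l" "l \<in> lists (UNIV \<times> G)" using ee unfolding E_def by blast
    have "of_rat q * c l x = c (map (%(r, A). (q * r, A)) l) x" for x
     by (induction l) (auto simp: c_def of_rat_mult algebra_simps)
    then show ?thesis unfolding E_def l(1) using l(2)
     by (intro image_eqI[of _ _ "map (%(r, A). (q * r, A)) l"]) (auto simp: in_lists_conv_set)
   qed
  qed
 qed
 have i: "appr (indicator A)" if "A \<in> G" for A
 proof (rule appr_E)
  have "c [(1, A)] = indicator A" by (simp add: c_def fun_eq_iff)
  then show "indicator A \<in> E" unfolding E_def using that by (intro image_eqI[of _ _ "[(1, A)]"]) auto
 qed
 have b: "appr (indicator A)" if "A \<in> sets borel" for A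
  by (rule appr_sigma_sets[OF G(2,3) _ i]) (use that m G(4) in auto)
 have "appr f" if "L2 ?N f" for f
 proof (rule appr_if_indicators[OF _ that])
  fix A assume "A \<in> sets ?N"
  \<comment> \<open>Sets of the restricted measure are Borel sets cut down to \<Omega>, and norms
    over \<Omega> do not see the difference.\<close>
  then obtain A' where A': "A' \<in> sets borel" "A = A' \<inter> \<Omega>" by (auto simp: sets_restrict_space)
  have e: "indicator A x = (indicator A' x :: real)" if "x \<in> \<Omega>" for x using that A' by (auto simp: indicator_def)
  have Am: "(indicator A :: 'a => real) \<in> borel_measurable ?N" using \<open>A \<in> sets ?N\<close> by simp
  have LA: "L2 ?N (indicator A :: 'a => real)" by (rule L2_bounded[OF fin Am, of 1]) (auto simp: indicator_def)
  have "L2_norm ?N (%x. indicator A x - g x) = L2_norm ?N (%x. indicator A' x - g x)" for g :: "'a => real"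
   unfolding L2_norm_def by (intro arg_cong[where f=sqrt] Bochner_Integration.integral_cong) (auto simp: space_restrict_space e)
  then show "appr (indicator A)" using b[OF A'(1)] LA unfolding appr_def by simp
 qed
 then have "\<exists>e\<in>E. L2_norm ?N (%x. f x - e x) < \<epsilon>" if "L2 ?N f" "\<epsilon> > 0" for f \<epsilon> using that unfolding appr_def by blast
 moreover have "countable E" unfolding E_def by (intro countable_image countable_lists countable_SIGMA G) auto
 ultimately show thesis using that E_L2 by blast
qed


section \<open>The time derivative\<close>

text \<open>A basis vector of the product points either in the time direction, where the derivative
  is 0, or in a space direction, where the induction hypothesis applies to a derivative of
  \<open>f\<close>.\<close>

lemma Ck_on_snd: "Ck_on k UNIV f ==> Ck_on k UNIV (%p::real \<times> 'a::euclidean_space. f (snd p))"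
proof (induction k arbitrary: f)
 case 0
 then show ?case by (auto intro!: continuous_on_compose2[of UNIV f] continuous_intros)
next
 case (Suc k)
 have fd: "f differentiable (at x)" for x using Suc.prems by simp
 show ?case
 proof (rule Ck_on_SucI[OF open_UNIV, where f'="%p h. FD f (snd p) (snd h)"])
  fix p :: "real \<times> 'a"
  have "(f has_derivative FD f (snd p)) (at (snd p))" using fd by (simp add: frechet_derivative_works)
  from has_derivative_compose[OF has_derivative_snd[OF has_derivative_ident] this]
  show "((%p. f (snd p)) has_derivative (%h. FD f (snd p) (snd h))) (at p)" .
 next
  fix b :: "real \<times> 'a" assume "b \<in> Basis"
  then consider "snd b = 0" | "snd b \<in> Basis" by (auto simp: Basis_prod_def)
  then show "Ck_on k UNIV (%p::real \<times> 'a. FD f (snd p) (snd b))"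
  proof cases
   case 1
   have "FD f (snd p) (snd b) = 0" for p :: "real \<times> 'a"
    using linear_0[OF linear_frechet_derivative[OF fd]] 1 by simp
   moreover have "smooth_on UNIV (%p::real \<times> 'a. 0)" by (rule smooth_on_const) simp
   ultimately show ?thesis by (simp add: smooth_on_def)
  next
   case 2
   with Suc.prems have "Ck_on k UNIV (%x. FD f x (snd b))" by simp
   then show ?thesis by (rule Suc.IH)
  qed
 qed
qed

lemma test_function_Times:
 fixes \<theta> :: "real => real" and \<zeta> :: "'a::euclidean_space => real"
 assumes t: "test_function A \<theta>" and z: "test_function B \<zeta>" and o: "open A" "open B"
 shows "test_function (A \<times> B) (%p. \<theta> (fst p) * \<zeta> (snd p))"
  and "FD (%p. \<theta> (fst p) * \<zeta> (snd p)) p (1, 0) = FD \<theta> (fst p) 1 * \<zeta> (snd p)"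
proof -
 obtain K where K: "compact K" "K \<subseteq> A" "\<And>x. x \<notin> K ==> \<theta> x = 0" using test_function_support[OF t] by metis
 obtain L where L: "compact L" "L \<subseteq> B" "\<And>x. x \<notin> L ==> \<zeta> x = 0" using test_function_support[OF z] by metis
 have s1: "smooth_on UNIV (%p::real \<times> 'a. \<theta> (fst p))"
  by (rule smooth_on_compose[OF open_UNIV test_functionD(1)[OF t]]) (auto intro: smooth_on_bounded_linear bounded_linear_fst)
 have s2: "smooth_on UNIV (%p::real \<times> 'a. \<zeta> (snd p))"
  using test_functionD(1)[OF z, of UNIV] Ck_on_snd unfolding smooth_on_def by blast
 show "test_function (A \<times> B) (%p. \<theta> (fst p) * \<zeta> (snd p))"
 proof (rule test_functionI[OF open_Times[OF o] smooth_on_subset[OF smooth_on_mult[OF open_UNIV s1 s2] subset_UNIV] compact_Times[OF K(1) L(1)]])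
  show "K \<times> L \<subseteq> A \<times> B" using K(2) L(2) by auto
  show "\<theta> (fst p) * \<zeta> (snd p) = 0" if "p \<notin> K \<times> L" for p using that K(3) L(3) by (cases p) auto
 qed
 have "(\<theta> has_derivative FD \<theta> (fst p)) (at (fst p))" "(\<zeta> has_derivative FD \<zeta> (snd p)) (at (snd p))"
  using test_functionD(3)[OF t] test_functionD(3)[OF z] by (simp_all add: frechet_derivative_works)
 from has_derivative_mult[OF has_derivative_compose[OF has_derivative_fst[OF has_derivative_ident] this(1)] has_derivative_compose[OF has_derivative_snd[OF has_derivative_ident] this(2)]]
 have "((%p. \<theta> (fst p) * \<zeta> (snd p)) has_derivative (%h. \<theta> (fst p) * FD \<zeta> (snd p) (snd h) + FD \<theta> (fst p) (fst h) * \<zeta> (snd p))) (at p)" .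
 from fun_cong[OF frechet_derivative_at[OF this], of "(1, 0)"]
 show "FD (%p. \<theta> (fst p) * \<zeta> (snd p)) p (1, 0) = FD \<theta> (fst p) 1 * \<zeta> (snd p)"
  using linear_0[OF linear_frechet_derivative[OF test_functionD(3)[OF z]]] by simp
qed

lemma sigma_finite_lborel_on: "open A ==> sigma_finite_measure (lborel_on A)"
 by (rule sigma_finite_measure_restrict_space[OF lborel.sigma_finite_measure_axioms]) simp

text \<open>Identifies the measure on the space-time cylinder with a product, so that Fubini's
  theorem can be used on it.\<close>

lemma lborel_on_Times:
 fixes A :: "'a::euclidean_space set" and B :: "'b::euclidean_space set"
 assumes o: "open A" "open B"
 shows "lborel_on A \<Otimes>\<^sub>M lborel_on B = lborel_on (A \<times> B)"
proof (rule pair_measure_eqI)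
 show "sigma_finite_measure (lborel_on A)" "sigma_finite_measure (lborel_on B)" using sigma_finite_lborel_on o by auto
 have sp: "space (lborel_on A \<Otimes>\<^sub>M lborel_on B) = A \<times> B" "space (lborel_on (A \<times> B)) = A \<times> B"
  by (simp_all add: space_pair_measure space_restrict_space)
 have id: "(%x. x) \<in> borel_measurable (lborel_on S)" for S :: "'c::euclidean_space set" by (rule measurable_restrict_space1) simp
 have m1: "(%p. (fst p, snd p)) \<in> borel_measurable (lborel_on A \<Otimes>\<^sub>M lborel_on B)"
  by (intro borel_measurable_Pair measurable_compose[OF measurable_fst id] measurable_compose[OF measurable_snd id])
 have m2: "(%p. (fst p, snd p)) \<in> measurable (lborel_on (A \<times> B)) (lborel_on A \<Otimes>\<^sub>M lborel_on B)"
 proof (intro measurable_Pair measurable_restrict_space2)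
  have "fst \<in> borel_measurable (borel :: ('a \<times> 'b) measure)" "snd \<in> borel_measurable (borel :: ('a \<times> 'b) measure)"
   by (intro borel_measurable_continuous_onI continuous_intros)+
  then show "fst \<in> measurable (lborel_on (A \<times> B)) lborel" "snd \<in> measurable (lborel_on (A \<times> B)) lborel"
   by (auto intro!: measurable_restrict_space1)
 qed (auto simp: sp)
 show "sets (lborel_on A \<Otimes>\<^sub>M lborel_on B) = sets (lborel_on (A \<times> B))"
 proof (intro set_eqI iffI)
  fix E assume E: "E \<in> sets (lborel_on A \<Otimes>\<^sub>M lborel_on B)"
  then have "E \<subseteq> A \<times> B" using sets.sets_into_space sp by metis
  then have "(%p. (fst p, snd p)) -` E \<inter> space (lborel_on (A \<times> B)) = E" by (auto simp: sp)
  then show "E \<in> sets (lborel_on (A \<times> B))" using measurable_sets[OF m2 E] by simp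
 next
  fix E assume "E \<in> sets (lborel_on (A \<times> B))"
  then obtain E' where E': "E' \<in> sets borel" "E = (A \<times> B) \<inter> E'" by (auto simp: sets_restrict_space)
  have "(%p. (fst p, snd p)) -` E' \<inter> space (lborel_on A \<Otimes>\<^sub>M lborel_on B) = E" unfolding E'(2) by (auto simp: sp)
  then show "E \<in> sets (lborel_on A \<Otimes>\<^sub>M lborel_on B)" using measurable_sets[OF m1 E'(1)] by simp
 qed
 fix X Y assume X: "X \<in> sets (lborel_on A)" and Y: "Y \<in> sets (lborel_on B)"
 have XA: "X \<in> sets borel" "X \<subseteq> A" and YB: "Y \<in> sets borel" "Y \<subseteq> B"
  using X Y o by (auto simp: sets_restrict_space_iff)
 have "emeasure (lborel_on (A \<times> B)) (X \<times> Y) = emeasure lborel (X \<times> Y)"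
  using XA YB open_Times[OF o] by (intro emeasure_restrict_space) auto
 also have "\<dots> = emeasure lborel X * emeasure lborel Y"
  unfolding lborel_prod[symmetric] using XA YB by (intro lborel.emeasure_pair_measure_Times) auto
 finally show "emeasure (lborel_on A) X * emeasure (lborel_on B) Y = emeasure (lborel_on (A \<times> B)) (X \<times> Y)"
  using XA YB o by (simp add: emeasure_restrict_space)
qed

section \<open>Pairing in space and weak derivatives in time\<close>

locale time_cylinder =
 fixes T :: real and \<Omega> :: "'a::euclidean_space set"
 assumes \<Omega>: "open \<Omega>" "finite_measure (lborel_on \<Omega>)"
begin

abbreviation I :: "real measure" where "I \<equiv> lborel_on {0<..<T}"
abbreviation N :: "'a measure" where "N \<equiv> lborel_on \<Omega>"
abbreviation C :: "(real \<times> 'a) set" where "C \<equiv> cylinder T \<Omega>"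

lemma finite_I: "finite_measure I"
proof (rule finite_measureI)
 have "emeasure lborel {0<..<T} < \<infinity>" by (rule emeasure_bounded_finite) (rule bounded_subset[OF bounded_cbox[of 0 T]], auto)
 then show "emeasure I (space I) ~= \<infinity>" by (simp add: space_restrict_space emeasure_restrict_space)
qed

sublocale pair: pair_sigma_finite I N
 by (simp add: pair_sigma_finite_def sigma_finite_lborel_on \<Omega>)

lemma lborel_on_C: "lborel_on C = I \<Otimes>\<^sub>M N"
 unfolding cylinder_def by (rule lborel_on_Times[symmetric]) (use \<Omega> in auto)

lemma open_C: "open C"
 unfolding cylinder_def by (intro open_Times \<Omega>) auto

lemma AE_C: "AE p in lborel_on C. P p ==> AE t in I. AE x in N. P (t, x)"
 unfolding lborel_on_C by (rule pair.AE_pair)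

lemma L2_C_slice:
 fixes f :: "real \<times> 'a => 'b::euclidean_space"
 assumes "L2 (lborel_on C) f" shows "AE t in I. L2 N (%x. f (t, x))"
proof -
 have f: "f \<in> borel_measurable (I \<Otimes>\<^sub>M N)" "integrable (I \<Otimes>\<^sub>M N) (%p. (norm (f p))\<^sup>2)" using assms by (auto simp: L2_def lborel_on_C)
 show ?thesis using pair.AE_integrable_fst'[OF f(2)] AE_space
 proof eventually_elim
  case (elim t)
  then show ?case using measurable_compose[OF measurable_Pair1'[OF elim(2)] f(1)] by (simp add: L2_def)
 qed
qed

lemma L2_C_snd:
 fixes z :: "'a => real"
 assumes "L2 N z" shows "L2 (lborel_on C) (%p. z (snd p))"
 unfolding lborel_on_C L2_real_iff
proof
 have z: "z \<in> borel_measurable N" "integrable N (%x. (z x)\<^sup>2)" using assms by (simp_all add: L2_real_iff)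
 show m: "(%p. z (snd p)) \<in> borel_measurable (I \<Otimes>\<^sub>M N)" by (rule measurable_compose[OF measurable_snd z(1)])
 interpret I: finite_measure I by (rule finite_I)
 show "integrable (I \<Otimes>\<^sub>M N) (%p. (z (snd p))\<^sup>2)"
  by (rule pair.Fubini_integrable) (use m z in auto)
qed

lemma L2_C_bounded_fst:
 fixes f :: "real \<times> 'a => real"
 assumes "L2 (lborel_on C) f" "continuous_on UNIV w" "\<And>t. \<bar>w t\<bar> <= B"
 shows "L2 (lborel_on C) (%p. w (fst p) * f p)"
proof (rule L2_mult_bounded[OF assms(1), where C=B])
 have "(%p::real \<times> 'a. w (fst p)) \<in> borel_measurable borel"
  by (intro borel_measurable_continuous_onI continuous_on_compose2[OF assms(2)] continuous_intros) auto
 then show "(%p. w (fst p)) \<in> borel_measurable (lborel_on C)" by (intro measurable_restrict_space1) auto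
qed (use assms(3) in auto)

text \<open>Pairing with a fixed square integrable \<open>z\<close> commutes with the weak time
  derivative. For a test function of space in place of \<open>z\<close> this is the definition,
  tested with a product; hence the time integral of \<theta> g + \<theta>' f is 0 at almost every
  point of space, and it can then be multiplied by any \<open>z\<close>.\<close>

lemma weak_deriv_integrated:
 fixes f g :: "real \<times> 'a => real"
 assumes wd: "has_weak_deriv C (1, 0) f g" and L: "L2 (lborel_on C) f" "L2 (lborel_on C) g"
  and \<theta>: "test_function {0<..<T} \<theta>" and z: "L2 N z"
 shows "integrable I (%t. \<theta> t * (\<integral>x. g (t, x) * z x \<partial>N))" "integrable I (%t. FD \<theta> t 1 * (\<integral>x. f (t, x) * z x \<partial>N))"
  and "(\<integral>t. \<theta> t * (\<integral>x. g (t, x) * z x \<partial>N) \<partial>I) + (\<integral>t. FD \<theta> t 1 * (\<integral>x. f (t, x) * z x \<partial>N) \<partial>I) = 0"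
proof -
 let ?\<theta>' = "%t. FD \<theta> t 1"
 have o: "open {0<..<T}" by simp
 have \<theta>': "test_function {0<..<T} ?\<theta>'" by (rule test_function_deriv[OF \<theta>]) simp
 obtain B1 where B1: "\<And>t. \<bar>\<theta> t\<bar> <= B1" using test_function_bounded[OF \<theta>] by metis
 obtain B2 where B2: "\<And>t. \<bar>?\<theta>' t\<bar> <= B2" using test_function_bounded[OF \<theta>'] by metis
 have Lg: "L2 (lborel_on C) (%p. \<theta> (fst p) * g p)" and Lf: "L2 (lborel_on C) (%p. ?\<theta>' (fst p) * f p)"
  by (rule L2_C_bounded_fst[OF L(2) test_functionD(2)[OF \<theta>] B1], rule L2_C_bounded_fst[OF L(1) test_functionD(2)[OF \<theta>'] B2])
 define k where "k p = \<theta> (fst p) * g p + ?\<theta>' (fst p) * f p" for p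
 have Lk: "L2 (lborel_on C) k" unfolding k_def[abs_def] by (rule L2_add[OF Lg Lf])
 have ik: "integrable (I \<Otimes>\<^sub>M N) (%p. k p * u (snd p))" if "L2 N u" for u
  using L2_integrable_mult[OF Lk L2_C_snd[OF that]] unfolding lborel_on_C .
 have one: "L2 N (%x. 1 :: real)" by (rule L2_bounded[OF \<Omega>(2), of _ 1]) auto
 define H where "H x = (\<integral>t. k (t, x) \<partial>I)" for x
 have iH: "integrable N H" unfolding H_def using pair.integrable_snd[of "%t x. k (t, x)"] ik[OF one] by (simp add: case_prod_beta')
 have "AE x in N. H x = 0"
 proof (rule fundamental_lemma[OF \<Omega>(1) locally_integrable_integrable[OF \<Omega>(1) iH]])
  fix \<zeta> assume \<zeta>: "test_function \<Omega> \<zeta>"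
  obtain B where B: "\<And>x. \<bar>\<zeta> x\<bar> <= B" using test_function_bounded[OF \<zeta>] by metis
  have "\<zeta> \<in> borel_measurable N" using test_functionD(2)[OF \<zeta>, of UNIV] by (intro measurable_restrict_space1) (auto intro: borel_measurable_continuous_onI)
  then have L\<zeta>: "L2 N \<zeta>" by (rule L2_bounded[OF \<Omega>(2), of _ B]) (use B in auto)
  note tt = test_function_Times[OF \<theta> \<zeta> o \<Omega>(1), folded cylinder_def]
  have i: "integrable (lborel_on C) (%p. (\<theta> (fst p) * \<zeta> (snd p)) * g p)" "integrable (lborel_on C) (%p. (?\<theta>' (fst p) * \<zeta> (snd p)) * f p)"
   using L2_integrable_mult[OF Lg L2_C_snd[OF L\<zeta>]] L2_integrable_mult[OF Lf L2_C_snd[OF L\<zeta>]] by (simp_all add: mult_ac)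
  have "(\<integral>x. \<zeta> x *\<^sub>R H x \<partial>N) = (\<integral>x. (\<integral>t. k (t, x) * \<zeta> x \<partial>I) \<partial>N)"
   unfolding H_def by (simp add: mult.commute)
  also have "\<dots> = (\<integral>p. k p * \<zeta> (snd p) \<partial>(I \<Otimes>\<^sub>M N))"
   using pair.integral_snd[of "%t x. k (t, x) * \<zeta> x"] ik[OF L\<zeta>] by (simp add: case_prod_beta')
  also have "\<dots> = (\<integral>p. (\<theta> (fst p) * \<zeta> (snd p)) * g p + (?\<theta>' (fst p) * \<zeta> (snd p)) * f p \<partial>lborel_on C)"
   unfolding lborel_on_C k_def by (intro Bochner_Integration.integral_cong) (auto simp: algebra_simps)
  also have "\<dots> = (\<integral>p. (\<theta> (fst p) * \<zeta> (snd p)) * g p \<partial>lborel_on C) + (\<integral>p. (?\<theta>' (fst p) * \<zeta> (snd p)) * f p \<partial>lborel_on C)"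
   by (rule Bochner_Integration.integral_add[OF i])
  also have "\<dots> = 0" using wd tt(1) unfolding has_weak_deriv_def by (simp flip: tt(2))
  finally show "(\<integral>x. \<zeta> x *\<^sub>R H x \<partial>N) = 0" .
 qed
 then have "(\<integral>x. H x * z x \<partial>N) = (\<integral>x. 0 \<partial>N)"
  using iH z by (intro integral_cong_AE) (auto simp: L2_def)
 moreover have "(\<integral>x. H x * z x \<partial>N) = (\<integral>p. k p * z (snd p) \<partial>(I \<Otimes>\<^sub>M N))"
  unfolding H_def using pair.integral_snd[of "%t x. k (t, x) * z x"] ik[OF z] by (simp add: case_prod_beta')
 moreover have jg: "integrable (I \<Otimes>\<^sub>M N) (%p. (\<theta> (fst p) * g p) * z (snd p))" and jf: "integrable (I \<Otimes>\<^sub>M N) (%p. (?\<theta>' (fst p) * f p) * z (snd p))"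
  using L2_integrable_mult[OF Lg L2_C_snd[OF z]] L2_integrable_mult[OF Lf L2_C_snd[OF z]] unfolding lborel_on_C by auto
 moreover have "(\<integral>p. k p * z (snd p) \<partial>(I \<Otimes>\<^sub>M N)) = (\<integral>p. (\<theta> (fst p) * g p) * z (snd p) \<partial>(I \<Otimes>\<^sub>M N)) + (\<integral>p. (?\<theta>' (fst p) * f p) * z (snd p) \<partial>(I \<Otimes>\<^sub>M N))"
  unfolding k_def distrib_right by (rule Bochner_Integration.integral_add[OF jg jf])
 moreover have "(\<integral>t. \<theta> t * (\<integral>x. g (t, x) * z x \<partial>N) \<partial>I) = (\<integral>p. (\<theta> (fst p) * g p) * z (snd p) \<partial>(I \<Otimes>\<^sub>M N))"
  using pair.integral_fst[of "%t x. \<theta> t * g (t, x) * z x"] jg by (simp add: case_prod_beta' mult.assoc)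
 moreover have "(\<integral>t. ?\<theta>' t * (\<integral>x. f (t, x) * z x \<partial>N) \<partial>I) = (\<integral>p. (?\<theta>' (fst p) * f p) * z (snd p) \<partial>(I \<Otimes>\<^sub>M N))"
  using pair.integral_fst[of "%t x. ?\<theta>' t * f (t, x) * z x"] jf by (simp add: case_prod_beta' mult.assoc)
 ultimately show "(\<integral>t. \<theta> t * (\<integral>x. g (t, x) * z x \<partial>N) \<partial>I) + (\<integral>t. ?\<theta>' t * (\<integral>x. f (t, x) * z x \<partial>N) \<partial>I) = 0" by simp
 show "integrable I (%t. \<theta> t * (\<integral>x. g (t, x) * z x \<partial>N))"
  using pair.integrable_fst[of "%t x. \<theta> t * g (t, x) * z x"] jg by (simp add: case_prod_beta' mult.assoc)
 show "integrable I (%t. ?\<theta>' t * (\<integral>x. f (t, x) * z x \<partial>N))"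
  using pair.integrable_fst[of "%t x. ?\<theta>' t * f (t, x) * z x"] jf by (simp add: case_prod_beta' mult.assoc)
qed

text \<open>For a fixed vector \<open>z\<close> the pairing with \<open>f\<close> is 0 for almost
  all times, and the pairing with \<open>g\<close> is its weak derivative in time. The exceptional
  null set depends on \<open>z\<close>.\<close>

lemma weak_time_derivative_orthogonal:
 fixes f g :: "real \<times> 'a => real^3" and z :: "3 => 'a => real"
 assumes wd: "has_weak_deriv C (1, 0) f g" and L: "L2 (lborel_on C) f" "L2 (lborel_on C) g"
  and z: "\<And>i. L2 N (z i)" and ort: "AE t in I. (\<Sum>i\<in>UNIV. \<integral>x. f (t, x) $ i * z i x \<partial>N) = 0"
 shows "AE t in I. (\<Sum>i\<in>UNIV. \<integral>x. g (t, x) $ i * z i x \<partial>N) = 0"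
proof -
 have b: "(1, 0) \<in> (Basis :: (real \<times> 'a) set)" by (simp add: Basis_prod_def)
 have wi: "has_weak_deriv C (1, 0) (%p. f p $ i) (%p. g p $ i)" for i
  using has_weak_deriv_inner[OF open_C b wd, of "ax i"] by (simp add: inner_axis)
 have Li: "L2 (lborel_on C) (%p. h p $ i)" if "L2 (lborel_on C) h" for h :: "real \<times> 'a => real^3" and i
 proof -
  have "(%x::real^3. x $ i) \<in> borel_measurable borel" by (intro borel_measurable_continuous_onI continuous_intros)
  from measurable_compose[OF L2D(1)[OF that] this] have m: "(%p. h p $ i) \<in> borel_measurable (lborel_on C)" .
  then show ?thesis unfolding L2_real_iff
   by (intro conjI Bochner_Integration.integrable_bound[OF L2D(2)[OF that]] AE_I2) (use component_le_norm_cart in \<open>auto simp: abs_le_square_iff[symmetric]\<close>)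
 qed
 note w = weak_deriv_integrated[OF wi Li[OF L(1)] Li[OF L(2)] _ z]
 let ?F = "%t. \<Sum>i\<in>UNIV. \<integral>x. f (t, x) $ i * z i x \<partial>N" and ?G = "%t. \<Sum>i\<in>UNIV. \<integral>x. g (t, x) $ i * z i x \<partial>N"
 have o: "open {0<..<T}" by simp
 have iG: "integrable I ?G"
 proof (rule Bochner_Integration.integrable_sum)
  fix i :: 3
  have "integrable (I \<Otimes>\<^sub>M N) (%p. g p $ i * z i (snd p))"
   using L2_integrable_mult[OF Li[OF L(2), of i] L2_C_snd[OF z[of i]]] unfolding lborel_on_C .
  then show "integrable I (%t. \<integral>x. g (t, x) $ i * z i x \<partial>N)"
   using pair.integrable_fst[of "%t x. g (t, x) $ i * z i x"] by (simp add: case_prod_beta')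
 qed
 show ?thesis
 proof (rule fundamental_lemma[OF o locally_integrable_integrable[OF o iG]])
  fix \<theta> :: "real => real" assume \<theta>: "test_function {0<..<T} \<theta>"
  let ?d = "%t. FD \<theta> t 1"
  have "0 = (\<Sum>i\<in>UNIV. (\<integral>t. \<theta> t * (\<integral>x. g (t, x) $ i * z i x \<partial>N) \<partial>I) + (\<integral>t. ?d t * (\<integral>x. f (t, x) $ i * z i x \<partial>N) \<partial>I))"
   by (simp add: w(3)[OF \<theta>])
  also have "\<dots> = (\<integral>t. \<theta> t * ?G t \<partial>I) + (\<integral>t. ?d t * ?F t \<partial>I)"
   using w(1,2)[OF \<theta>] by (simp add: sum_distrib_left sum.distrib)
  also have "(\<integral>t. ?d t * ?F t \<partial>I) = (\<integral>t. 0 \<partial>I)"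
  proof (rule integral_cong_AE)
   show "(%t. ?d t * ?F t) \<in> borel_measurable I" unfolding sum_distrib_left using w(2)[OF \<theta>] by (intro borel_measurable_sum) auto
   show "AE t in I. ?d t * ?F t = 0" using ort by (rule AE_mp) auto
  qed simp
  finally show "(\<integral>t. \<theta> t *\<^sub>R ?G t \<partial>I) = 0" by simp
 qed
qed

end

text \<open>The exceptional set of times can be chosen independently of the gradient because \<open>L\<^sup>2\<close> is separable.\<close>

lemma (in conical_shell) time_derivative_orthogonal_gradients:
 fixes f g :: "real \<times> (real^3) => real^3"
 assumes wd: "has_weak_deriv (cylinder T D) (1, 0) f g" and L: "L2 (lborel_on (cylinder T D)) f" "L2 (lborel_on (cylinder T D)) g"
  and ort: "AE t in lborel_on {0<..<T}. \<forall>Q q. H1 Q q --> (\<Sum>i\<in>UNIV. \<integral>x. f (t, x) $ i * q (ax i) x \<partial>M) = 0"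
 shows "AE t in lborel_on {0<..<T}. \<forall>Q q. H1 Q q --> (\<Sum>i\<in>UNIV. \<integral>x. g (t, x) $ i * q (ax i) x \<partial>M) = 0"
proof -
 interpret time_cylinder T D by (rule time_cylinder.intro[OF open_Dm finite_measure_Dm])
 obtain E :: "(real^3 => real) set" where E: "countable E" "\<And>e. e \<in> E ==> L2 M e"
  "\<And>f \<epsilon>. L2 M f ==> \<epsilon> > 0 ==> \<exists>e\<in>E. L2_norm M (%x. f x - e x) < \<epsilon>"
  using L2_separable[OF finite_measure_Dm] by blast
 \<comment> \<open>Members of the dense set need not be components of a gradient. For each triple of
   them and each accuracy, one gradient that close is selected if there is any; these countably many
   gradients share a null set.\<close>
 define near where "near = (%(e1, e2, e3, n) q. (\<exists>Q. H1 Q q) \<and> L2_norm M (%x. q (ax 1) x - e1 x) < inverse (real (Suc n))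
  \<and> L2_norm M (%x. q (ax 2) x - e2 x) < inverse (real (Suc n)) \<and> L2_norm M (%x. q (ax 3) x - e3 x) < inverse (real (Suc n)))"
 define sel where "sel k = (SOME q. near k q)" for k
 define K where "K = {k \<in> E \<times> E \<times> E \<times> (UNIV :: nat set). \<exists>q. near k q}"
 have sel: "near k (sel k)" if "k \<in> K" for k 
 proof -
  have "\<exists>q. near k q" using that unfolding K_def by blast
  then show ?thesis unfolding sel_def by (rule someI_ex)
 qed
 have selH: "\<exists>Q. H1 Q (sel k)" if "k \<in> K" for k using sel[OF that] by (cases k) (auto simp: near_def)
 have "countable (E \<times> E \<times> E \<times> (UNIV :: nat set))" using E(1) by (intro countable_SIGMA) auto
 then have "countable K" unfolding K_def by (rule countable_subset[rotated]) auto
 moreover have "AE t in I. (\<Sum>i\<in>UNIV. \<integral>x. g (t, x) $ i * sel k (ax i) x \<partial>M) = 0" if kK: "k \<in> K" for k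
 proof -
  obtain Q where Q: "H1 Q (sel k)" using selH[OF kK] by blast
  show ?thesis
   by (rule weak_time_derivative_orthogonal[OF wd L H1D(3)[OF Q ax_Basis]]) (use ort Q in \<open>auto elim!: AE_mp\<close>)
 qed
 ultimately have "AE t in I. \<forall>k\<in>K. (\<Sum>i\<in>UNIV. \<integral>x. g (t, x) $ i * sel k (ax i) x \<partial>M) = 0" by (simp add: AE_ball_countable)
 then show ?thesis using L2_C_slice[OF L(2)]
 proof eventually_elim
  case (elim t)
  have Lg: "L2 M (%x. g (t, x) $ i)" for i using L2_inner[OF elim(2), of "ax i"] by (simp add: inner_axis)
  let ?B = "\<Sum>i\<in>UNIV. L2_norm M (%x. g (t, x) $ i)"
  show ?case
  proof (intro allI impI)
   fix Q q assume Q: "H1 Q q"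
   note Lq = H1D(3)[OF Q ax_Basis]
   let ?S = "\<Sum>i\<in>UNIV. \<integral>x. g (t, x) $ i * q (ax i) x \<partial>M"
   have "\<bar>?S\<bar> <= ?B * (2 * inverse (real (Suc n)))" for n
   proof -
    have pos: "inverse (real (Suc n)) > 0" by simp
    obtain e where e: "\<And>i. e i \<in> E" "\<And>i. L2_norm M (%x. q (ax i) x - e i x) < inverse (real (Suc n))"
     using E(3)[OF Lq pos] by metis
    let ?k = "(e 1, e 2, e 3, n)"
    have "near ?k q" using Q e(2) by (auto simp: near_def)
    then have k: "?k \<in> K" using e(1) by (auto simp: K_def)
    obtain Q' where Q': "H1 Q' (sel ?k)" using selH[OF k] by blast
    note Ls = H1D(3)[OF Q' ax_Basis]
    have s: "L2_norm M (%x. sel ?k (ax i) x - e i x) < inverse (real (Suc n))" for i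
     using sel[OF k] exhaust_3[of i] by (auto simp: near_def)
    \<comment> \<open>The given and the selected gradient are both close to the same triple, hence
      twice the accuracy.\<close>
    have d: "L2_norm M (%x. q (ax i) x - sel ?k (ax i) x) <= 2 * inverse (real (Suc n))" for i
    proof -
     have "L2_norm M (%x. (q (ax i) x - e i x) - (sel ?k (ax i) x - e i x)) <= L2_norm M (%x. q (ax i) x - e i x) + L2_norm M (%x. sel ?k (ax i) x - e i x)"
      by (intro L2_norm_diff_le L2_diff Lq Ls E(2) e(1))
     then show ?thesis using e(2)[of i] s[of i] by simp
    qed
    have "?S = ?S - (\<Sum>i\<in>UNIV. \<integral>x. g (t, x) $ i * sel ?k (ax i) x \<partial>M)" using elim(1) k by simp
    also have "\<dots> = (\<Sum>i\<in>UNIV. \<integral>x. g (t, x) $ i * (q (ax i) x - sel ?k (ax i) x) \<partial>M)"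
     unfolding sum_subtractf[symmetric] right_diff_distrib
     by (intro sum.cong refl Bochner_Integration.integral_diff[symmetric] L2_integrable_mult Lg Lq Ls)
    finally have "\<bar>?S\<bar> <= (\<Sum>i\<in>UNIV. \<bar>\<integral>x. g (t, x) $ i * (q (ax i) x - sel ?k (ax i) x) \<partial>M\<bar>)" by (simp add: sum_abs)
    also have "\<dots> <= (\<Sum>i\<in>UNIV. L2_norm M (%x. g (t, x) $ i) * (2 * inverse (real (Suc n))))"
     by (intro sum_mono order_trans[OF L2_cauchy_schwarz[OF Lg L2_diff[OF Lq Ls]]] mult_left_mono d L2_norm_nonneg)
    finally show ?thesis by (simp only: sum_distrib_right)
   qed
   moreover have "(%n. ?B * (2 * inverse (real (Suc n)))) \<longlonglongrightarrow> ?B * (2 * 0)"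
    by (intro tendsto_intros LIMSEQ_inverse_real_of_nat)
   ultimately have "\<bar>?S\<bar> <= ?B * (2 * 0)" by (intro LIMSEQ_le_const) auto
   then show "?S = 0" by simp
  qed
 qed
qed

theorem lemma3p3:
  fixes \<alpha> T :: real and m :: nat
    and v0 :: "real^3 \<Rightarrow> real^3"
    and v :: "real \<Rightarrow> real^3 \<Rightarrow> real^3"
    and P :: "real \<Rightarrow> real^3 \<Rightarrow> real"
  assumes "0 < \<alpha>" and "\<alpha> \<le> pi / 6"
    and "m \<ge> 10 ^ 3"
    and "0 < T"
    and "strong_solution \<alpha> m T v0 v P"
  shows "AE t in lborel_on {0<..<T}.
    (let D = Dm \<alpha> m; N = L2_norm (lborel_on D);
         vr = c_rho (v t); vp = c_phi (v t); vt = c_theta (v t)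
     in L2_norm (lborel_on D) (weak_grad D (P t))
        \<le> (1 + cot \<alpha>) * N (\<lambda>x. 1 / rho x * ((vp x)\<^sup>2 + (vt x)\<^sup>2))
          + 6 * N (d_rho D vp)
          + 6 * N (\<lambda>x. d_phi D vp x / rho x)
          + 18 * (2 + cot \<alpha>) * N vp
          + N (\<lambda>x. vr x * d_rho D vr x + 1 / rho x * vp x * d_phi D vr x)
          + N (\<lambda>x. vr x * (d_rho D vp x + 1 / rho x * vp x) + 1 / rho x * vp x * d_phi D vp x))"
proof -
 interpret conical_shell \<alpha> m by unfold_locales (use assms in auto)
 interpret time_cylinder T D by (rule time_cylinder.intro[OF open_Dm finite_measure_Dm])
 let ?f = "%(t, x). v t x"
 have S: "AE t in I. axisymmetric D (v t) \<and> theta_indep D (P t)" "H1t_L2x T D v" "AE t in I. sobolev_H 2 D (v t)"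
  "Linf_tx T D v" "AE t in I. sobolev_H 1 D (P t)"
  "AE t in I. AE x in M. weak_laplacian D (v t) x - convection D (v t) (v t) x - weak_grad D (P t) x - time_deriv T D v t x = 0"
  "AE t in I. AE x in M. weak_div D (v t) x = 0" "AE t in I. boundary_condition \<alpha> m (v t)"
  using assms(5) unfolding strong_solution_def L2t_Hx_def Let_def by blast+
 obtain g where g: "has_weak_deriv C (1, 0) ?f g" "L2 (lborel_on C) g" and Lv: "L2 (lborel_on C) ?f"
  using S(2) unfolding H1t_L2x_def by blast
 \<comment> \<open>The equation contains a chosen representative of the time derivative, while
   square integrability is known for \<open>g\<close>; they agree in almost all points of almost all
   time slices.\<close>
 have "has_weak_deriv C (1, 0) ?f (weak_deriv C (1, 0) ?f)" unfolding weak_deriv_def by (rule someI[of "has_weak_deriv C (1, 0) ?f", OF g(1)])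
 from AE_C[OF has_weak_deriv_unique[OF open_C this g(1)]]
 have td: "AE t in I. AE x in M. time_deriv T D v t x = g (t, x)" by (simp add: time_deriv_def)
 obtain B where "AE (t, x) in lborel_on C. norm (v t x) <= B" using S(4) unfolding Linf_tx_def by blast
 from AE_C[OF this] have bd: "AE t in I. AE x in M. norm (v t x) <= B" by simp
 have vel: "AE t in I. velocity \<alpha> m (v t)"
  using S(1,3,7,8) bd
 proof eventually_elim
  case (elim t)
  then show ?case by unfold_locales auto
 qed
 \<comment> \<open>At every time at which the slice is a \<open>velocity\<close>, orthogonality
   holds for all gradients at once, so the quantifier over gradients can stand inside.\<close>
 have "AE t in I. \<forall>Q q. H1 Q q --> (\<Sum>i\<in>UNIV. \<integral>x. ?f (t, x) $ i * q (ax i) x \<partial>M) = 0"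
  using vel
 proof eventually_elim
  case (elim t)
  interpret velocity \<alpha> m "v t" by fact
  show ?case
  proof (intro allI impI)
   fix Q q assume Q: "H1 Q q"
   have "integrable M (%x. V i x * q (ax i) x)" for i by (rule L2_integrable_mult[OF L2_V H1D(3)[OF Q ax_Basis]])
   then show "(\<Sum>i\<in>UNIV. \<integral>x. ?f (t, x) $ i * q (ax i) x \<partial>M) = 0"
    using velocity_orthogonal[OF Q] by (simp add: V_nth)
  qed
 qed
 from time_derivative_orthogonal_gradients[OF g(1) Lv g(2) this]
 show ?thesis using vel S(1,5,6) td L2_C_slice[OF g(2)]
 proof eventually_elim
  case (elim t)
  interpret velocity \<alpha> m "v t" by (rule elim(2))
  define G where "G x = g (t, x)" for x
  note H = sobolev_H1_weak[OF elim(4)]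
  have Li: "L2 M (%x. G x $ i)" for i using L2_inner[OF elim(7), of "ax i"] by (simp add: inner_axis G_def)
  have i: "integrable M (%x. G x $ i * dc i (P t) x)" for i by (rule L2_integrable_mult[OF Li H1D(3)[OF H ax_Basis]])
  have dot: "G x \<bullet> weak_grad D (P t) x = (\<Sum>i\<in>UNIV. G x $ i * dc i (P t) x)" for x
   by (simp add: weak_grad_def sum_Basis_real3 inner_real3 ax_nth sum_3)
  have "(\<Sum>i\<in>UNIV. \<integral>x. G x $ i * dc i (P t) x \<partial>M) = 0" using elim(1) H unfolding G_def by blast
  then have z: "(\<integral>x. G x \<bullet> weak_grad D (P t) x \<partial>M) = 0" unfolding dot using i by simp
  have iG: "integrable M (%x. G x \<bullet> weak_grad D (P t) x)" unfolding dot by (intro Bochner_Integration.integrable_sum i)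
  have eq: "AE x in M. weak_laplacian D (v t) x - convection D (v t) (v t) x - weak_grad D (P t) x - G x = 0"
   using elim(5,6) by eventually_elim (simp add: G_def)
  have ti: "theta_indep D (P t)" using elim(3) by blast
  from pressure_estimate[OF elim(4) ti iG z eq] show ?case
   unfolding Let_def Tr_def[abs_def] Tp_def[abs_def] Bq_def[abs_def] .
 qed
qed

end
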